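(* There exists a data structure which, for every vector $x \in \mathbb{R}^n$ maintained in the strict turnstile model, upon query returns a list $L$ of $\mathcal{O}(1/\epsilon)$ coordinates that contains all $\epsilon$-heavy hitters of $x$ in the $\ell_1$ norm (i.e. all $i$ with $|x_i| \geq \epsilon \|x\|_1$). The space usage is $\mathcal{O}(\frac{1}{\epsilon}\log(\epsilon n))$, the amortized update time is $\mathcal{O}(\log^2(\frac{1}{\epsilon})\log(\epsilon n))$, and the query time is $\mathcal{O}(n \log^2(\frac{1}{\epsilon})\log(\epsilon n))$.
   Context: Strict turnstile model: a vector $x\in\mathbb{R}^n$, initially $0$, receives updates $(i,\Delta)$ which change $x_i$ to $x_i+\Delta$; both insertions and deletions are allowed, but it is guaranteed that $x_i \geq 0$ for all $i$ at all times. A coordinate $x_i$ is an $\epsilon$-heavy hitter in $\ell_p$ norm if $|x_i|^p \geq \epsilon \|x\|_p^p$. Space is measured in machine words and includes the storage of any hash functions.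
   Formalization: Containment of the heavy hitters is claimed only for x ≠ 0 (for x = 0 all n coordinates are heavy and cannot fit in O(1/ε)), and each logarithm in the bounds is read as max(1, log₂ ·), since log(1/ε) and log(εn) may vanish or be negative. *)

theory Defs
  imports Complex_Main
begin

section \<open>The machine\<close>

text \<open>
  A word RAM with a separate memory for the real numbers occurring in the stream. Both memories
  have a fixed finite size, and an access outside of them makes the machine get stuck, so the
  total number of cells bounds everything that is stored: hash functions, counters, work space
  and output. Words are the naturals below \<open>2 ^ w\<close>. A real cell can only be copied, added,
  subtracted and compared; since all real cells are initially \<open>0\<close> (see below) and there is no
  conversion between words and reals, every real cell is an integer linear combination of stream
  increments, and unbounded precision cannot be used to pack information into one cell.
\<close>

datatype word_op = Add | Sub | Mul | Div | Mod | And | Or | Xor | Shl | Shr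

fun eval_op :: "word_op \<Rightarrow> nat \<Rightarrow> nat \<Rightarrow> nat \<Rightarrow> nat" where
  "eval_op Add w a b = (a + b) mod 2 ^ w"
| "eval_op Sub w a b = (a + (2 ^ w - b)) mod 2 ^ w"
| "eval_op Mul w a b = (a * b) mod 2 ^ w"
| "eval_op Div w a b = a div b"
| "eval_op Mod w a b = a mod b"
| "eval_op And w a b = Bit_Operations.and a b"
| "eval_op Or w a b = Bit_Operations.or a b"
| "eval_op Xor w a b = Bit_Operations.xor a b"
| "eval_op Shl w a b = (a * 2 ^ b) mod 2 ^ w"
| "eval_op Shr w a b = a div 2 ^ b"

text \<open>
  Arguments are addresses, except for the constant of \<open>Const\<close> and the jump targets. \<open>Load\<close>,
  \<open>Store\<close>, \<open>RLoad\<close> and \<open>RStore\<close> are the indirect accesses.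
\<close>

datatype instr =
    Const nat nat
  | Op word_op nat nat nat
  | Load nat nat
  | Store nat nat
  | RAdd nat nat nat
  | RSub nat nat nat
  | RLoad nat nat
  | RStore nat nat
  | Jump nat
  | JumpLess nat nat nat
  | RJumpLess nat nat nat
  | Halt

type_synonym program = "instr list"
type_synonym memory = "nat list \<times> real list"

fun exec_instr :: "nat \<Rightarrow> instr \<Rightarrow> nat \<times> memory \<Rightarrow> (nat \<times> memory) option" where
  "exec_instr w (Const d v) (pc, ws, rs) =
     (if d < length ws then Some (Suc pc, ws[d := v mod 2 ^ w], rs) else None)"
| "exec_instr w (Op f d a b) (pc, ws, rs) =
     (if d < length ws \<and> a < length ws \<and> b < length ws
      then Some (Suc pc, ws[d := eval_op f w (ws ! a) (ws ! b)], rs) else None)"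
| "exec_instr w (Load d a) (pc, ws, rs) =
     (if d < length ws \<and> a < length ws \<and> ws ! a < length ws
      then Some (Suc pc, ws[d := ws ! (ws ! a)], rs) else None)"
| "exec_instr w (Store a b) (pc, ws, rs) =
     (if a < length ws \<and> b < length ws \<and> ws ! a < length ws
      then Some (Suc pc, ws[ws ! a := ws ! b], rs) else None)"
| "exec_instr w (RAdd d a b) (pc, ws, rs) =
     (if d < length rs \<and> a < length rs \<and> b < length rs
      then Some (Suc pc, ws, rs[d := rs ! a + rs ! b]) else None)"
| "exec_instr w (RSub d a b) (pc, ws, rs) =
     (if d < length rs \<and> a < length rs \<and> b < length rs
      then Some (Suc pc, ws, rs[d := rs ! a - rs ! b]) else None)"
| "exec_instr w (RLoad d a) (pc, ws, rs) =
     (if d < length rs \<and> a < length ws \<and> ws ! a < length rs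
      then Some (Suc pc, ws, rs[d := rs ! (ws ! a)]) else None)"
| "exec_instr w (RStore a b) (pc, ws, rs) =
     (if a < length ws \<and> b < length rs \<and> ws ! a < length rs
      then Some (Suc pc, ws, rs[ws ! a := rs ! b]) else None)"
| "exec_instr w (Jump l) (pc, ws, rs) = Some (l, ws, rs)"
| "exec_instr w (JumpLess a b l) (pc, ws, rs) =
     (if a < length ws \<and> b < length ws
      then Some (if ws ! a < ws ! b then l else Suc pc, ws, rs) else None)"
| "exec_instr w (RJumpLess a b l) (pc, ws, rs) =
     (if a < length rs \<and> b < length rs
      then Some (if rs ! a < rs ! b then l else Suc pc, ws, rs) else None)"
| "exec_instr w Halt (pc, ws, rs) = None"

text \<open>
  \<open>halts w P (pc, m) t m'\<close>: with word length \<open>w\<close>, program \<open>P\<close> started at \<open>pc\<close> with memory \<open>m\<close>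
  executes exactly \<open>t\<close> instructions and halts with memory \<open>m'\<close>.
\<close>

inductive halts :: "nat \<Rightarrow> program \<Rightarrow> nat \<times> memory \<Rightarrow> nat \<Rightarrow> memory \<Rightarrow> bool"
  for w :: nat and P :: program where
  halt: "pc < length P \<Longrightarrow> P ! pc = Halt \<Longrightarrow> halts w P (pc, m) 1 m"
| step: "pc < length P \<Longrightarrow> exec_instr w (P ! pc) (pc, m) = Some cfg \<Longrightarrow> halts w P cfg t m'
    \<Longrightarrow> halts w P (pc, m) (Suc t) m'"

lemma halts_deterministic:
  "halts w P cfg t m \<Longrightarrow> halts w P cfg t' m' \<Longrightarrow> t' = t \<and> m' = m"
proof (induction arbitrary: t' m' rule: halts.induct)
  case (halt pc m)
  have "exec_instr w (P ! pc) (pc, m) = None"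
    using halt.hyps(2) by (cases m) simp
  with halt.prems show ?case
    by (auto elim: halts.cases)
next
  case (step pc m cfg t m1)
  have not_Halt: "P ! pc \<noteq> Halt"
    using step.hyps(2) by (cases m) auto
  from step.prems obtain t'' where "t' = Suc t''" "halts w P cfg t'' m'"
    by (cases rule: halts.cases) (use step.hyps(2) not_Halt in simp_all)
  with step.IH show ?case
    by blast
qed


section \<open>Streams\<close>

datatype stream_op = Update nat real | Query

text \<open>Coordinates are numbered from \<open>0\<close> to \<open>n - 1\<close>.\<close>

fun apply_op :: "stream_op \<Rightarrow> (nat \<Rightarrow> real) \<Rightarrow> (nat \<Rightarrow> real)" where
  "apply_op (Update i \<Delta>) x = x(i := x i + \<Delta>)"
| "apply_op Query x = x"

definition stream_vector :: "stream_op list \<Rightarrow> nat \<Rightarrow> real" where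
  "stream_vector ops = fold apply_op ops (\<lambda>_. 0)"

definition strict_turnstile :: "nat \<Rightarrow> stream_op list \<Rightarrow> bool" where
  "strict_turnstile n ops \<longleftrightarrow>
     (\<forall>i \<Delta>. Update i \<Delta> \<in> set ops \<longrightarrow> i < n) \<and>
     (\<forall>k. \<forall>i<n. stream_vector (take k ops) i \<ge> 0)"

definition num_updates :: "stream_op list \<Rightarrow> nat" where
  "num_updates ops = length (filter (\<lambda>p. p \<noteq> Query) ops)"

definition l1_norm :: "nat \<Rightarrow> (nat \<Rightarrow> real) \<Rightarrow> real" where
  "l1_norm n x = (\<Sum>i<n. \<bar>x i\<bar>)"

definition heavy_hitters :: "nat \<Rightarrow> real \<Rightarrow> (nat \<Rightarrow> real) \<Rightarrow> nat set" where
  "heavy_hitters n \<epsilon> x = {i. i < n \<and> \<bar>x i\<bar> \<ge> \<epsilon> * l1_norm n x}"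


section \<open>Data structures\<close>

text \<open>An update \<open>(i, \<Delta>)\<close> is passed in word cell \<open>0\<close> and real cell \<open>0\<close>.\<close>

fun update_input :: "nat \<Rightarrow> real \<Rightarrow> memory \<Rightarrow> memory" where
  "update_input i \<Delta> (ws, rs) = (ws[0 := i], rs[0 := \<Delta>])"

text \<open>The answer to a query is in the word cells \<open>1, 2, \<dots>\<close>, its length in word cell \<open>0\<close>.\<close>

fun query_output :: "memory \<Rightarrow> nat list" where
  "query_output (ws, rs) = take (ws ! 0) (drop 1 ws)"

text \<open>
  \<open>processes w upd qry m\<^sub>0 ops T m\<close>: handling the stream \<open>ops\<close> from the initial memory \<open>m\<^sub>0\<close> leads
  to memory \<open>m\<close>, and the updates in \<open>ops\<close> have taken \<open>T\<close> steps altogether.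
\<close>

inductive processes ::
  "nat \<Rightarrow> program \<Rightarrow> program \<Rightarrow> memory \<Rightarrow> stream_op list \<Rightarrow> nat \<Rightarrow> memory \<Rightarrow> bool"
  for w :: nat and upd qry :: program and m\<^sub>0 :: memory where
  init: "processes w upd qry m\<^sub>0 [] 0 m\<^sub>0"
| update: "processes w upd qry m\<^sub>0 ops T m \<Longrightarrow> halts w upd (0, update_input i \<Delta> m) t m'
    \<Longrightarrow> processes w upd qry m\<^sub>0 (ops @ [Update i \<Delta>]) (T + t) m'"
| query: "processes w upd qry m\<^sub>0 ops T m \<Longrightarrow> halts w qry (0, m) t m'
    \<Longrightarrow> processes w upd qry m\<^sub>0 (ops @ [Query]) T m'"

definition word_length :: "nat \<Rightarrow> nat \<Rightarrow> nat" where
  "word_length c n = c * nat \<lceil>log 2 (real n + 1)\<rceil>"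

text \<open>
  The initial content of the word memory is unrestricted, as it contains the parameters and the
  fixed hash functions.
\<close>

fun initial_memory :: "nat \<Rightarrow> memory \<Rightarrow> bool" where
  "initial_memory w (ws, rs) \<longleftrightarrow> (\<forall>v\<in>set ws. v < 2 ^ w) \<and> (\<forall>r\<in>set rs. r = 0)"

fun memory_size :: "memory \<Rightarrow> nat" where
  "memory_size (ws, rs) = length ws + length rs"

text \<open>
  The logarithm as it is used inside asymptotic bounds, where a factor \<open>log y\<close> is never meant to
  drop below a constant.
\<close>

definition lg :: "real \<Rightarrow> real" where
  "lg y = max 1 (log 2 y)"

end

theory Submission
 imports Defs "HOL-Computational_Algebra.Computational_Algebra" "HOL-Number_Theory.Cong" "HOL-Library.FuncSet"
begin

text \<open>
 The structure is a derandomized count-min sketch: \<open>R = \<Theta>(log (\<epsilon>n))\<close> rows of \<open>m = \<Theta>(1/\<epsilon>)\<close> counters, row \<open>r\<close> adding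
 \<open>x i\<close> to the counter \<open>h r i\<close>. As \<open>x \<ge> 0\<close>, counters only overestimate, so every heavy hitter lies in heavy counters
 in all rows, and each row has \<open>O(1/\<epsilon>)\<close> of those. The \<open>h r\<close> are polynomials of degree below \<open>m\<close> modulo a prime, hence
 \<open>m\<close>-wise independent, and a union bound over all choices of heavy counters shows that some fixed choice of the
 polynomials lets fewer than \<open>m\<close> coordinates pass all rows. Storing them costs no more than the counters.

 A single evaluation of \<open>h r\<close> takes time \<open>\<Theta>(m)\<close>, so updates are buffered and \<open>\<Theta>(m / log m)\<close> points are evaluated at once,
 with \<open>O(m log m)\<close> work per row: a product tree, a Newton inversion of its root, and the transposed remainder tree, where
 products modulo the prime come from a fixed-point complex FFT whose error stays below one half. If \<open>\<epsilon>n\<close> is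
 bounded, listing all coordinates suffices.
\<close>

section \<open>A structured language and its compilation\<close>

text \<open>The batch size balances two costs. A pass over the product tree of \<open>mb\<close>
  points takes about \<open>mb\<close> times a squared logarithm, a convolution of length
  \<open>2 * m\<close> about m log m. With \<open>mb\<close> near m / log m both agree, and all
  levels of the tree still fit into O(m) words. A flush of \<open>R\<close> rows then takes O(R m
  log m) for about m / log m updates; this is the origin of the squared logarithm in the update
  time.

  The output convention shapes the programs. An answer occupies the words from cell \<open>1\<close>
  on, exactly where a program keeps its registers. Hence the parameters rest in an array and are
  reloaded by every operation, and the register cells in front of the list belong to the answer, so
  they have to contain coordinates: cells 2 to 63 are reset to \<open>0\<close>, and cell
  \<open>1\<close> keeps the address \<open>64 + 2 * m\<close> of the parameters, which is a
  coordinate once \<open>n\<close> exceeds it.\<close>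

datatype com =
  Skip
 | Prim instr
 | Seq com com (infixr ";;" 60)
 | IfW nat nat com com
 | IfR nat nat com com
 | While nat nat com

type_synonym words = "nat \<Rightarrow> nat"
type_synonym reals = "nat \<Rightarrow> real"
type_synonym state = "(nat \<Rightarrow> nat) \<times> (nat \<Rightarrow> real)"

text \<open>Cell \<open>2\<close> is reserved for the increment of the loop counters.\<close>

definition For :: "nat \<Rightarrow> nat \<Rightarrow> com \<Rightarrow> com" where
 "For i n c = Prim (Const i 0) ;; While i n (c ;; Prim (Const 2 1) ;; Prim (Op Add i i 2))"

section \<open>Structured programs with exact step counts and their weakest preconditions\<close>

locale machine =
 fixes w lw lr :: nat
begin

text \<open>States are total functions although the memories are finite: the length checks of the
  machine turn into partiality here. Jumps and \<open>Halt\<close> have no meaning, so control flow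
  exists only through the constructors of \<open>com\<close>.\<close>

fun prim :: "instr \<Rightarrow> state \<Rightarrow> state option" where
 "prim (Const d v) (W, X) = (if d < lw then Some (W(d := v mod 2 ^ w), X) else None)"
| "prim (Op f d a b) (W, X) =
   (if d < lw \<and> a < lw \<and> b < lw then Some (W(d := eval_op f w (W a) (W b)), X) else None)"
| "prim (Load d a) (W, X) =
   (if d < lw \<and> a < lw \<and> W a < lw then Some (W(d := W (W a)), X) else None)"
| "prim (Store a b) (W, X) =
   (if a < lw \<and> b < lw \<and> W a < lw then Some (W(W a := W b), X) else None)"
| "prim (RAdd d a b) (W, X) =
   (if d < lr \<and> a < lr \<and> b < lr then Some (W, X(d := X a + X b)) else None)"
| "prim (RSub d a b) (W, X) =
   (if d < lr \<and> a < lr \<and> b < lr then Some (W, X(d := X a - X b)) else None)"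
| "prim (RLoad d a) (W, X) =
   (if d < lr \<and> a < lw \<and> W a < lr then Some (W, X(d := X (W a))) else None)"
| "prim (RStore a b) (W, X) =
   (if a < lw \<and> b < lr \<and> W a < lr then Some (W, X(W a := X b)) else None)"
| "prim (Jump l) s = None"
| "prim (JumpLess a b l) s = None"
| "prim (RJumpLess a b l) s = None"
| "prim Halt s = None"

text \<open>The constants are the jumps of the compiled code. The else branch is laid out first and
  left by a jump, so it costs 2 and the then branch 1. A loop test is a conditional jump together
  with one plain jump, either out of the loop or, after the body, back to the test.\<close>

inductive run :: "com \<Rightarrow> state \<Rightarrow> nat \<Rightarrow> state \<Rightarrow> bool" where
 "run Skip s 0 s"
| "prim i s = Some s' \<Longrightarrow> run (Prim i) s 1 s'"
| "run c s t s' \<Longrightarrow> run d s' t' s'' \<Longrightarrow> run (c ;; d) s (t + t') s''"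
| "a < lw \<Longrightarrow> b < lw \<Longrightarrow> fst s a < fst s b \<Longrightarrow> run c s t s' \<Longrightarrow> run (IfW a b c d) s (t + 1) s'"
| "a < lw \<Longrightarrow> b < lw \<Longrightarrow> \<not> fst s a < fst s b \<Longrightarrow> run d s t s' \<Longrightarrow> run (IfW a b c d) s (t + 2) s'"
| "a < lr \<Longrightarrow> b < lr \<Longrightarrow> snd s a < snd s b \<Longrightarrow> run c s t s' \<Longrightarrow> run (IfR a b c d) s (t + 1) s'"
| "a < lr \<Longrightarrow> b < lr \<Longrightarrow> \<not> snd s a < snd s b \<Longrightarrow> run d s t s' \<Longrightarrow> run (IfR a b c d) s (t + 2) s'"
| "a < lw \<Longrightarrow> b < lw \<Longrightarrow> \<not> fst s a < fst s b \<Longrightarrow> run (While a b c) s 2 s"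
| "a < lw \<Longrightarrow> b < lw \<Longrightarrow> fst s a < fst s b \<Longrightarrow> run c s t s' \<Longrightarrow> run (While a b c) s' t' s''
  \<Longrightarrow> run (While a b c) s (t + t' + 2) s''"

text \<open>Existence of a run makes this total correctness; the first argument of \<open>Q\<close>
  is the exact running time.\<close>

definition wp :: "com \<Rightarrow> (nat \<Rightarrow> state \<Rightarrow> bool) \<Rightarrow> state \<Rightarrow> bool" where
 "wp c Q s \<longleftrightarrow> (\<exists>t s'. run c s t s' \<and> Q t s')"

inductive_cases run_SkipE: "run Skip s t s'"
inductive_cases run_PrimE: "run (Prim i) s t s'"
inductive_cases run_SeqE: "run (c ;; d) s t s'"
inductive_cases run_IfWE: "run (IfW a b c d) s t s'"
inductive_cases run_IfRE: "run (IfR a b c d) s t s'"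

lemma wp_Skip [simp]: "wp Skip Q s = Q 0 s"
 unfolding wp_def by (blast elim: run_SkipE intro: run.intros)

lemma wp_Prim: "wp (Prim i) Q s = (\<exists>s'. prim i s = Some s' \<and> Q 1 s')"
 unfolding wp_def
proof
 assume "\<exists>t s'. run (Prim i) s t s' \<and> Q t s'"
 then show "\<exists>s'. prim i s = Some s' \<and> Q 1 s'" by (auto elim!: run_PrimE)
qed (blast intro: run.intros)

lemma wp_Prims [simp]:
 "wp (Prim (Const d v)) Q (W, X) = (d < lw \<and> Q 1 (W(d := v mod 2 ^ w), X))"
 "wp (Prim (Op f d a b)) Q (W, X) =
   (d < lw \<and> a < lw \<and> b < lw \<and> Q 1 (W(d := eval_op f w (W a) (W b)), X))"
 "wp (Prim (Load d a)) Q (W, X) = (d < lw \<and> a < lw \<and> W a < lw \<and> Q 1 (W(d := W (W a)), X))"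
 "wp (Prim (Store a b)) Q (W, X) = (a < lw \<and> b < lw \<and> W a < lw \<and> Q 1 (W(W a := W b), X))"
 "wp (Prim (RAdd d a b)) Q (W, X) =
   (d < lr \<and> a < lr \<and> b < lr \<and> Q 1 (W, X(d := X a + X b)))"
 "wp (Prim (RSub d a b)) Q (W, X) =
   (d < lr \<and> a < lr \<and> b < lr \<and> Q 1 (W, X(d := X a - X b)))"
 "wp (Prim (RLoad d a)) Q (W, X) = (d < lr \<and> a < lw \<and> W a < lr \<and> Q 1 (W, X(d := X (W a))))"
 "wp (Prim (RStore a b)) Q (W, X) = (a < lw \<and> b < lr \<and> W a < lr \<and> Q 1 (W, X(W a := X b)))"
 by (auto simp: wp_Prim)

lemma wp_Seq [simp]: "wp (c ;; d) Q s = wp c (\<lambda>t s'. wp d (\<lambda>t'. Q (t + t')) s') s"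
 unfolding wp_def by (fastforce elim!: run_SeqE intro: run.intros)

lemma wp_IfW [simp]: "wp (IfW a b c d) Q s =
 (a < lw \<and> b < lw \<and>
  (if fst s a < fst s b then wp c (\<lambda>t. Q (t + 1)) s else wp d (\<lambda>t. Q (t + 2)) s))"
 (is "?L = ?R")
proof
 show ?R if ?L using that unfolding wp_def by (auto elim!: run_IfWE)
 show ?L if ?R
 proof (cases "fst s a < fst s b")
  case True
  with that show ?thesis unfolding wp_def by (simp only: if_True) (blast intro: run.intros)
 next
  case False
  with that show ?thesis unfolding wp_def by (simp only: if_False) (blast intro: run.intros)
 qed
qed

lemma wp_IfR [simp]: "wp (IfR a b c d) Q s =
 (a < lr \<and> b < lr \<and>
  (if snd s a < snd s b then wp c (\<lambda>t. Q (t + 1)) s else wp d (\<lambda>t. Q (t + 2)) s))"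
 (is "?L = ?R")
proof
 show ?R if ?L using that unfolding wp_def by (auto elim!: run_IfRE)
 show ?L if ?R
 proof (cases "snd s a < snd s b")
  case True
  with that show ?thesis unfolding wp_def by (simp only: if_True) (blast intro: run.intros)
 next
  case False
  with that show ?thesis unfolding wp_def by (simp only: if_False) (blast intro: run.intros)
 qed
qed

lemma wp_mono: "wp c Q s \<Longrightarrow> (\<And>t s'. Q t s' \<Longrightarrow> Q' t s') \<Longrightarrow> wp c Q' s"
 unfolding wp_def by blast

lemma wp_While_exit:
 "a < lw \<Longrightarrow> b < lw \<Longrightarrow> \<not> fst s a < fst s b \<Longrightarrow> Q 2 s \<Longrightarrow> wp (While a b c) Q s"
 unfolding wp_def by (blast intro: run.intros)

lemma wp_While_step:
 assumes "a < lw" "b < lw" "fst s a < fst s b"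
  "wp c (\<lambda>t s'. wp (While a b c) (\<lambda>t'. Q (t + t' + 2)) s') s"
 shows "wp (While a b c) Q s"
 using assms unfolding wp_def by (blast intro: run.intros)

text \<open>The invariant for \<open>Suc k\<close> is demanded of the state after the increment,
  which also overwrites cell \<open>2\<close> with \<open>1\<close>. The 4 steps added to each round
  are two for the increment and two for the test and the jump back; the remaining 3 are the initial
  constant and the failing test.\<close>

lemma wp_For_sum:
 assumes regs: "i < lw" "n < lw" "2 < lw" "i \<noteq> n" "i \<noteq> 2" "n \<noteq> 2"
  and N: "W n = N" "N < 2 ^ w"
  and init: "I 0 (W(i := 0)) X"
  and step: "\<And>k W X. k < N \<Longrightarrow> I k W X \<Longrightarrow> W i = k \<Longrightarrow> W n = N \<Longrightarrow>
   wp c (\<lambda>t (W', X'). t \<le> B k \<and> W' i = k \<and> W' n = N \<and> I (Suc k) (W'(2 := 1, i := Suc k)) X') (W, X)"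
  and fin: "\<And>t W X. t \<le> 3 + (\<Sum>j<N. B j + 4) \<Longrightarrow> I N W X \<Longrightarrow> W i = N \<Longrightarrow> W n = N \<Longrightarrow> Q t (W, X)"
 shows "wp (For i n c) Q (W, X)"
proof -
 define b where "b = c ;; Prim (Const 2 1) ;; Prim (Op Add i i 2)"
 have loop: "wp (While i n b) (\<lambda>t (W', X'). t \<le> 2 + (\<Sum>j=k..<N. B j + 4) \<and> I N W' X' \<and> W' i = N \<and> W' n = N) (W, X)"
  if "k \<le> N" "I k W X" "W i = k" "W n = N" for k W X
  using that
 proof (induction "N - k" arbitrary: k W X)
  case 0
  then show ?case by (intro wp_While_exit) (use regs in auto)
 next
  case (Suc d)
  then have k: "k < N" by simp
  have Sk: "Suc k < 2 ^ w" "1 < (2::nat) ^ w" "Suc 0 mod 2 ^ w = 1"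
   using k N(2) by (auto, cases w) auto
  show ?case
  proof (rule wp_While_step)
   show "i < lw" "n < lw" "fst (W, X) i < fst (W, X) n" using regs k Suc.prems by auto
   show "wp b (\<lambda>t s'. wp (While i n b) (\<lambda>t' (W', X'). t + t' + 2 \<le> 2 + (\<Sum>j=k..<N. B j + 4) \<and>
      I N W' X' \<and> W' i = N \<and> W' n = N) s') (W, X)"
    \<comment> \<open>Unfolds \<open>b\<close> only where it is the command being run, so that
      \<open>While i n b\<close> in the postcondition stays intact for the induction
      hypothesis.\<close>
    unfolding b_def[THEN arg_cong[where f = "\<lambda>c. wp c Q s" for Q s]]
   proof (rule wp_Seq[THEN iffD2], rule wp_mono[OF step[OF k Suc.prems(2,3,4)]])
    fix t s'
    assume "case s' of (W', X') \<Rightarrow> t \<le> B k \<and> W' i = k \<and> W' n = N \<and> I (Suc k) (W'(2 := 1, i := Suc k)) X'"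
    then obtain W' X' where s': "s' = (W', X')"
     and *: "t \<le> B k" "W' i = k" "W' n = N" "I (Suc k) (W'(2 := 1, i := Suc k)) X'"
     by (cases s') auto
    let ?W = "W'(2 := 1, i := Suc k)"
    have e: "(\<Sum>j=k..<N. B j + 4) = (B k + 4) + (\<Sum>j=Suc k..<N. B j + 4)"
     using k by (simp only: sum.atLeast_Suc_lessThan)
    have "wp (While i n b) (\<lambda>t (W', X'). t \<le> 2 + (\<Sum>j=Suc k..<N. B j + 4) \<and> I N W' X' \<and> W' i = N \<and> W' n = N) (?W, X')"
     using Suc.hyps(2) k *(3) regs by (intro Suc.hyps(1) *(4)) auto
    then have "wp (While i n b) (\<lambda>t' (W', X'). t + 2 + t' + 2 \<le> 2 + (\<Sum>j=k..<N. B j + 4) \<and>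
      I N W' X' \<and> W' i = N \<and> W' n = N) (?W, X')"
     by (rule wp_mono) (use e *(1) in auto)
    then show "wp (Prim (Const 2 1) ;; Prim (Op Add i i 2)) (\<lambda>t' s'. wp (While i n b)
      (\<lambda>t'' (W', X'). t + t' + t'' + 2 \<le> 2 + (\<Sum>j=k..<N. B j + 4) \<and> I N W' X' \<and> W' i = N \<and> W' n = N) s') s'"
     using regs *(2) Sk by (simp add: s' numeral_eq_Suc)
   qed
  qed
 qed
 have "wp (While i n b) (\<lambda>t (W', X'). t \<le> 2 + (\<Sum>j=0..<N. B j + 4) \<and> I N W' X' \<and> W' i = N \<and> W' n = N) (W(i := 0), X)"
  by (rule loop) (use init regs N in auto)
 then have "wp (While i n b) (\<lambda>t. Q (1 + t)) (W(i := 0), X)"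
  by (rule wp_mono) (auto intro!: fin simp: atLeast0LessThan)
 then show ?thesis
  using regs by (simp add: For_def b_def)
qed

lemma wp_For:
 assumes regs: "i < lw" "n < lw" "2 < lw" "i \<noteq> n" "i \<noteq> 2" "n \<noteq> 2"
  and N: "W n = N" "N < 2 ^ w"
  and init: "I 0 (W(i := 0)) X"
  and step: "\<And>k W X. k < N \<Longrightarrow> I k W X \<Longrightarrow> W i = k \<Longrightarrow> W n = N \<Longrightarrow>
   wp c (\<lambda>t (W', X'). t \<le> B \<and> W' i = k \<and> W' n = N \<and> I (Suc k) (W'(2 := 1, i := Suc k)) X') (W, X)"
  and fin: "\<And>t W X. t \<le> 3 + N * (B + 4) \<Longrightarrow> I N W X \<Longrightarrow> W i = N \<Longrightarrow> W n = N \<Longrightarrow> Q t (W, X)"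
 shows "wp (For i n c) Q (W, X)"
 by (rule wp_For_sum[where I = I and B = "\<lambda>_. B" and N = N]) (use assms in auto)

end

section \<open>Compilation to jump code\<close>

fun clen :: "com \<Rightarrow> nat" where
 "clen Skip = 0"
| "clen (Prim i) = 1"
| "clen (c ;; d) = clen c + clen d"
| "clen (IfW a b c d) = clen c + clen d + 2"
| "clen (IfR a b c d) = clen c + clen d + 2"
| "clen (While a b c) = clen c + 3"

fun compile :: "nat \<Rightarrow> com \<Rightarrow> program" where
 "compile pc Skip = []"
| "compile pc (Prim i) = [i]"
| "compile pc (c ;; d) = compile pc c @ compile (pc + clen c) d"
| "compile pc (IfW a b c d) = JumpLess a b (pc + clen d + 2) # compile (pc + 1) d @
   Jump (pc + clen d + 2 + clen c) # compile (pc + clen d + 2) c"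
| "compile pc (IfR a b c d) = RJumpLess a b (pc + clen d + 2) # compile (pc + 1) d @
   Jump (pc + clen d + 2 + clen c) # compile (pc + clen d + 2) c"
| "compile pc (While a b c) = JumpLess a b (pc + 2) # Jump (pc + clen c + 3) # compile (pc + 2) c @ [Jump pc]"

lemma length_compile [simp]: "length (compile pc c) = clen c"
 by (induction c arbitrary: pc) auto

definition code_at :: "program \<Rightarrow> nat \<Rightarrow> program \<Rightarrow> bool" where
 "code_at P pc is \<longleftrightarrow> pc + length is \<le> length P \<and> (\<forall>i<length is. P ! (pc + i) = is ! i)"

lemma code_at_append: "code_at P pc (xs @ ys) \<longleftrightarrow> code_at P pc xs \<and> code_at P (pc + length xs) ys"
proof
 assume *: "code_at P pc (xs @ ys)"
 have "P ! (pc + i) = xs ! i" if "i < length xs" for i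
  using *[unfolded code_at_def, THEN conjunct2, rule_format, of i] that by (simp add: nth_append)
 moreover have "P ! (pc + length xs + i) = ys ! i" if "i < length ys" for i
  using *[unfolded code_at_def, THEN conjunct2, rule_format, of "length xs + i"] that
  by (simp add: add.assoc)
 ultimately show "code_at P pc xs \<and> code_at P (pc + length xs) ys"
  using * by (auto simp: code_at_def)
next
 assume *: "code_at P pc xs \<and> code_at P (pc + length xs) ys"
 show "code_at P pc (xs @ ys)"
  unfolding code_at_def
 proof (intro conjI allI impI)
  fix i assume "i < length (xs @ ys)"
  then show "P ! (pc + i) = (xs @ ys) ! i"
   using * by (cases "i < length xs") (auto simp: code_at_def nth_append dest: spec[of _ "i - length xs"])
 qed (use * in \<open>auto simp: code_at_def\<close>)
qed

lemma code_at_Cons: "code_at P pc (x # xs) \<longleftrightarrow> pc < length P \<and> P ! pc = x \<and> code_at P (pc + 1) xs"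
 using code_at_append[of P pc "[x]" xs] by (auto simp: code_at_def)

context machine
begin

definition mem_of :: "state \<Rightarrow> memory" where
 "mem_of s = (map (fst s) [0..<lw], map (snd s) [0..<lr])"

lemma map_upt_update: "(map f [0..<n])[d := v] = map (f(d := v)) [0..<n]"
 by (rule nth_equalityI) (auto simp: nth_list_update)

lemma exec_prim:
 assumes "prim i s = Some s'"
 shows "exec_instr w i (pc, mem_of s) = Some (Suc pc, mem_of s')"
 using assms by (cases s; cases i) (auto simp: mem_of_def map_upt_update split: if_splits)

text \<open>Stated with a continuation: whatever halts from the end of the code of \<open>c\<close>
  halts from its start, \<open>t\<close> steps later. In this form sequencing and the backward jump
  of a loop need nothing but the induction hypotheses.\<close>

lemma run_halts:
 "run c s t s' \<Longrightarrow> code_at P pc (compile pc c) \<Longrightarrow> halts w P (pc + clen c, mem_of s') t0 m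
  \<Longrightarrow> halts w P (pc, mem_of s) (t + t0) m"
proof (induction arbitrary: pc t0 m rule: run.induct)
 case (2 i s s')
 then show ?case
  using halts.step[of pc P w "mem_of s" "(Suc pc, mem_of s')" t0 m] exec_prim[of i s s' pc]
  by (auto simp: code_at_Cons)
next
 case (3 c s t s' d t' s'')
 then show ?case
  by (auto simp: code_at_append add.assoc)
next
 case (4 a b s c t s' d)
 have "halts w P (pc + clen d + 2, mem_of s) (t + t0) m"
  by (rule "4.IH") (use 4 in \<open>auto simp: code_at_Cons code_at_append algebra_simps\<close>)
 then show ?case
  using 4 halts.step[of pc P w "mem_of s" "(pc + clen d + 2, mem_of s)" "t + t0" m]
  by (auto simp: code_at_Cons mem_of_def)
next
 case (5 a b s d t s' c)
 have "halts w P (pc + 1 + clen d, mem_of s') (Suc t0) m"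
  by (rule halts.step) (use 5 in \<open>auto simp: code_at_Cons code_at_append algebra_simps mem_of_def\<close>)
 then have "halts w P (pc + 1, mem_of s) (t + Suc t0) m"
  by (intro "5.IH") (use 5 in \<open>auto simp: code_at_Cons code_at_append algebra_simps\<close>)
 then show ?case
  using 5 halts.step[of pc P w "mem_of s" "(pc + 1, mem_of s)" "t + Suc t0" m]
  by (auto simp: code_at_Cons mem_of_def)
next
 case (6 a b s c t s' d)
 have "halts w P (pc + clen d + 2, mem_of s) (t + t0) m"
  by (rule "6.IH") (use 6 in \<open>auto simp: code_at_Cons code_at_append algebra_simps\<close>)
 then show ?case
  using 6 halts.step[of pc P w "mem_of s" "(pc + clen d + 2, mem_of s)" "t + t0" m]
  by (auto simp: code_at_Cons mem_of_def)
next
 case (7 a b s d t s' c)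
 have "halts w P (pc + 1 + clen d, mem_of s') (Suc t0) m"
  by (rule halts.step) (use 7 in \<open>auto simp: code_at_Cons code_at_append algebra_simps mem_of_def\<close>)
 then have "halts w P (pc + 1, mem_of s) (t + Suc t0) m"
  by (intro "7.IH") (use 7 in \<open>auto simp: code_at_Cons code_at_append algebra_simps\<close>)
 then show ?case
  using 7 halts.step[of pc P w "mem_of s" "(pc + 1, mem_of s)" "t + Suc t0" m]
  by (auto simp: code_at_Cons mem_of_def)
next
 case (8 a b s c)
 have "halts w P (pc + 1, mem_of s) (Suc t0) m"
  by (rule halts.step) (use 8 in \<open>auto simp: code_at_Cons code_at_append algebra_simps mem_of_def\<close>)
 then show ?case
  using 8 halts.step[of pc P w "mem_of s" "(pc + 1, mem_of s)" "Suc t0" m]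
  by (auto simp: code_at_Cons mem_of_def)
next
 case (9 a b s c t s' t' s'')
 \<comment> \<open>A round is assembled from its end: the remaining rounds, the jump back, the body,
   the test.\<close>
 have "halts w P (pc, mem_of s') (t' + t0) m"
  by (rule "9.IH"(2)) (use 9 in auto)
 then have "halts w P (pc + 2 + clen c, mem_of s') (Suc (t' + t0)) m"
  by (intro halts.step) (use 9 in \<open>auto simp: code_at_Cons code_at_append algebra_simps mem_of_def\<close>)
 then have "halts w P (pc + 2, mem_of s) (t + Suc (t' + t0)) m"
  by (intro "9.IH"(1)) (use 9 in \<open>auto simp: code_at_Cons code_at_append algebra_simps\<close>)
 then have "halts w P (pc, mem_of s) (Suc (t + Suc (t' + t0))) m"
  by (intro halts.step) (use 9 in \<open>auto simp: code_at_Cons mem_of_def\<close>)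
 then show ?case
  by (simp add: algebra_simps)
qed auto

lemma wp_halts:
 assumes "wp c Q s"
 obtains t s' where "Q t s'" "halts w (compile 0 c @ [Halt]) (0, mem_of s) (t + 1) (mem_of s')"
proof -
 let ?P = "compile 0 c @ [Halt]"
 from assms obtain t s' where run: "run c s t s'" and Q: "Q t s'"
  by (auto simp: wp_def)
 have "halts w ?P (0 + clen c, mem_of s') 1 (mem_of s')"
  by (rule halts.halt) (auto simp: nth_append)
 then have "halts w ?P (0, mem_of s) (t + 1) (mem_of s')"
  by (intro run_halts[OF run]) (auto simp: code_at_def nth_append)
 with Q that show ?thesis by blast
qed

end

section \<open>Cyclic convolution by the fast Fourier transform\<close>

text \<open>Independent cyclic convolutions on all aligned blocks of length \<open>h\<close>, where
  \<open>i - i mod h\<close> is the start of the block of \<open>i\<close>. At \<open>h = 1\<close>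
  this is the pointwise product.\<close>

definition block_conv :: "nat \<Rightarrow> (nat \<Rightarrow> 'a::comm_ring_1) \<Rightarrow> (nat \<Rightarrow> 'a) \<Rightarrow> nat \<Rightarrow> 'a" where
 "block_conv h x y i =
   (\<Sum>r<h. x (i - i mod h + r) * y (i - i mod h + (i mod h + h - r) mod h))"

text \<open>The Gentleman-Sande butterfly. A block of length \<open>2 * h\<close> represents a
  polynomial modulo z^(2h) - 1; its lower half becomes the residue modulo z^h - 1, its upper half
  the residue modulo z^h + 1 with \<omega> z substituted for z.\<close>

definition stage :: "'a::comm_ring_1 \<Rightarrow> nat \<Rightarrow> (nat \<Rightarrow> 'a) \<Rightarrow> nat \<Rightarrow> 'a" where
 "stage \<omega> h x i = (if i mod (2 * h) < h then x i + x (i + h)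
   else (x (i - h) - x i) * \<omega> ^ (i mod h))"

definition inv_stage :: "'a::comm_ring_1 \<Rightarrow> nat \<Rightarrow> (nat \<Rightarrow> 'a) \<Rightarrow> nat \<Rightarrow> 'a" where
 "inv_stage \<omega> h x i = (if i mod (2 * h) < h then x i + x (i + h) * \<omega> ^ (i mod h)
   else x (i - h) - x i * \<omega> ^ (i mod h))"

lemma sum_lessThan_double:
 fixes f :: "nat \<Rightarrow> 'a::comm_monoid_add"
 shows "(\<Sum>r<2*h. f r) = (\<Sum>r<h. f r + f (r + h))"
proof -
 have "(\<Sum>r<2*h. f r) = (\<Sum>r<h. f r) + (\<Sum>r=h..<h+h. f r)"
  using sum.atLeastLessThan_concat[of 0 h "h + h" f] by (simp add: lessThan_atLeast0 mult_2)
 also have "(\<Sum>r=h..<h+h. f r) = (\<Sum>r<h. f (r + h))"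
  using sum.shift_bounds_nat_ivl[of f 0 h h] by (simp add: lessThan_atLeast0)
 finally show ?thesis
  by (simp add: sum.distrib)
qed

lemma index_split:
 assumes "(h::nat) > 0"
 obtains b q where "q < h" "i = 2 * h * b + q" "i mod (2 * h) = q" "i mod h = q"
 | b q where "q < h" "i = 2 * h * b + h + q" "i mod (2 * h) = h + q" "i mod h = q"
proof (cases "i mod (2 * h) < h")
 case True
 have i: "i = 2 * h * (i div (2 * h)) + i mod (2 * h)" by simp
 have "(2 * h * (i div (2 * h)) + i mod (2 * h)) mod h = i mod (2 * h)"
  using True by (metis mod_less mod_mult_self4 mult.assoc mult.commute)
 with True i that(1) show ?thesis by metis
next
 case False
 define q where "q = i mod (2 * h) - h"
 have q: "q < h" "i mod (2 * h) = h + q" using False assms mod_less_divisor[of "2 * h" i] by (auto simp: q_def simp del: mod_less_divisor)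
 have i: "i = 2 * h * (i div (2 * h)) + h + q"
  using q(2) by (metis add.assoc mult_div_mod_eq)
 have "i = q + h * (2 * (i div (2 * h)) + 1)" using i by (simp add: algebra_simps)
 then have "i mod h = q" using q(1) by (metis mod_less mod_mult_self2)
 with i q that(2) show ?thesis by blast
qed

text \<open>Chinese remainder theorem for z^(2h) - 1 = (z^h - 1)(z^h + 1). As \<omega>^h = -1,
  substituting \<omega> z turns the second factor into z^h - 1 up to sign, so both halves carry
  cyclic convolutions again.\<close>

lemma stage_block_conv:
 assumes h: "h > 0" and \<omega>: "\<omega> ^ h = - 1"
 shows "stage \<omega> h (block_conv (2 * h) x y) = block_conv h (stage \<omega> h x) (stage \<omega> h y)"
proof
 fix i
 define C where "C b q = (\<Sum>r<2*h. x (2 * h * b + r) * y (2 * h * b + (q + 2 * h - r) mod (2 * h)))" for b q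
 have bc: "block_conv (2 * h) x y (2 * h * b + q) = C b q" if "q < 2 * h" for b q
  using that by (simp add: block_conv_def C_def)
 define u where "u b r = x (2 * h * b + r)" for b r
 define v where "v b r = y (2 * h * b + r)" for b r
 have M: "a mod l = c" if "a = c \<or> a = c + l" "c < l" for a c l :: nat
  using that by auto
 \<comment> \<open>With summation indices split into \<open>r\<close> and \<open>r + h\<close>,
   every index modulo \<open>2 * h\<close> is decided by comparing \<open>r\<close> with
   \<open>q\<close>.\<close>
 have mods: "(q + 2 * h - r) mod (2 * h) = (if r \<le> q then q - r else q + h - r + h)"
  "(q + 2 * h - (r + h)) mod (2 * h) = (if r \<le> q then q - r + h else q + h - r)"
  "(q + h + 2 * h - r) mod (2 * h) = (if r \<le> q then q - r + h else q + h - r)"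
  "(q + h + 2 * h - (r + h)) mod (2 * h) = (if r \<le> q then q - r else q + h - r + h)" if "q < h" "r < h" for q r
  by (cases "r \<le> q"; simp only: if_True if_False; rule M; use that in arith)+
 have C_eq: "C b q = (\<Sum>r<h. if r \<le> q then u b r * v b (q - r) + u b (r + h) * v b (q - r + h)
    else u b r * v b (q + h - r + h) + u b (r + h) * v b (q + h - r))"
  and C_eq': "C b (q + h) = (\<Sum>r<h. if r \<le> q then u b r * v b (q - r + h) + u b (r + h) * v b (q - r)
    else u b r * v b (q + h - r) + u b (r + h) * v b (q + h - r + h))" if "q < h" for b q
  unfolding C_def sum_lessThan_double by (intro sum.cong refl, simp only: lessThan_iff mods[OF that] u_def v_def, simp)+
 have st: "stage \<omega> h z (2 * h * b + r) = z (2 * h * b + r) + z (2 * h * b + (r + h))"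
  "stage \<omega> h z (2 * h * b + h + r) = (z (2 * h * b + r) - z (2 * h * b + (r + h))) * \<omega> ^ r"
  if "r < h" for z b r
 proof -
  have "(2 * h * b + r) mod (2 * h) = r" "(2 * h * b + h + r) mod (2 * h) = h + r"
   using that by (simp_all add: add.assoc)
  moreover have "2 * h * b + h + r = r + h * (2 * b + 1)" by (simp add: algebra_simps)
  then have "(2 * h * b + h + r) mod h = r"
   using that by (metis mod_less mod_mult_self2)
  ultimately show "stage \<omega> h z (2 * h * b + r) = z (2 * h * b + r) + z (2 * h * b + (r + h))"
   "stage \<omega> h z (2 * h * b + h + r) = (z (2 * h * b + r) - z (2 * h * b + (r + h))) * \<omega> ^ r"
   using that by (simp_all add: stage_def add.assoc add.commute[of h r])
 qed
 have md: "(q + h - r) mod h = (if r \<le> q then q - r else q + h - r)" if "q < h" "r < h" for q r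
  by (cases "r \<le> q"; simp only: if_True if_False; rule M; use that in arith)
 show "stage \<omega> h (block_conv (2 * h) x y) i = block_conv h (stage \<omega> h x) (stage \<omega> h y) i"
  using h
 proof (cases rule: index_split[of h i])
  case (1 b q)
  have i: "i - i mod h = 2 * h * b" using 1 by simp
  have "stage \<omega> h (block_conv (2 * h) x y) i = C b q + C b (q + h)"
   unfolding 1(2) st(1)[OF 1(1)] using 1(1) bc[of q b] bc[of "q + h" b] by simp
  also have "\<dots> = (\<Sum>r<h. (u b r + u b (r + h)) * (v b ((q + h - r) mod h) + v b ((q + h - r) mod h + h)))"
   unfolding C_eq[OF 1(1)] C_eq'[OF 1(1)] sum.distrib[symmetric]
  proof (intro sum.cong refl)
   fix r assume "r \<in> {..<h}"
   then have r: "r < h" by simp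
   show "(if r \<le> q then u b r * v b (q - r) + u b (r + h) * v b (q - r + h)
      else u b r * v b (q + h - r + h) + u b (r + h) * v b (q + h - r)) +
     (if r \<le> q then u b r * v b (q - r + h) + u b (r + h) * v b (q - r)
      else u b r * v b (q + h - r) + u b (r + h) * v b (q + h - r + h)) =
     (u b r + u b (r + h)) * (v b ((q + h - r) mod h) + v b ((q + h - r) mod h + h))"
    unfolding md[OF 1(1) r] by (cases "r \<le> q") (simp_all only: if_True if_False ring_distribs ac_simps)
  qed
  also have "\<dots> = block_conv h (stage \<omega> h x) (stage \<omega> h y) i"
   unfolding block_conv_def i unfolding 1(4)
  proof (intro sum.cong refl)
   fix r assume "r \<in> {..<h}"
   then have r: "r < h" by simp
   show "(u b r + u b (r + h)) * (v b ((q + h - r) mod h) + v b ((q + h - r) mod h + h)) =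
    stage \<omega> h x (2 * h * b + r) * stage \<omega> h y (2 * h * b + (q + h - r) mod h)"
    unfolding st(1)[OF r] st(1)[OF mod_less_divisor[OF h]] u_def v_def by simp
  qed
  finally show ?thesis .
 next
  case (2 b q)
  have i: "i - i mod h = 2 * h * b + h" using 2 by simp
  have "stage \<omega> h (block_conv (2 * h) x y) i = (C b q - C b (q + h)) * \<omega> ^ q"
   unfolding 2(2) st(2)[OF 2(1)] using 2(1) bc[of q b] bc[of "q + h" b] by simp
  also have "\<dots> = (\<Sum>r<h. (u b r - u b (r + h)) * \<omega> ^ r *
    ((v b ((q + h - r) mod h) - v b ((q + h - r) mod h + h)) * \<omega> ^ ((q + h - r) mod h)))"
   unfolding C_eq[OF 2(1)] C_eq'[OF 2(1)] sum_subtractf[symmetric] sum_distrib_right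
  proof (intro sum.cong refl)
   fix r assume "r \<in> {..<h}"
   then have r: "r < h" by simp
   have p1: "\<omega> ^ q = \<omega> ^ r * \<omega> ^ (q - r)" if "r \<le> q"
    using that by (simp flip: power_add)
   \<comment> \<open>An index that wraps around picks up \<omega>^h = -1: this is the sign of the
     negacyclic product modulo z^h + 1.\<close>
   have p2: "\<omega> ^ r * \<omega> ^ (q + h - r) = - (\<omega> ^ q)"
   proof -
    have "\<omega> ^ r * \<omega> ^ (q + h - r) = \<omega> ^ (q + h)" using r by (simp only: power_add[symmetric]) simp
    then show ?thesis using \<omega> by (simp add: power_add)
   qed
   show "((if r \<le> q then u b r * v b (q - r) + u b (r + h) * v b (q - r + h)
      else u b r * v b (q + h - r + h) + u b (r + h) * v b (q + h - r)) -
     (if r \<le> q then u b r * v b (q - r + h) + u b (r + h) * v b (q - r)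
      else u b r * v b (q + h - r) + u b (r + h) * v b (q + h - r + h))) * \<omega> ^ q =
     (u b r - u b (r + h)) * \<omega> ^ r *
     ((v b ((q + h - r) mod h) - v b ((q + h - r) mod h + h)) * \<omega> ^ ((q + h - r) mod h))"
   proof (cases "r \<le> q")
    case True
    then show ?thesis unfolding md[OF 2(1) r] p1[OF True]
     by (simp only: if_True) (simp add: algebra_simps)
   next
    case False
    have "(u b r - u b (r + h)) * \<omega> ^ r * ((v b (q + h - r) - v b (q + h - r + h)) * \<omega> ^ (q + h - r)) =
     (u b r - u b (r + h)) * (v b (q + h - r) - v b (q + h - r + h)) * (\<omega> ^ r * \<omega> ^ (q + h - r))"
     by (simp add: algebra_simps)
    then show ?thesis using False unfolding md[OF 2(1) r] p2
     by (simp only: if_False) (simp add: algebra_simps)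
   qed
  qed
  also have "\<dots> = block_conv h (stage \<omega> h x) (stage \<omega> h y) i"
   unfolding block_conv_def i unfolding 2(4)
  proof (intro sum.cong refl)
   fix r assume "r \<in> {..<h}"
   then have r: "r < h" by simp
   show "(u b r - u b (r + h)) * \<omega> ^ r *
    ((v b ((q + h - r) mod h) - v b ((q + h - r) mod h + h)) * \<omega> ^ ((q + h - r) mod h)) =
    stage \<omega> h x (2 * h * b + h + r) * stage \<omega> h y (2 * h * b + h + (q + h - r) mod h)"
    unfolding st(2)[OF r] st(2)[OF mod_less_divisor[OF h]] u_def v_def by simp
  qed
  finally show ?thesis .
 qed
qed

lemma inv_stage_stage:
 assumes h: "h > 0" and "\<omega> * \<omega>' = 1"
 shows "inv_stage \<omega>' h (stage \<omega> h x) = (\<lambda>i. 2 * x i)"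
proof
 fix i
 have pw: "\<omega> ^ q * \<omega>' ^ q = 1" for q
  using assms(2) by (simp flip: power_mult_distrib)
 have pw': "a * \<omega> ^ q * \<omega>' ^ q = a" for a q
  using pw[of q] by (simp add: mult.assoc)
 show "inv_stage \<omega>' h (stage \<omega> h x) i = 2 * x i"
  using h
 proof (cases rule: index_split[of h i])
  case (1 b q)
  have "(i + h) mod (2 * h) = h + q"
   using 1 by (simp add: add.assoc add.commute[of q h])
  moreover have "(i + h) mod h = q"
   using 1(4) by simp
  ultimately show ?thesis
   using 1 by (simp add: inv_stage_def stage_def pw')
 next
  case (2 b q)
  have "(i - h) mod (2 * h) = q"
   using 2 by simp
  then show ?thesis
   using 2 by (simp add: inv_stage_def stage_def pw' add.assoc add.commute[of h q])
 qed
qed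

text \<open>The spectrum comes out in bit-reversed order. \<open>bwd\<close> undoes the stages in
  the opposite order and consumes it as it stands, so no permutation occurs.\<close>

primrec fwd :: "(nat \<Rightarrow> 'a::comm_ring_1) \<Rightarrow> nat \<Rightarrow> (nat \<Rightarrow> 'a) \<Rightarrow> nat \<Rightarrow> nat \<Rightarrow> 'a" where
 "fwd om K x 0 = x"
| "fwd om K x (Suc t) = stage (om (2 ^ (K - Suc t))) (2 ^ (K - Suc t)) (fwd om K x t)"

primrec bwd :: "(nat \<Rightarrow> 'a::comm_ring_1) \<Rightarrow> (nat \<Rightarrow> 'a) \<Rightarrow> nat \<Rightarrow> nat \<Rightarrow> 'a" where
 "bwd om x 0 = x"
| "bwd om x (Suc t) = inv_stage (om (2 ^ t)) (2 ^ t) (bwd om x t)"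

lemma fwd_block_conv:
 assumes "\<And>h. h > 0 \<Longrightarrow> om h ^ h = - 1" and "t \<le> K"
 shows "fwd om K (block_conv (2 ^ K) x y) t = block_conv (2 ^ (K - t)) (fwd om K x t) (fwd om K y t)"
 using assms(2)
proof (induction t)
 case (Suc t)
 have "(2::nat) ^ (K - t) = 2 * 2 ^ (K - Suc t)"
  using Suc.prems by (simp flip: power_Suc add: Suc_diff_Suc)
 with Suc show ?case
  by (simp add: stage_block_conv assms(1))
qed simp

lemma bwd_fwd:
 assumes "\<And>h. h > 0 \<Longrightarrow> om h * om' h = 1" and "t \<le> K"
 shows "bwd om' (fwd om K x K) t = (\<lambda>i. 2 ^ t * fwd om K x (K - t) i)"
 using assms(2)
proof (induction t)
 case (Suc t)
 have "K - t = Suc (K - Suc t)" using Suc.prems by simp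
 then have "fwd om K x (K - t) = stage (om (2 ^ t)) (2 ^ t) (fwd om K x (K - Suc t))"
  using Suc.prems by simp
 then have "bwd om' (fwd om K x K) (Suc t) =
   inv_stage (om' (2 ^ t)) (2 ^ t) (\<lambda>i. 2 ^ t * stage (om (2 ^ t)) (2 ^ t) (fwd om K x (K - Suc t)) i)"
  using Suc by simp
 also have "\<dots> = (\<lambda>i. 2 ^ t * inv_stage (om' (2 ^ t)) (2 ^ t) (stage (om (2 ^ t)) (2 ^ t) (fwd om K x (K - Suc t))) i)"
  by (auto simp: inv_stage_def[of _ _ "\<lambda>i. 2 ^ t * _ i"] inv_stage_def[of _ _ "stage _ _ _"] fun_eq_iff algebra_simps)
 finally show ?case
  by (simp add: inv_stage_stage assms(1) mult.assoc mult.left_commute[of 2])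
qed simp

text \<open>After \<open>K\<close> stages the blocks have length 1 and the convolution is pointwise.
  The inverse stages do not halve, which leaves the factor \<open>2 ^ K\<close>; the final rounding
  removes it.\<close>

theorem fft_conv:
 assumes "\<And>h. h > 0 \<Longrightarrow> om h ^ h = - 1" "\<And>h. h > 0 \<Longrightarrow> om h * om' h = 1"
 shows "bwd om' (\<lambda>i. fwd om K x K i * fwd om K y K i) K = (\<lambda>i. 2 ^ K * block_conv (2 ^ K) x y i)"
proof -
 have "(\<lambda>i. fwd om K x K i * fwd om K y K i) = fwd om K (block_conv (2 ^ K) x y) K"
  using fwd_block_conv[OF assms(1), where K = K and t = K and x = x and y = y] by (simp add: block_conv_def fun_eq_iff)
 then show ?thesis
  using bwd_fwd[OF assms(2), where K = K and t = K and x = "block_conv (2 ^ K) x y"] by simp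
qed

section \<open>Fixed-point error analysis\<close>

text \<open>Pairs are complex numbers with \<open>f\<close> fractional bits. The division rounds
  both parts down, as the shift on words does.\<close>

definition fmul :: "nat \<Rightarrow> int \<times> int \<Rightarrow> int \<times> int \<Rightarrow> int \<times> int" where
 "fmul f u v = ((fst u * fst v - snd u * snd v) div 2 ^ f, (fst u * snd v + snd u * fst v) div 2 ^ f)"

definition padd :: "int \<times> int \<Rightarrow> int \<times> int \<Rightarrow> int \<times> int" where
 "padd u v = (fst u + fst v, snd u + snd v)"

definition psub :: "int \<times> int \<Rightarrow> int \<times> int \<Rightarrow> int \<times> int" where
 "psub u v = (fst u - fst v, snd u - snd v)"

definition pcnj :: "int \<times> int \<Rightarrow> int \<times> int" where
 "pcnj u = (fst u, - snd u)"

definition cv :: "nat \<Rightarrow> int \<times> int \<Rightarrow> complex" where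
 "cv f u = Complex (of_int (fst u) / 2 ^ f) (of_int (snd u) / 2 ^ f)"

lemma cv_padd: "cv f (padd u v) = cv f u + cv f v"
 by (simp add: cv_def padd_def complex_eq_iff add_divide_distrib)

lemma cv_psub: "cv f (psub u v) = cv f u - cv f v"
 by (simp add: cv_def psub_def complex_eq_iff diff_divide_distrib)

lemma cv_pcnj: "cv f (pcnj u) = cnj (cv f u)"
 by (simp add: cv_def pcnj_def complex_eq_iff)

lemma cv_bound:
 assumes "cmod (cv f u) \<le> B"
 shows "\<bar>real_of_int (fst u)\<bar> \<le> 2 ^ f * B" "\<bar>real_of_int (snd u)\<bar> \<le> 2 ^ f * B"
 using order_trans[OF abs_Re_le_cmod assms] order_trans[OF abs_Im_le_cmod assms]
 by (simp_all add: cv_def field_simps)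

lemma int_div_pow_error: "\<bar>real_of_int (x div 2 ^ f) - real_of_int x / 2 ^ f\<bar> \<le> 1"
proof -
 have "x div 2 ^ f = \<lfloor>real_of_int x / 2 ^ f\<rfloor>"
  using floor_divide_of_int_eq[where ?'a = real, of x "2 ^ f"] by simp
 then show ?thesis by linarith
qed

lemma fmul_error: "cmod (cv f (fmul f u v) - cv f u * cv f v) \<le> 2 / 2 ^ f"
proof -
 have "\<bar>real_of_int (x div 2 ^ f) / 2 ^ f - real_of_int x / 2 ^ f / 2 ^ f\<bar> \<le> 1 / 2 ^ f" for x
  using divide_right_mono[OF int_div_pow_error[of x f], of "2 ^ f"]
  by (simp only: diff_divide_distrib[symmetric] abs_divide) simp
 from this[of "fst u * fst v - snd u * snd v"] this[of "fst u * snd v + snd u * fst v"]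
 have "\<bar>Re (cv f (fmul f u v) - cv f u * cv f v)\<bar> \<le> 1 / 2 ^ f"
  "\<bar>Im (cv f (fmul f u v) - cv f u * cv f v)\<bar> \<le> 1 / 2 ^ f"
  by (simp_all add: cv_def fmul_def diff_divide_distrib add_divide_distrib)
 then show ?thesis
  using cmod_le[of "cv f (fmul f u v) - cv f u * cv f v"] by linarith
qed

definition mstage :: "nat \<Rightarrow> (nat \<Rightarrow> int \<times> int) \<Rightarrow> nat \<Rightarrow> (nat \<Rightarrow> int \<times> int) \<Rightarrow> nat \<Rightarrow> int \<times> int" where
 "mstage f tw h A i = (if i mod (2 * h) < h then padd (A i) (A (i + h))
   else fmul f (psub (A (i - h)) (A i)) (tw (i mod h)))"

definition minv_stage :: "nat \<Rightarrow> (nat \<Rightarrow> int \<times> int) \<Rightarrow> nat \<Rightarrow> (nat \<Rightarrow> int \<times> int) \<Rightarrow> nat \<Rightarrow> int \<times> int" where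
 "minv_stage f tw h A i = (if i mod (2 * h) < h then padd (A i) (fmul f (A (i + h)) (pcnj (tw (i mod h))))
   else psub (A (i - h)) (fmul f (A i) (pcnj (tw (i mod h)))))"

text \<open>Error and magnitude travel together, because the error of a product depends on the size
  of its factors.\<close>

definition near :: "nat \<Rightarrow> nat \<Rightarrow> (nat \<Rightarrow> int \<times> int) \<Rightarrow> (nat \<Rightarrow> complex) \<Rightarrow> real \<Rightarrow> real \<Rightarrow> bool" where
 "near f N A X E M \<longleftrightarrow> (\<forall>i<N. cmod (cv f (A i) - X i) \<le> E \<and> cmod (X i) \<le> M)"

lemma near_bound: "near f N A X E M \<Longrightarrow> i < N \<Longrightarrow> cmod (cv f (A i)) \<le> M + E"
 unfolding near_def by (smt (verit) norm_triangle_sub)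

lemma partner_less:
 assumes "2 * h dvd N" "i < N" "i mod (2 * h) < h"
 shows "i + h < (N::nat)"
proof -
 from assms(1) obtain c where N: "N = 2 * h * c" by auto
 have "i = 2 * h * (i div (2 * h)) + i mod (2 * h)" by simp
 moreover have "i div (2 * h) < c"
  using assms(2) by (simp add: N less_mult_imp_div_less mult.commute)
 then have "2 * h * (i div (2 * h) + 1) \<le> 2 * h * c" by (intro mult_left_mono) auto
 ultimately show ?thesis using assms(3) unfolding N by (simp add: algebra_simps)
qed

lemma mult_error:
 fixes u v u' v' :: complex
 assumes "cmod (u' - u) \<le> E" "cmod (v' - v) \<le> F"
 shows "cmod (u' * v' - u * v) \<le> E * cmod v' + cmod u * F"
proof -
 have "u' * v' - u * v = (u' - u) * v' + u * (v' - v)" by (simp add: algebra_simps)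
 then have "cmod (u' * v' - u * v) \<le> cmod (u' - u) * cmod v' + cmod u * cmod (v' - v)"
  by (metis norm_mult norm_triangle_ineq)
 then show ?thesis
  using mult_right_mono[OF assms(1), of "cmod v'"] mult_left_mono[OF assms(2), of "cmod u"] by simp
qed

locale twiddle =
 fixes f m :: nat and tab :: "nat \<Rightarrow> int \<times> int"
 assumes f_pos: "f \<ge> 1" and m_pos: "m > 0"
  and tab: "t < m \<Longrightarrow> cmod (cv f (tab t) - cis (pi * t / m)) \<le> 2 / 2 ^ f"
begin

text \<open>One table of \<open>m\<close> angles below pi serves every stage: if \<open>h\<close>
  divides \<open>m\<close>, the angle pi q / h is number \<open>q * (m div h)\<close> in it.\<close>

definition tw :: "nat \<Rightarrow> nat \<Rightarrow> int \<times> int" where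
 "tw h q = tab (q * (m div h))"

definition \<delta> :: real where "\<delta> = 2 / 2 ^ f"

definition om :: "nat \<Rightarrow> complex" where "om h = cis (pi / h)"
definition om' :: "nat \<Rightarrow> complex" where "om' h = cis (- (pi / h))"

lemma \<delta>: "0 < \<delta>" "\<delta> \<le> 1"
proof -
 have "(2::real) ^ 1 \<le> 2 ^ f" using f_pos by (intro power_increasing) auto
 then show "0 < \<delta>" "\<delta> \<le> 1" by (simp_all add: \<delta>_def)
qed

lemma fmul_\<delta>: "cmod (cv f (fmul f u v) - cv f u * cv f v) \<le> \<delta>"
 unfolding \<delta>_def by (rule fmul_error)

lemma om_pow: "h > 0 \<Longrightarrow> om h ^ h = - 1"
 by (simp add: om_def Complex.DeMoivre)

lemma om_om': "om h * om' h = 1"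
 by (simp add: om_def om'_def cis_mult)

lemma tw_index: "h dvd m \<Longrightarrow> q < h \<Longrightarrow> q * (m div h) < m"
 using m_pos by (auto elim!: dvdE)

lemma tw: "h dvd m \<Longrightarrow> q < h \<Longrightarrow> cmod (cv f (tw h q) - om h ^ q) \<le> \<delta>"
proof -
 assume h: "h dvd m" "q < h"
 then obtain c where c: "m = h * c" by auto
 have "pi * real (q * (m div h)) / real m = real q * (pi / real h)"
  using c m_pos h by (auto simp: field_simps)
 with tab[OF tw_index[OF h]] show ?thesis
  by (simp add: tw_def om_def Complex.DeMoivre \<delta>_def)
qed

lemma tw_cnj: "h dvd m \<Longrightarrow> q < h \<Longrightarrow> cmod (cv f (pcnj (tw h q)) - om' h ^ q) \<le> \<delta>"
proof -
 assume "h dvd m" "q < h"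
 from tw[OF this] have "cmod (cnj (cv f (tw h q) - om h ^ q)) \<le> \<delta>"
  by (simp only: complex_mod_cnj)
 then show ?thesis
  by (simp add: cv_pcnj om_def om'_def Complex.DeMoivre cis_cnj)
qed

lemma norm_om [simp]: "cmod (om h ^ q) = 1" "cmod (om' h ^ q) = 1"
 by (simp_all add: om_def om'_def norm_power)

lemma tw_bound: "h dvd m \<Longrightarrow> q < h \<Longrightarrow> cmod (cv f (tw h q)) \<le> 2" "h dvd m \<Longrightarrow> q < h \<Longrightarrow> cmod (cv f (pcnj (tw h q))) \<le> 2"
 using tw[of h q] tw_cnj[of h q] norm_triangle_sub[of "cv f (tw h q)" "om h ^ q"]
  norm_triangle_sub[of "cv f (pcnj (tw h q))" "om' h ^ q"] \<delta>(2) norm_om[of h q] by linarith+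

text \<open>The term \<open>2 * E\<close> comes from the crude bound 2 on the rounded twiddle
  factor, \<open>M * \<delta>\<close> from the error of that factor, and one further
  \<open>\<delta>\<close> from rounding the product.\<close>

lemma fmul_near:
 assumes "cmod (cv f u - x) \<le> E" "cmod x \<le> M" "cmod (cv f v - z) \<le> \<delta>" "cmod z = 1"
 shows "cmod (cv f (fmul f u v) - x * z) \<le> 2 * E + (M + 1) * \<delta>"
proof -
 have "cmod (cv f v) \<le> 2"
  using assms(3,4) norm_triangle_sub[of "cv f v" z] \<delta>(2) by linarith
 moreover have "0 \<le> E" using assms(1) norm_ge_zero order_trans by blast
 ultimately have "E * cmod (cv f v) \<le> E * 2" by (intro mult_left_mono)
 moreover have "cmod x * \<delta> \<le> M * \<delta>" using assms(2) \<delta> by (intro mult_right_mono) auto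
 ultimately have "cmod (cv f u * cv f v - x * z) \<le> 2 * E + M * \<delta>"
  using mult_error[OF assms(1,3)] by linarith
 then show ?thesis
  using fmul_\<delta>[of u v] norm_triangle_ineq[of "cv f (fmul f u v) - cv f u * cv f v" "cv f u * cv f v - x * z"]
  by (simp add: algebra_simps)
qed

text \<open>The upper half is the critical one: it multiplies a difference with error
  \<open>2 * E\<close> and magnitude \<open>2 * M\<close>, and \<open>fmul_near\<close> turns these
  into the bound.\<close>

lemma near_mstage:
 assumes A: "near f N A X E M" and h: "2 * h dvd N" "h dvd m" "h > 0"
 shows "near f N (mstage f (tw h) h A) (stage (om h) h X) (4 * E + (2 * M + 1) * \<delta>) (2 * M)"
 unfolding near_def
proof safe
 fix i assume i: "i < N"
 have E: "0 \<le> E" "0 \<le> M" using A i unfolding near_def by (meson norm_ge_zero order_trans)+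
 have nn: "0 \<le> (2 * M + 1) * \<delta>" using E \<delta> by simp
 show "cmod (cv f (mstage f (tw h) h A i) - stage (om h) h X i) \<le> 4 * E + (2 * M + 1) * \<delta>"
 proof (cases "i mod (2 * h) < h")
  case True
  have "i + h < N" by (rule partner_less) (use True h i in auto)
  then have "cmod (cv f (A i) - X i) \<le> E" "cmod (cv f (A (i + h)) - X (i + h)) \<le> E"
   using A i by (auto simp: near_def)
  then have "cmod ((cv f (A i) - X i) + (cv f (A (i + h)) - X (i + h))) \<le> 2 * E"
   by (smt (verit) norm_triangle_ineq)
  with True nn E show ?thesis
   by (simp add: mstage_def stage_def cv_padd algebra_simps)
 next
  case False
  have "cmod (cv f (A (i - h)) - X (i - h)) \<le> E" "cmod (cv f (A i) - X i) \<le> E"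
   "cmod (X (i - h)) \<le> M" "cmod (X i) \<le> M"
   using A i by (auto simp: near_def)
  then have "cmod ((cv f (A (i - h)) - X (i - h)) - (cv f (A i) - X i)) \<le> 2 * E" "cmod (X (i - h) - X i) \<le> 2 * M"
   by (smt (verit) norm_triangle_ineq4)+
  moreover have "(cv f (A (i - h)) - X (i - h)) - (cv f (A i) - X i) = cv f (psub (A (i - h)) (A i)) - (X (i - h) - X i)"
   by (simp add: cv_psub)
  ultimately have "cmod (cv f (fmul f (psub (A (i - h)) (A i)) (tw h (i mod h))) - (X (i - h) - X i) * om h ^ (i mod h))
    \<le> 2 * (2 * E) + (2 * M + 1) * \<delta>"
   using h by (intro fmul_near tw) auto
  with False show ?thesis
   by (simp add: mstage_def stage_def)
 qed
 show "cmod (stage (om h) h X i) \<le> 2 * M"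
 proof (cases "i mod (2 * h) < h")
  case True
  have "i + h < N" by (rule partner_less) (use True h i in auto)
  then have "cmod (X i) \<le> M" "cmod (X (i + h)) \<le> M"
   using A i by (auto simp: near_def)
  with True show ?thesis
   by (simp add: stage_def) (smt (verit) norm_triangle_ineq)
 next
  case False
  have "cmod (X (i - h)) \<le> M" "cmod (X i) \<le> M"
   using A i by (auto simp: near_def)
  with False show ?thesis
   by (simp add: stage_def norm_mult) (smt (verit) norm_triangle_ineq4)
 qed
qed

lemma near_minv_stage:
 assumes A: "near f N A X E M" and h: "2 * h dvd N" "h dvd m" "h > 0"
 shows "near f N (minv_stage f (tw h) h A) (inv_stage (om' h) h X) (4 * E + (2 * M + 1) * \<delta>) (2 * M)"
 unfolding near_def
proof safe
 fix i assume i: "i < N"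
 have E: "0 \<le> E" "0 \<le> M" using A i unfolding near_def by (meson norm_ge_zero order_trans)+
 have nn: "(M + 1) * \<delta> \<le> (2 * M + 1) * \<delta>" using E \<delta> by (intro mult_right_mono) auto
 have q: "i mod h < h" using h by simp
 show "cmod (cv f (minv_stage f (tw h) h A i) - inv_stage (om' h) h X i) \<le> 4 * E + (2 * M + 1) * \<delta>"
 proof (cases "i mod (2 * h) < h")
  case True
  have "i + h < N" by (rule partner_less) (use True h i in auto)
  then have *: "cmod (cv f (A i) - X i) \<le> E" "cmod (cv f (A (i + h)) - X (i + h)) \<le> E" "cmod (X (i + h)) \<le> M"
   using A i by (auto simp: near_def)
  from fmul_near[OF *(2,3) tw_cnj[OF h(2) q]]
  have "cmod (cv f (fmul f (A (i + h)) (pcnj (tw h (i mod h)))) - X (i + h) * om' h ^ (i mod h)) \<le> 2 * E + (M + 1) * \<delta>"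
   by simp
  with *(1) have "cmod ((cv f (A i) - X i) + (cv f (fmul f (A (i + h)) (pcnj (tw h (i mod h)))) - X (i + h) * om' h ^ (i mod h)))
    \<le> 3 * E + (M + 1) * \<delta>"
   by (smt (verit) norm_triangle_ineq)
  with True nn E show ?thesis
   by (simp add: minv_stage_def inv_stage_def cv_padd algebra_simps)
 next
  case False
  have *: "cmod (cv f (A (i - h)) - X (i - h)) \<le> E" "cmod (cv f (A i) - X i) \<le> E" "cmod (X i) \<le> M"
   using A i by (auto simp: near_def)
  from fmul_near[OF *(2,3) tw_cnj[OF h(2) q]]
  have "cmod (cv f (fmul f (A i) (pcnj (tw h (i mod h)))) - X i * om' h ^ (i mod h)) \<le> 2 * E + (M + 1) * \<delta>"
   by simp
  with *(1) have "cmod ((cv f (A (i - h)) - X (i - h)) - (cv f (fmul f (A i) (pcnj (tw h (i mod h)))) - X i * om' h ^ (i mod h)))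
    \<le> 3 * E + (M + 1) * \<delta>"
   by (smt (verit) norm_triangle_ineq4)
  with False nn E show ?thesis
   by (simp add: minv_stage_def inv_stage_def cv_psub algebra_simps)
 qed
 show "cmod (inv_stage (om' h) h X i) \<le> 2 * M"
 proof (cases "i mod (2 * h) < h")
  case True
  have "i + h < N" by (rule partner_less) (use True h i in auto)
  then have "cmod (X i) \<le> M" "cmod (X (i + h) * om' h ^ (i mod h)) \<le> M"
   using A i by (auto simp: near_def norm_mult)
  with True show ?thesis
   by (simp add: inv_stage_def) (smt (verit) norm_triangle_ineq)
 next
  case False
  have "cmod (X (i - h)) \<le> M" "cmod (X i * om' h ^ (i mod h)) \<le> M"
   using A i by (auto simp: near_def norm_mult)
  with False show ?thesis
   by (simp add: inv_stage_def) (smt (verit) norm_triangle_ineq4)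
 qed
qed

primrec mfwd :: "nat \<Rightarrow> (nat \<Rightarrow> int \<times> int) \<Rightarrow> nat \<Rightarrow> nat \<Rightarrow> int \<times> int" where
 "mfwd K A 0 = A"
| "mfwd K A (Suc t) = mstage f (tw (2 ^ (K - Suc t))) (2 ^ (K - Suc t)) (mfwd K A t)"

primrec mbwd :: "(nat \<Rightarrow> int \<times> int) \<Rightarrow> nat \<Rightarrow> nat \<Rightarrow> int \<times> int" where
 "mbwd A 0 = A"
| "mbwd A (Suc t) = minv_stage f (tw (2 ^ t)) (2 ^ t) (mbwd A t)"

text \<open>A stage quadruples the error and adds a term that grows like 2^t. The rate 8 has room
  for both, 4 for the old error and 4 for the new term, and \<open>8 ^ K\<close> is simply the cube
  of the transform length.\<close>

lemma error_step:
 assumes "E \<le> 8 ^ t * e" "(M + 1) * \<delta> \<le> e" "0 \<le> M"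
 shows "4 * E + (2 * (2 ^ t * M) + 1) * \<delta> \<le> 8 ^ Suc t * e"
proof -
 have e: "0 \<le> e" using assms \<delta> by (smt (verit) mult_nonneg_nonneg)
 have "(2 * (2 ^ t * M) + 1) * \<delta> \<le> (2 * 2 ^ t * (M + 1)) * \<delta>"
 proof (intro mult_right_mono)
  have "(1::real) \<le> 2 ^ t" by simp
  then have "(1::real) \<le> 2 * 2 ^ t" by linarith
  then show "2 * (2 ^ t * M) + 1 \<le> 2 * 2 ^ t * (M + 1)" by (simp add: algebra_simps)
 qed (use \<delta> in auto)
 also have "\<dots> \<le> 2 * 2 ^ t * e" using assms(2) by (simp add: mult.assoc)
 also have "\<dots> \<le> 4 * 8 ^ t * e"
  by (intro mult_right_mono mult_mono power_mono) (use e in auto)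
 finally show ?thesis using assms(1) by simp
qed

lemma near_mono: "near f N A X E M \<Longrightarrow> E \<le> E' \<Longrightarrow> M \<le> M' \<Longrightarrow> near f N A X E' M'"
 unfolding near_def by (meson order_trans)

lemma near_mfwd:
 assumes "near f (2 ^ K) A X 0 M" "0 \<le> M" "t \<le> K" "2 ^ K dvd 2 * m"
 shows "near f (2 ^ K) (mfwd K A t) (fwd om K X t) (8 ^ t * ((M + 1) * \<delta>)) (2 ^ t * M)"
 using assms(3)
proof (induction t)
 case 0
 show ?case
  unfolding fwd.simps bwd.simps mfwd.simps mbwd.simps
  by (rule near_mono[OF assms(1)]) (use assms(2) \<delta> in simp_all)
next
 case (Suc t)
 let ?h = "2 ^ (K - Suc t) :: nat"
 have "2 * ?h = 2 ^ (K - t)" using Suc.prems by (simp flip: power_Suc add: Suc_diff_Suc)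
 then have h: "2 * ?h dvd 2 ^ K" by (simp add: le_imp_power_dvd)
 then have "2 * ?h dvd 2 * m" using assms(4) dvd_trans by blast
 then have "?h dvd m" by simp
 from near_mstage[OF Suc.IH[OF Suc_leD[OF Suc.prems]] h this]
 have "near f (2 ^ K) (mfwd K A (Suc t)) (fwd om K X (Suc t))
   (4 * (8 ^ t * ((M + 1) * \<delta>)) + (2 * (2 ^ t * M) + 1) * \<delta>) (2 * (2 ^ t * M))"
  by simp
 then show ?case
  by (rule near_mono) (rule error_step, use assms(2) in simp_all)
qed

lemma near_mbwd:
 assumes "near f (2 ^ K) A X E M" "0 \<le> M" "0 \<le> E" "t \<le> K" "2 ^ K dvd 2 * m"
 shows "near f (2 ^ K) (mbwd A t) (bwd om' X t) (8 ^ t * (E + (M + 1) * \<delta>)) (2 ^ t * M)"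
 using assms(4)
proof (induction t)
 case 0
 show ?case
  unfolding fwd.simps bwd.simps mfwd.simps mbwd.simps
  by (rule near_mono[OF assms(1)]) (use assms(2) \<delta> in simp_all)
next
 case (Suc t)
 have h: "2 * 2 ^ t dvd (2::nat) ^ K" using Suc.prems by (metis le_imp_power_dvd power_Suc)
 then have "2 * 2 ^ t dvd 2 * m" using assms(5) dvd_trans by blast
 then have "2 ^ t dvd m" by simp
 from near_minv_stage[OF Suc.IH[OF Suc_leD[OF Suc.prems]] h this]
 have "near f (2 ^ K) (mbwd A (Suc t)) (bwd om' X (Suc t))
   (4 * (8 ^ t * (E + (M + 1) * \<delta>)) + (2 * (2 ^ t * M) + 1) * \<delta>) (2 * (2 ^ t * M))"
  by simp
 then show ?case
  by (rule near_mono) (rule error_step, use assms(2,3) in simp_all)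
qed

section \<open>Error budget of a whole convolution\<close>

lemma cv_init: "cv f (int a * 2 ^ f, 0) = of_nat a"
 by (simp add: cv_def complex_eq_iff)

text \<open>The exponents in \<open>prec\<close> add up over the three phases. With N = 2^K, the
  forward transforms end with error 2 N^3 P \<delta>, the pointwise product raises it to 7 N^4 P^2
  \<delta>, and the backward transform multiplies by N^3 once more. As \<delta> = 2 / 2^f, the
  factor 512 brings the result below 1/16.\<close>

context
 fixes K P :: nat and a b :: "nat \<Rightarrow> nat"
 assumes K: "2 ^ K dvd 2 * m" and P: "P \<ge> 1" and prec: "512 * (2 ^ K) ^ 7 * P ^ 2 \<le> (2::nat) ^ f"
  and a: "\<And>i. i < 2 ^ K \<Longrightarrow> a i \<le> P" and b: "\<And>i. i < 2 ^ K \<Longrightarrow> b i \<le> P"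
begin

definition "Af t = mfwd K (\<lambda>i. (int (a i) * 2 ^ f, 0)) t"
definition "Bf t = mfwd K (\<lambda>i. (int (b i) * 2 ^ f, 0)) t"
definition "Cf t = mbwd (\<lambda>i. fmul f (Af K i) (Bf K i)) t"

abbreviation (input) "NN \<equiv> (2::real) ^ K"
abbreviation (input) "PP \<equiv> real P"

lemma prec_real: "512 * NN ^ 7 * PP ^ 2 \<le> 2 ^ f"
 using prec by (metis (mono_tags, lifting) of_nat_le_iff of_nat_mult of_nat_numeral of_nat_power)

lemma NP: "NN \<ge> 1" "PP \<ge> 1"
 using P by simp_all

lemma \<delta>_le: "512 * NN ^ 7 * PP ^ 2 * \<delta> \<le> 2"
 using prec_real by (simp add: \<delta>_def field_simps)

lemma fwd_error: "(PP + 1) * \<delta> \<le> 2 * PP * \<delta>" "t \<le> K \<Longrightarrow> 8 ^ t * ((PP + 1) * \<delta>) \<le> 2 * NN ^ 3 * PP * \<delta>"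
proof -
 show *: "(PP + 1) * \<delta> \<le> 2 * PP * \<delta>" using NP \<delta> by (intro mult_right_mono) auto
 assume "t \<le> K"
 then have "(8::real) ^ t \<le> 8 ^ K" by (intro power_increasing) auto
 also have "(8::real) ^ K = NN ^ 3" using power_mult[of "2::real" 3 K] power_mult[of "2::real" K 3] by (simp add: mult.commute)
 finally show "8 ^ t * ((PP + 1) * \<delta>) \<le> 2 * NN ^ 3 * PP * \<delta>"
  using mult_mono[OF _ *, of "8 ^ t" "NN ^ 3"] \<delta> NP by (simp add: algebra_simps)
qed

lemma fwd_error_le_1: "2 * NN ^ 3 * PP * \<delta> \<le> 1"
proof -
 have "4 * NN ^ 3 * PP * \<delta> \<le> 512 * NN ^ 7 * PP ^ 2 * \<delta>"
  by (intro mult_right_mono mult_mono power_increasing) (use NP \<delta> self_le_power[of PP 2] in auto)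
 with \<delta>_le show ?thesis by linarith
qed

lemma near_Af: "t \<le> K \<Longrightarrow> near f (2 ^ K) (Af t) (fwd om K (\<lambda>i. of_nat (a i)) t) (2 * NN ^ 3 * PP * \<delta>) (NN * PP)"
 unfolding Af_def
proof (rule near_mono[OF near_mfwd[of K _ _ PP]])
 show "near f (2 ^ K) (\<lambda>i. (int (a i) * 2 ^ f, 0)) (\<lambda>i. of_nat (a i)) 0 PP"
  using a by (simp add: near_def cv_init)
 show "2 ^ t * PP \<le> NN * PP" if "t \<le> K"
  using that by (intro mult_right_mono power_increasing) auto
qed (use K fwd_error(2)[of t] in simp_all)

lemma near_Bf: "t \<le> K \<Longrightarrow> near f (2 ^ K) (Bf t) (fwd om K (\<lambda>i. of_nat (b i)) t) (2 * NN ^ 3 * PP * \<delta>) (NN * PP)"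
 unfolding Bf_def
proof (rule near_mono[OF near_mfwd[of K _ _ PP]])
 show "near f (2 ^ K) (\<lambda>i. (int (b i) * 2 ^ f, 0)) (\<lambda>i. of_nat (b i)) 0 PP"
  using b by (simp add: near_def cv_init)
 show "2 ^ t * PP \<le> NN * PP" if "t \<le> K"
  using that by (intro mult_right_mono power_increasing) auto
qed (use K fwd_error(2)[of t] in simp_all)

lemma bound_AB:
 assumes "t \<le> K" "i < 2 ^ K"
 shows "cmod (cv f (Af t i)) \<le> 2 * NN * PP" "cmod (cv f (Bf t i)) \<le> 2 * NN * PP"
proof -
 have "1 \<le> NN * PP" using mult_mono[of 1 NN 1 PP] NP by simp
 with near_bound[OF near_Af[OF assms(1)] assms(2)] near_bound[OF near_Bf[OF assms(1)] assms(2)] fwd_error_le_1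
 show "cmod (cv f (Af t i)) \<le> 2 * NN * PP" "cmod (cv f (Bf t i)) \<le> 2 * NN * PP" by linarith+
qed

lemma near_C0: "near f (2 ^ K) (\<lambda>i. fmul f (Af K i) (Bf K i))
 (\<lambda>i. fwd om K (\<lambda>i. of_nat (a i)) K i * fwd om K (\<lambda>i. of_nat (b i)) K i) (7 * NN ^ 4 * PP ^ 2 * \<delta>) (NN ^ 2 * PP ^ 2)"
 unfolding near_def
proof safe
 fix i :: nat assume i: "i < 2 ^ K"
 let ?x = "fwd om K (\<lambda>i. of_nat (a i)) K i" and ?y = "fwd om K (\<lambda>i. of_nat (b i)) K i"
 let ?E = "2 * NN ^ 3 * PP * \<delta>"
 have x: "cmod (cv f (Af K i) - ?x) \<le> ?E" "cmod ?x \<le> NN * PP" "cmod (cv f (Bf K i) - ?y) \<le> ?E" "cmod ?y \<le> NN * PP"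
  using near_Af[of K] near_Bf[of K] i by (auto simp: near_def)
 have E0: "0 \<le> ?E" using \<delta> NP by simp
 have "cmod (cv f (Af K i) * cv f (Bf K i) - ?x * ?y) \<le> ?E * cmod (cv f (Bf K i)) + cmod ?x * ?E"
  by (rule mult_error) (use x in auto)
 also have "\<dots> \<le> ?E * (2 * NN * PP) + (NN * PP) * ?E"
  by (intro add_mono mult_left_mono mult_right_mono) (use bound_AB[of K i] i x E0 in auto)
 also have "\<dots> = 6 * NN ^ 4 * PP ^ 2 * \<delta>" by (simp add: power_numeral_reduce algebra_simps)
 finally have "cmod (cv f (Af K i) * cv f (Bf K i) - ?x * ?y) \<le> 6 * NN ^ 4 * PP ^ 2 * \<delta>" .
 moreover have "\<delta> \<le> NN ^ 4 * PP ^ 2 * \<delta>"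
  using mult_mono[of 1 "NN ^ 4" 1 "PP ^ 2"] NP \<delta> by (simp add: mult_le_cancel_right1)
 ultimately show "cmod (cv f (fmul f (Af K i) (Bf K i)) - ?x * ?y) \<le> 7 * NN ^ 4 * PP ^ 2 * \<delta>"
  using fmul_\<delta>[of "Af K i" "Bf K i"]
   norm_triangle_ineq[of "cv f (fmul f (Af K i) (Bf K i)) - cv f (Af K i) * cv f (Bf K i)" "cv f (Af K i) * cv f (Bf K i) - ?x * ?y"]
  by (simp add: algebra_simps)
 show "cmod (?x * ?y) \<le> NN ^ 2 * PP ^ 2"
  using mult_mono[OF x(2,4)] NP by (simp add: norm_mult power2_eq_square algebra_simps)
qed

lemma bwd_error: "t \<le> K \<Longrightarrow> 8 ^ t * (7 * NN ^ 4 * PP ^ 2 * \<delta> + (NN ^ 2 * PP ^ 2 + 1) * \<delta>) \<le> 1 / 16"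
proof -
 assume "t \<le> K"
 then have "(8::real) ^ t \<le> 8 ^ K" by (intro power_increasing) auto
 also have "(8::real) ^ K = NN ^ 3" using power_mult[of "2::real" 3 K] power_mult[of "2::real" K 3] by (simp add: mult.commute)
 finally have 8: "(8::real) ^ t \<le> NN ^ 3" .
 have "1 \<le> NN ^ 4 * PP ^ 2" using mult_mono[of 1 "NN ^ 4" 1 "PP ^ 2"] NP by simp
 moreover have "NN ^ 2 * PP ^ 2 \<le> NN ^ 4 * PP ^ 2" using NP by (intro mult_right_mono power_increasing) auto
 ultimately have "(7 * NN ^ 4 * PP ^ 2 + (NN ^ 2 * PP ^ 2 + 1)) * \<delta> \<le> (9 * NN ^ 4 * PP ^ 2) * \<delta>"
  using \<delta> by (intro mult_right_mono) linarith+
 then have "8 ^ t * (7 * NN ^ 4 * PP ^ 2 * \<delta> + (NN ^ 2 * PP ^ 2 + 1) * \<delta>) \<le> NN ^ 3 * ((9 * NN ^ 4 * PP ^ 2) * \<delta>)"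
  using 8 \<delta> NP by (intro mult_mono) (auto simp: distrib_right)
 also have "\<dots> = 9 * NN ^ 7 * PP ^ 2 * \<delta>" by (simp add: power_numeral_reduce algebra_simps)
 finally show ?thesis using \<delta>_le by linarith
qed

lemma near_Cf: "t \<le> K \<Longrightarrow> near f (2 ^ K) (Cf t)
 (bwd om' (\<lambda>i. fwd om K (\<lambda>i. of_nat (a i)) K i * fwd om K (\<lambda>i. of_nat (b i)) K i) t) (1 / 16) (NN ^ 3 * PP ^ 2)"
 unfolding Cf_def
proof (rule near_mono[OF near_mbwd[OF near_C0]])
 assume "t \<le> K"
 have "2 ^ t * (NN ^ 2 * PP ^ 2) \<le> NN * (NN ^ 2 * PP ^ 2)"
  using \<open>t \<le> K\<close> by (intro mult_right_mono power_increasing) auto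
 then show "2 ^ t * (NN ^ 2 * PP ^ 2) \<le> NN ^ 3 * PP ^ 2"
  by (simp add: power_numeral_reduce algebra_simps)
qed (use bwd_error[of t] K \<delta> in simp_all)

lemma bound_C:
 assumes "t \<le> K" "i < 2 ^ K"
 shows "cmod (cv f (Cf t i)) \<le> 2 * NN ^ 3 * PP ^ 2"
proof -
 have "1 \<le> NN ^ 3 * PP ^ 2" using mult_mono[of 1 "NN ^ 3" 1 "PP ^ 2"] NP by simp
 with near_bound[OF near_Cf[OF assms(1)] assms(2)] show ?thesis by linarith
qed

text \<open>The computed value is \<open>NN * c\<close> up to 1/16, hence off by less than half of
  \<open>NN\<close>. Adding \<open>2 ^ (f + K - 1)\<close> and discarding \<open>f + K\<close> bits
  therefore recovers the integer \<open>c\<close>; the \<open>K\<close> extra bits cancel the factor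
  left by the unnormalised inverse transform.\<close>

lemma Cf_exact:
 assumes i: "i < 2 ^ K"
 shows "\<bar>real_of_int (fst (Cf K i)) / 2 ^ f - NN * real_of_int (block_conv (2 ^ K) (\<lambda>i. int (a i)) (\<lambda>i. int (b i)) i)\<bar> \<le> 1 / 16" (is ?A)
  and "(fst (Cf K i) + 2 ^ (f + K - 1)) div 2 ^ (f + K) = block_conv (2 ^ K) (\<lambda>i. int (a i)) (\<lambda>i. int (b i)) i" (is ?B)
proof -
 define c where "c = block_conv (2 ^ K) (\<lambda>i. int (a i)) (\<lambda>i. int (b i)) i"
 define x where "x = fst (Cf K i)"
 have c: "block_conv (2 ^ K) (\<lambda>i. of_nat (a i)) (\<lambda>i. of_nat (b i)) i = complex_of_real (real_of_int c)"
  by (simp add: c_def block_conv_def)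
 have "cmod (cv f (Cf K i) - 2 ^ K * block_conv (2 ^ K) (\<lambda>i. of_nat (a i)) (\<lambda>i. of_nat (b i)) i) \<le> 1 / 16"
  using near_Cf[of K] i fft_conv[of om om' K "\<lambda>i. of_nat (a i)" "\<lambda>i. of_nat (b i)"] om_pow om_om'
  by (simp add: near_def)
 then have "\<bar>Re (cv f (Cf K i) - 2 ^ K * complex_of_real (real_of_int c))\<bar> \<le> 1 / 16"
  unfolding c using abs_Re_le_cmod order_trans by blast
 moreover have "Re (2 ^ K * complex_of_real (real_of_int c)) = NN * real_of_int c"
 proof -
  have "2 ^ K * complex_of_real (real_of_int c) = complex_of_real (NN * real_of_int c)" by simp
  then show ?thesis by (simp only: Re_complex_of_real)
 qed
 ultimately have A: "\<bar>real_of_int x / 2 ^ f - NN * real_of_int c\<bar> \<le> 1 / 16"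
  by (simp add: cv_def x_def)
 then show ?A by (simp add: x_def c_def)
 define e where "e = real_of_int x / 2 ^ f - NN * real_of_int c"
 have x: "real_of_int x = 2 ^ f * (NN * c + e)" by (simp add: e_def)
 have e: "\<bar>e\<bar> \<le> 1 / 16" using A by (simp add: e_def)
 have half: "(2::real) ^ (f + K - 1) = 2 ^ f * NN / 2"
  using f_pos by (cases f) (auto simp: power_add)
 have "0 \<le> e + NN / 2" "e + NN / 2 < NN" using e NP(1) by linarith+
 then have "2 ^ f * (NN * c) \<le> 2 ^ f * (NN * c + e + NN / 2)" "2 ^ f * (NN * c + e + NN / 2) < 2 ^ f * (NN * c + NN)"
  by simp_all
 moreover have "real_of_int (c * 2 ^ (f + K)) = 2 ^ f * (NN * c)"
  "real_of_int ((c + 1) * 2 ^ (f + K)) = 2 ^ f * (NN * c + NN)"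
  by (simp_all add: power_add algebra_simps)
 moreover have "real_of_int (2 ^ (f + K - 1)) = 2 ^ f * NN / 2"
  by (simp only: of_int_power of_int_numeral half)
 then have "real_of_int (x + 2 ^ (f + K - 1)) = 2 ^ f * (NN * c + e + NN / 2)"
  by (simp only: of_int_add x) (simp add: distrib_left)
 ultimately have "real_of_int (c * 2 ^ (f + K)) \<le> real_of_int (x + 2 ^ (f + K - 1))"
  "real_of_int (x + 2 ^ (f + K - 1)) < real_of_int ((c + 1) * 2 ^ (f + K))"
  by (simp_all only:)
 then have "c * 2 ^ (f + K) \<le> x + 2 ^ (f + K - 1)" "x + 2 ^ (f + K - 1) < (c + 1) * 2 ^ (f + K)"
  by (simp_all only: of_int_le_iff of_int_less_iff)
 then have "(x + 2 ^ (f + K - 1)) div 2 ^ (f + K) = c"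
  by (intro int_div_pos_eq[where r = "x + 2 ^ (f + K - 1) - c * 2 ^ (f + K)"]) (simp_all add: distrib_right)
 then show ?B by (simp add: x_def c_def)
qed

end

end

section \<open>Transposed multipoint evaluation\<close>

text \<open>Linear factors in reversed form: their inverses are geometric series, and the constant
  coefficient is always 1, so that \<open>h\<close> numbers describe a node of \<open>h\<close>
  points.\<close>

definition node_poly :: "(nat \<Rightarrow> nat) \<Rightarrow> nat \<Rightarrow> nat \<Rightarrow> int poly" where
 "node_poly x b h = (\<Prod>j=b..<b+h. [:1, - int (x j):])"

definition node_series :: "(nat \<Rightarrow> nat) \<Rightarrow> nat \<Rightarrow> nat \<Rightarrow> int fps" where
 "node_series x b h = (\<Prod>j=b..<b+h. Abs_fps (\<lambda>k. int (x j) ^ k))"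

text \<open>The transposed product of the coefficient vector with the series of a node, read at
  offset \<open>a\<close>. For a single point the series consists of its powers, and offset
  \<open>0\<close> gives the value of the polynomial there.\<close>

definition transposed :: "(nat \<Rightarrow> nat) \<Rightarrow> (nat \<Rightarrow> nat) \<Rightarrow> nat \<Rightarrow> nat \<Rightarrow> nat \<Rightarrow> nat \<Rightarrow> int" where
 "transposed x c m b h a = (\<Sum>i=a..<m. int (c i) * node_series x b h $ (i - a))"

lemma node_poly_split: "node_poly x b (h + h') = node_poly x b h * node_poly x (b + h) h'"
 unfolding node_poly_def by (simp add: prod.atLeastLessThan_concat add.assoc)

lemma node_series_split: "node_series x b (h + h') = node_series x b h * node_series x (b + h) h'"
 unfolding node_series_def by (simp add: prod.atLeastLessThan_concat add.assoc)

lemma linear_times_geometric: "fps_of_poly [:1, - c:] * Abs_fps (\<lambda>k. c ^ k) = (1::int fps)"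
proof (rule fps_ext)
 fix n
 show "(fps_of_poly [:1, - c:] * Abs_fps (\<lambda>k. c ^ k)) $ n = (1::int fps) $ n"
 proof (cases n)
  case (Suc k)
  have "(\<Sum>i=0..Suc k. coeff [:1, - c:] i * c ^ (Suc k - i)) =
   (\<Sum>i\<in>{0,1}. coeff [:1, - c:] i * c ^ (Suc k - i))"
   by (rule sum.mono_neutral_right) (auto simp: coeff_pCons split: nat.splits)
  then show ?thesis by (simp add: Suc fps_mult_nth)
 qed simp
qed

lemma node_poly_series: "fps_of_poly (node_poly x b h) * node_series x b h = 1"
 unfolding node_poly_def node_series_def fps_of_poly_prod prod.distrib[symmetric]
 by (simp add: linear_times_geometric)

lemma coeff_node_poly_0 [simp]: "coeff (node_poly x b h) 0 = 1"
 by (simp add: node_poly_def poly_0_coeff_0[symmetric] poly_prod)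

lemma degree_node_poly: "degree (node_poly x b h) \<le> h"
proof -
 have "degree (node_poly x b h) \<le> (\<Sum>j=b..<b+h. degree [:1, - int (x j):])"
  unfolding node_poly_def using degree_prod_sum_le[of "{b..<b+h}" "\<lambda>j. [:1, - int (x j):]"] by (simp add: o_def)
 also have "\<dots> \<le> (\<Sum>j=b..<b+h. 1)" by (intro sum_mono) auto
 finally show ?thesis by simp
qed

lemma coeff_node_poly_eq_0: "h < i \<Longrightarrow> coeff (node_poly x b h) i = 0"
 using degree_node_poly[of x b h] by (intro coeff_eq_0) simp

lemma node_poly_1: "node_poly x b 1 = [:1, - int (x b):]"
 by (simp add: node_poly_def)

text \<open>Splits off the two constant coefficients 1. What remains is a convolution of the stored
  parts; storing coefficient \<open>e + 1\<close> at index \<open>e\<close> on both sides shifts it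
  to index \<open>t - 1\<close>.\<close>

lemma coeff_mult_unit_Suc:
 fixes P Q :: "int poly"
 assumes "coeff P 0 = 1" "coeff Q 0 = 1"
 shows "coeff (P * Q) (Suc t) = coeff P (Suc t) + coeff Q (Suc t) +
  (if t = 0 then 0 else \<Sum>e\<le>t - 1. coeff P (Suc e) * coeff Q (Suc (t - 1 - e)))"
proof -
 have "coeff (P * Q) (Suc t) = (\<Sum>i\<le>Suc t. coeff P i * coeff Q (Suc t - i))"
  by (simp add: coeff_mult)
 also have "\<dots> = coeff Q (Suc t) + (\<Sum>i\<le>t. coeff P (Suc i) * coeff Q (t - i))"
  using assms by (subst sum.atMost_Suc_shift) simp
 also have "(\<Sum>i\<le>t. coeff P (Suc i) * coeff Q (t - i)) =
   coeff P (Suc t) + (if t = 0 then 0 else \<Sum>e\<le>t - 1. coeff P (Suc e) * coeff Q (Suc (t - 1 - e)))"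
 proof (cases t)
  case (Suc s)
  have "(\<Sum>i\<le>s. coeff P (Suc i) * coeff Q (Suc s - i)) = (\<Sum>i\<le>s. coeff P (Suc i) * coeff Q (Suc (s - i)))"
   by (intro sum.cong) (auto simp: Suc_diff_le)
  then show ?thesis using assms by (simp add: Suc)
 qed (use assms in simp)
 finally show ?thesis by simp
qed

text \<open>The condition concerns the single index that is read. Other entries may wrap around,
  which is what middle products exploit.\<close>

lemma block_conv_linear:
 assumes "t < N" and "\<And>e. t < e \<Longrightarrow> e < N \<Longrightarrow> a e = 0 \<or> b (N + t - e) = 0"
 shows "block_conv N a b t = (\<Sum>e\<le>t. a e * b (t - e))"
proof -
 have "block_conv N a b t = (\<Sum>e<N. a e * b ((t + N - e) mod N))"
  using assms(1) by (simp add: block_conv_def)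
 also have "\<dots> = (\<Sum>e\<in>{..t}. a e * b ((t + N - e) mod N))"
 proof (rule sum.mono_neutral_right)
  show "\<forall>e\<in>{..<N} - {..t}. a e * b ((t + N - e) mod N) = 0"
  proof
   fix e assume "e \<in> {..<N} - {..t}"
   then have "t < e" "e < N" by auto
   then show "a e * b ((t + N - e) mod N) = 0"
    using assms(2)[of e] by (auto simp: add.commute)
  qed
 qed (use assms in auto)
 also have "\<dots> = (\<Sum>e\<le>t. a e * b (t - e))"
 proof (intro sum.cong refl)
  fix e assume "e \<in> {..t}"
  then have "t + N - e = (t - e) + N" by simp
  then have "(t + N - e) mod N = t - e"
   using assms(1) by (simp only: mod_add_self2) simp
  then show "a e * b ((t + N - e) mod N) = a e * b (t - e)" by simp
 qed
 finally show ?thesis .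
qed

text \<open>For the truncation \<open>Qh\<close> of \<open>Q\<close> one has P Qh = 1 + X^h U, and
  multiplication by Q gives Qh = Q + X^h U Q. Since \<open>Qh\<close> vanishes at \<open>t\<close>,
  the coefficient of Q there is minus that of X^h U Q, in which Q enters only at indices
  \<open>t - b < h\<close> that are already known.\<close>

lemma newton_step:
 fixes P Q :: "int fps"
 assumes PQ: "P * Q = 1" and P0: "P $ 0 = 1" and t: "h \<le> t" "t < 2 * h"
 shows "Q $ t = - (\<Sum>b=h..t. (\<Sum>a\<le>b. P $ a * (if b - a < h then Q $ (b - a) else 0)) * Q $ (t - b))"
proof -
 define Qh where "Qh = Abs_fps (\<lambda>i. if i < h then Q $ i else 0)"
 define U where "U = fps_shift h (P * Qh)"
 have low: "(P * Qh) $ i = (P * Q) $ i" if "i < h" for i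
  unfolding fps_mult_nth Qh_def using that by (intro sum.cong) auto
 have PQh: "P * Qh = 1 + fps_X ^ h * U"
 proof (rule fps_ext)
  fix i
  show "(P * Qh) $ i = (1 + fps_X ^ h * U) $ i"
   using low[of i] t by (cases "i < h") (auto simp: PQ U_def fps_X_power_mult_nth)
 qed
 have "Qh = Q * (P * Qh)" using PQ by (simp add: mult.assoc[symmetric] mult.commute[of Q])
 then have "Qh = Q + fps_X ^ h * (U * Q)" unfolding PQh by (simp add: algebra_simps)
 then have "Qh $ t = Q $ t + (U * Q) $ (t - h)"
  using t by (metis (no_types, lifting) fps_X_power_mult_nth fps_add_nth not_le)
 then have "Q $ t = - ((U * Q) $ (t - h))" using t by (simp add: Qh_def)
 also have "(U * Q) $ (t - h) = (\<Sum>c=0..t - h. (P * Qh) $ (c + h) * Q $ (t - h - c))"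
  by (simp add: fps_mult_nth[of U] fps_shift_nth[of h "P * Qh"] U_def[symmetric]) (simp add: U_def)
 also have "\<dots> = (\<Sum>b=0 + h..(t - h) + h. (P * Qh) $ b * Q $ (t - b))"
  unfolding sum.shift_bounds_cl_nat_ivl by (intro sum.cong) (auto simp: add.commute)
 also have "\<dots> = (\<Sum>b=h..t. (P * Qh) $ b * Q $ (t - b))" using t by simp
 finally show ?thesis
  by (simp add: fps_mult_nth[of P] Qh_def atLeast0AtMost)
qed

lemma transposed_leaf: "transposed x c m b 1 0 = (\<Sum>i<m. int (c i) * int (x b) ^ i)"
 by (simp add: transposed_def node_series_def lessThan_atLeast0)

text \<open>Multiplication of the series by \<open>P\<close> becomes its adjoint on offsets:
  coefficient \<open>e\<close> of \<open>P\<close> picks the value at offset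
  \<open>a + e\<close>.\<close>

lemma transposed_child:
 fixes P S :: "int fps"
 assumes "S' = P * S" and P: "\<And>e. h < e \<Longrightarrow> P $ e = 0"
 shows "(\<Sum>i=a..<m. c i * S' $ (i - a)) = (\<Sum>e\<le>h. P $ e * (\<Sum>i=a+e..<m. c i * S $ (i - (a + e))))"
proof -
 have "(\<Sum>e\<le>h. P $ e * (\<Sum>i=a+e..<m. c i * S $ (i - (a + e)))) =
  (\<Sum>e\<le>h. \<Sum>i=a..<m. if e \<le> i - a then c i * (P $ e * S $ (i - a - e)) else 0)"
 proof (intro sum.cong refl)
  fix e
  have "(\<Sum>i=a+e..<m. c i * S $ (i - (a + e))) = (\<Sum>i=a..<m. if e \<le> i - a then c i * S $ (i - a - e) else 0)"
   by (rule sum.mono_neutral_cong_left) (auto simp: diff_diff_left)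
  then show "P $ e * (\<Sum>i=a+e..<m. c i * S $ (i - (a + e))) =
    (\<Sum>i=a..<m. if e \<le> i - a then c i * (P $ e * S $ (i - a - e)) else 0)"
   by (simp add: sum_distrib_left if_distrib mult_ac cong: if_cong)
 qed
 also have "\<dots> = (\<Sum>i=a..<m. \<Sum>e\<le>h. if e \<le> i - a then c i * (P $ e * S $ (i - a - e)) else 0)"
  by (rule sum.swap)
 also have "\<dots> = (\<Sum>i=a..<m. c i * S' $ (i - a))"
 proof (intro sum.cong refl)
  fix i
  have "S' $ (i - a) = (\<Sum>e\<le>i - a. P $ e * S $ (i - a - e))"
   by (simp add: assms(1) fps_mult_nth atLeast0AtMost)
  also have "\<dots> = (\<Sum>e\<in>{..i - a} \<inter> {..h}. P $ e * S $ (i - a - e))"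
   by (rule sum.mono_neutral_right) (use P in \<open>auto simp: not_le\<close>)
  also have "\<dots> = (\<Sum>e\<le>h. if e \<le> i - a then P $ e * S $ (i - a - e) else 0)"
   by (rule sum.mono_neutral_cong_left) auto
  finally show "(\<Sum>e\<le>h. if e \<le> i - a then c i * (P $ e * S $ (i - a - e)) else 0) = c i * S' $ (i - a)"
   by (simp add: sum_distrib_left if_distrib cong: if_cong)
 qed
 finally show ?thesis ..
qed

text \<open>Multiplying the series of the parent by the polynomial of the sibling cancels the
  sibling's part. For offsets \<open>a < h\<close> only offsets of the parent below
  \<open>2 * h\<close> occur, so each node keeps as many values as it has points.\<close>

lemma transposed_left:
 "transposed x c m b h a = (\<Sum>e\<le>h. coeff (node_poly x (b + h) h) e * transposed x c m b (h + h) (a + e))"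
proof -
 have "node_series x b h = fps_of_poly (node_poly x (b + h) h) * node_series x b (h + h)"
  using node_poly_series[of x "b + h" h] by (simp add: node_series_split mult.left_commute)
 from transposed_child[OF this, where h = h and a = a and c = "\<lambda>i. int (c i)" and m = m] show ?thesis
  by (simp add: transposed_def coeff_node_poly_eq_0)
qed

lemma transposed_right:
 "transposed x c m (b + h) h a = (\<Sum>e\<le>h. coeff (node_poly x b h) e * transposed x c m b (h + h) (a + e))"
proof -
 have "node_series x (b + h) h = fps_of_poly (node_poly x b h) * node_series x b (h + h)"
  using node_poly_series[of x b h] by (simp add: node_series_split mult.assoc[symmetric])
 from transposed_child[OF this, where h = h and a = a and c = "\<lambda>i. int (c i)" and m = m] show ?thesis
  by (simp add: transposed_def coeff_node_poly_eq_0)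
qed

section \<open>Primes and hash functions\<close>

lemma Suc_div_diff:
 assumes "(d::nat) > 0"
 shows "Suc n div d = n div d + (if d dvd Suc n then 1 else 0)"
 using assms by (simp add: div_Suc dvd_eq_mod_eq_0)

text \<open>Legendre's formula, by induction: the new factor \<open>Suc n\<close> contributes one
  for each power of \<open>p\<close> that divides it.\<close>

lemma multiplicity_fact:
 fixes p :: nat
 assumes p: "prime p" and "n < p ^ K"
 shows "multiplicity p (fact n :: nat) = (\<Sum>k=1..K. n div p ^ k)"
 using assms(2)
proof (induction n)
 case (Suc n)
 have p1: "p > 1" using p prime_gt_1_nat by blast
 have mult: "multiplicity p (Suc n) = card {k\<in>{1..K}. p ^ k dvd Suc n}"
 proof -
  have "multiplicity p (Suc n) \<le> K"
  proof (rule ccontr)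
   assume "\<not> ?thesis"
   then have "p ^ K dvd Suc n" by (intro multiplicity_dvd') simp
   then show False using Suc.prems by (meson dvd_imp_le not_less zero_less_Suc)
  qed
  then have "{k\<in>{1..K}. p ^ k dvd Suc n} = {1..multiplicity p (Suc n)}"
   using p1 by (auto simp: power_dvd_iff_le_multiplicity)
  then show ?thesis by simp
 qed
 have "multiplicity p (fact (Suc n) :: nat) = multiplicity p (Suc n) + multiplicity p (fact n :: nat)"
  unfolding fact_Suc of_nat_id
  by (rule prime_elem_multiplicity_mult_distrib) (use p in auto)
 also have "\<dots> = card {k\<in>{1..K}. p ^ k dvd Suc n} + (\<Sum>k=1..K. n div p ^ k)"
  using Suc mult by simp
 also have "card {k\<in>{1..K}. p ^ k dvd Suc n} = (\<Sum>k=1..K. if p ^ k dvd Suc n then 1 else 0)"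
  by (simp add: sum.If_cases Int_def)
 also have "\<dots> + (\<Sum>k=1..K. n div p ^ k) = (\<Sum>k=1..K. Suc n div p ^ k)"
  unfolding sum.distrib[symmetric] using p1 by (intro sum.cong) (auto simp: Suc_div_diff)
 finally show ?case .
qed simp

text \<open>In Legendre's formula for the binomial coefficient every term (2N div p^k) - 2 (N div
  p^k) is at most 1, and it vanishes as soon as p^k exceeds 2N. The exponent is thus at most the
  number of powers of \<open>p\<close> up to 2N.\<close>

lemma prime_power_central_binomial:
 fixes p :: nat
 assumes p: "prime p" and N: "N \<ge> 1"
 shows "p ^ multiplicity p (2 * N choose N) \<le> 2 * N"
proof -
 define K where "K = 2 * N"
 have p1: "p > 1" using p prime_gt_1_nat by blast
 have K: "2 * N < p ^ K"
 proof -
  have "2 * N < 2 ^ K" unfolding K_def by (rule less_exp)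
  also have "\<dots> \<le> p ^ K" using p1 by (intro power_mono) auto
  finally show ?thesis .
 qed
 let ?C = "2 * N choose N"
 have "fact N * fact N * ?C = (fact (2 * N) :: nat)"
  using binomial_fact_lemma[of N "2 * N"] by (simp add: mult_2)
 then have "multiplicity p (fact (2 * N) :: nat) = multiplicity p (fact N * fact N * ?C)" by simp
 also have "\<dots> = 2 * multiplicity p (fact N :: nat) + multiplicity p ?C"
 proof -
  have pe: "prime_elem p" using p by simp
  have "multiplicity p (fact N * fact N * ?C) = multiplicity p (fact N * fact N :: nat) + multiplicity p ?C"
   by (rule prime_elem_multiplicity_mult_distrib[OF pe]) auto
  moreover have "multiplicity p (fact N * fact N :: nat) = multiplicity p (fact N :: nat) + multiplicity p (fact N :: nat)"
   by (rule prime_elem_multiplicity_mult_distrib[OF pe]) auto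
  ultimately show ?thesis by simp
 qed
 finally have "multiplicity p ?C + 2 * (\<Sum>k=1..K. N div p ^ k) = (\<Sum>k=1..K. (2 * N) div p ^ k)"
  using multiplicity_fact[OF p, of N K] multiplicity_fact[OF p, of "2 * N" K] K by simp
 also have "(\<Sum>k=1..K. (2 * N) div p ^ k) \<le> (\<Sum>k=1..K. 2 * (N div p ^ k) + (if p ^ k \<le> 2 * N then 1 else 0))"
 proof (rule sum_mono)
  fix k
  have pk: "p ^ k > 0" using p1 by simp
  have "2 * N div p ^ k < 2 * (N div p ^ k) + 2"
  proof (rule less_mult_imp_div_less)
   show "2 * N < (2 * (N div p ^ k) + 2) * p ^ k"
    using dividend_less_div_times[OF pk, of N] by (simp add: algebra_simps)
  qed
  moreover have "2 * N div p ^ k = 0" if "\<not> p ^ k \<le> 2 * N" using that by simp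
  ultimately show "2 * N div p ^ k \<le> 2 * (N div p ^ k) + (if p ^ k \<le> 2 * N then 1 else 0)"
   by auto
 qed
 also have "\<dots> = 2 * (\<Sum>k=1..K. N div p ^ k) + card {k\<in>{1..K}. p ^ k \<le> 2 * N}"
  by (simp add: sum.distrib sum_distrib_left sum.If_cases Int_def)
 finally have le: "multiplicity p ?C \<le> card {k\<in>{1..K}. p ^ k \<le> 2 * N}" by simp
 show ?thesis
 proof (cases "multiplicity p ?C = 0")
  case False
  \<comment> \<open>The exponent is at most the size of \<open>S\<close>, hence at most its largest
    element, whose power is still bounded by \<open>2 * N\<close>.\<close>
  define S where "S = {k\<in>{1..K}. p ^ k \<le> 2 * N}"
  have "card S \<noteq> 0" using False le unfolding S_def by linarith
  then have S: "finite S" "S \<noteq> {}" by (auto simp: card_eq_0_iff)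
  have "S \<subseteq> {1..Max S}" using S by (auto simp: S_def)
  then have "card S \<le> Max S" using card_mono[of "{1..Max S}" S] by simp
  then have "multiplicity p ?C \<le> Max S" using le by (simp add: S_def)
  then have "p ^ multiplicity p ?C \<le> p ^ Max S" using p1 by (intro power_increasing) auto
  also have "\<dots> \<le> 2 * N" using Max_in[OF S] by (simp add: S_def)
  finally show ?thesis .
 qed (use N in simp)
qed

lemma central_binomial_ge: "2 ^ N \<le> (2 * N choose N)"
proof (induction N)
 case (Suc N)
 have "Suc N * (2 * Suc N choose Suc N) = (2 * Suc N) * (Suc (2 * N) choose N)"
  using Suc_times_binomial[of N "Suc (2 * N)"] by simp
 then have "2 * Suc N choose Suc N = 2 * (Suc (2 * N) choose N)"
  by (metis mult.assoc mult.left_commute mult_left_cancel nat.simps(3))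
 moreover have "(2 * N choose N) \<le> (Suc (2 * N) choose N)"
  by (cases N) auto
 ultimately show ?case using Suc by simp
qed simp

text \<open>Otherwise all prime factors of the coefficient for N = 4 n^2 are at most n, which bounds
  it by (2N)^n, against the lower bound 2^N = (2^(4n))^n. A polynomial bound is good enough because
  \<open>p\<close> has to fit into a word of O(log n) bits.\<close>

lemma prime_polynomial_gap:
 assumes n: "n \<ge> 1"
 obtains p :: nat where "prime p" "n < p" "p \<le> 8 * n\<^sup>2"
proof (rule ccontr)
 assume "\<not> thesis"
 with that have no: "\<And>p. prime p \<Longrightarrow> p \<le> 8 * n\<^sup>2 \<Longrightarrow> p \<le> n" by (meson not_le)
 define N where "N = 4 * n\<^sup>2"
 let ?C = "2 * N choose N"
 have N: "N \<ge> 1" using n by (simp add: N_def)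
 have C0: "?C > 0" by simp
 have pf: "q \<le> n" "prime q" if "q \<in> prime_factors ?C" for q
 proof -
  show q: "prime q" using that by auto
  have "q dvd ?C" using that by auto
  moreover have "fact N * fact N * ?C = (fact (2 * N) :: nat)"
   using binomial_fact_lemma[of N "2 * N"] by (simp add: mult_2)
  ultimately have "q dvd fact (2 * N)" by (metis dvd_mult)
  then have "q \<le> 2 * N" using q prime_dvd_fact_iff by blast
  then show "q \<le> n" using no[OF q] by (simp add: N_def)
 qed
 have "prime_factors ?C \<subseteq> {1..n}" using pf prime_ge_1_nat by auto
 then have card: "card (prime_factors ?C) \<le> n" using card_mono[of "{1..n}"] by fastforce
 have "?C = (\<Prod>q\<in>prime_factors ?C. q ^ multiplicity q ?C)"
  using prime_factorization_nat[OF C0] by (simp add: count_prime_factorization_prime pf)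
 also have "\<dots> \<le> (\<Prod>q\<in>prime_factors ?C. 2 * N)"
  by (intro prod_mono) (use prime_power_central_binomial[OF _ N] pf in auto)
 also have "\<dots> = (2 * N) ^ card (prime_factors ?C)" by simp
 also have "\<dots> \<le> (2 * N) ^ n" using card N by (intro power_increasing) auto
 finally have "2 ^ N \<le> (2 * N) ^ n" using central_binomial_ge[of N] by linarith
 moreover have "(2::nat) ^ N = (2 ^ (4 * n)) ^ n" by (simp add: N_def power_mult[symmetric] power2_eq_square)
 ultimately have le: "(2::nat) ^ (4 * n) \<le> 8 * n\<^sup>2"
  using n power_le_imp_le_base[of "2 ^ (4 * n)" "n - 1" "8 * n\<^sup>2"] by (simp add: N_def)
 have "(2::nat) ^ (4 * n) = 2 ^ (2 * n) * (2 ^ n * 2 ^ n)" by (simp flip: power_add)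
 moreover have "n * n < 2 ^ n * 2 ^ n" using less_exp[of n] by (intro mult_strict_mono) auto
 moreover have "(4::nat) \<le> 2 ^ (2 * n)" using power_increasing[of 2 "2 * n" "2::nat"] n by simp
 \<comment> \<open>The next estimate takes the factor 8 from \<open>2 ^ (2 * n)\<close>, which is
   available from n = 2 on; for n = 1 the inequality \<open>le\<close> would read 16 \<le>
   8.\<close>
 moreover have "n \<noteq> 1" using le by auto
 then have "(8::nat) \<le> 2 ^ (2 * n)" using power_increasing[of 3 "2 * n" "2::nat"] n by simp
 then have "8 * (n * n) < 2 ^ (2 * n) * (2 ^ n * 2 ^ n)"
  using \<open>n * n < 2 ^ n * 2 ^ n\<close> n by (intro mult_le_less_imp_less) auto
 ultimately show False using le by (simp add: power2_eq_square)
qed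

section \<open>Independence of polynomial hash functions and the union bound\<close>

lemma poly_roots_mod_prime:
 fixes c :: "nat \<Rightarrow> int"
 assumes p: "prime p" and "finite I" "card I = m"
  and dist: "\<And>i j. i \<in> I \<Longrightarrow> j \<in> I \<Longrightarrow> i \<noteq> j \<Longrightarrow> \<not> p dvd (i - j)"
  and roots: "\<And>i. i \<in> I \<Longrightarrow> p dvd (\<Sum>b<m. c b * i ^ b)"
 shows "\<forall>b<m. (p::int) dvd c b"
 using assms(2-)
proof (induction m arbitrary: I c)
 case (Suc m)
 from Suc.prems(2) obtain i\<^sub>0 J where I: "I = insert i\<^sub>0 J" "i\<^sub>0 \<notin> J" "finite J" "card J = m"
  by (metis card_Suc_eq Suc.prems(1) finite_insert)
 \<comment> \<open>Synthetic division at the root \<open>i\<^sub>0\<close>: the quotient has the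
   coefficients \<open>d\<close> and vanishes at all other points, and the recurrence
   \<open>dm\<close> carries divisibility from \<open>d\<close> back to \<open>c\<close>.\<close>
 define d where "d e = (\<Sum>b=Suc e..m. c b * i\<^sub>0 ^ (b - Suc e))" for e
 have synth: "(\<Sum>b<Suc m. c b * i ^ b) - (\<Sum>b<Suc m. c b * i\<^sub>0 ^ b) = (i - i\<^sub>0) * (\<Sum>e<m. d e * i ^ e)" for i
 proof -
  have "(\<Sum>b<Suc m. c b * i ^ b) - (\<Sum>b<Suc m. c b * i\<^sub>0 ^ b) = (\<Sum>b<Suc m. c b * (i ^ b - i\<^sub>0 ^ b))"
   by (simp add: sum_subtractf right_diff_distrib)
  also have "\<dots> = (\<Sum>b<Suc m. c b * ((i - i\<^sub>0) * (\<Sum>e<b. i\<^sub>0 ^ (b - Suc e) * i ^ e)))"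
   by (simp only: power_diff_sumr2)
  also have "\<dots> = (i - i\<^sub>0) * (\<Sum>b<Suc m. \<Sum>e<b. c b * (i\<^sub>0 ^ (b - Suc e) * i ^ e))"
   by (simp only: sum_distrib_left mult.left_commute)
  also have "(\<Sum>b<Suc m. \<Sum>e<b. c b * (i\<^sub>0 ^ (b - Suc e) * i ^ e)) =
   (\<Sum>e<m. \<Sum>b=Suc e..m. c b * (i\<^sub>0 ^ (b - Suc e) * i ^ e))"
   by (subst sum.Sigma, simp, simp, subst sum.Sigma, simp, simp)
     (rule sum.reindex_bij_witness[of _ "\<lambda>(e, b). (b, e)" "\<lambda>(b, e). (e, b)"], auto)
  also have "\<dots> = (\<Sum>e<m. d e * i ^ e)"
   by (simp add: d_def sum_distrib_right mult.assoc)
  finally show ?thesis .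
 qed
 have "\<forall>e<m. p dvd d e"
 proof (rule Suc.IH[of J])
  fix i assume i: "i \<in> J"
  have "p dvd (\<Sum>b<Suc m. c b * i ^ b) - (\<Sum>b<Suc m. c b * i\<^sub>0 ^ b)"
   by (intro dvd_diff Suc.prems(4)) (use i I in auto)
  then have "p dvd (i - i\<^sub>0) * (\<Sum>e<m. d e * i ^ e)" by (simp only: synth)
  moreover have "\<not> p dvd (i - i\<^sub>0)" using Suc.prems(3)[of i i\<^sub>0] i I by auto
  ultimately show "p dvd (\<Sum>e<m. d e * i ^ e)" using p prime_dvd_mult_iff by blast
 qed (use I Suc.prems(3) in auto)
 have dm: "d e = c (Suc e) + i\<^sub>0 * d (Suc e)" if "e < m" for e
 proof -
  have "d e = c (Suc e) + (\<Sum>b=Suc (Suc e)..m. c b * i\<^sub>0 ^ (b - Suc e))"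
   using that by (simp add: d_def sum.atLeast_Suc_atMost)
  also have "(\<Sum>b=Suc (Suc e)..m. c b * i\<^sub>0 ^ (b - Suc e)) = i\<^sub>0 * d (Suc e)"
   unfolding d_def sum_distrib_left
   by (intro sum.cong) (auto simp: Suc_diff_Suc power_Suc[symmetric] simp del: power_Suc)
  finally show ?thesis .
 qed
 have hi: "p dvd c (Suc e)" if "e < m" for e
 proof -
  have "p dvd d (Suc e)"
   using \<open>\<forall>e<m. p dvd d e\<close> that by (cases "Suc e < m") (auto simp: d_def)
  moreover have "p dvd d e" using \<open>\<forall>e<m. p dvd d e\<close> that by auto
  ultimately show ?thesis using dm[OF that] by (metis dvd_add_left_iff dvd_mult)
 qed
 have "p dvd (\<Sum>b<Suc m. c b * i\<^sub>0 ^ b)" using Suc.prems(4)[of i\<^sub>0] I by auto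
 also have "(\<Sum>b<Suc m. c b * i\<^sub>0 ^ b) = c 0 + (\<Sum>b<m. c (Suc b) * i\<^sub>0 ^ Suc b)"
  by (subst sum.lessThan_Suc_shift) simp
 finally have "p dvd c 0"
  using hi by (metis (no_types, lifting) dvd_add_left_iff dvd_mult2 dvd_sum lessThan_iff)
 with hi show ?case by (metis Suc_less_eq not0_implies_Suc)
qed simp

text \<open>This is the m-wise independence. There are as many coefficient vectors as value vectors
  on \<open>m\<close> points, so injectivity makes the vector of values at any \<open>m\<close>
  distinct points uniform.\<close>

lemma eval_vector_inj:
 fixes p m :: nat
 assumes p: "prime p" and I: "I \<subseteq> {..<p}" "card I = m"
 shows "inj_on (\<lambda>c. \<lambda>i\<in>I. (\<Sum>b<m. c b * i ^ b) mod p) ({..<m} \<rightarrow>\<^sub>E {..<p})"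
proof (rule inj_onI)
 fix c c' assume c: "c \<in> {..<m} \<rightarrow>\<^sub>E {..<p}" "c' \<in> {..<m} \<rightarrow>\<^sub>E {..<p}"
  and eq: "(\<lambda>i\<in>I. (\<Sum>b<m. c b * i ^ b) mod p) = (\<lambda>i\<in>I. (\<Sum>b<m. c' b * i ^ b) mod p)"
 have fin: "finite I" using I(1) finite_subset by blast
 have "\<forall>b<m. int p dvd int (c b) - int (c' b)"
 proof (rule poly_roots_mod_prime[of "int p" "int ` I"])
  show "prime (int p)" using p by simp
  show "card (int ` I) = m" using I by (simp add: card_image)
  show "finite (int ` I)" using fin by simp
  show "\<not> int p dvd i - j" if ij: "i \<in> int ` I" "j \<in> int ` I" "i \<noteq> j" for i j
  proof
   assume d: "int p dvd i - j"
   obtain x y where "i = int x" "j = int y" "x < p" "y < p" using ij(1,2) I(1) by auto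
   then have "\<bar>i - j\<bar> < int p" by linarith
   with d ij(3) show False using dvd_imp_le_int[of "i - j" "int p"] by simp
  qed
  show "int p dvd (\<Sum>b<m. (int (c b) - int (c' b)) * i ^ b)" if "i \<in> int ` I" for i
  proof -
   from that obtain j where j: "i = int j" "j \<in> I" by auto
   have "(\<Sum>b<m. c b * j ^ b) mod p = (\<Sum>b<m. c' b * j ^ b) mod p"
    using fun_cong[OF eq, of j] j by simp
   then have "int (\<Sum>b<m. c b * j ^ b) mod int p = int (\<Sum>b<m. c' b * j ^ b) mod int p"
    by (simp only: zmod_int[symmetric])
   then have "int p dvd int (\<Sum>b<m. c b * j ^ b) - int (\<Sum>b<m. c' b * j ^ b)"
    by (simp only: mod_eq_dvd_iff)
   also have "int (\<Sum>b<m. c b * j ^ b) - int (\<Sum>b<m. c' b * j ^ b) = (\<Sum>b<m. (int (c b) - int (c' b)) * i ^ b)"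
    by (simp add: j left_diff_distrib sum_subtractf)
   finally show ?thesis .
  qed
 qed
 then have "c b = c' b" if "b < m" for b
 proof -
  have "c b < p" "c' b < p" using c that by (auto dest: PiE_mem)
  then have "\<bar>int (c b) - int (c' b)\<bar> < int p" by auto
  moreover have "int p dvd int (c b) - int (c' b)" using \<open>\<forall>b<m. _\<close> that by blast
  ultimately show ?thesis using dvd_imp_le_int[of "int (c b) - int (c' b)" "int p"] by auto
 qed
 then show "c = c'" using c by (intro PiE_ext) auto
qed

text \<open>Reducing modulo \<open>m\<close> after reducing modulo \<open>p\<close> is not uniform:
  a residue class has up to \<open>p div m + 1\<close> members. As \<open>m \<le> p\<close>, this at
  most doubles the density 1/8 of \<open>W\<close>.\<close>

lemma card_residues_le:
 fixes p m A :: nat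
 assumes W: "W \<subseteq> {..<m}" "card W \<le> A" and "m = 8 * A" "m \<le> p" "A \<ge> 1"
 shows "4 * card {v. v < p \<and> v mod m \<in> W} \<le> p"
proof -
 have m: "m > 0" using assms by simp
 have "{v. v < p \<and> v mod m \<in> W} \<subseteq> (\<lambda>(k, u). k * m + u) ` ({..p div m} \<times> W)"
 proof
  fix v assume "v \<in> {v. v < p \<and> v mod m \<in> W}"
  then have "v = (v div m) * m + v mod m" "v div m \<le> p div m" "v mod m \<in> W"
   by (auto simp: div_le_mono)
  then show "v \<in> (\<lambda>(k, u). k * m + u) ` ({..p div m} \<times> W)"
   by (intro image_eqI[of _ _ "(v div m, v mod m)"]) simp_all
 qed
 moreover have fW: "finite W" using W finite_subset by blast
 ultimately have "card {v. v < p \<and> v mod m \<in> W} \<le> card ({..p div m} \<times> W)"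
  by (intro surj_card_le[where f = "\<lambda>(k, u). k * m + u"]) simp_all
 also have "\<dots> = (p div m + 1) * card W" by (simp add: card_cartesian_product)
 also have "\<dots> \<le> (p div m + 1) * A" using W(2) by (rule mult_le_mono2)
 finally have "4 * card {v. v < p \<and> v mod m \<in> W} \<le> 4 * ((p div m + 1) * A)" by simp
 also have "2 * (4 * ((p div m + 1) * A)) = (p div m) * m + m" using assms by (simp add: algebra_simps)
 then have "2 * (4 * ((p div m + 1) * A)) \<le> 2 * p"
  using assms(4) div_times_less_eq_dividend[of p m] by linarith
 then have "4 * ((p div m + 1) * A) \<le> p" by simp
 finally show ?thesis .
qed

text \<open>One term in the binomial expansion of (1 + m/n)^n, which is at most e^m; the number e is
  then rounded up to 4.\<close>

lemma binomial_le_pow: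
 assumes "1 \<le> m" "m \<le> n"
 shows "real (n choose m) * real m ^ m \<le> 4 ^ m * real n ^ m"
proof -
 define x where "x = real m / real n"
 have x: "x \<ge> 0" by (simp add: x_def)
 have "real (n choose m) * x ^ m = real (n choose m) * x ^ m * 1 ^ (n - m)" by simp
 also have "\<dots> \<le> (\<Sum>k\<le>n. real (n choose k) * x ^ k * 1 ^ (n - k))"
  by (rule member_le_sum[of m "{..n}" "\<lambda>k. real (n choose k) * x ^ k * 1 ^ (n - k)"]) (use assms x in auto)
 also have "\<dots> = (x + 1) ^ n" by (simp add: binomial_ring)
 also have "\<dots> \<le> exp x ^ n" using exp_ge_add_one_self[of x] x by (intro power_mono) (auto simp: add.commute)
 also have "\<dots> = exp (real m)" using assms by (simp add: x_def exp_of_nat_mult[symmetric])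
 also have "\<dots> = exp 1 ^ m" by (simp add: exp_of_nat_mult[symmetric])
 also have "\<dots> \<le> 4 ^ m" using exp_le by (intro power_mono) auto
 finally show ?thesis
  using assms by (simp add: x_def power_divide field_simps)
qed

text \<open>By the choice of \<open>m\<close> and \<open>R\<close>, the base 4n/m = n/(2A) is at
  most 2^(R-1); the spare factor 2^m makes the inequality strict.\<close>

lemma binomial_less_pow:
 assumes A: "A \<ge> 1" and m: "m = 8 * A" "m \<le> n" and R: "n \<le> A * 2 ^ R"
 shows "(n choose m) < 2 ^ (m * R)"
proof -
 have m1: "1 \<le> m" using A m by simp
 have "real n \<le> real (A * 2 ^ R)" using R of_nat_le_iff by blast
 then have "4 * real n * 2 \<le> real m * 2 ^ R" by (simp add: m)
 then have "(4 * real n * 2) ^ m \<le> (real m * 2 ^ R) ^ m" by (intro power_mono) auto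
 moreover have "(4 * real n) ^ m * 1 < (4 * real n) ^ m * 2 ^ m"
  using m1 m(2) by (intro mult_strict_left_mono) (auto simp: one_less_power)
 ultimately have "(4 * real n) ^ m < (real m * 2 ^ R) ^ m"
  by (simp only: power_mult_distrib[of "4 * real n" 2] mult_1_right)
 then have "4 ^ m * real n ^ m < (real m * 2 ^ R) ^ m" by (simp only: power_mult_distrib[of 4])
 with binomial_le_pow[OF m1 m(2)] have "real (n choose m) * real m ^ m < (2 ^ R) ^ m * real m ^ m"
  by (simp add: power_mult_distrib mult.commute)
 then have "real (n choose m) < (2 ^ R) ^ m" using m1 by simp
 then have "real (n choose m) < real (2 ^ (m * R))" by (simp add: power_mult[symmetric] mult.commute)
 then show ?thesis using of_nat_less_iff by blast
qed

definition poly_hash :: "nat \<Rightarrow> nat \<Rightarrow> (nat \<Rightarrow> nat) \<Rightarrow> nat \<Rightarrow> nat" where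
 "poly_hash p m c i = (\<Sum>b<m. c b * i ^ b) mod p mod m"

text \<open>Union bound over the sets \<open>I\<close> of \<open>m\<close> coordinates, fewer than
  2^(mR), and the choices \<open>W\<close> of bucket sets, at most 2^(mR): each pair is bad for a
  fraction of at most 4^(-mR) of the coefficient choices. Since the conclusion holds for every
  \<open>W\<close>, the functions may be fixed before the stream is known.\<close>

theorem hash_family_exists:
 fixes p m n A R :: nat
 assumes p: "prime p" "n < p" and A: "A \<ge> 1" and m: "m = 8 * A" "m \<le> n" and R: "n \<le> A * 2 ^ R"
 obtains c where "\<And>r b. r < R \<Longrightarrow> b < m \<Longrightarrow> c r b < p"
  and "\<And>W. (\<And>r. r < R \<Longrightarrow> W r \<subseteq> {..<m} \<and> card (W r) \<le> A) \<Longrightarrow>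
   card {i. i < n \<and> (\<forall>r<R. poly_hash p m (c r) i \<in> W r)} < m"
proof (rule ccontr)
 assume no: "\<not> thesis"
 define F where "F = {..<m} \<rightarrow>\<^sub>E {..<p}"
 define Fs where "Fs = {..<R} \<rightarrow>\<^sub>E F"
 define Is where "Is = {I. I \<subseteq> {..<n} \<and> card I = m}"
 define Ws where "Ws = {..<R} \<rightarrow>\<^sub>E {W. W \<subseteq> {..<m} \<and> card W \<le> A}"
 define bad where "bad I W = {c \<in> Fs. \<forall>r<R. \<forall>i\<in>I. poly_hash p m (c r) i \<in> W r}" for I W
 have fin: "finite F" "finite Fs" "finite Is" "finite Ws"
 proof -
  show F: "finite F" unfolding F_def by (rule finite_PiE) simp_all
  show "finite Fs" unfolding Fs_def by (rule finite_PiE) (simp_all add: F)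
  have "Is \<subseteq> Pow {..<n}" unfolding Is_def by blast
  then show "finite Is" by (rule finite_subset) simp
  have "finite {W. W \<subseteq> {..<m} \<and> card W \<le> A}" by (rule finite_subset[of _ "Pow {..<m}"]) auto
  then show "finite Ws" unfolding Ws_def by (intro finite_PiE) simp_all
 qed
 have card_Is: "card Is = n choose m" unfolding Is_def using n_subsets[of "{..<n}" m] by simp
 have card_Ws: "card Ws \<le> 2 ^ (m * R)"
 proof -
  have "card {W. W \<subseteq> {..<m} \<and> card W \<le> A} \<le> card (Pow {..<m})" by (intro card_mono) auto
  then have "card {W. W \<subseteq> {..<m} \<and> card W \<le> A} \<le> 2 ^ m" by (simp add: card_Pow)
  then have "card {W. W \<subseteq> {..<m} \<and> card W \<le> A} ^ R \<le> (2 ^ m) ^ R" by (rule power_mono) simp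
  then show ?thesis unfolding Ws_def by (simp add: card_PiE power_mult)
 qed
 have card_F: "card F = p ^ m" by (simp add: F_def card_PiE)
 have "Fs \<subseteq> (\<Union>(I, W)\<in>Is \<times> Ws. bad I W)"
 proof
  fix c assume c: "c \<in> Fs"
  have cp: "c r b < p" if "r < R" "b < m" for r b
   using c that unfolding Fs_def F_def by (metis PiE_mem lessThan_iff)
  have "\<exists>W. (\<forall>r<R. W r \<subseteq> {..<m} \<and> card (W r) \<le> A) \<and>
   \<not> card {i. i < n \<and> (\<forall>r<R. poly_hash p m (c r) i \<in> W r)} < m"
  proof (rule ccontr)
   assume h: "\<not> ?thesis"
   have "thesis"
   proof (rule that[of c])
    fix W assume "\<And>r. r < R \<Longrightarrow> W r \<subseteq> {..<m} \<and> card (W r) \<le> A"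
    then have "\<forall>r<R. W r \<subseteq> {..<m} \<and> card (W r) \<le> A" by simp
    then show "card {i. i < n \<and> (\<forall>r<R. poly_hash p m (c r) i \<in> W r)} < m"
     using spec[OF h[unfolded not_ex], of W] by simp
   qed (rule cp)
   with no show False by simp
  qed
  then obtain W where W: "\<And>r. r < R \<Longrightarrow> W r \<subseteq> {..<m} \<and> card (W r) \<le> A"
   and big: "\<not> card {i. i < n \<and> (\<forall>r<R. poly_hash p m (c r) i \<in> W r)} < m"
   by auto
  obtain I where I: "I \<subseteq> {i. i < n \<and> (\<forall>r<R. poly_hash p m (c r) i \<in> W r)}" "card I = m"
   by (rule obtain_subset_with_card_n[OF leI[OF big]])
  have "I \<in> Is" using I by (auto simp: Is_def)
  moreover have "restrict W {..<R} \<in> Ws" using W by (simp add: Ws_def PiE_iff)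
  moreover have "c \<in> bad I (restrict W {..<R})" using I(1) c by (auto simp: bad_def)
  ultimately show "c \<in> (\<Union>(I, W)\<in>Is \<times> Ws. bad I W)"
   by (intro UN_I[of "(I, restrict W {..<R})"]) simp_all
 qed
 then have "card Fs \<le> card (\<Union>(I, W)\<in>Is \<times> Ws. bad I W)"
  using fin by (intro card_mono finite_UN_I finite_cartesian_product) (auto simp: bad_def)
 also have "\<dots> \<le> (\<Sum>x\<in>Is \<times> Ws. card (case x of (I, W) \<Rightarrow> bad I W))"
  by (rule card_UN_le) (use fin in auto)
 finally have card_le: "card Fs \<le> (\<Sum>x\<in>Is \<times> Ws. card (case x of (I, W) \<Rightarrow> bad I W))" .
 \<comment> \<open>The rows are chosen independently, and within a row so are the values at the
   \<open>m\<close> points of \<open>I\<close>; each of the \<open>m * R\<close> values falls into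
   its set with probability at most 1/4.\<close>
 have card_bad: "4 ^ (m * R) * card (bad I W) \<le> p ^ (m * R)" if "I \<in> Is" "W \<in> Ws" for I W
 proof -
  define V where "V r = {v. v < p \<and> v mod m \<in> W r}" for r
  define G where "G r = {c \<in> F. \<forall>i\<in>I. poly_hash p m c i \<in> W r}" for r
  have I: "I \<subseteq> {..<p}" "card I = m" "finite I" using that(1) p(2) finite_subset by (auto simp: Is_def)
  have G: "4 ^ m * card (G r) \<le> p ^ m" if "r < R" for r
  proof -
   have Wr: "W r \<subseteq> {..<m}" "card (W r) \<le> A"
    using \<open>W \<in> Ws\<close> \<open>r < R\<close> PiE_mem[of W "{..<R}" _ r] unfolding Ws_def by auto
   let ?ev = "\<lambda>c. \<lambda>i\<in>I. (\<Sum>b<m. c b * i ^ b) mod p"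
   have "inj_on ?ev (G r)"
    by (rule inj_on_subset[OF eval_vector_inj[OF p(1) I(1,2)]]) (auto simp: G_def F_def)
   moreover have "?ev ` G r \<subseteq> I \<rightarrow>\<^sub>E V r"
   proof
    fix y assume "y \<in> ?ev ` G r"
    then obtain c where c: "c \<in> G r" "y = ?ev c" by blast
    have "(\<Sum>b<m. c b * i ^ b) mod p \<in> V r" if "i \<in> I" for i
     using c(1) that p(1) prime_gt_0_nat[of p] unfolding G_def V_def poly_hash_def by simp
    then show "y \<in> I \<rightarrow>\<^sub>E V r" unfolding c(2) PiE_iff by simp
   qed
   moreover have "finite (I \<rightarrow>\<^sub>E V r)" using I by (intro finite_PiE) (auto simp: V_def)
   ultimately have "card (G r) \<le> card (I \<rightarrow>\<^sub>E V r)" using card_inj_on_le by blast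
   also have "\<dots> = card (V r) ^ m" using I by (simp add: card_PiE)
   finally have "4 ^ m * card (G r) \<le> (4 * card (V r)) ^ m" by (simp add: power_mult_distrib)
   also have "\<dots> \<le> p ^ m"
    using card_residues_le[OF Wr m(1) _ A, of p] m(2) p(2) by (intro power_mono) (auto simp: V_def)
   finally show ?thesis .
  qed
  have "bad I W = (\<Pi>\<^sub>E r\<in>{..<R}. G r)"
  proof (rule set_eqI)
   fix c
   have "c \<in> bad I W \<longleftrightarrow> c \<in> extensional {..<R} \<and> (\<forall>r<R. c r \<in> F) \<and> (\<forall>r<R. \<forall>i\<in>I. poly_hash p m (c r) i \<in> W r)"
    unfolding bad_def Fs_def PiE_iff by blast
   also have "\<dots> \<longleftrightarrow> c \<in> (\<Pi>\<^sub>E r\<in>{..<R}. G r)"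
    unfolding PiE_iff G_def by blast
   finally show "c \<in> bad I W \<longleftrightarrow> c \<in> (\<Pi>\<^sub>E r\<in>{..<R}. G r)" .
  qed
  then have "card (bad I W) = (\<Prod>r<R. card (G r))" by (simp add: card_PiE)
  then have "4 ^ (m * R) * card (bad I W) = (\<Prod>r<R. 4 ^ m * card (G r))"
   by (simp add: prod.distrib power_mult)
  also have "\<dots> \<le> (\<Prod>r<R. p ^ m)" using G by (intro prod_mono) auto
  also have "\<dots> = p ^ (m * R)" by (simp add: power_mult)
  finally show ?thesis .
 qed
 have "4 ^ (m * R) * card Fs \<le> 4 ^ (m * R) * (\<Sum>x\<in>Is \<times> Ws. card (case x of (I, W) \<Rightarrow> bad I W))"
  using card_le by simp
 also have "\<dots> \<le> (\<Sum>x\<in>Is \<times> Ws. p ^ (m * R))"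
  unfolding sum_distrib_left by (intro sum_mono) (use card_bad in auto)
 also have "\<dots> = card Is * card Ws * p ^ (m * R)" by (simp add: card_cartesian_product)
 also have "\<dots> \<le> (n choose m) * 2 ^ (m * R) * p ^ (m * R)"
  using card_Ws by (simp add: card_Is)
 finally have "4 ^ (m * R) * card Fs \<le> (n choose m) * 2 ^ (m * R) * p ^ (m * R)" .
 moreover have "card Fs = p ^ (m * R)" by (simp add: Fs_def card_PiE card_F power_mult)
 moreover have "p ^ (m * R) > 0" using p by (simp add: prime_gt_0_nat)
 ultimately have "4 ^ (m * R) \<le> (n choose m) * 2 ^ (m * R)"
  by (metis mult_le_cancel2)
 moreover have "(4::nat) ^ (m * R) = 2 ^ (m * R) * 2 ^ (m * R)" by (simp flip: power_mult_distrib)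
 ultimately have "2 ^ (m * R) \<le> (n choose m)" by simp
 with binomial_less_pow[OF A m R] show False by simp
qed

section \<open>The convolution program\<close>

abbreviation "add d a b \<equiv> Prim (Op Add d a b)"
abbreviation "sub d a b \<equiv> Prim (Op Sub d a b)"
abbreviation "mul d a b \<equiv> Prim (Op Mul d a b)"
abbreviation "quo d a b \<equiv> Prim (Op Div d a b)"
abbreviation "rem d a b \<equiv> Prim (Op Mod d a b)"
abbreviation "shl d a b \<equiv> Prim (Op Shl d a b)"
abbreviation "shr d a b \<equiv> Prim (Op Shr d a b)"
abbreviation "cst d v \<equiv> Prim (Const d v)"
abbreviation "load d a \<equiv> Prim (Load d a)"
abbreviation "store a b \<equiv> Prim (Store a b)"

definition mov :: "nat \<Rightarrow> nat \<Rightarrow> com" where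
 "mov d a = cst 2 0 ;; add d a 2"

text \<open>Arithmetic shift by \<open>f\<close> on two's complement words: register 5 holds half
  the word range, which makes the value nonnegative, and register 6 holds the same bias after the
  shift.\<close>

definition asr :: "nat \<Rightarrow> com" where
 "asr x = add x x 5 ;; shr x x 4 ;; sub x x 6"

text \<open>Word registers 36--46 are scratch space of \<open>g\<close>, which leaves its result in 41.\<close>

definition map_loop :: "nat \<Rightarrow> nat \<Rightarrow> com \<Rightarrow> com" where
 "map_loop l b g = For 35 l (g ;; add 37 b 35 ;; store 37 41)"

text \<open>Loads the butterfly whose number is in register 35, at the distance given by register
  32. Registers 54 and 55 point to the real and imaginary parts, 23 and 24 to the twiddle table, and
  33 is the stride in that table.\<close>

definition butterfly_addr :: com where
 "butterfly_addr = rem 36 35 32 ;; add 47 35 35 ;; sub 47 47 36 ;;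
   add 37 54 47 ;; add 38 37 32 ;; add 39 55 47 ;; add 40 39 32 ;;
   load 41 37 ;; load 43 38 ;; load 42 39 ;; load 44 40 ;;
   mul 48 36 33 ;; add 49 23 48 ;; load 45 49 ;; add 49 24 48 ;; load 46 49"

definition fwd_body :: com where
 "fwd_body = butterfly_addr ;;
   add 49 41 43 ;; store 37 49 ;; add 49 42 44 ;; store 39 49 ;;
   sub 41 41 43 ;; sub 42 42 44 ;;
   mul 49 41 45 ;; mul 50 42 46 ;; sub 49 49 50 ;; asr 49 ;; store 38 49 ;;
   mul 49 41 46 ;; mul 50 42 45 ;; add 49 49 50 ;; asr 49 ;; store 40 49"

definition bwd_body :: com where
 "bwd_body = butterfly_addr ;;
   mul 49 43 45 ;; mul 50 44 46 ;; add 49 49 50 ;; asr 49 ;;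
   mul 48 44 45 ;; mul 50 43 46 ;; sub 48 48 50 ;; asr 48 ;;
   add 50 41 49 ;; store 37 50 ;; add 50 42 48 ;; store 39 50 ;;
   sub 50 41 49 ;; store 38 50 ;; sub 50 42 48 ;; store 40 50"

definition fft_fwd :: com where
 "fft_fwd = mov 32 51 ;;
   For 34 52 (quo 33 7 32 ;; For 35 51 fwd_body ;; quo 32 32 15)"

definition fft_bwd :: com where
 "fft_bwd = cst 32 1 ;; For 34 52 (quo 33 7 32 ;; For 35 51 bwd_body ;; add 32 32 32)"

definition pointwise_body :: com where
 "pointwise_body = add 37 16 35 ;; add 39 17 35 ;; load 41 37 ;; load 42 39 ;;
   add 38 18 35 ;; load 45 38 ;; add 38 19 35 ;; load 46 38 ;;
   mul 49 41 45 ;; mul 50 42 46 ;; sub 49 49 50 ;; asr 49 ;; store 37 49 ;;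
   mul 49 41 46 ;; mul 50 42 45 ;; add 49 49 50 ;; asr 49 ;; store 39 49"

definition round_body :: com where
 "round_body = add 37 16 35 ;; load 41 37 ;; add 41 41 48 ;; shr 41 41 47 ;; rem 41 41 3"

text \<open>Registers 16 and 17 point to the first factor, 18 and 19 to the second, and 20 to the
  result. Both transforms and the pointwise product run in place.\<close>

definition conv :: com where
 "conv = mov 54 16 ;; mov 55 17 ;; fft_fwd ;;
   mov 54 18 ;; mov 55 19 ;; fft_fwd ;;
   For 35 53 pointwise_body ;;
   mov 54 16 ;; mov 55 17 ;; fft_bwd ;;
   add 47 4 52 ;; sub 48 47 14 ;; shl 48 14 48 ;; map_loop 53 20 round_body"

section \<open>Two's complement arithmetic\<close>

definition rep :: "nat \<Rightarrow> int \<Rightarrow> nat" where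
 "rep w z = nat (z mod 2 ^ w)"

lemma int_rep: "int (rep w z) = z mod 2 ^ w"
 by (simp add: rep_def)

lemma rep_less [simp]: "rep w z < 2 ^ w"
 by (simp add: rep_def nat_less_iff)

lemma rep_eqI: "int x = z mod 2 ^ w \<Longrightarrow> x = rep w z"
 by (simp add: rep_def)

lemma ev_rep_add: "eval_op Add w (rep w a) (rep w b) = rep w (a + b)"
 by (rule rep_eqI) (simp add: zmod_int int_rep mod_add_eq)

lemma ev_rep_mul: "eval_op Mul w (rep w a) (rep w b) = rep w (a * b)"
 by (rule rep_eqI) (simp add: zmod_int int_rep mod_mult_eq)

lemma ev_rep_sub: "eval_op Sub w (rep w a) (rep w b) = rep w (a - b)"
proof (rule rep_eqI)
 have "rep w b \<le> 2 ^ w" using rep_less[of w b] by (rule less_imp_le)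
 then have "int (rep w a + (2 ^ w - rep w b)) = (a mod 2 ^ w - b mod 2 ^ w) + 2 ^ w"
  by (simp add: int_rep of_nat_diff)
 then have "int ((rep w a + (2 ^ w - rep w b)) mod 2 ^ w) = ((a mod 2 ^ w - b mod 2 ^ w) + 2 ^ w) mod 2 ^ w"
  by (simp only: zmod_int of_nat_power of_nat_numeral)
 then show "int (eval_op Sub w (rep w a) (rep w b)) = (a - b) mod 2 ^ w"
  by (simp add: mod_diff_eq)
qed

text \<open>The bound on \<open>v\<close> keeps the biased value within one word, and the bias is
  divisible by 2^f, so that rounding down commutes with adding it.\<close>

lemma ev_asr:
 assumes v: "\<bar>v\<bar> < 2 ^ (w - 1)" and f: "f < w"
 shows "eval_op Sub w (eval_op Shr w (eval_op Add w (rep w v) (2 ^ (w - 1))) f) (2 ^ (w - 1 - f)) = rep w (v div 2 ^ f)"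
proof (rule rep_eqI)
 define y where "y = (rep w v + 2 ^ (w - 1)) mod 2 ^ w div 2 ^ f"
 have ww: "(2::int) ^ w = 2 * 2 ^ (w - 1)" using f by (cases w) auto
 have "int ((rep w v + 2 ^ (w - 1)) mod 2 ^ w) = (v + 2 ^ (w - 1)) mod 2 ^ w"
  by (simp add: zmod_int int_rep mod_add_left_eq)
 also have "\<dots> = v + 2 ^ (w - 1)" using v ww by simp
 finally have 1: "int ((rep w v + 2 ^ (w - 1)) mod 2 ^ w) = v + 2 ^ (w - 1)" .
 have "(2::int) ^ (w - 1) = 2 ^ (w - 1 - f) * 2 ^ f" using f by (simp flip: power_add)
 then have "(v + 2 ^ (w - 1)) div 2 ^ f = v div 2 ^ f + 2 ^ (w - 1 - f)" by simp
 then have 2: "int y = v div 2 ^ f + 2 ^ (w - 1 - f)"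
  unfolding y_def zdiv_int 1 of_nat_power of_nat_numeral .
 have le: "(2::nat) ^ (w - 1 - f) \<le> 2 ^ w" by (rule power_increasing) auto
 have "int (y + (2 ^ w - 2 ^ (w - 1 - f))) = v div 2 ^ f + 2 ^ w"
  by (simp only: of_nat_add of_nat_diff[OF le] 2 of_nat_power of_nat_numeral)
 then have "int ((y + (2 ^ w - 2 ^ (w - 1 - f))) mod 2 ^ w) = (v div 2 ^ f + 2 ^ w) mod 2 ^ w"
  by (simp only: zmod_int of_nat_power of_nat_numeral)
 then show "int (eval_op Sub w (eval_op Shr w (eval_op Add w (rep w v) (2 ^ (w - 1))) f) (2 ^ (w - 1 - f))) = v div 2 ^ f mod 2 ^ w"
  by (simp add: y_def)
qed

lemma rep_of_nat: "x < 2 ^ w \<Longrightarrow> rep w (int x) = x"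
 by (rule rep_eqI[symmetric]) (metis mod_less of_nat_mod of_nat_numeral of_nat_power)

lemma ev_add: "a + b < 2 ^ w \<Longrightarrow> eval_op Add w a b = a + b"
 by simp

lemma ev_sub: "b \<le> a \<Longrightarrow> a < 2 ^ w \<Longrightarrow> eval_op Sub w a b = a - b"
proof -
 assume "b \<le> a" "a < 2 ^ w"
 then have "a + (2 ^ w - b) = (a - b) + 2 ^ w" by simp
 then have "(a + (2 ^ w - b)) mod 2 ^ w = ((a - b) + 2 ^ w) mod 2 ^ w" by (simp only:)
 then show ?thesis using \<open>a < 2 ^ w\<close> by simp
qed

lemma ev_mul: "a * b < 2 ^ w \<Longrightarrow> eval_op Mul w a b = a * b"
 by simp

lemma ev_shl: "a * 2 ^ b < 2 ^ w \<Longrightarrow> eval_op Shl w a b = a * 2 ^ b"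
 by simp

lemmas ev_div = eval_op.simps(4) and ev_mod = eval_op.simps(5) and ev_shr = eval_op.simps(10)

declare eval_op.simps [simp del]

section \<open>Memory layout: registers, slots and footprints\<close>

locale layout = machine w lw lr for w lw lr +
 fixes M2 NS :: nat
 assumes lw: "lw = 64 + NS * M2" and lw_small: "lw < 2 ^ w"
begin

definition ad :: "nat \<Rightarrow> nat \<Rightarrow> nat" where
 "ad s t = 64 + s * M2 + t"

lemma ad_less: "s < NS \<Longrightarrow> t < M2 \<Longrightarrow> ad s t < lw"
proof -
 assume "s < NS" "t < M2"
 then have "s * M2 + t < Suc s * M2" by simp
 also have "\<dots> \<le> NS * M2" using \<open>s < NS\<close> by (intro mult_le_mono1) simp
 finally show ?thesis by (simp add: ad_def lw)
qed

lemma ad_reg: "r < 64 \<Longrightarrow> (ad s t = r) = False" "r < 64 \<Longrightarrow> (r = ad s t) = False"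
 by (auto simp: ad_def)

lemma ad_inj: "t < M2 \<Longrightarrow> t' < M2 \<Longrightarrow> ad s t = ad s' t' \<longleftrightarrow> s = s' \<and> t = t'"
proof
 assume t: "t < M2" "t' < M2" "ad s t = ad s' t'"
 then have *: "s * M2 + t = s' * M2 + t'" by (simp add: ad_def)
 from t(1,2) have "(s * M2 + t) mod M2 = t" "(s' * M2 + t') mod M2 = t'" by simp_all
 then have "t = t'" using * by simp
 then show "s = s' \<and> t = t'" using * t by auto
qed auto

lemma reg_less: "r < 64 \<Longrightarrow> r < lw"
 by (simp add: lw)

lemma ad_add: "s < NS \<Longrightarrow> t + t' < M2 \<Longrightarrow> eval_op Add w (ad s t) t' = ad s (t + t')"
 using ad_less[of s "t + t'"] lw_small by (subst ev_add) (auto simp: ad_def)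

text \<open>The footprint of a program: it may change the registers in \<open>Rs\<close> and the
  slots in \<open>Ss\<close>. Parameters and earlier results are carried across subprograms by such
  facts.\<close>

definition frame :: "nat set \<Rightarrow> nat set \<Rightarrow> words \<Rightarrow> words \<Rightarrow> bool" where
 "frame Rs Ss W W' \<longleftrightarrow> (\<forall>r<64. r \<notin> Rs \<longrightarrow> W' r = W r) \<and>
   (\<forall>s t. s < NS \<longrightarrow> t < M2 \<longrightarrow> s \<notin> Ss \<longrightarrow> W' (ad s t) = W (ad s t))"

lemma frame_refl [simp]: "frame Rs Ss W W"
 by (simp add: frame_def)

lemma frame_trans: "frame Rs Ss W W' \<Longrightarrow> frame Rs' Ss' W' W'' \<Longrightarrow> Rs \<subseteq> Rs'' \<Longrightarrow> Rs' \<subseteq> Rs'' \<Longrightarrow>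
  Ss \<subseteq> Ss'' \<Longrightarrow> Ss' \<subseteq> Ss'' \<Longrightarrow> frame Rs'' Ss'' W W''"
 unfolding frame_def by (metis subsetD)

lemma frame_reg: "frame Rs Ss W W' \<Longrightarrow> r < 64 \<Longrightarrow> r \<notin> Rs \<Longrightarrow> W' r = W r"
 by (simp add: frame_def)

lemma frame_slot: "frame Rs Ss W W' \<Longrightarrow> s < NS \<Longrightarrow> t < M2 \<Longrightarrow> s \<notin> Ss \<Longrightarrow> W' (ad s t) = W (ad s t)"
 by (simp add: frame_def)

lemma frame_upd_reg: "frame Rs Ss W W' \<Longrightarrow> r \<in> Rs \<Longrightarrow> r < 64 \<Longrightarrow> frame Rs Ss W (W'(r := v))"
 by (auto simp: frame_def ad_reg)

lemma frame_upd_slot: "frame Rs Ss W W' \<Longrightarrow> s \<in> Ss \<Longrightarrow> t < M2 \<Longrightarrow> frame Rs Ss W (W'(ad s t := v))"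
 by (auto simp: frame_def ad_reg ad_inj)

end

text \<open>\<open>prec\<close> keeps the error of a convolution of length at most
  \<open>2 * m\<close> below the rounding threshold; \<open>width\<close> makes the products of
  fixed-point numbers fit into signed words. Of the \<open>15 + R\<close> slots, the last
  \<open>R\<close> hold the coefficients of the rows.\<close>

locale sketch = layout w lw lr "2 * m" NS + twiddle f m tab
 for w lw lr NS f m tab +
 fixes p k u mb R n a nblk :: nat and cf :: "nat \<Rightarrow> nat \<Rightarrow> nat"
 assumes f_less: "f < w" and NS_eq: "NS = 15 + R" and m_eq: "m = 2 ^ k" and m_ge: "64 \<le> m"
  and mb_eq: "mb = 2 ^ u" and R_pos: "R \<ge> 1" and p_pos: "p \<ge> 1"
  and prec: "512 * (2 * m) ^ 7 * p\<^sup>2 \<le> 2 ^ f" and width: "32 * 4 ^ f * (2 * m) ^ 3 * p\<^sup>2 < 2 ^ (w - 1)"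
begin

definition HB :: nat where "HB = 2 ^ (w - 1)"
definition HF :: nat where "HF = 2 ^ (w - 1 - f)"
definition small :: "int \<Rightarrow> bool" where "small v \<longleftrightarrow> \<bar>v\<bar> < 2 ^ (w - 1)"

lemma ev_asr': "small v \<Longrightarrow> eval_op Sub w (eval_op Shr w (eval_op Add w (rep w v) HB) f) HF = rep w (v div 2 ^ f)"
 unfolding HB_def HF_def small_def using ev_asr[OF _ f_less] by blast

text \<open>Besides parameters and slot addresses this fixes the read-only tables: the twiddle
  factors in slots 9 and 10 and the hash coefficients from slot 15 on.\<close>

definition env :: "words \<Rightarrow> bool" where
 "env W \<longleftrightarrow> W 3 = p \<and> W 4 = f \<and> W 5 = HB \<and> W 6 = HF \<and> W 7 = m \<and> W 8 = k \<and> W 9 = u \<and> W 10 = mb \<and>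
   W 11 = R \<and> W 12 = n \<and> W 13 = a \<and> W 14 = 1 \<and> W 15 = 2 \<and>
   W 16 = ad 2 0 \<and> W 17 = ad 3 0 \<and> W 18 = ad 4 0 \<and> W 19 = ad 5 0 \<and> W 20 = ad 6 0 \<and> W 21 = ad 7 0 \<and>
   W 22 = ad 8 0 \<and> W 23 = ad 9 0 \<and> W 24 = ad 10 0 \<and> W 25 = ad 11 0 \<and> W 26 = ad 12 0 \<and> W 27 = ad 13 0 \<and>
   W 28 = ad 14 0 \<and> W 29 = ad 15 0 \<and> W 30 = nblk \<and>
   (\<forall>t<m. W (ad 9 t) = rep w (fst (tab t)) \<and> W (ad 10 t) = rep w (snd (tab t))) \<and>
   (\<forall>r<R. \<forall>t<m. W (ad (15 + r) t) = cf r t)"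

lemma slot_less: "s < 15 \<Longrightarrow> s < NS" "r < R \<Longrightarrow> 15 + r < NS"
 by (simp_all add: NS_eq)

lemma m2_less: "2 * m < 2 ^ w"
proof -
 have "1 * (2 * m) \<le> NS * (2 * m)" by (rule mult_le_mono1) (simp add: NS_eq)
 then show ?thesis using lw lw_small by linarith
qed

lemma env_frame:
 assumes "env W" "frame Rs Ss W W'" "Rs \<subseteq> {2} \<union> {31..<64}" "Ss \<subseteq> {0..<9} \<union> {11..<15}"
 shows "env W'"
proof -
 have r: "W' r = W r" if "r \<in> {3..<31}" for r
  using assms(2,3) that by (intro frame_reg[OF assms(2)]) auto
 have t: "W' (ad s t) = W (ad s t)" if "s \<in> {9, 10} \<union> {15..<NS}" "t < m" for s t
  by (rule frame_slot[OF assms(2)]) (use assms(4) that slot_less(1) in auto)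
 show ?thesis
  using assms(1) r t NS_eq unfolding env_def by simp
qed

text \<open>The lower index of butterfly \<open>t\<close>. It equals 2h (t div h) + t mod h; for
  \<open>h\<close> a power of two, a zero bit is inserted into \<open>t\<close> at the position of
  \<open>h\<close>.\<close>

definition pair_index :: "nat \<Rightarrow> nat \<Rightarrow> nat" where
 "pair_index h t = 2 * t - t mod h"

lemma fwd_body_wp:
 assumes env: "env W" and regs: "W 32 = h" "W 33 = m div h" "W 35 = t" "W 54 = ad sr 0" "W 55 = ad si 0"
  and s: "sr < 9" "si < 9" "sr \<noteq> si" and h: "h > 0" "pair_index h t + h < 2 * m" "t < m" "(t mod h) * (m div h) < m"
  and tw: "tab ((t mod h) * (m div h)) = (c, d)"
  and vals: "W (ad sr (pair_index h t)) = rep w ar" "W (ad si (pair_index h t)) = rep w ai"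
   "W (ad sr (pair_index h t + h)) = rep w br" "W (ad si (pair_index h t + h)) = rep w bi"
  and sm: "small ((ar - br) * c - (ai - bi) * d)" "small ((ar - br) * d + (ai - bi) * c)"
 shows "wp fwd_body (\<lambda>tm (W', X'). tm = 36 \<and> X' = X \<and> frame {36..<51} {sr, si} W W' \<and>
   (\<forall>i<2*m. W' (ad sr i) = (if i = pair_index h t then rep w (ar + br)
    else if i = pair_index h t + h then rep w (((ar - br) * c - (ai - bi) * d) div 2 ^ f) else W (ad sr i))) \<and>
   (\<forall>i<2*m. W' (ad si i) = (if i = pair_index h t then rep w (ai + bi)
    else if i = pair_index h t + h then rep w (((ar - br) * d + (ai - bi) * c) div 2 ^ f) else W (ad si i)))) (W, X)"
proof -
 define i where "i = pair_index h t"
 have ns: "sr < NS" "si < NS" "9 < NS" "10 < NS" using s slot_less by auto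
 have e1: "eval_op Mod w t h = t mod h" by (simp add: ev_mod)
 have e2: "eval_op Add w t t = 2 * t" using h(3) m2_less by (subst ev_add) auto
 have e3: "eval_op Sub w (2 * t) (t mod h) = i"
  unfolding i_def pair_index_def using h(3) m2_less mod_less_eq_dividend[of t h] by (subst ev_sub) linarith+
 have e4: "eval_op Mul w (t mod h) (m div h) = (t mod h) * (m div h)" using h(4) m2_less by (subst ev_mul) auto
 have ih: "i + h < 2 * m" "i < 2 * m" using h(2) by (auto simp: i_def)
 have tabs: "W (ad 9 ((t mod h) * (m div h))) = rep w c" "W (ad 10 ((t mod h) * (m div h))) = rep w d"
  using env h(4) tw by (auto simp: env_def)
 note er = env[unfolded env_def]
 have regs': "W 4 = f" "W 5 = HB" "W 6 = HF" "W 23 = ad 9 0" "W 24 = ad 10 0"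
  using er by auto
 show ?thesis
  unfolding fwd_body_def butterfly_addr_def asr_def i_def[symmetric]
  using s ns ih h tabs vals[folded i_def] sm regs regs'
  by (simp add: reg_less ad_less ad_reg ad_inj ad_add e1 e2 e3 e4 ev_rep_add ev_rep_sub ev_rep_mul ev_asr' frame_def)
qed

lemma bwd_body_wp:
 assumes env: "env W" and regs: "W 32 = h" "W 33 = m div h" "W 35 = t" "W 54 = ad sr 0" "W 55 = ad si 0"
  and s: "sr < 9" "si < 9" "sr \<noteq> si" and h: "h > 0" "pair_index h t + h < 2 * m" "t < m" "(t mod h) * (m div h) < m"
  and tw: "tab ((t mod h) * (m div h)) = (c, d)"
  and vals: "W (ad sr (pair_index h t)) = rep w ar" "W (ad si (pair_index h t)) = rep w ai"
   "W (ad sr (pair_index h t + h)) = rep w br" "W (ad si (pair_index h t + h)) = rep w bi"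
  and sm: "small (br * c + bi * d)" "small (bi * c - br * d)"
 shows "wp bwd_body (\<lambda>tm (W', X'). tm = 36 \<and> X' = X \<and> frame {36..<51} {sr, si} W W' \<and>
   (\<forall>i<2*m. W' (ad sr i) = (if i = pair_index h t then rep w (ar + (br * c + bi * d) div 2 ^ f)
    else if i = pair_index h t + h then rep w (ar - (br * c + bi * d) div 2 ^ f) else W (ad sr i))) \<and>
   (\<forall>i<2*m. W' (ad si i) = (if i = pair_index h t then rep w (ai + (bi * c - br * d) div 2 ^ f)
    else if i = pair_index h t + h then rep w (ai - (bi * c - br * d) div 2 ^ f) else W (ad si i)))) (W, X)"
proof -
 define i where "i = pair_index h t"
 have ns: "sr < NS" "si < NS" "9 < NS" "10 < NS" using s slot_less by auto
 have e1: "eval_op Mod w t h = t mod h" by (simp add: ev_mod)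
 have e2: "eval_op Add w t t = 2 * t" using h(3) m2_less by (subst ev_add) auto
 have e3: "eval_op Sub w (2 * t) (t mod h) = i"
  unfolding i_def pair_index_def using h(3) m2_less mod_less_eq_dividend[of t h] by (subst ev_sub) linarith+
 have e4: "eval_op Mul w (t mod h) (m div h) = (t mod h) * (m div h)" using h(4) m2_less by (subst ev_mul) auto
 have ih: "i + h < 2 * m" "i < 2 * m" using h(2) by (auto simp: i_def)
 have tabs: "W (ad 9 ((t mod h) * (m div h))) = rep w c" "W (ad 10 ((t mod h) * (m div h))) = rep w d"
  using env h(4) tw by (auto simp: env_def)
 note er = env[unfolded env_def]
 have regs': "W 4 = f" "W 5 = HB" "W 6 = HF" "W 23 = ad 9 0" "W 24 = ad 10 0"
  using er by auto
 show ?thesis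
  unfolding bwd_body_def butterfly_addr_def asr_def i_def[symmetric]
  using s ns ih h tabs vals[folded i_def] sm regs regs'
  by (simp add: reg_less ad_less ad_reg ad_inj ad_add e1 e2 e3 e4 ev_rep_add ev_rep_sub ev_rep_mul ev_asr' frame_def)
qed

text \<open>The last claim is the inverse map: each index lies in exactly one butterfly. This is
  what allows a stage to run in place.\<close>

lemma pair_index_props:
 assumes h: "h > 0" "2 * h dvd N" and t: "t < N div 2"
 shows "pair_index h t + h < N" "pair_index h t mod (2 * h) = t mod h" "pair_index h t mod h = t mod h"
  "(pair_index h t + h) mod (2 * h) = h + t mod h" "(pair_index h t + h) mod h = t mod h"
  "i div (2 * h) * h + i mod h = t \<longleftrightarrow> i = pair_index h t \<or> i = pair_index h t + h"
proof -
 define b q where "b = t div h" and "q = t mod h"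
 have t': "t = h * b + q" "q < h" using h by (simp_all add: b_def q_def)
 have pi: "pair_index h t = 2 * h * b + q"
  unfolding pair_index_def q_def[symmetric] by (simp add: t'(1))
 show 1: "pair_index h t mod (2 * h) = t mod h" unfolding pi q_def[symmetric] using t'(2) by simp
 show 2: "(pair_index h t + h) mod (2 * h) = h + t mod h"
 proof -
  have "pair_index h t + h = (h + q) + 2 * h * b" unfolding pi by simp
  then show ?thesis unfolding q_def[symmetric] using t'(2) by (simp only: mod_mult_self2) simp
 qed
 show 3: "pair_index h t mod h = t mod h"
 proof -
  have "pair_index h t = q + h * (2 * b)" unfolding pi by simp
  then show ?thesis unfolding q_def[symmetric] using t'(2) by (simp only: mod_mult_self2) simp
 qed
 then show "(pair_index h t + h) mod h = t mod h" by simp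
 show "pair_index h t + h < N"
 proof -
  from h(2) obtain c where N: "N = 2 * h * c" by auto
  then have "h * b + q < h * c" using t t' by simp
  then have "h * b < h * c" by linarith
  then have "b < c" by simp
  then have "2 * h * (b + 1) \<le> 2 * h * c" by (intro mult_le_mono2) simp
  then show ?thesis unfolding pi N using t'(2) by simp
 qed
 show "i div (2 * h) * h + i mod h = t \<longleftrightarrow> i = pair_index h t \<or> i = pair_index h t + h"
  using h(1)
 proof (cases rule: index_split[of h i])
  case (1 b' q')
  have "i div (2 * h) = b'" using 1(1) unfolding 1(2) by simp
  then have "i div (2 * h) * h + i mod h = h * b' + q'" using 1(4) by simp
  moreover have "h * b' + q' = h * b + q \<longleftrightarrow> b' = b \<and> q' = q"
   using 1(1) t'(2) by (metis div_mult_self4 mod_mult_self4 add.commute div_less add_0 mod_less not_gr0 h(1))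
  moreover have "i = pair_index h t \<longleftrightarrow> b' = b \<and> q' = q"
  proof
   assume "i = pair_index h t"
   then have e: "2 * h * b' + q' = 2 * h * b + q" using 1(2) pi by simp
   have "q' = q" using 1(3) \<open>i = pair_index h t\<close> \<open>pair_index h t mod (2 * h) = t mod h\<close> q_def by simp
   with e h(1) show "b' = b \<and> q' = q" by simp
  qed (use 1(2) pi in simp)
  moreover have "i \<noteq> pair_index h t + h"
   using 1(1,3) 2 by auto
  ultimately show ?thesis using t'(1) by auto
 next
  case (2 b' q')
  have "i div (2 * h) = b'" using 2(1) unfolding 2(2) by (simp add: add.assoc)
  then have "i div (2 * h) * h + i mod h = h * b' + q'" using 2(4) by simp
  moreover have "h * b' + q' = h * b + q \<longleftrightarrow> b' = b \<and> q' = q"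
   using 2(1) t'(2) by (metis div_mult_self4 mod_mult_self4 add.commute div_less add_0 mod_less not_gr0 h(1))
  moreover have "i = pair_index h t + h \<longleftrightarrow> b' = b \<and> q' = q"
  proof
   assume "i = pair_index h t + h"
   then have e: "2 * h * b' + q' = 2 * h * b + q" using 2(2) pi by simp
   have "q' = q" using 2(4) \<open>i = pair_index h t + h\<close> \<open>pair_index h t mod h = t mod h\<close> q_def by simp
   with e h(1) show "b' = b \<and> q' = q" by simp
  qed (use 2(2) pi in simp)
  moreover have "i \<noteq> pair_index h t"
  proof
   assume "i = pair_index h t"
   then have "h + q' = t mod h" using 2(3) 1 by simp
   with mod_less_divisor[OF h(1), of t] show False by linarith
  qed
  ultimately show ?thesis using t'(1) by auto
 qed
qed

section \<open>In-place transforms on words\<close>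

definition holds :: "nat \<Rightarrow> nat \<Rightarrow> nat \<Rightarrow> (nat \<Rightarrow> int \<times> int) \<Rightarrow> words \<Rightarrow> bool" where
 "holds sr si N A W \<longleftrightarrow> (\<forall>i<N. W (ad sr i) = rep w (fst (A i)) \<and> W (ad si i) = rep w (snd (A i)))"

abbreviation (input) "changes_pair sr si q h S X W tm W' X' \<equiv> tm \<le> (38::nat) \<and> X' = (X::reals) \<and> frame {36..<51} {sr, si} W W' \<and>
 (\<forall>i<2*m. W' (ad sr i) = (if i = q \<or> i = q + h then rep w (fst (S i)) else W (ad sr i)) \<and>
  W' (ad si i) = (if i = q \<or> i = q + h then rep w (snd (S i)) else W (ad si i)))"

text \<open>Common to both directions. The butterflies are disjoint pairs, so an entry already has
  its new value exactly if the number \<open>pi\<close> of its butterfly is below the loop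
  counter.\<close>

lemma stage_loop:
 assumes body: "\<And>t W. t < N div 2 \<Longrightarrow> env W \<Longrightarrow> W 32 = h \<Longrightarrow> W 33 = m div h \<Longrightarrow> W 35 = t \<Longrightarrow>
   W 54 = ad sr 0 \<Longrightarrow> W 55 = ad si 0 \<Longrightarrow>
   W (ad sr (pair_index h t)) = rep w (fst (A (pair_index h t))) \<Longrightarrow>
   W (ad si (pair_index h t)) = rep w (snd (A (pair_index h t))) \<Longrightarrow>
   W (ad sr (pair_index h t + h)) = rep w (fst (A (pair_index h t + h))) \<Longrightarrow>
   W (ad si (pair_index h t + h)) = rep w (snd (A (pair_index h t + h))) \<Longrightarrow>
   wp c (\<lambda>tm (W', X'). changes_pair sr si (pair_index h t) h S X W tm W' X') (W, X)"
  and env: "env W" and s: "sr < 9" "si < 9" and h: "h > 0" "2 * h dvd N" and N: "N \<le> 2 * m"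
  and regs: "W 32 = h" "W 33 = m div h" "W 51 = N div 2" "W 54 = ad sr 0" "W 55 = ad si 0"
  and A: "holds sr si N A W"
  and Q: "\<And>tm W'. tm \<le> 3 + N div 2 * 42 \<Longrightarrow> frame ({2} \<union> {35..<51}) {sr, si} W W' \<Longrightarrow> holds sr si N S W' \<Longrightarrow> Q tm (W', X)"
 shows "wp (For 35 51 c) Q (W, X)"
proof -
 define pi where "pi i = i div (2 * h) * h + i mod h" for i
 define I where "I k W' X' \<longleftrightarrow> X' = X \<and> frame ({2} \<union> {35..<51}) {sr, si} W W' \<and>
   holds sr si N (\<lambda>i. if pi i < k then S i else A i) W'" for k W' and X' :: "nat \<Rightarrow> real"
 have slots: "sr < NS" "si < NS" using s slot_less by auto
 show ?thesis
 proof (rule wp_For[where I = I and B = 38 and N = "N div 2"])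
  show "I 0 (W(35 := 0)) X"
   using A by (auto simp: I_def holds_def ad_reg intro: frame_upd_reg)
 next
  fix t W1 X1
  assume t: "t < N div 2" and I: "I t W1 X1" and r: "W1 35 = t" "W1 51 = N div 2"
  have X1: "X1 = X" and fr: "frame ({2} \<union> {35..<51}) {sr, si} W W1"
   and hl: "holds sr si N (\<lambda>i. if pi i < t then S i else A i) W1" using I by (auto simp: I_def)
  note pp = pair_index_props[OF h t, folded pi_def]
  have pit: "pi (pair_index h t) = t" "pi (pair_index h t + h) = t" using pp(6) by blast+
  have "wp c (\<lambda>tm (W', X'). changes_pair sr si (pair_index h t) h S X W1 tm W' X') (W1, X)"
  proof (rule body[OF t])
   show "env W1" by (rule env_frame[OF env fr]) (use s in auto)
   show "W1 32 = h" "W1 33 = m div h" "W1 54 = ad sr 0" "W1 55 = ad si 0"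
    using frame_reg[OF fr] regs by auto
   show "W1 (ad sr (pair_index h t)) = rep w (fst (A (pair_index h t)))"
    "W1 (ad si (pair_index h t)) = rep w (snd (A (pair_index h t)))"
    "W1 (ad sr (pair_index h t + h)) = rep w (fst (A (pair_index h t + h)))"
    "W1 (ad si (pair_index h t + h)) = rep w (snd (A (pair_index h t + h)))"
    using hl pp(1) pit by (auto simp: holds_def)
  qed (rule r)
  then show "wp c (\<lambda>tm (W', X'). tm \<le> 38 \<and> W' 35 = t \<and> W' 51 = N div 2 \<and> I (Suc t) (W'(2 := 1, 35 := Suc t)) X') (W1, X1)"
   unfolding X1
  proof (rule wp_mono)
   fix tm s'
   assume "case s' of (W', X') \<Rightarrow> changes_pair sr si (pair_index h t) h S X W1 tm W' X'"
   then obtain W' where s': "s' = (W', X)" "tm \<le> 38" and fr': "frame {36..<51} {sr, si} W1 W'"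
    and v: "\<And>i. i < 2*m \<Longrightarrow> W' (ad sr i) = (if i = pair_index h t \<or> i = pair_index h t + h then rep w (fst (S i)) else W1 (ad sr i)) \<and>
      W' (ad si i) = (if i = pair_index h t \<or> i = pair_index h t + h then rep w (snd (S i)) else W1 (ad si i))"
    by (cases s') auto
   have "frame ({2} \<union> {35..<51}) {sr, si} W W'"
    by (rule frame_trans[OF fr fr']) auto
   then have f2: "frame ({2} \<union> {35..<51}) {sr, si} W (W'(2 := 1, 35 := Suc t))"
    by (intro frame_upd_reg) auto
   have "holds sr si N (\<lambda>i. if pi i < Suc t then S i else A i) W'"
    unfolding holds_def
   proof (intro allI impI)
    fix i assume i: "i < N"
    have "pi i = t \<longleftrightarrow> i = pair_index h t \<or> i = pair_index h t + h" by (rule pp(6))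
    then show "W' (ad sr i) = rep w (fst (if pi i < Suc t then S i else A i)) \<and>
      W' (ad si i) = rep w (snd (if pi i < Suc t then S i else A i))"
     using v[of i] i N hl unfolding holds_def by (cases "pi i = t") (auto simp: less_Suc_eq)
   qed
   then have "I (Suc t) (W'(2 := 1, 35 := Suc t)) X"
    using f2 by (simp add: I_def holds_def ad_reg)
   moreover have "W' 35 = t" "W' 51 = N div 2" using frame_reg[OF fr'] r by auto
   ultimately show "case s' of (W', X') \<Rightarrow> tm \<le> 38 \<and> W' 35 = t \<and> W' 51 = N div 2 \<and> I (Suc t) (W'(2 := 1, 35 := Suc t)) X'"
    using s' by simp
  qed
 next
  fix tm W' X'
  assume "tm \<le> 3 + N div 2 * (38 + 4)" "I (N div 2) W' X'"
  moreover have "pi i < N div 2" if "i < N" for i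
  proof -
   from h(2) obtain c where Nc: "N = 2 * h * c" by auto
   then have "i div (2 * h) < c" using that by (simp add: less_mult_imp_div_less mult.commute)
   then have "(i div (2 * h) + 1) * h \<le> c * h" by (intro mult_le_mono1) simp
   moreover have "i mod h < h" using h by simp
   ultimately show ?thesis unfolding pi_def Nc by (simp add: mult.commute)
  qed
  ultimately show "Q tm (W', X')"
   unfolding I_def by (auto simp: holds_def intro!: Q)
 next
  show "N div 2 < 2 ^ w" using N m2_less by linarith
 qed (use regs in \<open>auto simp: reg_less\<close>)
qed

end

lemma wp_mono_prod:
 assumes "machine.wp w lw lr c (\<lambda>t (W', X'). P t W' X') s"
  and "\<And>t W' X'. P t W' X' \<Longrightarrow> Q t (W', X')"
 shows "machine.wp w lw lr c Q s"
 by (rule machine.wp_mono[OF assms(1)]) (use assms(2) in auto)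

section \<open>Triples with time bounds\<close>

context machine
begin

definition ends :: "com \<Rightarrow> nat \<Rightarrow> (words \<Rightarrow> reals \<Rightarrow> bool) \<Rightarrow> words \<Rightarrow> reals \<Rightarrow> bool" where
 "ends c T Q W X \<longleftrightarrow> wp c (\<lambda>t (W', X'). t \<le> T \<and> Q W' X') (W, X)"

lemma ends_mono:
 "ends c T P W X \<Longrightarrow> (\<And>W' X'. P W' X' \<Longrightarrow> Q W' X') \<Longrightarrow> T \<le> T' \<Longrightarrow> ends c T' Q W X"
 unfolding ends_def by (erule wp_mono) auto

lemma ends_Seq:
 assumes "ends c T P W X" "\<And>W' X'. P W' X' \<Longrightarrow> ends d T' Q W' X'" "T + T' \<le> B"
 shows "ends (c ;; d) B Q W X"
 unfolding ends_def wp_Seq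
 by (rule wp_mono[OF assms(1)[unfolded ends_def]])
  (use assms(2,3) in \<open>fastforce simp: ends_def elim: wp_mono\<close>)

lemmas ends_SeqI = ends_Seq[OF _ _ order_refl]

end

abbreviation (input) "loopR \<equiv> {2} \<union> {35..<47::nat}"
abbreviation (input) "stageR \<equiv> {2} \<union> {35..<51::nat}"
abbreviation (input) "fftR \<equiv> {2} \<union> {32..<51::nat}"
abbreviation (input) "nodeR \<equiv> {2} \<union> {32..<56::nat}"

context layout
begin

abbreviation (input) "computes c T v W X \<equiv> ends c T (\<lambda>W' X'. X' = X \<and> frame {36..<47} {} W W' \<and> W' 41 = v) W X"

text \<open>A view of the memory without registers. Invariants stated about \<open>arr\<close> are
  untouched by loop counters.\<close>

definition arr :: "words \<Rightarrow> nat \<Rightarrow> nat \<Rightarrow> nat" where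
 "arr W s t = W (ad s t)"

lemma arr_upd_reg: "r < 64 \<Longrightarrow> arr (W(r := v)) = arr W"
 by (auto simp: arr_def fun_eq_iff ad_reg)

end

context sketch
begin

definition bounded :: "nat \<Rightarrow> (nat \<Rightarrow> int \<times> int) \<Rightarrow> bool" where
 "bounded N A \<longleftrightarrow> (\<forall>i<N. cmod (cv f (A i)) \<le> 2 * (2 * real m) ^ 3 * real p ^ 2)"

lemma width_real: "32 * 4 ^ f * (2 * real m) ^ 3 * real p ^ 2 < 2 ^ (w - 1)"
proof -
 have "real (32 * 4 ^ f * (2 * m) ^ 3 * p\<^sup>2) < real (2 ^ (w - 1))"
  using width by (simp only: of_nat_less_iff)
 then show ?thesis by (simp only: of_nat_mult of_nat_power of_nat_numeral)
qed

text \<open>The parts of a pair are at most 2^f times its modulus, so a sum of two products is at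
  most 2 * 4^f * B * C.\<close>

lemma small_products:
 fixes x y :: "int \<times> int"
 assumes "cmod (cv f x) \<le> B" "cmod (cv f y) \<le> C" "4 ^ f * (2 * B * C) < 2 ^ (w - 1)"
 shows "small (fst x * fst y - snd x * snd y)" "small (fst x * snd y + snd x * fst y)"
  "small (fst x * fst y + snd x * snd y)" "small (snd x * fst y - fst x * snd y)"
proof -
 have uB: "\<bar>real_of_int (fst x)\<bar> \<le> 2 ^ f * B" "\<bar>real_of_int (snd x)\<bar> \<le> 2 ^ f * B"
  using cv_bound[OF assms(1)] by auto
 have vC: "\<bar>real_of_int (fst y)\<bar> \<le> 2 ^ f * C" "\<bar>real_of_int (snd y)\<bar> \<le> 2 ^ f * C"
  using cv_bound[OF assms(2)] by auto
 have B0: "0 \<le> B" "0 \<le> C" using assms(1,2) norm_ge_zero order_trans by blast+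
 have pr: "\<bar>real_of_int x0 * real_of_int y0\<bar> \<le> 4 ^ f * (B * C)"
  if "\<bar>real_of_int x0\<bar> \<le> 2 ^ f * B" "\<bar>real_of_int y0\<bar> \<le> 2 ^ f * C" for x0 y0
 proof -
  have "\<bar>real_of_int x0\<bar> * \<bar>real_of_int y0\<bar> \<le> (2 ^ f * B) * (2 ^ f * C)"
   using that B0 by (intro mult_mono) auto
  also have "\<dots> = (2 ^ f * 2 ^ f) * (B * C)" by (simp add: algebra_simps)
  also have "(2::real) ^ f * 2 ^ f = 4 ^ f" by (simp flip: power_mult_distrib)
  finally show ?thesis by (simp add: abs_mult)
 qed
 have sm: "small z" if "\<bar>real_of_int z\<bar> \<le> 4 ^ f * (2 * B * C)" for z
 proof -
  have "real_of_int \<bar>z\<bar> < real_of_int (2 ^ (w - 1))" using that assms(3) by simp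
  then show ?thesis unfolding small_def by (simp only: of_int_less_iff)
 qed
 have e: "4 ^ f * (2 * B * C) = 4 ^ f * (B * C) + 4 ^ f * (B * C)" by simp
 note p1 = pr[OF uB(1) vC(1)] and p2 = pr[OF uB(2) vC(2)] and p3 = pr[OF uB(1) vC(2)] and p4 = pr[OF uB(2) vC(1)]
 show "small (fst x * fst y - snd x * snd y)" by (rule sm) (use p1 p2 e in \<open>simp add: abs_le_iff\<close>)
 show "small (fst x * snd y + snd x * fst y)" by (rule sm) (use p3 p4 e in \<open>simp add: abs_le_iff\<close>)
 show "small (fst x * fst y + snd x * snd y)" by (rule sm) (use p1 p2 e in \<open>simp add: abs_le_iff\<close>)
 show "small (snd x * fst y - fst x * snd y)" by (rule sm) (use p3 p4 e in \<open>simp add: abs_le_iff\<close>)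
qed

text \<open>With \<open>z\<close> as below, forming the difference doubles the bound in
  \<open>bounded\<close>, the twiddle factor contributes 2, and the two products are added. This
  gives \<open>16 * z\<close>, within the \<open>32 * z\<close> that \<open>width\<close>
  provides.\<close>

lemma small_twiddle:
 assumes A: "bounded N A" and ij: "i < N" "j < N" and h: "h dvd m" "q < h"
 shows "small (fst (psub (A i) (A j)) * fst (tw h q) - snd (psub (A i) (A j)) * snd (tw h q))"
  "small (fst (psub (A i) (A j)) * snd (tw h q) + snd (psub (A i) (A j)) * fst (tw h q))"
  "small (fst (A i) * fst (tw h q) + snd (A i) * snd (tw h q))"
  "small (snd (A i) * fst (tw h q) - fst (A i) * snd (tw h q))"
proof -
 let ?B = "2 * (2 * real m) ^ 3 * real p ^ 2"
 have b: "cmod (cv f (A i)) \<le> ?B" "cmod (cv f (A j)) \<le> ?B" using A ij by (auto simp: bounded_def)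
 then have d: "cmod (cv f (psub (A i) (A j))) \<le> 2 * ?B"
  unfolding cv_psub by (smt (verit) norm_triangle_ineq4)
 note t = tw_bound(1)[OF h]
 define z where "z = 4 ^ f * (2 * real m) ^ 3 * real p ^ 2"
 have z: "0 \<le> z" "32 * z < 2 ^ (w - 1)" using width_real by (simp_all add: z_def mult.assoc)
 have "4 ^ f * (2 * (2 * ?B) * 2) = 16 * z" "4 ^ f * (2 * ?B * 2) = 8 * z"
  unfolding z_def by (simp_all add: algebra_simps)
 with z have 1: "4 ^ f * (2 * (2 * ?B) * 2) < 2 ^ (w - 1)" and 2: "4 ^ f * (2 * ?B * 2) < 2 ^ (w - 1)"
  by linarith+
 show "small (fst (psub (A i) (A j)) * fst (tw h q) - snd (psub (A i) (A j)) * snd (tw h q))"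
  "small (fst (psub (A i) (A j)) * snd (tw h q) + snd (psub (A i) (A j)) * fst (tw h q))"
  using small_products[OF d t 1] by auto
 show "small (fst (A i) * fst (tw h q) + snd (A i) * snd (tw h q))"
  "small (snd (A i) * fst (tw h q) - fst (A i) * snd (tw h q))"
  using small_products[OF b(1) t 2] by auto
qed

lemma fwd_stage_wp:
 assumes env: "env W" and s: "sr < 9" "si < 9" "sr \<noteq> si" and h: "h > 0" "2 * h dvd N" "h dvd m" and N: "N \<le> 2 * m"
  and regs: "W 32 = h" "W 33 = m div h" "W 51 = N div 2" "W 54 = ad sr 0" "W 55 = ad si 0"
  and A: "holds sr si N A W" "bounded N A"
  and Q: "\<And>tm W'. tm \<le> 3 + N div 2 * 42 \<Longrightarrow> frame stageR {sr, si} W W' \<Longrightarrow>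
    holds sr si N (mstage f (tw h) h A) W' \<Longrightarrow> Q tm (W', X)"
 shows "wp (For 35 51 fwd_body) Q (W, X)"
proof (rule stage_loop[OF _ env s(1,2) h(1,2) N regs A(1)])
 fix t W
 assume t: "t < N div 2" and e: "env W" "W 32 = h" "W 33 = m div h" "W 35 = t" "W 54 = ad sr 0" "W 55 = ad si 0"
  and v: "W (ad sr (pair_index h t)) = rep w (fst (A (pair_index h t)))"
   "W (ad si (pair_index h t)) = rep w (snd (A (pair_index h t)))"
   "W (ad sr (pair_index h t + h)) = rep w (fst (A (pair_index h t + h)))"
   "W (ad si (pair_index h t + h)) = rep w (snd (A (pair_index h t + h)))"
 note pp = pair_index_props[OF h(1,2) t]
 let ?i = "pair_index h t" and ?q = "t mod h"
 have q: "?q < h" using h by simp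
 have tm: "t < m" using t N by linarith
 have pN: "?i < N" using pp(1) by simp
 obtain c d where cd: "tab (?q * (m div h)) = (c, d)" by force
 have sm: "small ((fst (A ?i) - fst (A (?i + h))) * c - (snd (A ?i) - snd (A (?i + h))) * d)"
  "small ((fst (A ?i) - fst (A (?i + h))) * d + (snd (A ?i) - snd (A (?i + h))) * c)"
  using small_twiddle(1,2)[OF A(2) pN pp(1) h(3) q] by (simp_all add: psub_def tw_def cd)
 have "?i + h < 2 * m" using pp(1) N by linarith
 from fwd_body_wp[OF e(1-6) s h(1) this tm tw_index[OF h(3) q] cd v sm]
 show "wp fwd_body (\<lambda>tm (W', X'). changes_pair sr si ?i h (mstage f (tw h) h A) X W tm W' X') (W, X)"
 proof (rule wp_mono_prod)
  fix tm :: nat and W' and X' :: "nat \<Rightarrow> real"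
  assume "tm = 36 \<and> X' = X \<and> frame {36..<51} {sr, si} W W' \<and>
   (\<forall>i<2*m. W' (ad sr i) = (if i = ?i then rep w (fst (A ?i) + fst (A (?i + h)))
    else if i = ?i + h then rep w (((fst (A ?i) - fst (A (?i + h))) * c - (snd (A ?i) - snd (A (?i + h))) * d) div 2 ^ f) else W (ad sr i))) \<and>
   (\<forall>i<2*m. W' (ad si i) = (if i = ?i then rep w (snd (A ?i) + snd (A (?i + h)))
    else if i = ?i + h then rep w (((fst (A ?i) - fst (A (?i + h))) * d + (snd (A ?i) - snd (A (?i + h))) * c) div 2 ^ f) else W (ad si i)))"
  moreover have "mstage f (tw h) h A ?i = padd (A ?i) (A (?i + h))"
   using pp(2) q by (simp add: mstage_def)
  moreover have "mstage f (tw h) h A (?i + h) = fmul f (psub (A ?i) (A (?i + h))) (c, d)"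
   using pp(4,5) cd by (simp add: mstage_def tw_def)
  ultimately show "case (W', X') of (W', X') \<Rightarrow> changes_pair sr si ?i h (mstage f (tw h) h A) X W tm W' X'"
   using h(1) by (auto simp: padd_def psub_def fmul_def)
 qed
qed (rule Q)

lemma bwd_stage_wp:
 assumes env: "env W" and s: "sr < 9" "si < 9" "sr \<noteq> si" and h: "h > 0" "2 * h dvd N" "h dvd m" and N: "N \<le> 2 * m"
  and regs: "W 32 = h" "W 33 = m div h" "W 51 = N div 2" "W 54 = ad sr 0" "W 55 = ad si 0"
  and A: "holds sr si N A W" "bounded N A"
  and Q: "\<And>tm W'. tm \<le> 3 + N div 2 * 42 \<Longrightarrow> frame stageR {sr, si} W W' \<Longrightarrow>
    holds sr si N (minv_stage f (tw h) h A) W' \<Longrightarrow> Q tm (W', X)"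
 shows "wp (For 35 51 bwd_body) Q (W, X)"
proof (rule stage_loop[OF _ env s(1,2) h(1,2) N regs A(1)])
 fix t W
 assume t: "t < N div 2" and e: "env W" "W 32 = h" "W 33 = m div h" "W 35 = t" "W 54 = ad sr 0" "W 55 = ad si 0"
  and v: "W (ad sr (pair_index h t)) = rep w (fst (A (pair_index h t)))"
   "W (ad si (pair_index h t)) = rep w (snd (A (pair_index h t)))"
   "W (ad sr (pair_index h t + h)) = rep w (fst (A (pair_index h t + h)))"
   "W (ad si (pair_index h t + h)) = rep w (snd (A (pair_index h t + h)))"
 note pp = pair_index_props[OF h(1,2) t]
 let ?i = "pair_index h t" and ?q = "t mod h"
 have q: "?q < h" using h by simp
 have tm: "t < m" using t N by linarith
 obtain c d where cd: "tab (?q * (m div h)) = (c, d)" by force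
 have sm: "small (fst (A (?i + h)) * c + snd (A (?i + h)) * d)"
  "small (snd (A (?i + h)) * c - fst (A (?i + h)) * d)"
  using small_twiddle(3,4)[OF A(2) pp(1) pp(1) h(3) q] by (simp_all add: tw_def cd)
 have "?i + h < 2 * m" using pp(1) N by linarith
 from bwd_body_wp[OF e(1-6) s h(1) this tm tw_index[OF h(3) q] cd v sm]
 show "wp bwd_body (\<lambda>tm (W', X'). changes_pair sr si ?i h (minv_stage f (tw h) h A) X W tm W' X') (W, X)"
 proof (rule wp_mono_prod)
  fix tm :: nat and W' and X' :: "nat \<Rightarrow> real"
  assume "tm = 36 \<and> X' = X \<and> frame {36..<51} {sr, si} W W' \<and>
   (\<forall>i<2*m. W' (ad sr i) = (if i = ?i then rep w (fst (A ?i) + (fst (A (?i + h)) * c + snd (A (?i + h)) * d) div 2 ^ f)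
    else if i = ?i + h then rep w (fst (A ?i) - (fst (A (?i + h)) * c + snd (A (?i + h)) * d) div 2 ^ f) else W (ad sr i))) \<and>
   (\<forall>i<2*m. W' (ad si i) = (if i = ?i then rep w (snd (A ?i) + (snd (A (?i + h)) * c - fst (A (?i + h)) * d) div 2 ^ f)
    else if i = ?i + h then rep w (snd (A ?i) - (snd (A (?i + h)) * c - fst (A (?i + h)) * d) div 2 ^ f) else W (ad si i)))"
  moreover have "minv_stage f (tw h) h A ?i = padd (A ?i) (fmul f (A (?i + h)) (pcnj (c, d)))"
   using pp(2,3) q cd by (simp add: minv_stage_def tw_def)
  moreover have "minv_stage f (tw h) h A (?i + h) = psub (A ?i) (fmul f (A (?i + h)) (pcnj (c, d)))"
   using pp(4,5) cd by (simp add: minv_stage_def tw_def)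
  ultimately show "case (W', X') of (W', X') \<Rightarrow> changes_pair sr si ?i h (minv_stage f (tw h) h A) X W tm W' X'"
   using h(1) by (auto simp: padd_def psub_def fmul_def pcnj_def algebra_simps)
 qed
qed (rule Q)

lemma w_pos: "w \<noteq> 0"
 using f_less by simp

lemma pow_K:
 assumes "2 ^ K dvd 2 * m"
 shows "(2::nat) ^ K \<le> 2 * m" "K \<le> Suc k" "t < K \<Longrightarrow> (2::nat) ^ t dvd m" "t < K \<Longrightarrow> 2 * 2 ^ t dvd (2::nat) ^ K"
proof -
 show 1: "(2::nat) ^ K \<le> 2 * m" using assms m_pos by (intro dvd_imp_le) auto
 then have "(2::nat) ^ K \<le> 2 ^ Suc k" by (simp add: m_eq)
 then show 2: "K \<le> Suc k" by (simp only: power_increasing_iff) 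
 show "(2::nat) ^ t dvd m" if "t < K" using that 2 unfolding m_eq by (intro le_imp_power_dvd) simp
 show "2 * 2 ^ t dvd (2::nat) ^ K" if "t < K"
  using that by (metis Suc_leI le_imp_power_dvd power_Suc)
qed

text \<open>The time is that of \<open>K\<close> stages with \<open>2 ^ K div 2\<close> butterflies
  at 42 steps each. The bound on magnitudes is required at every intermediate stage, since each of
  them could overflow.\<close>

lemma fft_fwd_wp:
 assumes env: "env W" and s: "sr < 9" "si < 9" "sr \<noteq> si" and K: "2 ^ K dvd 2 * m" "K \<ge> 1"
  and regs: "W 51 = 2 ^ K div 2" "W 52 = K" "W 54 = ad sr 0" "W 55 = ad si 0"
  and A: "holds sr si (2 ^ K) A W" "\<And>t. t \<le> K \<Longrightarrow> bounded (2 ^ K) (mfwd K A t)"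
  and Q: "\<And>tm W'. tm \<le> 5 + K * (21 * 2 ^ K + 9) \<Longrightarrow> frame fftR {sr, si} W W' \<Longrightarrow>
    holds sr si (2 ^ K) (mfwd K A K) W' \<Longrightarrow> Q tm (W', X)"
 shows "wp fft_fwd Q (W, X)"
proof -
 note pK = pow_K[OF K(1)]
 \<comment> \<open>Register 32 is described by a quotient because the halving after the last stage
   leaves \<open>0\<close> in it, which is not a power of two.\<close>
 define I where "I t W' X' \<longleftrightarrow> X' = X \<and> frame fftR {sr, si} W W' \<and>
   W' 32 = 2 ^ K div 2 div 2 ^ t \<and> holds sr si (2 ^ K) (mfwd K A t) W'" for t W' and X' :: "nat \<Rightarrow> real"
 let ?W0 = "W(2 := 0, 32 := 2 ^ K div 2)"
 have K2: "(2::nat) ^ K div 2 < 2 ^ w" "K < 2 ^ w"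
  using pK(1) m2_less less_exp[of K] by linarith+
 have "wp (For 34 52 (quo 33 7 32 ;; For 35 51 fwd_body ;; quo 32 32 15)) (\<lambda>t. Q (2 + t)) (?W0, X)"
 proof (rule wp_For[where I = I and B = "5 + 21 * 2 ^ K" and N = K])
  show "I 0 (?W0(34 := 0)) X"
   unfolding I_def using A(1) by (auto simp: holds_def ad_reg intro!: frame_upd_reg)
 next
  fix t W1 X1
  assume t: "t < K" and I: "I t W1 X1" and r: "W1 34 = t" "W1 52 = K"
  have X1: "X1 = X" and fr: "frame fftR {sr, si} W W1" and h0: "W1 32 = 2 ^ K div 2 div 2 ^ t"
   and hl: "holds sr si (2 ^ K) (mfwd K A t) W1" using I by (auto simp: I_def)
  define h where "h = (2::nat) ^ (K - Suc t)"
  have h: "W1 32 = h" "h > 0" "h div 2 = 2 ^ K div 2 div 2 ^ Suc t"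
  proof -
   have "(2::nat) ^ K = h * (2 * 2 ^ t)" unfolding h_def using t by (simp flip: power_Suc power_add)
   then have "(2::nat) ^ K div 2 div 2 ^ t = h" by (simp add: div_mult2_eq[symmetric])
   moreover have "(2::nat) ^ K div 2 div 2 ^ Suc t = 2 ^ K div 2 div 2 ^ t div 2"
    by (simp only: power_Suc2 div_mult2_eq)
   ultimately show "W1 32 = h" "h div 2 = 2 ^ K div 2 div 2 ^ Suc t" using h0
    by simp_all
   show "h > 0" by (simp add: h_def)
  qed
  have hm: "2 * h dvd 2 ^ K" "h dvd m" using pK(3,4)[of "K - Suc t"] t unfolding h_def by auto
  have env1: "env W1" by (rule env_frame[OF env fr]) (use s in auto)
  have er: "W1 7 = m" "W1 15 = 2" using env1 by (auto simp: env_def)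
  let ?W2 = "W1(33 := m div h)"
  have fr2: "frame fftR {sr, si} W ?W2" using fr by (intro frame_upd_reg) auto
  have "wp (For 35 51 fwd_body) (\<lambda>ta s'. wp (quo 32 32 15) (\<lambda>t' (W', X').
    1 + (ta + t') \<le> 5 + 21 * 2 ^ K \<and> W' 34 = t \<and> W' 52 = K \<and> I (Suc t) (W'(2 := 1, 34 := Suc t)) X') s') (?W2, X)"
  proof (rule fwd_stage_wp[OF _ s h(2) hm pK(1)])
   show "env ?W2" by (rule env_frame[OF env fr2]) (use s in auto)
   show "?W2 32 = h" "?W2 33 = m div h" using h by auto
   show "?W2 51 = 2 ^ K div 2" "?W2 54 = ad sr 0" "?W2 55 = ad si 0" using frame_reg[OF fr] regs by auto
   show "holds sr si (2 ^ K) (mfwd K A t) ?W2" using hl by (simp add: holds_def ad_reg)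
   show "bounded (2 ^ K) (mfwd K A t)" using A(2) t by simp
   fix tm :: nat and W'
   assume tm: "tm \<le> 3 + 2 ^ K div 2 * 42" and fr': "frame stageR {sr, si} ?W2 W'"
    and hl': "holds sr si (2 ^ K) (mstage f (tw h) h (mfwd K A t)) W'"
   have "frame fftR {sr, si} W W'" by (rule frame_trans[OF fr2 fr']) auto
   then have fr3: "frame fftR {sr, si} W (W'(32 := h div 2, 2 := 1, 34 := Suc t))"
    by (intro frame_upd_reg) auto
   have r': "W' 32 = h" "W' 15 = 2" "W' 34 = t" "W' 52 = K"
    using frame_reg[OF fr'] h er r by auto
   have "I (Suc t) (W'(32 := h div 2, 2 := 1, 34 := Suc t)) X"
    using fr3 hl' h(3) unfolding I_def by (simp add: holds_def ad_reg h_def)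
   moreover have "1 + (tm + 1) \<le> 5 + 21 * 2 ^ K" using tm by linarith
   ultimately show "wp (quo 32 32 15) (\<lambda>t' (W', X'). 1 + (tm + t') \<le> 5 + 21 * 2 ^ K \<and> W' 34 = t \<and>
     W' 52 = K \<and> I (Suc t) (W'(2 := 1, 34 := Suc t)) X') (W', X)"
    using r' by (simp add: reg_less ev_div)
  qed
  then show "wp (quo 33 7 32 ;; For 35 51 fwd_body ;; quo 32 32 15) (\<lambda>tm (W', X'). tm \<le> 5 + 21 * 2 ^ K \<and>
    W' 34 = t \<and> W' 52 = K \<and> I (Suc t) (W'(2 := 1, 34 := Suc t)) X') (W1, X1)"
   using er h X1 by (simp add: reg_less ev_div add.assoc)
 next
  fix tm W' X'
  assume "tm \<le> 3 + K * (5 + 21 * 2 ^ K + 4)" "I K W' X'"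
  then show "Q (2 + tm) (W', X')" unfolding I_def by (auto intro!: Q simp: algebra_simps)
 qed (use regs K2 in \<open>auto simp: reg_less\<close>)
 moreover have "eval_op Add w (2 ^ K div 2) 0 = 2 ^ K div 2" using K2 by (simp add: ev_add)
 ultimately show ?thesis
  unfolding fft_fwd_def mov_def using regs by (simp add: reg_less)
qed

lemma fft_bwd_wp:
 assumes env: "env W" and s: "sr < 9" "si < 9" "sr \<noteq> si" and K: "2 ^ K dvd 2 * m" "K \<ge> 1"
  and regs: "W 51 = 2 ^ K div 2" "W 52 = K" "W 54 = ad sr 0" "W 55 = ad si 0"
  and A: "holds sr si (2 ^ K) A W" "\<And>t. t \<le> K \<Longrightarrow> bounded (2 ^ K) (mbwd A t)"
  and Q: "\<And>tm W'. tm \<le> 5 + K * (21 * 2 ^ K + 9) \<Longrightarrow> frame fftR {sr, si} W W' \<Longrightarrow>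
    holds sr si (2 ^ K) (mbwd A K) W' \<Longrightarrow> Q tm (W', X)"
 shows "wp fft_bwd Q (W, X)"
proof -
 note pK = pow_K[OF K(1)]
 define I where "I t W' X' \<longleftrightarrow> X' = X \<and> frame fftR {sr, si} W W' \<and>
   W' 32 = 2 ^ t \<and> holds sr si (2 ^ K) (mbwd A t) W'" for t W' and X' :: "nat \<Rightarrow> real"
 let ?W0 = "W(32 := 1)"
 have K2: "K < 2 ^ w" "(1::nat) < 2 ^ w" using pK(1) m2_less m_pos less_exp[of K] by linarith+
 have "wp (For 34 52 (quo 33 7 32 ;; For 35 51 bwd_body ;; add 32 32 32)) (\<lambda>t. Q (1 + t)) (?W0, X)"
 proof (rule wp_For[where I = I and B = "5 + 21 * 2 ^ K" and N = K])
  show "I 0 (?W0(34 := 0)) X"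
   unfolding I_def using A(1) by (auto simp: holds_def ad_reg intro!: frame_upd_reg)
 next
  fix t W1 X1
  assume t: "t < K" and I: "I t W1 X1" and r: "W1 34 = t" "W1 52 = K"
  have X1: "X1 = X" and fr: "frame fftR {sr, si} W W1" and h0: "W1 32 = 2 ^ t"
   and hl: "holds sr si (2 ^ K) (mbwd A t) W1" using I by (auto simp: I_def)
  define h where "h = (2::nat) ^ t"
  have h: "W1 32 = h" "h > 0" using h0 by (simp_all add: h_def)
  have hm: "2 * h dvd 2 ^ K" "h dvd m" using pK(3,4)[OF t] unfolding h_def by auto
  have "h + h \<le> 2 * m" using dvd_imp_le[OF hm(2) m_pos] by simp
  then have hh: "eval_op Add w h h = 2 * h" using m2_less by (subst ev_add) auto
  have env1: "env W1" by (rule env_frame[OF env fr]) (use s in auto)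
  have er: "W1 7 = m" using env1 by (auto simp: env_def)
  let ?W2 = "W1(33 := m div h)"
  have fr2: "frame fftR {sr, si} W ?W2" using fr by (intro frame_upd_reg) auto
  have "wp (For 35 51 bwd_body) (\<lambda>ta s'. wp (add 32 32 32) (\<lambda>t' (W', X').
    1 + (ta + t') \<le> 5 + 21 * 2 ^ K \<and> W' 34 = t \<and> W' 52 = K \<and> I (Suc t) (W'(2 := 1, 34 := Suc t)) X') s') (?W2, X)"
  proof (rule bwd_stage_wp[OF _ s h(2) hm pK(1)])
   show "env ?W2" by (rule env_frame[OF env fr2]) (use s in auto)
   show "?W2 32 = h" "?W2 33 = m div h" using h by auto
   show "?W2 51 = 2 ^ K div 2" "?W2 54 = ad sr 0" "?W2 55 = ad si 0" using frame_reg[OF fr] regs by auto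
   show "holds sr si (2 ^ K) (mbwd A t) ?W2" using hl by (simp add: holds_def ad_reg)
   show "bounded (2 ^ K) (mbwd A t)" using A(2) t by simp
   fix tm :: nat and W'
   assume tm: "tm \<le> 3 + 2 ^ K div 2 * 42" and fr': "frame stageR {sr, si} ?W2 W'"
    and hl': "holds sr si (2 ^ K) (minv_stage f (tw h) h (mbwd A t)) W'"
   have "frame fftR {sr, si} W W'" by (rule frame_trans[OF fr2 fr']) auto
   then have fr3: "frame fftR {sr, si} W (W'(32 := 2 * h, 2 := 1, 34 := Suc t))"
    by (intro frame_upd_reg) auto
   have r': "W' 32 = h" "W' 34 = t" "W' 52 = K"
    using frame_reg[OF fr'] h r by auto
   have "I (Suc t) (W'(32 := 2 * h, 2 := 1, 34 := Suc t)) X"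
    using fr3 hl' unfolding I_def by (simp add: holds_def ad_reg h_def)
   moreover have "1 + (tm + 1) \<le> 5 + 21 * 2 ^ K" using tm by linarith
   ultimately show "wp (add 32 32 32) (\<lambda>t' (W', X'). 1 + (tm + t') \<le> 5 + 21 * 2 ^ K \<and> W' 34 = t \<and>
     W' 52 = K \<and> I (Suc t) (W'(2 := 1, 34 := Suc t)) X') (W', X)"
    using r' by (simp add: reg_less hh)
  qed
  then show "wp (quo 33 7 32 ;; For 35 51 bwd_body ;; add 32 32 32) (\<lambda>tm (W', X'). tm \<le> 5 + 21 * 2 ^ K \<and>
    W' 34 = t \<and> W' 52 = K \<and> I (Suc t) (W'(2 := 1, 34 := Suc t)) X') (W1, X1)"
   using er h X1 by (simp add: reg_less ev_div add.assoc)
 next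
  fix tm W' X'
  assume "tm \<le> 3 + K * (5 + 21 * 2 ^ K + 4)" "I K W' X'"
  then show "Q (1 + tm) (W', X')" unfolding I_def by (auto intro!: Q simp: algebra_simps)
 qed (use regs K2 in \<open>auto simp: reg_less\<close>)
 then show ?thesis
  unfolding fft_bwd_def using regs K2 w_pos by (simp add: reg_less)
qed

text \<open>The counter \<open>i\<close> belongs to the footprint of the loop but not to that of its
  body, and \<open>P\<close> sees only the slots; so neither is disturbed by the increment.\<close>

lemma loop_ends_sum:
 assumes regs: "i \<in> Rs" "2 \<in> Rs" "l \<notin> Rs" "Rs \<subseteq> {..<64}" "i \<noteq> 2" "l < 64" and N: "W l = N" "N < 2 ^ w"
  and init: "P 0 (arr W) X"
  and step: "\<And>j W' X'. j < N \<Longrightarrow> frame Rs Ss W W' \<Longrightarrow> W' i = j \<Longrightarrow> P j (arr W') X' \<Longrightarrow>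
   ends c (B j) (\<lambda>W'' X''. frame (Rs - {i}) Ss W' W'' \<and> P (Suc j) (arr W'') X'') W' X'"
 shows "ends (For i l c) (3 + (\<Sum>j<N. B j + 4)) (\<lambda>W' X'. frame Rs Ss W W' \<and> P N (arr W') X') W X"
proof -
 have i64: "i < 64" using regs by auto
 have il: "i \<noteq> l" "l \<noteq> 2" using regs by auto
 show ?thesis
  unfolding ends_def
 proof (rule wp_For_sum[where I = "\<lambda>j W' X'. frame Rs Ss W W' \<and> P j (arr W') X'" and B = B and N = N])
  show "frame Rs Ss W (W(i := 0)) \<and> P 0 (arr (W(i := 0))) X"
   using init regs i64 by (simp add: frame_upd_reg arr_upd_reg)
 next
  fix j W' X' assume j: "j < N" "frame Rs Ss W W' \<and> P j (arr W') X'" "W' i = j" "W' l = N"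
  from j(2) have fr: "frame Rs Ss W W'" and P: "P j (arr W') X'" by auto
  from step[OF j(1) fr j(3) P]
  show "wp c (\<lambda>t (W'', X''). t \<le> B j \<and> W'' i = j \<and> W'' l = N \<and>
    frame Rs Ss W (W''(2 := 1, i := Suc j)) \<and> P (Suc j) (arr (W''(2 := 1, i := Suc j))) X'') (W', X')"
   unfolding ends_def
  proof (rule wp_mono_prod)
   fix t W'' X'' assume *: "t \<le> B j \<and> frame (Rs - {i}) Ss W' W'' \<and> P (Suc j) (arr W'') X''"
   then have f': "frame (Rs - {i}) Ss W' W''" by simp
   have "frame Rs Ss W W''" by (rule frame_trans[OF fr f']) auto
   moreover have "W'' i = j" "W'' l = N" using frame_reg[OF f'] i64 regs j by auto
   ultimately show "case (W'', X'') of (W'', X'') \<Rightarrow> t \<le> B j \<and> W'' i = j \<and> W'' l = N \<and>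
    frame Rs Ss W (W''(2 := 1, i := Suc j)) \<and> P (Suc j) (arr (W''(2 := 1, i := Suc j))) X''"
    using * regs i64 by (simp add: frame_upd_reg arr_upd_reg)
  qed
 qed (use regs i64 il N in \<open>auto simp: reg_less\<close>)
qed

lemma loop_ends:
 assumes "i \<in> Rs" "2 \<in> Rs" "l \<notin> Rs" "Rs \<subseteq> {..<64}" "i \<noteq> 2" "l < 64" and "W l = N" "N < 2 ^ w"
  and "P 0 (arr W) X"
  and "\<And>j W' X'. j < N \<Longrightarrow> frame Rs Ss W W' \<Longrightarrow> W' i = j \<Longrightarrow> P j (arr W') X' \<Longrightarrow>
   ends c B (\<lambda>W'' X''. frame (Rs - {i}) Ss W' W'' \<and> P (Suc j) (arr W'') X'') W' X'"
 shows "ends (For i l c) (3 + N * (B + 4)) (\<lambda>W' X'. frame Rs Ss W W' \<and> P N (arr W') X') W X"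
 using loop_ends_sum[where i = i and Rs = Rs and l = l and W = W and N = N and P = P and X = X and Ss = Ss and c = c and B = "\<lambda>_. B"] assms
 by simp

text \<open>The contents of the target slot are handed to \<open>g\<close>: while entry
  \<open>t\<close> is computed, everything outside the part already written is still old. Loops that
  read from the slot they write to rely on this.\<close>

lemma map_loop_ends:
 assumes regs: "l < 64" "l \<notin> loopR" "b < 64" "b \<notin> loopR"
  and W: "W l = N" "W b = ad s lo" "s < NS" "lo + N \<le> 2 * m"
  and g: "\<And>t W'. t < N \<Longrightarrow> frame loopR {s} W W' \<Longrightarrow> W' 35 = t \<Longrightarrow>
   (\<And>j. j < 2 * m \<Longrightarrow> W' (ad s j) = (if lo \<le> j \<and> j < lo + t then v (j - lo) else W (ad s j))) \<Longrightarrow>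
   computes g B (v t) W' X"
 shows "ends (map_loop l b g) (3 + N * (B + 6)) (\<lambda>W' X'. X' = X \<and> frame loopR {s} W W' \<and>
   (\<forall>j<2*m. W' (ad s j) = (if lo \<le> j \<and> j < lo + N then v (j - lo) else W (ad s j)))) W X"
proof -
 let ?P = "\<lambda>t A X'. X' = X \<and> (\<forall>j<2*m. A s j = (if lo \<le> j \<and> j < lo + t then v (j - lo) else W (ad s j)))"
 have "ends (For 35 l (g ;; add 37 b 35 ;; store 37 41)) (3 + N * (B + 2 + 4))
   (\<lambda>W' X'. frame loopR {s} W W' \<and> ?P N (arr W') X') W X"
 proof (rule loop_ends[where P = ?P])
  show "N < 2 ^ w" using W(4) m2_less by linarith
 next
  fix t W' X'
  assume t: "t < N" and fr: "frame loopR {s} W W'" and r: "W' 35 = t" and P: "?P t (arr W') X'"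
  from P have X: "X' = X" and A: "\<And>j. j < 2 * m \<Longrightarrow> W' (ad s j) = (if lo \<le> j \<and> j < lo + t then v (j - lo) else W (ad s j))"
   by (auto simp: arr_def)
  from g[OF t fr r A] show "ends (g ;; add 37 b 35 ;; store 37 41) (B + 2) (\<lambda>W'' X''. frame (loopR - {35}) {s} W' W'' \<and>
   ?P (Suc t) (arr W'') X'') W' X'"
   unfolding X
  proof (rule ends_Seq)
   fix W'' X''
   assume "X'' = X \<and> frame {36..<47} {} W' W'' \<and> W'' 41 = v t"
   then have X'': "X'' = X" and fr': "frame {36..<47} {} W' W''" and v: "W'' 41 = v t" by auto
   have r': "W'' 35 = t" "W'' b = ad s lo"
    using frame_reg[OF fr'] frame_reg[OF fr] regs r W by auto
   have lt: "lo + t < 2 * m" using t W by simp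
   have "frame (loopR - {35}) {s} W' (W''(37 := ad s (lo + t), ad s (lo + t) := v t))"
    using lt by (intro frame_upd_slot frame_upd_reg frame_trans[OF fr' frame_refl[of "{}" "{}"]]) auto
   moreover have "\<forall>j<2*m. arr (W''(37 := ad s (lo + t), ad s (lo + t) := v t)) s j =
     (if lo \<le> j \<and> j < lo + Suc t then v (j - lo) else W (ad s j))"
   proof (intro allI impI)
    fix j assume j: "j < 2 * m"
    then have "W'' (ad s j) = W' (ad s j)" using frame_slot[OF fr'] W by simp
    then show "arr (W''(37 := ad s (lo + t), ad s (lo + t) := v t)) s j =
     (if lo \<le> j \<and> j < lo + Suc t then v (j - lo) else W (ad s j))"
     using A[OF j] j lt by (auto simp: arr_def ad_reg ad_inj)
   qed
   ultimately show "ends (add 37 b 35 ;; store 37 41) 2 (\<lambda>W'' X''.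
    frame (loopR - {35}) {s} W' W'' \<and> ?P (Suc t) (arr W'') X'') W'' X''"
    unfolding ends_def using r' v lt X'' W regs by (simp add: reg_less ad_add ad_less)
  qed simp_all
 qed (use regs W in \<open>auto simp: arr_def\<close>)
 then show ?thesis
  unfolding map_loop_def by (rule ends_mono) (auto simp: arr_def)
qed

end

section \<open>Multiplication modulo \<open>p\<close>\<close>

definition fill :: "nat \<Rightarrow> nat \<Rightarrow> com \<Rightarrow> com" where
 "fill br bi g = map_loop 53 br (g ;; shl 41 41 4) ;; map_loop 53 bi (cst 41 0)"

text \<open>Register 52 holds the binary logarithm of the length of the convolution.\<close>

definition multiply :: "com \<Rightarrow> com \<Rightarrow> com" where
 "multiply g g' = shl 53 14 52 ;; quo 51 53 15 ;; fill 16 17 g ;; fill 18 19 g' ;; conv"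

context machine
begin

lemma ends_pre:
 assumes "ends c T (\<lambda>W' X'. W' = W1 \<and> X' = X1) W X" "ends d T' Q W1 X1" "T + T' \<le> B"
 shows "ends (c ;; d) B Q W X"
 by (rule ends_Seq[OF assms(1) _ assms(3)]) (use assms(2) in auto)

lemmas ends_preI = ends_pre[OF _ _ order_refl]

end

context sketch
begin

abbreviation (input) "filled s l N v W X \<equiv> (\<lambda>W' X'. X' = X \<and> frame loopR {s} W W' \<and>
 (\<forall>j<2*m. W' (ad s j) = (if l \<le> j \<and> j < l + N then v (j - l) else W (ad s j))))"

definition cmul :: "nat \<Rightarrow> words \<Rightarrow> words \<Rightarrow> nat \<Rightarrow> nat" where
 "cmul N x y t = nat (block_conv N (\<lambda>i. int (x i)) (\<lambda>i. int (y i)) t mod int p)"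

abbreviation "convR \<equiv> fftR \<union> {54, 55::nat}"

lemma env_regs:
 assumes "env W"
 shows "W 3 = p" "W 4 = f" "W 5 = HB" "W 6 = HF" "W 7 = m" "W 8 = k" "W 9 = u" "W 10 = mb" "W 11 = R" "W 12 = n"
  "W 13 = a" "W 14 = 1" "W 15 = 2" "W 16 = ad 2 0" "W 17 = ad 3 0" "W 18 = ad 4 0" "W 19 = ad 5 0" "W 20 = ad 6 0"
  "W 21 = ad 7 0" "W 22 = ad 8 0" "W 25 = ad 11 0" "W 26 = ad 12 0" "W 27 = ad 13 0" "W 28 = ad 14 0" "W 29 = ad 15 0"
  "W 30 = nblk"
 using assms by (simp_all add: env_def)

text \<open>The premise on \<open>c\<close> leaves its postcondition open, so that either transform
  can be supplied as a \<open>wp\<close> rule.\<close>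

lemma mov_slots_ends:
 assumes env: "env W" and s: "sr < 9" "si < 9" and b: "b < 64" "b' < 64" "b \<notin> convR" "b' \<notin> convR"
  and regs: "W b = ad sr 0" "W b' = ad si 0" and A: "holds sr si N A W"
  and c: "\<And>V Q. env V \<Longrightarrow> V 51 = W 51 \<Longrightarrow> V 52 = W 52 \<Longrightarrow> V 54 = ad sr 0 \<Longrightarrow> V 55 = ad si 0 \<Longrightarrow> holds sr si N A V \<Longrightarrow>
   (\<And>tm W'. tm \<le> 5 + T \<Longrightarrow> frame fftR {sr, si} V W' \<Longrightarrow> holds sr si N B W' \<Longrightarrow> Q tm (W', X)) \<Longrightarrow> wp c Q (V, X)"
 shows "ends (mov 54 b ;; mov 55 b' ;; c) (9 + T) (\<lambda>W' X'. X' = X \<and> frame convR {sr, si} W W' \<and> holds sr si N B W') W X"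
proof -
 have ns: "sr < NS" "si < NS" using s slot_less by auto
 have m0: "0 < 2 * m" using m_pos by simp
 let ?W = "W(2 := 0, 54 := ad sr 0, 55 := ad si 0)"
 have fr: "frame convR {sr, si} W ?W" by (intro frame_upd_reg) auto
 have "wp c (\<lambda>t (W', X'). 4 + t \<le> 9 + T \<and> X' = X \<and> frame convR {sr, si} W W' \<and> holds sr si N B W') (?W, X)"
 proof (rule c)
  show "env ?W" by (rule env_frame[OF env fr]) (use s in auto)
  show "holds sr si N A ?W" using A by (simp add: holds_def ad_reg)
  fix tm :: nat and W'
  assume "tm \<le> 5 + T" "frame fftR {sr, si} ?W W'" "holds sr si N B W'"
  then show "case (W', X) of (W', X') \<Rightarrow> 4 + tm \<le> 9 + T \<and> X' = X \<and> frame convR {sr, si} W W' \<and> holds sr si N B W'"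
   using frame_trans[OF fr, of "fftR" "{sr, si}" W' convR "{sr, si}"] by auto
 qed auto
 moreover have "eval_op Add w (ad sr 0) 0 = ad sr 0" "eval_op Add w (ad si 0) 0 = ad si 0"
  using ad_add[of sr 0 0] ad_add[of si 0 0] ns m0 by auto
 moreover have "W(2 := 0, 54 := ad sr 0, 2 := 0, 55 := ad si 0) = ?W" by auto
 ultimately show ?thesis
  unfolding mov_def ends_def using b regs by (simp add: reg_less)
qed

lemma fft_ends:
 assumes env: "env W" and s: "sr < 9" "si < 9" "sr \<noteq> si" and b: "b < 64" "b' < 64" "b \<notin> convR" "b' \<notin> convR"
  and K: "2 ^ K dvd 2 * m" "K \<ge> 1"
  and regs: "W 51 = 2 ^ K div 2" "W 52 = K" "W b = ad sr 0" "W b' = ad si 0" and A: "holds sr si (2 ^ K) A W"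
 shows fft_fwd_ends: "(\<And>t. t \<le> K \<Longrightarrow> bounded (2 ^ K) (mfwd K A t)) \<Longrightarrow>
   ends (mov 54 b ;; mov 55 b' ;; fft_fwd) (9 + K * (21 * 2 ^ K + 9))
    (\<lambda>W' X'. X' = X \<and> frame convR {sr, si} W W' \<and> holds sr si (2 ^ K) (mfwd K A K) W') W X" (is "PROP _ \<Longrightarrow> ?F")
  and fft_bwd_ends: "(\<And>t. t \<le> K \<Longrightarrow> bounded (2 ^ K) (mbwd A t)) \<Longrightarrow>
   ends (mov 54 b ;; mov 55 b' ;; fft_bwd) (9 + K * (21 * 2 ^ K + 9))
    (\<lambda>W' X'. X' = X \<and> frame convR {sr, si} W W' \<and> holds sr si (2 ^ K) (mbwd A K) W') W X" (is "PROP _ \<Longrightarrow> ?B")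
proof -
 note e = mov_slots_ends[OF env s(1,2) b regs(3,4) A, unfolded regs]
 show ?F if "\<And>t. t \<le> K \<Longrightarrow> bounded (2 ^ K) (mfwd K A t)" by (rule e, rule fft_fwd_wp[OF _ s K]) (use that in auto)
 show ?B if "\<And>t. t \<le> K \<Longrightarrow> bounded (2 ^ K) (mbwd A t)" by (rule e, rule fft_bwd_wp[OF _ s K]) (use that in auto)
qed

lemma pointwise_ends:
 assumes env: "env W" and N: "N \<le> 2 * m" "W 53 = N"
  and A: "holds 2 3 N A W" "holds 4 5 N B W"
  and bd: "\<And>i. i < N \<Longrightarrow> cmod (cv f (A i)) \<le> D" "\<And>i. i < N \<Longrightarrow> cmod (cv f (B i)) \<le> D"
   "4 ^ f * (2 * D * D) < 2 ^ (w - 1)"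
 shows "ends (For 35 53 pointwise_body) (3 + N * 26)
  (\<lambda>W' X'. X' = X \<and> frame stageR {2, 3} W W' \<and> holds 2 3 N (\<lambda>i. fmul f (A i) (B i)) W') W X"
proof -
 define C where "C j i = (if i < j then fmul f (A i) (B i) else A i)" for j i
 let ?P = "\<lambda>j V X'. X' = X \<and> (\<forall>i<N. V 2 i = rep w (fst (C j i)) \<and> V 3 i = rep w (snd (C j i)))"
 have "ends (For 35 53 pointwise_body) (3 + N * (22 + 4)) (\<lambda>W' X'. frame stageR {2, 3} W W' \<and> ?P N (arr W') X') W X"
 proof (rule loop_ends[where P = ?P])
  show "N < 2 ^ w" using N m2_less by linarith
 next
  fix t W1 X1
  assume t: "t < N" and fr: "frame stageR {2, 3} W W1" and r: "W1 35 = t" and P: "?P t (arr W1) X1"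
  have env1: "env W1" by (rule env_frame[OF env fr]) auto
  have ns: "2 < NS" "3 < NS" "4 < NS" "5 < NS" using slot_less by auto
  have t2: "t < 2 * m" using t N by simp
  have v: "W1 (ad 2 t) = rep w (fst (A t))" "W1 (ad 3 t) = rep w (snd (A t))"
   using P t by (auto simp: arr_def C_def)
  have v': "W1 (ad 4 t) = rep w (fst (B t))" "W1 (ad 5 t) = rep w (snd (B t))"
   using A(2) t frame_slot[OF fr] ns t2 by (auto simp: holds_def)
  note er = env_regs[OF env1]
  note sm = small_products(1,2)[OF bd(1)[OF t] bd(2)[OF t] bd(3)]
  have X1: "X1 = X" using P by simp
  have "wp pointwise_body (\<lambda>tm (W', X'). tm = 22 \<and> X' = X \<and> frame ({36..<51}) {2, 3} W1 W' \<and>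
    (\<forall>i<2*m. W' (ad 2 i) = (if i = t then rep w (fst (fmul f (A t) (B t))) else W1 (ad 2 i)) \<and>
     W' (ad 3 i) = (if i = t then rep w (snd (fmul f (A t) (B t))) else W1 (ad 3 i)))) (W1, X)"
   unfolding pointwise_body_def asr_def using ns t2 v v' er(2-4,14-17) sm r
   by (simp add: reg_less ad_less ad_reg ad_add ev_rep_add ev_rep_sub ev_rep_mul ev_asr' fmul_def ad_inj frame_def)
  then show "ends pointwise_body 22 (\<lambda>W' X'. frame (stageR - {35}) {2, 3} W1 W' \<and> ?P (Suc t) (arr W') X') W1 X1"
   unfolding ends_def X1
  proof (rule wp_mono_prod)
   fix tm :: nat and W' and X' :: "nat \<Rightarrow> real"
   assume *: "tm = 22 \<and> X' = X \<and> frame ({36..<51}) {2, 3} W1 W' \<and>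
    (\<forall>i<2*m. W' (ad 2 i) = (if i = t then rep w (fst (fmul f (A t) (B t))) else W1 (ad 2 i)) \<and>
     W' (ad 3 i) = (if i = t then rep w (snd (fmul f (A t) (B t))) else W1 (ad 3 i)))"
   then have fr': "frame {36..<51} {2, 3} W1 W'" by simp
   have "frame (stageR - {35}) {2, 3} W1 W'"
    by (rule frame_trans[OF fr' frame_refl[of "{}" "{}"]]) auto
   moreover have "?P (Suc t) (arr W') X'"
    using * P N by (auto simp: arr_def C_def less_Suc_eq)
   ultimately show "case (W', X') of (W', X') \<Rightarrow> tm \<le> 22 \<and> frame (stageR - {35}) {2, 3} W1 W' \<and> ?P (Suc t) (arr W') X'"
    using * by simp
  qed
 qed (use N A in \<open>auto simp: C_def arr_def holds_def\<close>)
 then show ?thesis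
  by (rule ends_mono) (auto simp: arr_def holds_def C_def)
qed

lemma power_mono_1: "1 \<le> (x::real) \<Longrightarrow> x \<le> y \<Longrightarrow> i \<le> j \<Longrightarrow> x ^ i \<le> y ^ j"
 by (meson order_trans power_increasing power_mono zero_le_one)

lemma conv_ends:
 assumes env: "env W" and K: "2 ^ K dvd 2 * m" "K \<ge> 1"
  and regs: "W 53 = 2 ^ K" "W 52 = K" "W 51 = 2 ^ K div 2"
  and xy: "\<And>i. i < 2 ^ K \<Longrightarrow> x i \<le> p" "\<And>i. i < 2 ^ K \<Longrightarrow> y i \<le> p"
  and A: "\<And>i. i < 2 ^ K \<Longrightarrow> W (ad 2 i) = x i * 2 ^ f" "\<And>i. i < 2 ^ K \<Longrightarrow> W (ad 3 i) = 0"
   "\<And>i. i < 2 ^ K \<Longrightarrow> W (ad 4 i) = y i * 2 ^ f" "\<And>i. i < 2 ^ K \<Longrightarrow> W (ad 5 i) = 0"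
 shows "ends conv (150 * K * 2 ^ K) (\<lambda>W' X'. X' = X \<and> frame convR {2..<7} W W' \<and>
   (\<forall>t<2 ^ K. W' (ad 6 t) = cmul (2 ^ K) x y t)) W X"
proof -
 note pK = pow_K[OF K(1)]
 let ?N = "(2::nat) ^ K" and ?R = "real (2 * m)" and ?p = "real p"
 have NR: "(2::real) ^ K \<le> ?R" using pK(1) by (metis of_nat_le_iff of_nat_numeral of_nat_power)
 have N1: "(1::real) \<le> 2 ^ K" by simp
 have p1: "1 \<le> ?p" using p_pos by simp
 have aux: "(2::real) ^ f \<le> 4 ^ f" "2 ^ K \<le> ?R ^ 3" "1 \<le> ?p ^ 2" "?p \<le> ?p ^ 2" "1 \<le> ?R ^ 3"
  using power_mono_1[OF N1 NR, of 1 3] power_mono_1[OF p1 order_refl, of 1 2] p1 N1 NR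
   one_le_power[of ?R 3, OF order_trans[OF N1 NR]]
  by (auto intro: power_mono one_le_power)
 have precK: "512 * (2 ^ K) ^ 7 * p ^ 2 \<le> (2::nat) ^ f"
  using pK(1) by (intro order_trans[OF _ prec] mult_le_mono power_mono) auto
 note L = K(1) p_pos precK xy
 define F G H where "F t = Af K x t" and "G t = Bf K y t" and "H t = Cf K x y t" for t
 have FG: "F t = mfwd K (\<lambda>i. (int (x i) * 2 ^ f, 0)) t" "G t = mfwd K (\<lambda>i. (int (y i) * 2 ^ f, 0)) t"
  "H t = mbwd (\<lambda>i. fmul f (F K i) (G K i)) t" for t
  using L by (simp_all add: F_def G_def H_def Af_def Bf_def Cf_def)
 define Z where "Z = 4 ^ f * ?R ^ 3 * ?p ^ 2"
 have Z: "32 * Z < 2 ^ (w - 1)" using width_real by (simp add: Z_def mult.assoc)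
 have Z0: "0 \<le> Z" by (simp add: Z_def)
 have ww: "(2::real) ^ w = 2 * 2 ^ (w - 1)" using w_pos by (cases w) auto
 have b1: "2 * (2 ^ K) * ?p \<le> 2 * ?R ^ 3 * ?p ^ 2"
  using power_mono_1[OF N1 NR, of 1 3] power_mono_1[OF p1 order_refl, of 1 2] by (intro mult_mono) auto
 have b2: "2 * (2 ^ K) ^ 3 * ?p ^ 2 \<le> 2 * ?R ^ 3 * ?p ^ 2"
  using NR by (intro mult_right_mono mult_left_mono power_mono) auto
 have AB: "cmod (cv f (F t i)) \<le> 2 * 2 ^ K * ?p" "cmod (cv f (G t i)) \<le> 2 * 2 ^ K * ?p"
  "cmod (cv f (H t i)) \<le> 2 * (2 ^ K) ^ 3 * ?p ^ 2" if "t \<le> K" "i < 2 ^ K" for t i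
  unfolding F_def G_def H_def
  using bound_AB[where K = K and P = p and a = x and b = y] bound_C[where K = K and P = p and a = x and b = y] L that
  by blast+
 have bF: "bounded ?N (F t)" "bounded ?N (G t)" "bounded ?N (H t)" if "t \<le> K" for t
 proof -
  have R: "(2 * real m) = ?R" by simp
  show "bounded ?N (F t)" "bounded ?N (G t)"
   unfolding bounded_def R using order_trans[OF AB(1)[OF that] b1] order_trans[OF AB(2)[OF that] b1] by blast+
  show "bounded ?N (H t)"
   unfolding bounded_def R using order_trans[OF AB(3)[OF that] b2] by blast
 qed
 have bP: "4 ^ f * (2 * (2 * 2 ^ K * ?p) * (2 * 2 ^ K * ?p)) < 2 ^ (w - 1)"
 proof -
  have "4 ^ f * (2 * (2 * 2 ^ K * ?p) * (2 * 2 ^ K * ?p)) = 8 * (4 ^ f * (2 ^ K) ^ 2 * ?p ^ 2)"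
   by (simp add: power2_eq_square)
  also have "\<dots> \<le> 8 * Z" unfolding Z_def
   using power_mono_1[OF N1 NR, of 2 3] by (intro mult_left_mono mult_right_mono) auto
  also have "\<dots> < 2 ^ (w - 1)" using Z Z0 by linarith
  finally show ?thesis .
 qed
 have fw: "p * 2 ^ f < 2 ^ w"
 proof -
  have "?p * 2 ^ f = 2 ^ f * 1 * ?p" by simp
  also have "\<dots> \<le> Z" unfolding Z_def by (intro mult_mono aux) auto
  also have "\<dots> < 2 ^ w" using Z Z0 ww by linarith
  finally have "real (p * 2 ^ f) < real (2 ^ w)" by simp
  then show ?thesis by (simp only: of_nat_less_iff)
 qed
 have init: "v * 2 ^ f = rep w (int v * 2 ^ f)" if "v \<le> p" for v
 proof -
  have "v * 2 ^ f < 2 ^ w" using that fw by (meson le_less_trans mult_le_mono1)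
  from rep_of_nat[OF this] show ?thesis by simp
 qed
 have rep0: "rep w 0 = 0" by (simp add: rep_def)
 have hA: "holds 2 3 ?N (F 0) W" "holds 4 5 ?N (G 0) W"
  using A xy init by (simp_all add: FG holds_def rep0)
 have sl: "s < NS" if "s \<le> 6" for s using slot_less that by simp
 have roundH: "0 \<le> fst (H K i) + 2 ^ (f + K - 1)" "fst (H K i) + 2 ^ (f + K - 1) < 2 ^ w"
   "nat (fst (H K i) + 2 ^ (f + K - 1)) div 2 ^ (f + K) mod p = cmul ?N x y i" if i: "i < ?N" for i
 proof -
  let ?s = "fst (H K i) + 2 ^ (f + K - 1)"
  have e: "?s div 2 ^ (f + K) = block_conv ?N (\<lambda>i. int (x i)) (\<lambda>i. int (y i)) i" (is "_ = ?c")
   using Cf_exact(2)[where K = K and P = p and a = x and b = y] L i by (simp add: H_def)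
  have c0: "0 \<le> ?c" by (simp add: block_conv_def sum_nonneg)
  \<comment> \<open>A negative dividend would give a negative quotient, but the quotient is a
    convolution of natural numbers.\<close>
  then show s0: "0 \<le> ?s" using e by (metis not_le div_neg_pos_less0 zero_less_power zero_less_numeral)
  have "nat (?s div 2 ^ (f + K) mod int p) = nat ?s div 2 ^ (f + K) mod p"
   using s0 by (simp add: nat_mod_distrib nat_div_distrib nat_power_eq pos_imp_zdiv_nonneg_iff)
  then show "nat ?s div 2 ^ (f + K) mod p = cmul ?N x y i" using e by (simp add: cmul_def)
  have "cmod (cv f (H K i)) \<le> 2 * ?R ^ 3 * ?p ^ 2" using bF(3)[of K] i by (simp add: bounded_def)
  then have "\<bar>real_of_int (fst (H K i))\<bar> \<le> 2 ^ f * (2 * ?R ^ 3 * ?p ^ 2)" using cv_bound by blast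
  also have "\<dots> \<le> 4 ^ f * (2 * ?R ^ 3 * ?p ^ 2)" by (intro mult_right_mono power_mono) auto
  also have "\<dots> = 2 * Z" by (simp add: Z_def)
  finally have 1: "real_of_int (fst (H K i)) \<le> 2 * Z" by simp
  have "(2::real) ^ (f + K - 1) \<le> 2 ^ (f + K)" by (intro power_increasing) auto
  also have "\<dots> = 2 ^ f * 2 ^ K * 1" by (simp add: power_add)
  also have "\<dots> \<le> 4 ^ f * ?R ^ 3 * ?p ^ 2"
   by (intro mult_mono aux) auto
  finally have "(2::real) ^ (f + K - 1) \<le> Z" by (simp add: Z_def)
  then have "real_of_int ?s < 2 ^ w" using 1 Z Z0 ww by simp
  then have "real_of_int ?s < real_of_int (2 ^ w)" by simp
  then show "?s < 2 ^ w" by (simp only: of_int_less_iff)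
 qed
 have fK: "(2::nat) ^ (f + K) < 2 ^ w"
 proof -
  have "(2::real) ^ (f + K) = 2 ^ f * 2 ^ K * 1" by (simp add: power_add)
  also have "\<dots> \<le> 4 ^ f * ?R ^ 3 * ?p ^ 2"
   by (intro mult_mono aux) auto
  also have "\<dots> = Z" by (simp add: Z_def)
  also have "\<dots> < 2 ^ w" using Z Z0 ww by linarith
  finally have "real (2 ^ (f + K)) < real (2 ^ w)" by simp
  then show ?thesis by (simp only: of_nat_less_iff)
 qed
 have fK': "f + K < 2 ^ w" "(2::nat) ^ (f + K - 1) < 2 ^ w"
  using fK less_exp[of "f + K"] power_increasing[of "f + K - 1" "f + K" "2::nat"] by linarith+
 let ?T = "9 + K * (21 * 2 ^ K + 9)"
 let ?Q = "\<lambda>W' X'. X' = X \<and> frame convR {2..<7} W W' \<and> (\<forall>t<?N. W' (ad 6 t) = cmul ?N x y t)"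
 have "ends ((mov 54 16 ;; mov 55 17 ;; fft_fwd) ;; (mov 54 18 ;; mov 55 19 ;; fft_fwd) ;;
   For 35 53 pointwise_body ;; (mov 54 16 ;; mov 55 17 ;; fft_bwd) ;;
   (add 47 4 52 ;; sub 48 47 14 ;; shl 48 14 48) ;; map_loop 53 20 round_body)
   (?T + (?T + (3 + ?N * 26 + (?T + (3 + (3 + ?N * 11)))))) ?Q W X"
 proof (rule ends_SeqI)
  show "ends (mov 54 16 ;; mov 55 17 ;; fft_fwd) ?T
    (\<lambda>W' X'. X' = X \<and> frame convR {2, 3} W W' \<and> holds 2 3 ?N (F K) W') W X"
   unfolding FG
   by (rule fft_fwd_ends[OF env]) (use K regs env_regs[OF env] hA bF in \<open>simp_all add: FG\<close>)
  fix W1 X1 assume *: "X1 = X \<and> frame convR {2, 3} W W1 \<and> holds 2 3 ?N (F K) W1"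
  then have X1: "X1 = X" and fr1: "frame convR {2, 3} W W1" by auto
  have env1: "env W1" by (rule env_frame[OF env fr1]) auto
  have regs1: "W1 51 = ?N div 2" "W1 52 = K" "W1 53 = ?N" using frame_reg[OF fr1] regs by auto
  have hG1: "holds 4 5 ?N (G 0) W1"
   using hA(2) frame_slot[OF fr1] sl pK(1) by (auto simp: holds_def)
  show "ends ((mov 54 18 ;; mov 55 19 ;; fft_fwd) ;; For 35 53 pointwise_body ;; (mov 54 16 ;; mov 55 17 ;; fft_bwd) ;;
   (add 47 4 52 ;; sub 48 47 14 ;; shl 48 14 48) ;; map_loop 53 20 round_body)
   (?T + (3 + ?N * 26 + (?T + (3 + (3 + ?N * 11))))) ?Q W1 X1"
  proof (rule ends_SeqI)
   show "ends (mov 54 18 ;; mov 55 19 ;; fft_fwd) ?T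
    (\<lambda>W' X'. X' = X1 \<and> frame convR {4, 5} W1 W' \<and> holds 4 5 ?N (G K) W') W1 X1"
    unfolding FG
    by (rule fft_fwd_ends[OF env1]) (use K regs1 env_regs[OF env1] hG1 bF in \<open>simp_all add: FG\<close>)
   fix W2 X2 assume *: "X2 = X1 \<and> frame convR {4, 5} W1 W2 \<and> holds 4 5 ?N (G K) W2"
   then have X2: "X2 = X" and fr12: "frame convR {4, 5} W1 W2" and hG2: "holds 4 5 ?N (G K) W2" using X1 by auto
   have fr2: "frame convR {2..<7} W W2" by (rule frame_trans[OF fr1 fr12]) auto
   have env2: "env W2" by (rule env_frame[OF env fr2]) auto
   have regs2: "W2 51 = ?N div 2" "W2 52 = K" "W2 53 = ?N" using frame_reg[OF fr2] regs by auto
   have hF2: "holds 2 3 ?N (F K) W2"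
    using \<open>X1 = X \<and> frame convR {2, 3} W W1 \<and> holds 2 3 ?N (F K) W1\<close> frame_slot[OF fr12] sl pK(1) by (auto simp: holds_def)
   show "ends (For 35 53 pointwise_body ;; (mov 54 16 ;; mov 55 17 ;; fft_bwd) ;;
     (add 47 4 52 ;; sub 48 47 14 ;; shl 48 14 48) ;; map_loop 53 20 round_body)
     (3 + ?N * 26 + (?T + (3 + (3 + ?N * 11)))) ?Q W2 X2"
   proof (rule ends_SeqI)
    let ?post1 = "\<lambda>W' X'. X' = X2 \<and> frame stageR {2, 3} W2 W' \<and> holds 2 3 ?N (\<lambda>i. fmul f (F K i) (G K i)) W'"
    show "ends (For 35 53 pointwise_body) (3 + ?N * 26) ?post1 W2 X2"
     by (rule pointwise_ends[OF env2 pK(1) regs2(3) hF2 hG2 _ _ bP])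
       (use AB in auto)
    fix W3 X3 assume *: "?post1 W3 X3"
    then have X3: "X3 = X" and fr23: "frame stageR {2, 3} W2 W3" and hH3: "holds 2 3 ?N (H 0) W3"
     using X2 by (auto simp: FG)
    have fr3: "frame convR {2..<7} W W3" by (rule frame_trans[OF fr2 fr23]) auto
    have env3: "env W3" by (rule env_frame[OF env fr3]) auto
    have regs3: "W3 51 = ?N div 2" "W3 52 = K" "W3 53 = ?N" using frame_reg[OF fr3] regs by auto
    show "ends ((mov 54 16 ;; mov 55 17 ;; fft_bwd) ;;
      (add 47 4 52 ;; sub 48 47 14 ;; shl 48 14 48) ;; map_loop 53 20 round_body)
      (?T + (3 + (3 + ?N * 11))) ?Q W3 X3"
    proof (rule ends_SeqI)
     show "ends (mov 54 16 ;; mov 55 17 ;; fft_bwd) ?T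
       (\<lambda>W' X'. X' = X3 \<and> frame convR {2, 3} W3 W' \<and> holds 2 3 ?N (H K) W') W3 X3"
      unfolding FG(3)
      by (rule fft_bwd_ends[OF env3]) (use K regs3 env_regs[OF env3] hH3 bF(3) in \<open>simp_all add: FG(3)\<close>)
     fix W4 X4 assume *: "X4 = X3 \<and> frame convR {2, 3} W3 W4 \<and> holds 2 3 ?N (H K) W4"
     then have X4: "X4 = X" and fr34: "frame convR {2, 3} W3 W4" and hH4: "holds 2 3 ?N (H K) W4"
      using X3 by auto
     have fr4: "frame convR {2..<7} W W4" by (rule frame_trans[OF fr3 fr34]) auto
     have env4: "env W4" by (rule env_frame[OF env fr4]) auto
     have regs4: "W4 51 = ?N div 2" "W4 52 = K" "W4 53 = ?N" using frame_reg[OF fr4] regs by auto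
     let ?W5 = "W4(47 := f + K, 48 := 2 ^ (f + K - 1))"
     have fr5: "frame convR {2..<7} W ?W5" using fr4 by (intro frame_upd_reg) auto
     have env5: "env ?W5" by (rule env_frame[OF env fr5]) auto
     have e1: "eval_op Add w f K = f + K" using fK' by (simp add: ev_add)
     have e2: "eval_op Sub w (f + K) 1 = f + K - 1" using fK' K(2) by (intro ev_sub) auto
     have e3: "eval_op Shl w 1 (f + K - 1) = 2 ^ (f + K - 1)" using fK' by (subst ev_shl) auto
     let ?post2 = "filled 6 0 ?N (\<lambda>j. cmul ?N x y j) ?W5 X"
     have "ends (map_loop 53 20 round_body) (3 + ?N * (5 + 6)) ?post2 ?W5 X"
     proof (rule map_loop_ends)
      show "?W5 20 = ad 6 0" "?W5 53 = ?N" using env_regs[OF env4] regs4 by auto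
      fix t W6 assume t: "t < ?N" and fr6: "frame loopR {6} ?W5 W6" and r: "W6 35 = t"
      have t2: "t < 2 * m" using t pK(1) by simp
      have env6: "env W6" by (rule env_frame[OF env5 fr6]) auto
      have v: "W6 (ad 2 t) = rep w (fst (H K t))" "W6 47 = f + K" "W6 48 = 2 ^ (f + K - 1)"
       using frame_slot[OF fr6, of 2 t] frame_reg[OF fr6] sl t2 hH4 t by (auto simp: holds_def ad_reg)
      have e: "eval_op Add w (rep w (fst (H K t))) (2 ^ (f + K - 1)) = nat (fst (H K t) + 2 ^ (f + K - 1))"
      proof -
       have "(2::nat) ^ (f + K - 1) = rep w (2 ^ (f + K - 1))" using rep_of_nat[OF fK'(2)] by simp
       then have "eval_op Add w (rep w (fst (H K t))) (2 ^ (f + K - 1)) = rep w (fst (H K t) + 2 ^ (f + K - 1))"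
        using ev_rep_add by simp
       then show ?thesis using roundH(1,2)[OF t] by (simp add: rep_def)
      qed
      have "2 < NS" using sl by simp
      then show "ends round_body 5 (\<lambda>W' X'. X' = X \<and> frame {36..<47} {} W6 W' \<and> W' 41 = cmul ?N x y t) W6 X"
       unfolding round_body_def ends_def using t2 r v env_regs[OF env6] e roundH(3)[OF t]
       by (simp add: reg_less ad_less ad_reg ad_add ev_shr ev_mod frame_def)
     qed (use pK(1) sl in auto)
     then have "ends (map_loop 53 20 round_body) (3 + ?N * 11) ?Q ?W5 X"
     proof (rule ends_mono)
      fix W' X' assume *: "?post2 W' X'"
      then have fr': "frame loopR {6} ?W5 W'" by simp
      have "frame convR {2..<7} W W'" by (rule frame_trans[OF fr5 fr']) auto
      with * pK(1) show "?Q W' X'" by auto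
     qed simp
     moreover have "ends (add 47 4 52 ;; sub 48 47 14 ;; shl 48 14 48) 3 (\<lambda>W' X'. W' = ?W5 \<and> X' = X) W4 X4"
      unfolding ends_def using env_regs[OF env4] regs4 X4 e1 e2 e3 by (simp add: reg_less)
     ultimately show "ends ((add 47 4 52 ;; sub 48 47 14 ;; shl 48 14 48) ;; map_loop 53 20 round_body)
       (3 + (3 + ?N * 11)) ?Q W4 X4"
      by (blast intro: ends_pre)
    qed
   qed
  qed
 qed
 then have "ends conv (?T + (?T + (3 + ?N * 26 + (?T + (3 + (3 + ?N * 11)))))) ?Q W X"
  unfolding conv_def ends_def by (simp add: add.assoc)
 then show ?thesis
 proof (rule ends_mono)
  \<comment> \<open>As \<open>K \<ge> 1\<close>, all lower-order terms are bounded by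
    \<open>K * ?N\<close>, and 150 covers the sum of the coefficients.\<close>
  have "2 \<le> ?N" using K(2) power_increasing[of 1 K "2::nat"] by simp
  then have *: "?N \<le> K * ?N" "K * 2 \<le> K * ?N" "2 \<le> K * ?N" using K(2) mult_le_mono[of 1 K 2 ?N] by auto
  have "?T = 9 + 21 * (K * ?N) + 9 * K" "150 * K * ?N = 150 * (K * ?N)" by (simp_all add: algebra_simps)
  with * show "?T + (?T + (3 + ?N * 26 + (?T + (3 + (3 + ?N * 11))))) \<le> 150 * K * 2 ^ K" by linarith
 qed
qed

lemma p_shift: "p * 2 ^ f < 2 ^ w"
proof -
 have "1 * p * (1 * 2 ^ f) \<le> (p * p) * ((32 * (2 * m) ^ 3) * 4 ^ f)"
  using p_pos m_pos by (intro mult_le_mono power_mono) auto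
 also have "\<dots> = 32 * 4 ^ f * (2 * m) ^ 3 * p\<^sup>2" by (simp add: power2_eq_square)
 also have "\<dots> < 2 ^ (w - 1)" by (rule width)
 also have "\<dots> \<le> 2 ^ w" by (intro power_increasing) auto
 finally show ?thesis by simp
qed

lemma fill_ends:
 assumes env: "env W" and W: "W 53 = N" "N \<le> 2 * m" "W br = ad sr 0" "W bi = ad si 0"
  and s: "sr < 9" "si < 9" "sr \<noteq> si" and b: "br < 64" "bi < 64" "br \<notin> loopR" "bi \<notin> loopR"
  and x: "\<And>t. t < N \<Longrightarrow> x t \<le> p"
  and g: "\<And>t W'. t < N \<Longrightarrow> frame loopR {sr} W W' \<Longrightarrow> W' 35 = t \<Longrightarrow>
   computes g B (x t) W' X"
 shows "ends (fill br bi g) (6 + N * (B + 14)) (\<lambda>W' X'. X' = X \<and> frame loopR {sr, si} W W' \<and>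
   (\<forall>t<N. W' (ad sr t) = x t * 2 ^ f \<and> W' (ad si t) = 0)) W X"
 unfolding fill_def
proof (rule ends_Seq)
 have ns: "sr < NS" "si < NS" using s slot_less by auto
 let ?post1 = "filled sr 0 N (\<lambda>j. x j * 2 ^ f) W X"
 show "ends (map_loop 53 br (g ;; shl 41 41 4)) (3 + N * (B + 1 + 6)) ?post1 W X"
 proof (rule map_loop_ends)
  fix t W' assume t: "t < N" and fr: "frame loopR {sr} W W'" and r: "W' 35 = t"
  have env': "env W'" by (rule env_frame[OF env fr]) (use s in auto)
  from g[OF t fr r] show "computes (g ;; shl 41 41 4) (B + 1) (x t * 2 ^ f) W' X"
  proof (rule ends_SeqI)
   fix W'' X'' assume *: "X'' = X \<and> frame {36..<47} {} W' W'' \<and> W'' 41 = x t"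
   then have fr': "frame {36..<47} {} W' W''" by simp
   have env'': "env W''" by (rule env_frame[OF env' fr']) auto
   have "x t * 2 ^ f < 2 ^ w" using x[OF t] p_shift by (meson le_less_trans mult_le_mono1)
   moreover have "frame {36..<47} {} W' (W''(41 := x t * 2 ^ f))" using fr' by (intro frame_upd_reg) auto
   ultimately show "ends (shl 41 41 4) 1 (\<lambda>W'' X''. X'' = X \<and> frame {36..<47} {} W' W'' \<and> W'' 41 = x t * 2 ^ f) W'' X''"
    unfolding ends_def using env_regs[OF env''] * by (simp add: reg_less ev_shl)
  qed
 qed (use W b ns in auto)
 fix W1 X1 assume *: "?post1 W1 X1"
 then have fr1: "frame loopR {sr} W W1" by simp
 let ?post2 = "\<lambda>W' X'. X' = X1 \<and> frame loopR {si} W1 W' \<and> (\<forall>j<2*m. W' (ad si j) = (if 0 \<le> j \<and> j < 0 + N then 0 else W1 (ad si j)))"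
 have "ends (map_loop 53 bi (cst 41 0)) (3 + N * (1 + 6)) ?post2 W1 X1"
 proof (rule map_loop_ends)
  show "W1 53 = N" "W1 bi = ad si 0" using frame_reg[OF fr1] b W by auto
  show "computes (cst 41 0) 1 0 W' X1" for W'
   unfolding ends_def by (simp add: reg_less frame_upd_reg)
 qed (use W b ns in auto)
 then show "ends (map_loop 53 bi (cst 41 0)) (3 + N * 7) (\<lambda>W' X'. X' = X \<and> frame loopR {sr, si} W W' \<and>
   (\<forall>t<N. W' (ad sr t) = x t * 2 ^ f \<and> W' (ad si t) = 0)) W1 X1"
 proof (rule ends_mono)
  fix W2 X2 assume **: "?post2 W2 X2"
  then have fr2: "frame loopR {si} W1 W2" by simp
  have "frame loopR {sr, si} W W2" by (rule frame_trans[OF fr1 fr2]) auto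
  then show "X2 = X \<and> frame loopR {sr, si} W W2 \<and> (\<forall>t<N. W2 (ad sr t) = x t * 2 ^ f \<and> W2 (ad si t) = 0)"
   using * ** W(2) frame_slot[OF fr2 ns(1)] s(3) by auto
 qed simp
qed (simp add: algebra_simps)

text \<open>Register 52 and those from 56 on survive a multiplication: the length can be used again,
  and the others hold the state of the surrounding loops.\<close>

abbreviation "mulR \<equiv> {2} \<union> {32..<52} \<union> {53, 54, 55::nat}"
abbreviation (input) "product K x y W X \<equiv>
 (\<lambda>W' X'. X' = X \<and> frame mulR {2..<7} W W' \<and> (\<forall>t<2 ^ K. W' (ad 6 t) = cmul (2 ^ K) x y t))"
abbreviation "argR \<equiv> {2, 51, 53} \<union> {35..<47::nat}"

text \<open>The arguments are programs that compute entry \<open>t\<close>. They run while slots 2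
  to 5 are filled and slot 6 is still untouched, so a factor may be read from the preceding
  product.\<close>

lemma multiply_ends:
 assumes env: "env W" and K: "2 ^ K dvd 2 * m" "K \<ge> 1" and W: "W 52 = K"
  and xy: "\<And>i. i < 2 ^ K \<Longrightarrow> x i \<le> p" "\<And>i. i < 2 ^ K \<Longrightarrow> y i \<le> p"
  and g: "\<And>t W'. t < 2 ^ K \<Longrightarrow> frame argR {2..<6} W W' \<Longrightarrow> W' 35 = t \<Longrightarrow>
   computes g 20 (x t) W' X"
  and g': "\<And>t W'. t < 2 ^ K \<Longrightarrow> frame argR {2..<6} W W' \<Longrightarrow> W' 35 = t \<Longrightarrow>
   computes g' 20 (y t) W' X"
 shows "ends (multiply g g') (300 * K * 2 ^ K) (product K x y W X) W X" (is "ends _ _ ?Q _ _")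
proof -
 let ?N = "(2::nat) ^ K"
 note pK = pow_K[OF K(1)]
 have N: "?N < 2 ^ w" using pK(1) m2_less by linarith
 let ?W1 = "W(53 := ?N, 51 := ?N div 2)"
 have fr1: "frame argR {2..<6} W ?W1" by (intro frame_upd_reg) auto
 have env1: "env ?W1" by (rule env_frame[OF env fr1]) auto
 have "ends ((shl 53 14 52 ;; quo 51 53 15) ;; fill 16 17 g ;; fill 18 19 g' ;; conv)
  (2 + (6 + ?N * (20 + 14) + (6 + ?N * (20 + 14) + 150 * K * ?N))) ?Q W X"
 proof (rule ends_SeqI)
  show "ends (shl 53 14 52 ;; quo 51 53 15) 2 (\<lambda>W' X'. W' = ?W1 \<and> X' = X) W X"
   unfolding ends_def using env_regs[OF env] W N by (simp add: reg_less ev_shl ev_div)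
  fix W0 X0 assume "W0 = ?W1 \<and> X0 = X"
  then have W0: "W0 = ?W1" "X0 = X" by auto
  show "ends (fill 16 17 g ;; fill 18 19 g' ;; conv) (6 + ?N * (20 + 14) + (6 + ?N * (20 + 14) + 150 * K * ?N)) ?Q W0 X0"
   unfolding W0
  proof (rule ends_SeqI)
   let ?post1 = "\<lambda>W' X'. X' = X \<and> frame loopR {2, 3} ?W1 W' \<and> (\<forall>t<?N. W' (ad 2 t) = x t * 2 ^ f \<and> W' (ad 3 t) = 0)"
   show "ends (fill 16 17 g) (6 + ?N * (20 + 14)) ?post1 ?W1 X"
   proof (rule fill_ends[OF env1])
    fix t W' assume t: "t < ?N" and fr: "frame loopR {2} ?W1 W'" and r: "W' 35 = t"
    have "frame argR {2..<6} W W'" by (rule frame_trans[OF fr1 fr]) auto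
    from g[OF t this r] show "computes g 20 (x t) W' X" .
   qed (use xy env_regs[OF env] pK(1) in auto)
   fix W2 X2 assume *: "?post1 W2 X2"
   then have X2: "X2 = X" and fr12: "frame loopR {2, 3} ?W1 W2" by auto
   have fr2: "frame argR {2..<6} W W2" by (rule frame_trans[OF fr1 fr12]) auto
   have env2: "env W2" by (rule env_frame[OF env fr2]) auto
   have r2: "W2 53 = ?N" "W2 51 = ?N div 2" "W2 52 = K" using frame_reg[OF fr12] W by auto
   show "ends (fill 18 19 g' ;; conv) (6 + ?N * (20 + 14) + 150 * K * ?N) ?Q W2 X2"
    unfolding X2
   proof (rule ends_SeqI)
    let ?post2 = "\<lambda>W' X'. X' = X \<and> frame loopR {4, 5} W2 W' \<and> (\<forall>t<?N. W' (ad 4 t) = y t * 2 ^ f \<and> W' (ad 5 t) = 0)"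
    show "ends (fill 18 19 g') (6 + ?N * (20 + 14)) ?post2 W2 X"
    proof (rule fill_ends[OF env2])
     fix t W' assume t: "t < ?N" and fr: "frame loopR {4} W2 W'" and r: "W' 35 = t"
     have "frame argR {2..<6} W W'" by (rule frame_trans[OF fr2 fr]) auto
     from g'[OF t this r] show "computes g' 20 (y t) W' X" .
    qed (use xy env_regs[OF env2] r2 pK(1) in auto)
    fix W3 X3 assume **: "?post2 W3 X3"
    then have X3: "X3 = X" and fr23: "frame loopR {4, 5} W2 W3" by auto
    have fr3: "frame argR {2..<6} W W3" by (rule frame_trans[OF fr2 fr23]) auto
    have env3: "env W3" by (rule env_frame[OF env fr3]) auto
    have r3: "W3 53 = ?N" "W3 51 = ?N div 2" "W3 52 = K" using frame_reg[OF fr23] r2 by auto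
    let ?post3 = "\<lambda>W' X'. X' = X \<and> frame convR {2..<7} W3 W' \<and> (\<forall>t<2 ^ K. W' (ad 6 t) = cmul (2 ^ K) x y t)"
    have "ends conv (150 * K * ?N) ?post3 W3 X"
    proof (rule conv_ends[OF env3 K])
     fix i :: nat assume i: "i < ?N"
     show "W3 (ad 2 i) = x i * 2 ^ f" "W3 (ad 3 i) = 0"
      using * i pK(1) frame_slot[OF fr23, of 2 i] frame_slot[OF fr23, of 3 i] slot_less(1) by auto
    qed (use r3 xy ** in auto)
    then show "ends conv (150 * K * ?N) ?Q W3 X3"
     unfolding X3
    proof (rule ends_mono)
     fix W' X' assume h: "?post3 W' X'"
     then have fr': "frame convR {2..<7} W3 W'" by simp
     have "frame mulR {2..<7} W W'" by (rule frame_trans[OF fr3 fr']) auto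
     with h show "?Q W' X'" by blast
    qed simp
   qed
  qed
 qed
 moreover have "2 + (6 + ?N * (20 + 14) + (6 + ?N * (20 + 14) + 150 * K * ?N)) \<le> 300 * K * ?N"
 proof -
  have "2 \<le> ?N" using K(2) power_increasing[of 1 K "2::nat"] by simp
  then have "?N \<le> K * ?N" "2 \<le> K * ?N" using K(2) mult_le_mono[of 1 K 2 ?N] by auto
  moreover have "?N * (20 + 14) = 34 * ?N" "150 * K * ?N = 150 * (K * ?N)" "300 * K * ?N = 300 * (K * ?N)" by simp_all
  ultimately show ?thesis by linarith
 qed
 ultimately have "ends ((shl 53 14 52 ;; quo 51 53 15) ;; fill 16 17 g ;; fill 18 19 g' ;; conv) (300 * K * ?N) ?Q W X"
  by (blast intro: ends_mono)
 then show ?thesis unfolding multiply_def ends_def by (simp add: add.assoc)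
qed

end

section \<open>The product tree\<close>

definition tree_left :: com where
 "tree_left = IfW 35 58 (add 36 48 35 ;; load 41 36) (cst 41 0)"

definition tree_right :: com where
 "tree_right = IfW 35 58 (add 36 49 35 ;; load 41 36) (cst 41 0)"

definition tree_combine :: com where
 "tree_combine = cst 41 0 ;;
   IfW 35 58 (add 36 48 35 ;; load 41 36 ;; add 36 49 35 ;; load 42 36 ;; add 41 41 42) Skip ;;
   IfW 35 14 Skip (sub 36 35 14 ;; add 36 20 36 ;; load 42 36 ;; add 41 41 42) ;; rem 41 41 3"

text \<open>Register 56 holds the level, 57 the node, 58 and 60 the lengths \<open>h\<close> and
  \<open>2 * h\<close>, 61 and 62 the starts of this level and the next. The addresses in 48 to 50
  are computed twice, being scratch space of the multiplication.\<close>

definition tree_node :: com where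
 "tree_node = (mul 50 57 60 ;; add 48 61 50 ;; add 49 48 58 ;; add 52 56 14) ;; multiply tree_left tree_right ;;
   (mul 50 57 60 ;; add 48 61 50 ;; add 49 48 58 ;; add 50 62 50) ;; map_loop 60 50 tree_combine"

definition tree_leaf :: com where
 "tree_leaf = add 36 25 35 ;; load 41 36 ;; sub 41 3 41 ;; rem 41 41 3"

definition tree_level :: com where
 "tree_level = (shl 58 14 56 ;; add 60 58 58 ;; quo 59 10 60 ;; mul 61 56 10 ;; add 61 21 61 ;; add 62 61 10) ;;
   For 57 59 tree_node"

definition tree_up :: com where
 "tree_up = map_loop 10 21 tree_leaf ;; For 56 9 tree_level"

text \<open>\<open>fit\<close> places all \<open>u + 1\<close> levels of the tree, \<open>mb\<close>
  words each, within the first half of one slot.\<close>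

locale batch = sketch +
 assumes fit: "mb * (u + 1) \<le> m" and u_less: "u < k" and n_less: "n < p" and p_ge: "2 \<le> p"
begin

definition res :: "int \<Rightarrow> nat" where
 "res z = nat (z mod int p)"

lemma int_res: "int (res z) = z mod int p"
 using p_pos by (simp add: res_def)

lemma res_less: "res z < p"
 using p_pos by (simp add: res_def nat_less_iff)

lemma cong_res: "[int (res z) = z] (mod int p)"
 by (simp add: int_res)

lemma res_congI: "[int v = z] (mod int p) \<Longrightarrow> v mod p = res z"
 unfolding res_def cong_def by (metis nat_int of_nat_mod)

text \<open>The passage from machine words to integer identities: the entries have to match
  \<open>c\<close> and \<open>d\<close> only modulo \<open>p\<close>, so these may be signed
  coefficients before any reduction.\<close>

lemma cmul_linear:
 assumes "t < N" "\<And>e. t < e \<Longrightarrow> e < N \<Longrightarrow> x e = 0 \<or> y (N + t - e) = 0"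
  and "\<And>e. e \<le> t \<Longrightarrow> [int (x e) = c e] (mod int p)" "\<And>e. e \<le> t \<Longrightarrow> [int (y e) = d e] (mod int p)"
 shows "cmul N x y t = res (\<Sum>e\<le>t. c e * d (t - e))"
proof -
 have "block_conv N (\<lambda>i. int (x i)) (\<lambda>i. int (y i)) t = (\<Sum>e\<le>t. int (x e) * int (y (t - e)))"
  by (rule block_conv_linear) (use assms(1,2) in auto)
 moreover have "[(\<Sum>e\<le>t. int (x e) * int (y (t - e))) = (\<Sum>e\<le>t. c e * d (t - e))] (mod int p)"
  by (intro cong_sum cong_mult assms(3,4)) auto
 ultimately show ?thesis
  unfolding cmul_def res_def by (simp add: cong_def)
qed

text \<open>Without the constant coefficients both factors have \<open>h\<close> stored entries, so
  a cyclic convolution of length \<open>2 * h\<close> does not wrap. The sum of the two linear terms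
  exists only in the lower half, as both degrees are at most \<open>h\<close>.\<close>

lemma tree_step:
 fixes A B :: "int poly"
 assumes "coeff A 0 = 1" "coeff B 0 = 1" and deg: "\<And>i. h < i \<Longrightarrow> coeff A i = 0" "\<And>i. h < i \<Longrightarrow> coeff B i = 0"
  and t: "t < 2 * h" and LR: "\<And>e. e < h \<Longrightarrow> L e = res (coeff A (Suc e))" "\<And>e. e < h \<Longrightarrow> R' e = res (coeff B (Suc e))"
 shows "((if t < h then L t + R' t else 0) + (if t = 0 then 0 else
   cmul (2 * h) (\<lambda>e. if e < h then L e else 0) (\<lambda>e. if e < h then R' e else 0) (t - 1))) mod p = res (coeff (A * B) (Suc t))"
proof (rule res_congI)
 have c: "cmul (2 * h) (\<lambda>e. if e < h then L e else 0) (\<lambda>e. if e < h then R' e else 0) (t - 1) =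
  res (\<Sum>e\<le>t - 1. coeff A (Suc e) * coeff B (Suc (t - 1 - e)))" if "t \<noteq> 0"
 proof (rule cmul_linear)
  show "t - 1 < 2 * h" using t by simp
  show "[int (if e < h then L e else 0) = coeff A (Suc e)] (mod int p)"
   "[int (if e < h then R' e else 0) = coeff B (Suc e)] (mod int p)" for e
   using LR deg by (auto simp: cong_res)
 qed auto
 have 1: "[int (if t < h then L t + R' t else 0) = coeff A (Suc t) + coeff B (Suc t)] (mod int p)"
  using LR deg by (auto intro!: cong_add simp: cong_res)
 have 2: "[int (if t = 0 then 0 else
   cmul (2 * h) (\<lambda>e. if e < h then L e else 0) (\<lambda>e. if e < h then R' e else 0) (t - 1)) =
   (if t = 0 then 0 else \<Sum>e\<le>t - 1. coeff A (Suc e) * coeff B (Suc (t - 1 - e)))] (mod int p)"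
  using c by (auto simp: cong_res)
 show "[int ((if t < h then L t + R' t else 0) + (if t = 0 then 0 else
   cmul (2 * h) (\<lambda>e. if e < h then L e else 0) (\<lambda>e. if e < h then R' e else 0) (t - 1))) = coeff (A * B) (Suc t)] (mod int p)"
  unfolding coeff_mult_unit_Suc[OF assms(1,2)] of_nat_add by (intro cong_add 1 2)
qed

text \<open>Each level takes exactly \<open>mb\<close> cells: node \<open>i div 2 ^ l\<close> stores
  the coefficients 1 to \<open>2 ^ l\<close> of its polynomial.\<close>

definition tval :: "words \<Rightarrow> nat \<Rightarrow> nat \<Rightarrow> nat" where
 "tval x l i = res (coeff (node_poly x (2 ^ l * (i div 2 ^ l)) (2 ^ l)) (Suc (i mod 2 ^ l)))"

lemma tval_node: "t < 2 ^ l \<Longrightarrow> tval x l (2 ^ l * b + t) = res (coeff (node_poly x (2 ^ l * b) (2 ^ l)) (Suc t))"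
 by (simp add: tval_def)

lemma tval_less: "tval x l i < p"
 by (simp add: tval_def res_less)

lemma tval_Suc:
 assumes "t < 2 ^ Suc l"
 shows "((if t < 2 ^ l then tval x l (2 ^ Suc l * v + t) + tval x l (2 ^ Suc l * v + 2 ^ l + t) else 0) + (if t = 0 then 0 else
   cmul (2 ^ Suc l) (\<lambda>e. if e < 2 ^ l then tval x l (2 ^ Suc l * v + e) else 0)
    (\<lambda>e. if e < 2 ^ l then tval x l (2 ^ Suc l * v + 2 ^ l + e) else 0) (t - 1))) mod p = tval x (Suc l) (2 ^ Suc l * v + t)"
proof -
 let ?h = "(2::nat) ^ l"
 have e: "2 ^ Suc l * v = ?h * (2 * v)" "2 ^ Suc l * v + ?h = ?h * (2 * v + 1)" by (simp_all add: algebra_simps)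
 have "tval x (Suc l) (2 ^ Suc l * v + t) = res (coeff (node_poly x (2 ^ Suc l * v) (?h + ?h)) (Suc t))"
  using tval_node[OF assms, of x v] by (simp add: mult_2)
 also have "node_poly x (2 ^ Suc l * v) (?h + ?h) = node_poly x (?h * (2 * v)) ?h * node_poly x (?h * (2 * v + 1)) ?h"
  unfolding node_poly_split e by (simp add: algebra_simps)
 finally have 1: "tval x (Suc l) (2 ^ Suc l * v + t) = res (coeff (node_poly x (?h * (2 * v)) ?h * node_poly x (?h * (2 * v + 1)) ?h) (Suc t))" .
 have 2: "(2::nat) ^ Suc l = 2 * ?h" by simp
 show ?thesis
  unfolding 1 unfolding e(2) unfolding e(1) unfolding 2
 proof (rule tree_step)
  show "tval x l (?h * (2 * v) + e) = res (coeff (node_poly x (?h * (2 * v)) ?h) (Suc e))"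
   "tval x l (?h * (2 * v + 1) + e) = res (coeff (node_poly x (?h * (2 * v + 1)) ?h) (Suc e))" if "e < ?h" for e
   by (rule tval_node[OF that])+
 qed (use assms in \<open>auto simp: coeff_node_poly_eq_0\<close>)
qed

lemma level_index:
 assumes "l \<le> u" "i < mb"
 shows "l * mb + i < m"
proof -
 have "l * mb \<le> u * mb" using assms by (intro mult_le_mono1) simp
 moreover have "u * mb + mb \<le> m" using fit by (simp add: algebra_simps)
 ultimately show ?thesis using assms(2) by linarith
qed

lemma u_mb: "u < mb"
 using less_exp[of u] mb_eq by simp

lemma small_less: "v \<le> 2 * m \<Longrightarrow> v < 2 ^ w"
 using m2_less by linarith

lemma pp_less: "4 * p < 2 ^ w"
proof -
 have "512 * 1 * 1 \<le> 512 * (2 * m) ^ 7 * p\<^sup>2" using m_pos p_pos by (intro mult_le_mono) auto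
 then have "4 \<le> (2::nat) ^ f" using prec by linarith
 then have "p * 4 \<le> p * 2 ^ f" by (intro mult_le_mono2)
 then show ?thesis using p_shift by linarith
qed

lemma u_props: "l < u \<Longrightarrow> 2 ^ Suc l dvd 2 * m" "mb \<le> m"
proof -
 show "2 ^ Suc l dvd 2 * m" if "l < u"
  unfolding m_eq power_Suc[symmetric] using that u_less by (intro le_imp_power_dvd) simp
 show "mb \<le> m" using fit by (metis le_add2 le_trans mult.right_neutral mult_le_mono2)
qed

lemma tree_node_ends:
 assumes env: "env W" and l: "l < u" and h: "h = 2 ^ l" and v: "v * (2 * h) + 2 * h \<le> mb"
  and r: "W 56 = l" "W 57 = v" "W 58 = h" "W 60 = 2 * h" "W 61 = ad 7 (l * mb)" "W 62 = ad 7 (l * mb + mb)"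
  and T: "\<And>i. i < mb \<Longrightarrow> W (ad 7 (l * mb + i)) = tval x l i"
 shows "ends tree_node (340 * (l + 1) * (2 * h)) (\<lambda>W' X'. X' = X \<and> frame nodeR {2..<8} W W' \<and>
   (\<forall>j<2*m. W' (ad 7 j) = (if l * mb + mb + v * (2 * h) \<le> j \<and> j < l * mb + mb + v * (2 * h) + 2 * h
    then tval x (l + 1) (j - (l * mb + mb)) else W (ad 7 j)))) W X"
proof -
 let ?o = "v * (2 * h)"
 let ?x = "\<lambda>e. if e < h then tval x l (?o + e) else 0"
 let ?y = "\<lambda>e. if e < h then tval x l (?o + h + e) else 0"
 have h0: "0 < h" "2 * h = 2 ^ Suc l" using h by simp_all
 have ob: "?o + 2 * h \<le> mb" "mb \<le> m" using v u_props by auto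
 \<comment> \<open>Source and target level both lie below \<open>m\<close>, since level
   \<open>l + 1\<close> ends at \<open>(l + 2) * mb\<close>.\<close>
 have lm: "l * mb + mb + mb \<le> m"
 proof -
  have "(l + 2) * mb \<le> (u + 1) * mb" using l by (intro mult_le_mono1) simp
  then show ?thesis using fit by (simp add: algebra_simps)
 qed
 have ns: "6 < NS" "7 < NS" using slot_less by auto
 have e1: "eval_op Mul w v (2 * h) = ?o" using ob by (intro ev_mul small_less) simp
 have e2: "eval_op Add w l 1 = Suc l" using l u_mb ob by (subst ev_add) (auto intro!: small_less)
 have a1: "eval_op Add w (ad 7 (l * mb)) ?o = ad 7 (l * mb + ?o)" "eval_op Add w (ad 7 (l * mb + ?o)) h = ad 7 (l * mb + ?o + h)"
  "eval_op Add w (ad 7 (l * mb + mb)) ?o = ad 7 (l * mb + mb + ?o)"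
  using lm ob h0(1) by (intro ad_add ns; linarith)+
 let ?W1 = "W(50 := ?o, 48 := ad 7 (l * mb + ?o), 49 := ad 7 (l * mb + ?o + h), 52 := Suc l)"
 have fr1: "frame nodeR {2..<8} W ?W1" by (intro frame_upd_reg) auto
 have env1: "env ?W1" by (rule env_frame[OF env fr1]) auto
 note er = env_regs[OF env]
 have T1: "?W1 (ad 7 j) = W (ad 7 j)" for j by (simp add: ad_reg)
 let ?Q = "\<lambda>W' X'. X' = X \<and> frame nodeR {2..<8} W W' \<and>
   (\<forall>j<2*m. W' (ad 7 j) = (if l * mb + mb + ?o \<le> j \<and> j < l * mb + mb + ?o + 2 * h
    then tval x (l + 1) (j - (l * mb + mb)) else W (ad 7 j)))"
 have vals: "W (ad 7 (l * mb + ?o + t)) = tval x l (?o + t)" if "t < 2 * h" for t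
  using T[of "?o + t"] that ob by (simp add: add.assoc)
 have val: "W' (ad 7 (l * mb + ?o + t)) = tval x l (?o + t)" if "frame Rs Ss ?W1 W'" "7 \<notin> Ss" "t < 2 * h" for Rs Ss W' t
  using frame_slot[OF that(1) ns(2), of "l * mb + ?o + t"] that vals[of t] lm ob T1 by auto
 have "ends tree_node (4 + (300 * Suc l * 2 ^ Suc l + (4 + (3 + 2 * h * (14 + 6))))) ?Q W X"
  unfolding tree_node_def
 proof (rule ends_preI)
  show "ends (mul 50 57 60 ;; add 48 61 50 ;; add 49 48 58 ;; add 52 56 14) 4 (\<lambda>W' X'. W' = ?W1 \<and> X' = X) W X"
   unfolding ends_def using r er e1 e2 a1 by (simp add: reg_less)
  show "ends (multiply tree_left tree_right ;; (mul 50 57 60 ;; add 48 61 50 ;; add 49 48 58 ;; add 50 62 50) ;; map_loop 60 50 tree_combine)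
   (300 * Suc l * 2 ^ Suc l + (4 + (3 + 2 * h * (14 + 6)))) ?Q ?W1 X"
  proof (rule ends_SeqI)
   let ?post1 = "product (Suc l) ?x ?y ?W1 X"
   show "ends (multiply tree_left tree_right) (300 * Suc l * 2 ^ Suc l) ?post1 ?W1 X"
   proof (rule multiply_ends[OF env1 u_props(1)[OF l]])
    fix t W' assume t: "t < 2 ^ Suc l" and fr: "frame argR {2..<6} ?W1 W'" and r35: "W' 35 = t"
    have r': "W' 58 = h" "W' 48 = ad 7 (l * mb + ?o)" "W' 49 = ad 7 (l * mb + ?o + h)"
     using frame_reg[OF fr] r by auto
    have v1: "W' (ad 7 (l * mb + ?o + t)) = tval x l (?o + t)" "W' (ad 7 (l * mb + ?o + h + t)) = tval x l (?o + h + t)" if "t < h"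
     using val[OF fr, of t] val[OF fr, of "h + t"] that by (simp_all add: add.assoc)
    have b: "l * mb + ?o + t < 2 * m" "t < h \<Longrightarrow> l * mb + ?o + h + t < 2 * m" using t h0 lm ob by auto
    show "computes tree_left 20 (?x t) W' X"
     unfolding tree_left_def ends_def using r35 r' v1 b ns
     by (cases "t < h") (simp_all add: reg_less ad_less ad_add ad_reg frame_upd_reg)
    show "computes tree_right 20 (?y t) W' X"
     unfolding tree_right_def ends_def using r35 r' v1 b ns
     by (cases "t < h") (simp_all add: reg_less ad_less ad_add ad_reg frame_upd_reg)
   qed (use tval_less[of x l] in \<open>auto intro: less_imp_le\<close>)
   fix W2 X2 assume *: "?post1 W2 X2"
   then have X2: "X2 = X" and fr12: "frame mulR {2..<7} ?W1 W2" and out: "\<And>t. t < 2 ^ Suc l \<Longrightarrow> W2 (ad 6 t) = cmul (2 ^ Suc l) ?x ?y t"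
    by auto
   have fr2: "frame nodeR {2..<8} W W2" by (rule frame_trans[OF fr1 fr12]) auto
   have r2: "W2 56 = l" "W2 57 = v" "W2 58 = h" "W2 60 = 2 * h" "W2 61 = ad 7 (l * mb)" "W2 62 = ad 7 (l * mb + mb)"
    using frame_reg[OF fr2] r by auto
   let ?W3 = "W2(50 := ad 7 (l * mb + mb + ?o), 48 := ad 7 (l * mb + ?o), 49 := ad 7 (l * mb + ?o + h))"
   have fr23: "frame mulR {2..<7} ?W1 ?W3" using fr12 by (intro frame_upd_reg) auto
   have fr3: "frame nodeR {2..<8} W ?W3" using fr2 by (intro frame_upd_reg) auto
   have env3: "env ?W3" by (rule env_frame[OF env fr3]) auto
   show "ends ((mul 50 57 60 ;; add 48 61 50 ;; add 49 48 58 ;; add 50 62 50) ;; map_loop 60 50 tree_combine)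
    (4 + (3 + 2 * h * (14 + 6))) ?Q W2 X2"
    unfolding X2
   proof (rule ends_preI)
    show "ends (mul 50 57 60 ;; add 48 61 50 ;; add 49 48 58 ;; add 50 62 50) 4 (\<lambda>W' X'. W' = ?W3 \<and> X' = X) W2 X"
     unfolding ends_def using r2 e1 a1 by (simp add: reg_less fun_upd_twist)
    let ?post2 = "filled 7 (l * mb + mb + ?o) (2 * h) (\<lambda>j. tval x (l + 1) (?o + j)) ?W3 X"
    have "ends (map_loop 60 50 tree_combine) (3 + 2 * h * (14 + 6)) ?post2 ?W3 X"
    proof (rule map_loop_ends[where v = "\<lambda>j. tval x (l + 1) (?o + j)"])
     fix t W' assume t: "t < 2 * h" and fr: "frame loopR {7} ?W3 W'" and r35: "W' 35 = t"
      and new: "\<And>j. j < 2 * m \<Longrightarrow> W' (ad 7 j) = (if l * mb + mb + ?o \<le> j \<and> j < l * mb + mb + ?o + t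
       then tval x (l + 1) (?o + (j - (l * mb + mb + ?o))) else ?W3 (ad 7 j))"
     have env': "env W'" by (rule env_frame[OF env3 fr]) auto
     have r': "W' 58 = h" "W' 48 = ad 7 (l * mb + ?o)" "W' 49 = ad 7 (l * mb + ?o + h)"
      using frame_reg[OF fr] r2 by auto
     \<comment> \<open>Level \<open>l\<close> is read and level \<open>l + 1\<close> written in the
       same slot; the ranges are disjoint, so the reads still see the old entries.\<close>
     have old: "W' (ad 7 (l * mb + ?o + t')) = tval x l (?o + t')" if "t' < 2 * h" for t'
     proof -
      have "W' (ad 7 (l * mb + ?o + t')) = ?W3 (ad 7 (l * mb + ?o + t'))"
       using that lm ob new[of "l * mb + ?o + t'"] by auto
      also have "\<dots> = tval x l (?o + t')" using val[OF fr23 _ that] by simp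
      finally show ?thesis .
     qed
     have v1: "W' (ad 7 (l * mb + ?o + t)) = tval x l (?o + t)" "W' (ad 7 (l * mb + ?o + h + t)) = tval x l (?o + h + t)" if "t < h"
      using old[of t] old[of "h + t"] that by (simp_all add: add.assoc)
     have v2: "W' (ad 6 (t - 1)) = cmul (2 ^ Suc l) ?x ?y (t - 1)"
      using frame_slot[OF fr ns(1), of "t - 1"] out[of "t - 1"] t h0 ob by (simp add: ad_reg)
     have b: "l * mb + ?o + t < 2 * m" "t < h \<Longrightarrow> l * mb + ?o + h + t < 2 * m" "t - 1 < 2 * m" using t h0 lm ob by auto
     have e: "eval_op Sub w t 1 = t - 1" if "t \<noteq> 0" using that t ob by (intro ev_sub small_less) auto
     have s1: "eval_op Add w (tval x l i) (tval x l i') = tval x l i + tval x l i'" for i i'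
      using pp_less tval_less[of x l i] tval_less[of x l i'] by (intro ev_add) linarith
     have c_less: "cmul (2 ^ Suc l) ?x ?y (t - 1) < p" using p_pos by (simp add: cmul_def nat_less_iff)
     have s2: "eval_op Add w (tval x l i + tval x l i') (cmul (2 ^ Suc l) ?x ?y (t - 1)) = tval x l i + tval x l i' + cmul (2 ^ Suc l) ?x ?y (t - 1)" for i i'
      using pp_less c_less tval_less[of x l i] tval_less[of x l i'] by (intro ev_add) linarith
     have s3: "eval_op Add w 0 (cmul (2 ^ Suc l) ?x ?y (t - 1)) = cmul (2 ^ Suc l) ?x ?y (t - 1)"
      using pp_less c_less by (subst ev_add) linarith+
     have tv: "((if t < h then tval x l (?o + t) + tval x l (?o + h + t) else 0) +
       (if t = 0 then 0 else cmul (2 ^ Suc l) ?x ?y (t - 1))) mod p = tval x (l + 1) (?o + t)"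
     proof -
      have "2 ^ Suc l * v = ?o" by (simp add: h mult.commute)
      from tval_Suc[of t l x v, unfolded this, folded h] t h0(2) show ?thesis by (simp only: Suc_eq_plus1[symmetric])
     qed
     have ns': "20 < (64::nat)" by simp
     consider "t < h" "t = 0" | "t < h" "t \<noteq> 0" | "\<not> t < h" "t \<noteq> 0" using h0 by linarith
     then show "computes tree_combine 14 (tval x (l + 1) (?o + t)) W' X"
     proof cases
      case 1
      then show ?thesis unfolding tree_combine_def ends_def
       using r35 r' v1 b ns env_regs[OF env'] tv s1
       by (simp add: reg_less ad_less ad_add ad_reg frame_upd_reg ev_mod)
     next
      case 2
      then show ?thesis unfolding tree_combine_def ends_def
       using r35 r' v1 v2 b ns env_regs[OF env'] tv s1 s2 e
       by (simp add: reg_less ad_less ad_add ad_reg frame_upd_reg ev_mod)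
     next
      case 3
      then show ?thesis unfolding tree_combine_def ends_def
       using r35 r' v2 b ns env_regs[OF env'] tv s3 e
       by (simp add: reg_less ad_less ad_add ad_reg frame_upd_reg ev_mod)
     qed
    qed (use r2 ns lm ob in auto)
    then show "ends (map_loop 60 50 tree_combine) (3 + 2 * h * (14 + 6)) ?Q ?W3 X"
    proof (rule ends_mono)
     fix W' X' assume **: "?post2 W' X'"
     then have fr': "frame loopR {7} ?W3 W'" by simp
     have "frame nodeR {2..<8} W W'" by (rule frame_trans[OF fr3 fr']) auto
     moreover have "?W3 (ad 7 j) = W (ad 7 j)" if "j < 2 * m" for j
      using frame_slot[OF fr23 ns(2) that] T1 by simp
     ultimately show "?Q W' X'" using ** by auto
    qed simp
   qed
  qed
 qed
 then show ?thesis
 proof (rule ends_mono)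
  have "2 * h \<le> Suc l * (2 * h)" by simp
  moreover have "2 \<le> 2 * h" using h0(1) by simp
  moreover have "2 * h * (14 + 6) = 20 * (2 * h)" by simp
  moreover have "300 * Suc l * 2 ^ Suc l = 300 * (Suc l * (2 * h))" "340 * (l + 1) * (2 * h) = 340 * (Suc l * (2 * h))"
   unfolding h0(2)[symmetric] by (simp_all only: mult.assoc Suc_eq_plus1)
  ultimately show "4 + (300 * Suc l * 2 ^ Suc l + (4 + (3 + 2 * h * (14 + 6)))) \<le> 340 * (l + 1) * (2 * h)" by linarith
 qed
qed

abbreviation "treeR \<equiv> {2} \<union> {32..<63::nat}"

lemma tree_level_ends:
 assumes env: "env W" and l: "l < u" and r: "W 56 = l"
  and T: "\<And>l' i. l' \<le> l \<Longrightarrow> i < mb \<Longrightarrow> W (ad 7 (l' * mb + i)) = tval x l' i"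
 shows "ends tree_level (350 * u * mb + 9) (\<lambda>W' X'. X' = X \<and> frame (treeR - {56}) {2..<8} W W' \<and>
   (\<forall>l'\<le>Suc l. \<forall>i<mb. W' (ad 7 (l' * mb + i)) = tval x l' i)) W X"
proof -
 define h where "h = (2::nat) ^ l"
 define nv where "nv = mb div (2 * h)"
 have nv: "nv * (2 * h) = mb"
  unfolding nv_def h_def mb_eq using l by (intro dvd_div_mult_self) (metis Suc_leI le_imp_power_dvd power_Suc)
 have h0: "0 < h" by (simp add: h_def)
 have mbm: "mb \<le> m" by (rule u_props)
 have hm: "2 * h \<le> mb" using nv by (metis mb_eq mult_0 mult_le_mono1 nat_mult_1 not_gr0 not_less_eq_eq One_nat_def le_0_eq power_eq_0_iff zero_neq_numeral)
 have lm: "l * mb + mb + mb \<le> m"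
 proof -
  have "(l + 2) * mb \<le> (u + 1) * mb" using l by (intro mult_le_mono1) simp
  then show ?thesis using fit by (simp add: algebra_simps)
 qed
 have ns: "7 < NS" using slot_less by auto
 let ?W1 = "W(58 := h, 60 := 2 * h, 59 := nv, 61 := ad 7 (l * mb), 62 := ad 7 (l * mb + mb))"
 have fr1: "frame (treeR - {56}) {2..<8} W ?W1" by (intro frame_upd_reg) auto
 have env1: "env ?W1" by (rule env_frame[OF env fr1]) auto
 note er = env_regs[OF env]
 have e: "eval_op Shl w 1 l = h" "eval_op Add w h h = 2 * h" "eval_op Mul w l mb = l * mb"
 proof -
  have "h < 2 ^ w" "h + h < 2 ^ w" "l * mb < 2 ^ w" using hm mbm lm by (auto intro!: small_less)
  then show "eval_op Shl w 1 l = h" "eval_op Add w h h = 2 * h" "eval_op Mul w l mb = l * mb"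
   using ev_shl[of 1 l w] ev_add[of h h w] ev_mul[of l mb w] by (simp_all add: h_def)
 qed
 have m0: "0 < 2 * m" using m_pos by simp
 let ?P = "\<lambda>v A X'. X' = X \<and> (\<forall>l'\<le>l. \<forall>i<mb. A 7 (l' * mb + i) = tval x l' i) \<and>
   (\<forall>i<v * (2 * h). A 7 (l * mb + mb + i) = tval x (Suc l) i)"
 let ?B = "340 * (l + 1) * (2 * h)"
 let ?post2 = "\<lambda>W' X'. frame (nodeR \<union> {57}) {2..<8} ?W1 W' \<and> ?P nv (arr W') X'"
 have "ends tree_level (6 + (3 + nv * (?B + 4))) ?post2 W X"
  unfolding tree_level_def
 proof (rule ends_preI)
  show "ends (shl 58 14 56 ;; add 60 58 58 ;; quo 59 10 60 ;; mul 61 56 10 ;; add 61 21 61 ;; add 62 61 10) 6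
    (\<lambda>W' X'. W' = ?W1 \<and> X' = X) W X"
   unfolding ends_def using r er e ns lm m0 nv_def by (simp add: reg_less ad_add ev_div fun_upd_twist)
  show "ends (For 57 59 tree_node) (3 + nv * (?B + 4)) ?post2 ?W1 X"
  proof (rule loop_ends[where P = ?P])
   show "nv < 2 ^ w" using nv mbm h0 by (intro small_less) (metis le_trans mult.commute mult_le_mono1 nat_mult_1 not_less_eq_eq One_nat_def not_gr0 less_eq_Suc_le le_add2 mult_2)
   show "?P 0 (arr ?W1) X" using T by (simp add: arr_def ad_reg)
   fix v W' X' assume v: "v < nv" and fr: "frame (nodeR \<union> {57}) {2..<8} ?W1 W'" and r57: "W' 57 = v" and P: "?P v (arr W') X'"
   have X': "X' = X" using P by simp
   have env': "env W'" by (rule env_frame[OF env1 fr]) auto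
   have vb: "v * (2 * h) + 2 * h \<le> mb"
   proof -
    have "Suc v * (2 * h) \<le> nv * (2 * h)" using v by (intro mult_le_mono1) simp
    then show ?thesis by (simp add: nv)
   qed
   let ?post1 = "\<lambda>W'' X''. X'' = X \<and> frame nodeR {2..<8} W' W'' \<and> (\<forall>j<2*m. W'' (ad 7 j) = (if l * mb + mb + v * (2 * h) \<le> j \<and> j < l * mb + mb + v * (2 * h) + 2 * h then tval x (l + 1) (j - (l * mb + mb)) else W' (ad 7 j)))"
   have "ends tree_node ?B ?post1 W' X"
    by (rule tree_node_ends[OF env' l h_def vb])
     (use frame_reg[OF fr] r r57 P in \<open>auto simp: arr_def\<close>)
   then show "ends tree_node ?B (\<lambda>W'' X''. frame (nodeR \<union> {57} - {57}) {2..<8} W' W'' \<and> ?P (Suc v) (arr W'') X'') W' X'"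
    unfolding X'
   proof (rule ends_mono)
    fix W'' X'' assume *: "?post1 W'' X''"
    then have fr': "frame nodeR {2..<8} W' W''" by simp
    have "frame (nodeR \<union> {57} - {57}) {2..<8} W' W''"
     by (rule frame_trans[OF fr' frame_refl[of "{}" "{}"]]) auto
    moreover have "W'' (ad 7 (l' * mb + i)) = tval x l' i" if "l' \<le> l" "i < mb" for l' i
    proof -
     have "l' * mb \<le> l * mb" using that by (intro mult_le_mono1) simp
     then have "l' * mb + i < l * mb + mb" using that by linarith
     then show ?thesis using * that lm P by (auto simp: arr_def)
    qed
    moreover have "W'' (ad 7 (l * mb + mb + i)) = tval x (Suc l) i" if "i < Suc v * (2 * h)" for i
    proof (cases "i < v * (2 * h)")
     case True
     then show ?thesis using * lm vb P by (auto simp: arr_def)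
    next
     case False
     then show ?thesis using * lm vb that by auto
    qed
    ultimately show "frame (nodeR \<union> {57} - {57}) {2..<8} W' W'' \<and> ?P (Suc v) (arr W'') X''"
     using * by (simp add: arr_def)
   qed simp
  qed auto
 qed
 then show ?thesis
 proof (rule ends_mono)
  fix W' X' assume *: "?post2 W' X'"
  then have fr': "frame (nodeR \<union> {57}) {2..<8} ?W1 W'" by blast
  have "frame (treeR - {56}) {2..<8} W W'" by (rule frame_trans[OF fr1 fr']) auto
  moreover have "W' (ad 7 (l' * mb + i)) = tval x l' i" if "l' \<le> Suc l" "i < mb" for l' i
  proof (cases "l' = Suc l")
   case True
   have "W' (ad 7 (l * mb + mb + i)) = tval x (Suc l) i" using * nv that by (simp add: arr_def)
   moreover have "l' * mb + i = l * mb + mb + i" using True by simp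
   ultimately show ?thesis by (simp only: True)
  qed (use * that in \<open>simp add: arr_def\<close>)
  ultimately show "X' = X \<and> frame (treeR - {56}) {2..<8} W W' \<and> (\<forall>l'\<le>Suc l. \<forall>i<mb. W' (ad 7 (l' * mb + i)) = tval x l' i)"
   using * by blast
 next
  \<comment> \<open>The \<open>nv\<close> nodes of length \<open>2 * h\<close> cover all
    \<open>mb\<close> cells, so the level enters the cost only through the factor
    \<open>l + 1\<close> of the transforms.\<close>
  have "nv * (?B + 4) = 340 * ((l + 1) * (nv * (2 * h))) + nv * 4" by (simp add: algebra_simps)
  then have 1: "nv * (?B + 4) = 340 * ((l + 1) * mb) + nv * 4" by (simp only: nv)
  have 2: "(l + 1) * mb \<le> u * mb" using l by (intro mult_le_mono1) simp
  have "nv * 2 \<le> nv * (2 * h)" using h0 by (intro mult_le_mono2) simp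
  then have 3: "nv * 2 \<le> mb" by (simp only: nv)
  have 4: "mb \<le> u * mb" using l by simp
  have "350 * u * mb = 350 * (u * mb)" by simp
  with 1 2 3 4 show "6 + (3 + nv * (?B + 4)) \<le> 350 * u * mb + 9" by linarith
 qed
qed

lemma tree_up_ends:
 assumes env: "env W" and x: "\<And>j. j < mb \<Longrightarrow> W (ad 11 j) = x j" "\<And>j. j < mb \<Longrightarrow> x j < p"
 shows "ends tree_up (400 * mb * (u + 1) * (u + 1)) (\<lambda>W' X'. X' = X \<and> frame treeR {2..<8} W W' \<and>
   (\<forall>l\<le>u. \<forall>i<mb. W' (ad 7 (l * mb + i)) = tval x l i)) W X"
proof -
 let ?P = "\<lambda>l A X'. X' = X \<and> (\<forall>l'\<le>l. \<forall>i<mb. A 7 (l' * mb + i) = tval x l' i)"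
 have mbm: "mb \<le> m" by (rule u_props)
 have ns: "7 < NS" "11 < NS" using slot_less by auto
 have "ends tree_up (3 + mb * (4 + 6) + (3 + u * (350 * u * mb + 9 + 4))) (\<lambda>W' X'. frame treeR {2..<8} W W' \<and> ?P u (arr W') X') W X"
  unfolding tree_up_def
 proof (rule ends_SeqI)
  let ?post1 = "filled 7 0 mb (\<lambda>j. tval x 0 j) W X"
  show "ends (map_loop 10 21 tree_leaf) (3 + mb * (4 + 6)) ?post1 W X"
  proof (rule map_loop_ends)
   fix t W' assume t: "t < mb" and fr: "frame loopR {7} W W'" and r: "W' 35 = t"
   have env': "env W'" by (rule env_frame[OF env fr]) auto
   have v: "W' (ad 11 t) = x t" using frame_slot[OF fr ns(2), of t] t mbm x by simp
   have e: "eval_op Sub w p (x t) = p - x t" using x(2)[OF t] pp_less by (intro ev_sub) auto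
   \<comment> \<open>A leaf stores the single coefficient \<open>- x t\<close>. The reduction
     matters for \<open>x t = 0\<close>, where the difference is \<open>p\<close>.\<close>
   have "(p - x t) mod p = tval x 0 t"
    unfolding tval_def using x(2)[OF t] node_poly_1[of x t] by (intro res_congI) (simp add: cong_iff_dvd_diff of_nat_diff)
   then show "computes tree_leaf 4 (tval x 0 t) W' X"
    unfolding tree_leaf_def ends_def using r v e t mbm ns env_regs[OF env']
    by (simp add: reg_less ad_less ad_add ad_reg frame_upd_reg ev_mod)
  qed (use env_regs[OF env] ns mbm in auto)
  fix W1 X1 assume *: "?post1 W1 X1"
  then have X1: "X1 = X" and fr1: "frame loopR {7} W W1" by auto
  have env1: "env W1" by (rule env_frame[OF env fr1]) auto
  have "ends (For 56 9 tree_level) (3 + u * (350 * u * mb + 9 + 4)) (\<lambda>W' X'. frame treeR {2..<8} W1 W' \<and> ?P u (arr W') X') W1 X"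
  proof (rule loop_ends[where P = ?P])
   show "u < 2 ^ w" using mbm mb_eq less_exp[of u] by (intro small_less) linarith
   show "?P 0 (arr W1) X" using * mbm by (auto simp: arr_def)
   fix l W' X' assume l: "l < u" and fr: "frame treeR {2..<8} W1 W'" and r: "W' 56 = l" and P: "?P l (arr W') X'"
   have X': "X' = X" using P by simp
   have env': "env W'" by (rule env_frame[OF env1 fr]) auto
   from tree_level_ends[OF env' l r, of x X] P
   show "ends tree_level (350 * u * mb + 9) (\<lambda>W'' X''. frame (treeR - {56}) {2..<8} W' W'' \<and> ?P (Suc l) (arr W'') X'') W' X'"
    unfolding X' by (auto simp: arr_def elim!: ends_mono)
  qed (use env_regs[OF env1] in auto)
  then show "ends (For 56 9 tree_level) (3 + u * (350 * u * mb + 9 + 4)) (\<lambda>W' X'. frame treeR {2..<8} W W' \<and> ?P u (arr W') X') W1 X1"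
   unfolding X1
  proof (rule ends_mono)
   fix W' X' assume **: "frame treeR {2..<8} W1 W' \<and> ?P u (arr W') X'"
   then have fr': "frame treeR {2..<8} W1 W'" by blast
   have "frame treeR {2..<8} W W'" by (rule frame_trans[OF fr1 fr']) auto
   with ** show "frame treeR {2..<8} W W' \<and> ?P u (arr W') X'" by blast
  qed simp
 qed
 then show ?thesis
 proof (rule ends_mono)
  have mb1: "1 \<le> mb" by (simp add: mb_eq)
  have e: "u * (350 * u * mb + 9 + 4) = 350 * (mb * (u * u)) + 13 * u"
   "400 * mb * (u + 1) * (u + 1) = 400 * (mb * (u * u)) + 800 * (mb * u) + 400 * mb" by (simp_all add: algebra_simps)
  have e': "mb * (4 + 6) = 10 * mb" by simp
  have "u \<le> mb * u" using mb1 by simp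
  then show "3 + mb * (4 + 6) + (3 + u * (350 * u * mb + 9 + 4)) \<le> 400 * mb * (u + 1) * (u + 1)"
   unfolding e e' using mb1 by linarith
 qed (auto simp: arr_def)
qed

end

section \<open>Newton inversion and batch evaluation\<close>

definition newton_q :: com where
 "newton_q = IfW 35 58 (add 36 22 35 ;; load 41 36) (cst 41 0)"

text \<open>The constant coefficient 1 is not in the tree and is supplied here, coefficient
  \<open>t\<close> is found at index \<open>t - 1\<close>, and beyond degree \<open>mb\<close> the
  polynomial is continued by zeros.\<close>

definition newton_p :: com where
 "newton_p = IfW 35 14 (cst 41 1) (IfW 35 60
   (sub 36 35 14 ;; IfW 36 10 (add 36 48 36 ;; load 41 36) (cst 41 0)) (cst 41 0))"

definition newton_e :: com where
 "newton_e = IfW 35 58 (cst 41 0) (IfW 35 60 (add 36 20 35 ;; load 41 36) (cst 41 0))"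

definition newton_neg :: com where
 "newton_neg = add 36 35 58 ;; add 36 20 36 ;; load 41 36 ;; sub 41 3 41 ;; rem 41 41 3"

text \<open>Doubles the number of known coefficients from \<open>h\<close> to \<open>2 * h\<close>.
  In both products a factor with at most \<open>2 * h\<close> entries meets one with
  \<open>h\<close> entries, so length \<open>4 * h\<close> avoids wrapping; from the first product
  only entries \<open>h\<close> to \<open>2 * h - 1\<close> enter the second.\<close>

definition newton_level :: com where
 "newton_level = (shl 58 14 56 ;; add 60 58 58 ;; mul 48 9 10 ;; add 48 21 48 ;; add 52 56 15) ;; multiply newton_p newton_q ;;
   multiply newton_e newton_q ;; add 50 22 58 ;; map_loop 58 50 newton_neg"

definition newton :: com where
 "newton = (cst 41 1 ;; store 22 41) ;; For 56 8 newton_level"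

definition root_f :: com where
 "root_f = IfW 35 7 (add 36 48 35 ;; load 41 36) (cst 41 0)"

definition root_q :: com where
 "root_q = IfW 35 7 (sub 36 7 14 ;; sub 36 36 35 ;; add 36 22 36 ;; load 41 36) (cst 41 0)"

definition root_out :: com where
 "root_out = sub 36 7 14 ;; add 36 36 35 ;; add 36 20 36 ;; load 41 36"

definition root :: com where
 "root = (add 36 7 7 ;; mul 36 61 36 ;; add 48 29 36 ;; add 52 8 14) ;; multiply root_f root_q ;; map_loop 10 26 root_out"

definition down_v :: com where
 "down_v = add 36 49 35 ;; load 41 36"

definition down_s :: com where
 "down_s = IfW 35 58 (sub 36 58 14 ;; sub 36 36 35 ;; add 36 50 36 ;; load 41 36) (cst 41 0)"

definition down_out :: com where
 "down_out = add 36 49 35 ;; load 41 36 ;; add 36 35 58 ;; add 36 20 36 ;; load 42 36 ;; add 41 41 42 ;; rem 41 41 3"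

text \<open>A child is combined with the polynomial of its sibling. Hence the offset by
  \<open>h\<close> is applied to the source for the left child and to the target for the right
  one.\<close>

definition down_child :: "bool \<Rightarrow> com" where
 "down_child right = (add 48 58 58 ;; mul 48 57 48 ;; add 49 26 48 ;; add 50 60 48 ;; (if right then Skip else add 50 50 58) ;; mov 52 62) ;;
   multiply down_v down_s ;;
   (add 48 58 58 ;; mul 48 57 48 ;; add 49 26 48 ;; add 50 27 48 ;; (if right then add 50 50 58 else Skip)) ;; map_loop 58 50 down_out"

text \<open>Both children need the values of the parent, so they are assembled in slot 13 and only
  then copied over the parent in slot 12.\<close>

definition down_node :: com where
 "down_node = down_child False ;; down_child True ;;
   (add 48 58 58 ;; mul 50 57 48 ;; add 49 27 50 ;; add 50 26 50) ;; map_loop 48 50 (add 36 49 35 ;; load 41 36)"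

definition down_level :: com where
 "down_level = (sub 48 9 14 ;; sub 48 48 56 ;; mul 60 48 10 ;; add 60 21 60 ;; shl 58 14 48 ;; add 62 48 14 ;;
   add 48 58 58 ;; quo 59 10 48) ;; For 57 59 down_node"

definition down :: com where
 "down = For 56 9 down_level"

abbreviation (input) "newtonS \<equiv> {2..<7} \<union> {8::nat}"
abbreviation (input) "evalS \<equiv> {2..<7} \<union> {12, 13::nat}"

context batch
begin

abbreviation (input) "ser x \<equiv> node_series x 0 mb"

lemma newton_level_ends:
 assumes env: "env W" and st: "st < k" "W 56 = st"
  and T: "\<And>i. i < mb \<Longrightarrow> W (ad 7 (u * mb + i)) = tval x u i"
  and q: "\<And>t. t < 2 ^ st \<Longrightarrow> W (ad 8 t) = res (ser x $ t)"
 shows "ends newton_level (6000 * k * 2 ^ st) (\<lambda>W' X'. X' = X \<and> frame (treeR - {56}) newtonS W W' \<and>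
   (\<forall>t<2 ^ Suc st. W' (ad 8 t) = res (ser x $ t))) W X" (is "ends _ _ ?Q _ _")
proof -
 define h where "h = (2::nat) ^ st"
 have h0: "0 < h" by (simp add: h_def)
 have hm: "2 * h \<le> m"
 proof -
  have "(2::nat) ^ Suc st \<le> 2 ^ k" using st by (intro power_increasing) auto
  then show ?thesis by (simp add: h_def m_eq)
 qed
 have N: "2 ^ (st + 2) = 4 * h" by (simp add: h_def)
 have N': "2 ^ Suc st = 2 * h" by (simp add: h_def)
 have K: "2 ^ (st + 2) dvd 2 * m" unfolding m_eq power_Suc[symmetric] using st by (intro le_imp_power_dvd) simp
 have mbm: "mb \<le> m" by (rule u_props)
 have um: "u * mb + mb \<le> m" using fit by (simp add: algebra_simps)
 have ns: "6 < NS" "7 < NS" "8 < NS" using slot_less by auto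
 have km: "k < m" using m_eq less_exp[of k] by simp
 define pc where "pc t = coeff (node_poly x 0 mb) t" for t
 let ?q = "\<lambda>t. if t < h then res (ser x $ t) else 0"
 let ?p = "\<lambda>t. if t < 1 then 1 else if t < 2 * h then (if t - 1 < mb then res (pc t) else 0) else 0"
 define o1 where "o1 t = cmul (4 * h) ?p ?q t" for t
 let ?e = "\<lambda>t. if t < h then 0 else if t < 2 * h then o1 t else 0"
 have PS: "fps_of_poly (node_poly x 0 mb) * ser x = 1" by (rule node_poly_series)
 have pc0: "pc t = 0" if "mb < t" for t using that by (simp add: pc_def coeff_node_poly_eq_0)
 have o1: "o1 t = res (\<Sum>e\<le>t. pc e * (if t - e < h then ser x $ (t - e) else 0))" if "t < 2 * h" for t
  unfolding o1_def
 proof (rule cmul_linear)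
  show "[int (?p e) = pc e] (mod int p)" if "e \<le> t" for e
   using that \<open>t < 2 * h\<close> pc0[of e] by (auto simp: cong_res pc_def)
  show "[int (?q e) = (if e < h then ser x $ e else 0)] (mod int p)" for e by (auto simp: cong_res)
 qed (use that in auto)
 \<comment> \<open>The minus sign of \<open>newton_step\<close> is realised by subtracting from
   \<open>p\<close>, and the reduction covers the case that the entry is \<open>0\<close>.\<close>
 have o2: "(p - cmul (4 * h) ?e ?q t) mod p = res (ser x $ t)" if t: "h \<le> t" "t < 2 * h" for t
 proof (rule res_congI)
  have "cmul (4 * h) ?e ?q t = res (\<Sum>b\<le>t. (if b < h then 0 else \<Sum>e\<le>b. pc e * (if b - e < h then ser x $ (b - e) else 0)) *
    (if t - b < h then ser x $ (t - b) else 0))"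
  proof (rule cmul_linear)
   show "[int (?e b) = (if b < h then 0 else \<Sum>e\<le>b. pc e * (if b - e < h then ser x $ (b - e) else 0))] (mod int p)" if "b \<le> t" for b
    using that t o1[of b] by (auto simp: cong_res)
   show "[int (?q e) = (if e < h then ser x $ e else 0)] (mod int p)" for e by (auto simp: cong_res)
  qed (use t in auto)
  also have "(\<Sum>b\<le>t. (if b < h then 0 else \<Sum>e\<le>b. pc e * (if b - e < h then ser x $ (b - e) else 0)) *
    (if t - b < h then ser x $ (t - b) else 0)) = (\<Sum>b=h..t. (\<Sum>e\<le>b. pc e * (if b - e < h then ser x $ (b - e) else 0)) * ser x $ (t - b))"
   by (rule sum.mono_neutral_cong_right) (use t in auto)
  also have "\<dots> = - (ser x $ t)"
   using newton_step[OF PS _ t] by (simp add: pc_def)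
  finally have c: "cmul (4 * h) ?e ?q t = res (- (ser x $ t))" .
  show "[int (p - cmul (4 * h) ?e ?q t) = ser x $ t] (mod int p)"
   unfolding c of_nat_diff[OF less_imp_le[OF res_less]] int_res cong_def by (simp add: mod_diff_eq mod_minus_eq)
 qed
 have le: "?q t \<le> p" "?p t \<le> p" "?e t \<le> p" for t
  using res_less p_pos less_imp_le[OF res_less] o1[of t] by auto
 let ?W1 = "W(58 := h, 60 := 2 * h, 48 := ad 7 (u * mb), 52 := st + 2)"
 have e1: "eval_op Shl w 1 st = h" "eval_op Add w h h = 2 * h" "eval_op Mul w u mb = u * mb" "eval_op Add w st 2 = st + 2"
  "eval_op Add w (ad 7 0) (u * mb) = ad 7 (u * mb)"
 proof -
  have "h < 2 ^ w" "h + h < 2 ^ w" "u * mb < 2 ^ w" "st + 2 < 2 ^ w" using hm um km st m_ge by (auto intro!: small_less)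
  then show "eval_op Shl w 1 st = h" "eval_op Add w h h = 2 * h" "eval_op Mul w u mb = u * mb" "eval_op Add w st 2 = st + 2"
   using ev_shl[of 1 st w] ev_add[of h h w] ev_mul[of u mb w] ev_add[of st 2 w] by (simp_all add: h_def)
  show "eval_op Add w (ad 7 0) (u * mb) = ad 7 (u * mb)" using ad_add[of 7 0 "u * mb"] ns um m_pos by simp
 qed
 have fr1: "frame (treeR - {56}) newtonS W ?W1" by (intro frame_upd_reg) auto
 have env1: "env ?W1" by (rule env_frame[OF env fr1]) auto
 have tv: "tval x u i = res (pc (Suc i))" if "i < mb" for i
  using tval_node[of i u x 0] that by (simp add: mb_eq pc_def)
 have gq: "computes newton_q 20 (?q t) W' X"
  if fr: "frame Rs Ss ?W1 W'" "58 \<notin> Rs" "8 \<notin> Ss" and "W' 35 = t" "env W'" for t W' Rs Ss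
 proof -
  have "W' 58 = h" using frame_reg[OF fr(1)] fr(2) by simp
  moreover have "W' (ad 8 t) = res (ser x $ t)" "t < 2 * m" if "t < h"
   using frame_slot[OF fr(1) ns(3), of t] fr(3) that hm q[of t] by (auto simp: h_def ad_reg)
  ultimately show ?thesis
   unfolding newton_q_def ends_def using that(4) env_regs[OF \<open>env W'\<close>] ns
   by (cases "t < h") (simp_all add: reg_less ad_less ad_add ad_reg frame_upd_reg)
 qed
 have "ends newton_level (5 + (300 * (st + 2) * (4 * h) + (300 * (st + 2) * (4 * h) + (1 + (3 + h * (5 + 6)))))) ?Q W X"
  unfolding newton_level_def
 proof (rule ends_preI)
  show "ends (shl 58 14 56 ;; add 60 58 58 ;; mul 48 9 10 ;; add 48 21 48 ;; add 52 56 15) 5 (\<lambda>W' X'. W' = ?W1 \<and> X' = X) W X"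
   unfolding ends_def using st e1 env_regs[OF env] by (simp add: reg_less)
  show "ends (multiply newton_p newton_q ;; multiply newton_e newton_q ;; add 50 22 58 ;; map_loop 58 50 newton_neg)
    (300 * (st + 2) * (4 * h) + (300 * (st + 2) * (4 * h) + (1 + (3 + h * (5 + 6))))) ?Q ?W1 X"
  proof (rule ends_SeqI)
   let ?post1 = "product (st + 2) ?p ?q ?W1 X"
   show "ends (multiply newton_p newton_q) (300 * (st + 2) * (4 * h)) ?post1 ?W1 X"
    unfolding N[symmetric]
   proof (rule multiply_ends[OF env1 K])
    fix t W' assume t: "t < 2 ^ (st + 2)" and fr: "frame argR {2..<6} ?W1 W'" and r35: "W' 35 = t"
    have env': "env W'" by (rule env_frame[OF env1 fr]) auto
    show "computes newton_q 20 (?q t) W' X"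
     by (rule gq[OF fr _ _ r35 env']) auto
    have r': "W' 60 = 2 * h" "W' 48 = ad 7 (u * mb)" using frame_reg[OF fr] by auto
    have v: "W' (ad 7 (u * mb + (t - 1))) = res (pc t)" "u * mb + (t - 1) < 2 * m" if "t - 1 < mb" "t \<noteq> 0"
     using frame_slot[OF fr ns(2), of "u * mb + (t - 1)"] T[of "t - 1"] tv[of "t - 1"] that um by (auto simp: ad_reg)
    have e: "eval_op Sub w t 1 = t - 1" if "t \<noteq> 0" using that t N hm by (intro ev_sub small_less) auto
    consider "t = 0" | "t \<noteq> 0" "t < 2 * h" "t - 1 < mb" | "t \<noteq> 0" "t < 2 * h" "\<not> t - 1 < mb" | "t \<noteq> 0" "\<not> t < 2 * h" by blast
    then show "computes newton_p 20 (?p t) W' X"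
     by cases (use r35 r' v e ns(2) env_regs(8,12)[OF env'] w_pos in
      \<open>simp_all add: newton_p_def ends_def reg_less ad_less ad_add ad_reg frame_upd_reg\<close>)
   qed (use le in auto)
   fix W2 X2 assume *: "?post1 W2 X2"
   then have X2: "X2 = X" and fr2: "frame mulR {2..<7} ?W1 W2" and out: "\<And>t. t < 4 * h \<Longrightarrow> W2 (ad 6 t) = o1 t"
    using *[unfolded N] by (auto simp: o1_def)
   have env2: "env W2" by (rule env_frame[OF env1 fr2]) auto
   show "ends (multiply newton_e newton_q ;; add 50 22 58 ;; map_loop 58 50 newton_neg)
     (300 * (st + 2) * (4 * h) + (1 + (3 + h * (5 + 6)))) ?Q W2 X2"
    unfolding X2
   proof (rule ends_SeqI)
    let ?post2 = "product (st + 2) ?e ?q W2 X"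
    show "ends (multiply newton_e newton_q) (300 * (st + 2) * (4 * h)) ?post2 W2 X"
     unfolding N[symmetric]
    proof (rule multiply_ends[OF env2 K])
     show "W2 52 = st + 2" using frame_reg[OF fr2] by simp
     fix t W' assume t: "t < 2 ^ (st + 2)" and fr: "frame argR {2..<6} W2 W'" and r35: "W' 35 = t"
     have env': "env W'" by (rule env_frame[OF env2 fr]) auto
     have fr': "frame mulR {2..<7} ?W1 W'" by (rule frame_trans[OF fr2 fr]) auto
     show "computes newton_q 20 (?q t) W' X"
      by (rule gq[OF fr' _ _ r35 env']) auto
     have r': "W' 58 = h" "W' 60 = 2 * h" using frame_reg[OF fr'] by auto
     have v: "W' (ad 6 t) = o1 t" "t < 2 * m" if "t < 2 * h"
      using frame_slot[OF fr ns(1), of t] out[of t] that hm by auto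
     consider "t < h" | "\<not> t < h" "t < 2 * h" | "\<not> t < h" "\<not> t < 2 * h" by blast
     then show "computes newton_e 20 (?e t) W' X"
      by cases (use r35 r' v ns(1) env_regs(18)[OF env'] w_pos in
       \<open>simp_all add: newton_e_def ends_def reg_less ad_less ad_add ad_reg frame_upd_reg\<close>)
    qed (use le in auto)
    fix W3 X3 assume **: "?post2 W3 X3"
    then have X3: "X3 = X" and fr23: "frame mulR {2..<7} W2 W3" and out3: "\<And>t. t < 4 * h \<Longrightarrow> W3 (ad 6 t) = cmul (4 * h) ?e ?q t"
     using **[unfolded N] by auto
    have fr3: "frame mulR {2..<7} ?W1 W3" by (rule frame_trans[OF fr2 fr23]) auto
    have env3: "env W3" by (rule env_frame[OF env1 fr3]) auto
    have r3: "W3 58 = h" using frame_reg[OF fr3] by simp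
    let ?W4 = "W3(50 := ad 8 h)"
    have fr4: "frame mulR {2..<7} ?W1 ?W4" using fr3 by (intro frame_upd_reg) auto
    have env4: "env ?W4" by (rule env_frame[OF env1 fr4]) auto
    have frW4: "frame (treeR - {56}) newtonS W ?W4" by (rule frame_trans[OF fr1 fr4]) auto
    show "ends (add 50 22 58 ;; map_loop 58 50 newton_neg) (1 + (3 + h * (5 + 6))) ?Q W3 X3"
     unfolding X3
    proof (rule ends_preI)
     show "ends (add 50 22 58) 1 (\<lambda>W' X'. W' = ?W4 \<and> X' = X) W3 X"
      unfolding ends_def using r3 env_regs[OF env3] ns hm h0 by (simp add: reg_less ad_add)
     let ?post3 = "filled 8 h h (\<lambda>j. res (ser x $ (h + j))) ?W4 X"
     have "ends (map_loop 58 50 newton_neg) (3 + h * (5 + 6)) ?post3 ?W4 X"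
     proof (rule map_loop_ends[where v = "\<lambda>j. res (ser x $ (h + j))"])
      fix t W' assume t: "t < h" and fr: "frame loopR {8} ?W4 W'" and r35: "W' 35 = t"
      have env': "env W'" by (rule env_frame[OF env4 fr]) auto
      have r': "W' 58 = h" using frame_reg[OF fr] r3 by simp
      have v: "W' (ad 6 (t + h)) = cmul (4 * h) ?e ?q (t + h)"
       using frame_slot[OF fr ns(1), of "t + h"] out3[of "t + h"] t hm by (simp add: ad_reg)
      have c_less: "cmul (4 * h) ?e ?q (t + h) < p" using p_pos by (simp add: cmul_def nat_less_iff)
      have e: "eval_op Add w t h = t + h" "eval_op Sub w p (cmul (4 * h) ?e ?q (t + h)) = p - cmul (4 * h) ?e ?q (t + h)"
       using t hm pp_less c_less by (auto intro!: ev_add small_less) (auto intro!: ev_sub)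
      have "(p - cmul (4 * h) ?e ?q (t + h)) mod p = res (ser x $ (h + t))" using o2[of "t + h"] t by (simp add: add.commute)
      then show "computes newton_neg 5 (res (ser x $ (h + t))) W' X"
       unfolding newton_neg_def ends_def using r35 r' v e t hm ns env_regs[OF env']
       by (simp add: reg_less ad_less ad_add ad_reg frame_upd_reg ev_mod)
     qed (use r3 ns hm in auto)
     then show "ends (map_loop 58 50 newton_neg) (3 + h * (5 + 6)) ?Q ?W4 X"
     proof (rule ends_mono)
      fix W' X' assume h1: "?post3 W' X'"
      then have fr': "frame loopR {8} ?W4 W'" by simp
      have "frame (treeR - {56}) newtonS W W'" by (rule frame_trans[OF frW4 fr']) auto
      moreover have "W' (ad 8 t) = res (ser x $ t)" if "t < 2 ^ Suc st" for t
      proof (cases "t < h")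
       case True
       then have "W' (ad 8 t) = ?W4 (ad 8 t)" using h1 hm by simp
       also have "\<dots> = W (ad 8 t)" using frame_slot[OF fr4 ns(3), of t] True hm by (simp add: ad_reg)
       finally show ?thesis using q True by (simp add: h_def)
      next
       case False
       then show ?thesis using h1 hm that N' by auto
      qed
      ultimately show "?Q W' X'" using h1 by blast
     qed simp
    qed
   qed
  qed
 qed
 then show ?thesis
 proof (rule ends_mono)
  have kh: "(st + 2) * h \<le> (2 * k) * h" "1 * h \<le> k * h" using st by (intro mult_le_mono1; linarith)+
  have "300 * (st + 2) * (4 * h) = 1200 * ((st + 2) * h)" "6000 * k * 2 ^ st = 6000 * (k * h)" "h * (5 + 6) = 11 * h" "(2 * k) * h = 2 * (k * h)"
   by (simp_all add: h_def algebra_simps)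
  then show "5 + (300 * (st + 2) * (4 * h) + (300 * (st + 2) * (4 * h) + (1 + (3 + h * (5 + 6))))) \<le> 6000 * k * 2 ^ st"
   using kh h0 by linarith
 qed
qed

lemma newton_ends:
 assumes env: "env W" and T: "\<And>i. i < mb \<Longrightarrow> W (ad 7 (u * mb + i)) = tval x u i"
 shows "ends newton (7000 * k * m) (\<lambda>W' X'. X' = X \<and> frame treeR newtonS W W' \<and>
   (\<forall>t<m. W' (ad 8 t) = res (ser x $ t))) W X"
proof -
 let ?P = "\<lambda>st A X'. X' = X \<and> (\<forall>t<2 ^ st. A 8 t = res (ser x $ t)) \<and> (\<forall>i<mb. A 7 (u * mb + i) = tval x u i)"
 let ?W1 = "W(41 := 1, ad 8 0 := 1)"
 have ns: "7 < NS" "8 < NS" using slot_less by auto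
 have m0: "0 < 2 * m" using m_pos by simp
 have um: "u * mb + mb \<le> m" using fit by (simp add: algebra_simps)
 have km: "k < m" using m_eq less_exp[of k] by simp
 have fr1: "frame treeR newtonS W ?W1" using m0 by (intro frame_upd_reg frame_upd_slot) auto
 have env1: "env ?W1" by (rule env_frame[OF env fr1]) auto
 have s0: "ser x $ 0 = 1"
 proof -
  have "(fps_of_poly (node_poly x 0 mb) * ser x) $ 0 = 1" by (simp add: node_poly_series)
  then show ?thesis by simp
 qed
 have r1: "res 1 = 1"
 proof -
  show ?thesis using p_ge by (simp add: res_def)
 qed
 have "ends newton (2 + (3 + (\<Sum>j<k. 6000 * k * 2 ^ j + 4))) (\<lambda>W' X'. frame treeR newtonS ?W1 W' \<and> ?P k (arr W') X') W X"
  unfolding newton_def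
 proof (rule ends_preI)
  show "ends (cst 41 1 ;; store 22 41) 2 (\<lambda>W' X'. W' = ?W1 \<and> X' = X) W X"
   unfolding ends_def using env_regs[OF env] ns m0 w_pos by (simp add: reg_less ad_less)
  show "ends (For 56 8 newton_level) (3 + (\<Sum>j<k. 6000 * k * 2 ^ j + 4)) (\<lambda>W' X'. frame treeR newtonS ?W1 W' \<and> ?P k (arr W') X') ?W1 X"
  proof (rule loop_ends_sum[where P = ?P])
   show "k < 2 ^ w" using km by (intro small_less) simp
   show "?P 0 (arr ?W1) X" using T s0 r1 um m0 by (simp add: arr_def ad_reg ad_inj)
   fix st W' X' assume st: "st < k" and fr: "frame treeR newtonS ?W1 W'" and r: "W' 56 = st" and P: "?P st (arr W') X'"
   have X': "X' = X" using P by simp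
   have env': "env W'" by (rule env_frame[OF env1 fr]) auto
   let ?post1 = "\<lambda>W'' X''. X'' = X \<and> frame (treeR - {56}) newtonS W' W'' \<and> (\<forall>t<2 ^ Suc st. W'' (ad 8 t) = res (ser x $ t))"
   have "ends newton_level (6000 * k * 2 ^ st) ?post1 W' X"
    by (rule newton_level_ends[OF env' st r]) (use P in \<open>auto simp: arr_def\<close>)
   then show "ends newton_level (6000 * k * 2 ^ st) (\<lambda>W'' X''. frame (treeR - {56}) newtonS W' W'' \<and> ?P (Suc st) (arr W'') X'') W' X'"
    unfolding X'
   proof (rule ends_mono)
    fix W'' X'' assume *: "?post1 W'' X''"
    then have fr': "frame (treeR - {56}) newtonS W' W''" by blast
    have "W'' (ad 7 (u * mb + i)) = tval x u i" if "i < mb" for i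
     using frame_slot[OF fr' ns(1), of "u * mb + i"] that um P by (auto simp: arr_def)
    with * show "frame (treeR - {56}) newtonS W' W'' \<and> ?P (Suc st) (arr W'') X''" by (simp add: arr_def)
   qed simp
  qed (use env_regs[OF env1] in auto)
 qed
 then show ?thesis
 proof (rule ends_mono)
  fix W' X' assume *: "frame treeR newtonS ?W1 W' \<and> ?P k (arr W') X'"
  then have fr': "frame treeR newtonS ?W1 W'" by blast
  have "frame treeR newtonS W W'" by (rule frame_trans[OF fr1 fr']) auto
  then show "X' = X \<and> frame treeR newtonS W W' \<and> (\<forall>t<m. W' (ad 8 t) = res (ser x $ t))"
   using *[folded m_eq] by (simp add: arr_def)
 next
  \<comment> \<open>The rounds form a geometric series dominated by the last one, so the inversion
    costs \<open>k * m\<close> up to a constant and not another factor \<open>k\<close>.\<close>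
  have "(\<Sum>j<k. (2::nat) ^ j) \<le> m" by (simp add: m_eq lessThan_atLeast0 sum_power2)
  then have "6000 * k * (\<Sum>j<k. 2 ^ j) \<le> 6000 * k * m" by (intro mult_le_mono2)
  then have "(\<Sum>j<k. 6000 * k * 2 ^ j + 4) \<le> 6000 * k * m + k * 4" by (simp add: sum.distrib sum_distrib_left)
  moreover have "k * 1 \<le> k * m" "1 * 64 \<le> k * m" using m_ge u_less by (intro mult_le_mono; linarith)+
  moreover have "6000 * k * m = 6000 * (k * m)" "7000 * k * m = 7000 * (k * m)" by simp_all
  ultimately show "2 + (3 + (\<Sum>j<k. 6000 * k * 2 ^ j + 4)) \<le> 7000 * k * m" by linarith
 qed
qed

text \<open>A transposed product is a convolution with the reversed series: at index
  \<open>m - 1 + i\<close>, coefficient \<open>e\<close> meets entry \<open>e - i\<close> of the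
  series. Both factors have \<open>m\<close> entries, so length \<open>2 * m\<close> does not
  wrap.\<close>

lemma root_ends:
 assumes env: "env W" and r: "r < R" "W 61 = r" and q: "\<And>t. t < m \<Longrightarrow> W (ad 8 t) = res (ser x $ t)"
  and cf: "\<And>t. t < m \<Longrightarrow> cf r t \<le> p"
 shows "ends root (2000 * k * m) (\<lambda>W' X'. X' = X \<and> frame nodeR ({2..<7} \<union> {12}) W W' \<and>
   (\<forall>i<mb. W' (ad 12 i) = res (transposed x (cf r) m 0 mb i))) W X" (is "ends _ _ ?Q _ _")
proof -
 have mbm: "mb \<le> m" by (rule u_props)
 have ns: "6 < NS" "8 < NS" "12 < NS" "15 < NS" "15 + r < NS" using r(1) by (simp_all add: NS_eq)
 have km: "k < m" using m_eq less_exp[of k] by simp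
 let ?f = "\<lambda>t. if t < m then cf r t else 0"
 let ?q = "\<lambda>t. if t < m then res (ser x $ (m - 1 - t)) else 0"
 have tr: "cmul (2 * m) ?f ?q (m - 1 + i) = res (transposed x (cf r) m 0 mb i)" if i: "i < mb" for i
 proof -
  have "cmul (2 * m) ?f ?q (m - 1 + i) = res (\<Sum>e\<le>m - 1 + i. (if e < m then int (cf r e) else 0) *
    (if m - 1 + i - e < m then ser x $ (m - 1 - (m - 1 + i - e)) else 0))"
  proof (rule cmul_linear)
   show "[int (?f e) = (if e < m then int (cf r e) else 0)] (mod int p)"
    "[int (?q e) = (if e < m then ser x $ (m - 1 - e) else 0)] (mod int p)" for e by (auto simp: cong_res)
  qed (use i mbm m_pos in auto)
  also have "(\<Sum>e\<le>m - 1 + i. (if e < m then int (cf r e) else 0) *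
    (if m - 1 + i - e < m then ser x $ (m - 1 - (m - 1 + i - e)) else 0)) = transposed x (cf r) m 0 mb i"
   unfolding transposed_def
   by (rule sum.mono_neutral_cong_right) (use m_pos in \<open>auto simp: diff_diff_right\<close>)
  finally show ?thesis .
 qed
 let ?W1 = "W(36 := r * (2 * m), 48 := ad (15 + r) 0, 52 := Suc k)"
 have lwb: "ad (15 + r) 0 < lw" using ad_less[of "15 + r" 0] ns m_pos by simp
 have e: "eval_op Add w m m = 2 * m" "eval_op Mul w r (2 * m) = r * (2 * m)" "eval_op Add w (ad 15 0) (r * (2 * m)) = ad (15 + r) 0"
  "eval_op Add w k 1 = Suc k"
 proof -
  have "r * (2 * m) \<le> ad (15 + r) 0" unfolding ad_def by (simp add: distrib_right)
  then have "m + m < 2 ^ w" "r * (2 * m) < 2 ^ w" "k + 1 < 2 ^ w" using m2_less lwb lw_small km by linarith+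
  then show "eval_op Add w m m = 2 * m" "eval_op Mul w r (2 * m) = r * (2 * m)" "eval_op Add w k 1 = Suc k"
   using ev_add[of m m w] ev_add[of k 1 w] ev_mul[of r "2 * m" w] by simp_all
  have "ad 15 0 + r * (2 * m) = ad (15 + r) 0" unfolding ad_def by (simp add: distrib_right)
  then show "eval_op Add w (ad 15 0) (r * (2 * m)) = ad (15 + r) 0" using lwb lw_small ev_add[of "ad 15 0" "r * (2 * m)" w] by simp
 qed
 have fr1: "frame nodeR ({2..<7} \<union> {12}) W ?W1" by (intro frame_upd_reg) auto
 have env1: "env ?W1" by (rule env_frame[OF env fr1]) auto
 have N: "2 ^ Suc k = 2 * m" by (simp add: m_eq)
 have "ends root (4 + (300 * Suc k * 2 ^ Suc k + (3 + mb * (4 + 6)))) ?Q W X"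
  unfolding root_def
 proof (rule ends_preI)
  show "ends (add 36 7 7 ;; mul 36 61 36 ;; add 48 29 36 ;; add 52 8 14) 4 (\<lambda>W' X'. W' = ?W1 \<and> X' = X) W X"
   unfolding ends_def using r e env_regs[OF env] by (simp add: reg_less)
  show "ends (multiply root_f root_q ;; map_loop 10 26 root_out) (300 * Suc k * 2 ^ Suc k + (3 + mb * (4 + 6))) ?Q ?W1 X"
  proof (rule ends_SeqI)
   let ?post1 = "product (Suc k) ?f ?q ?W1 X"
   show "ends (multiply root_f root_q) (300 * Suc k * 2 ^ Suc k) ?post1 ?W1 X"
   proof (rule multiply_ends[OF env1])
    show "2 ^ Suc k dvd 2 * m" unfolding N by (rule dvd_refl)
    fix t W' assume t: "t < 2 ^ Suc k" and fr: "frame argR {2..<6} ?W1 W'" and r35: "W' 35 = t"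
    have env': "env W'" by (rule env_frame[OF env1 fr]) auto
    have r': "W' 48 = ad (15 + r) 0" using frame_reg[OF fr] by simp
    have v: "W' (ad (15 + r) t) = cf r t" if "t < m" using env' r(1) that by (simp add: env_def)
    have v': "W' (ad 8 (m - 1 - t)) = res (ser x $ (m - 1 - t))"
     using frame_slot[OF fr ns(2), of "m - 1 - t"] q[of "m - 1 - t"] m_pos by (simp add: ad_reg)
    have e': "eval_op Sub w m 1 = m - 1" "eval_op Sub w (m - 1) t = m - 1 - t" if "t < m"
     using that by (intro ev_sub small_less; linarith)+
    show "computes root_f 20 (?f t) W' X"
     unfolding root_f_def ends_def using r35 r' v env_regs[OF env'] ns
     by (cases "t < m") (simp_all add: reg_less ad_less ad_add ad_reg frame_upd_reg)
    show "computes root_q 20 (?q t) W' X"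
     unfolding root_q_def ends_def using r35 v' e' env_regs[OF env'] ns
     by (cases "t < m") (simp_all add: reg_less ad_less ad_add ad_reg frame_upd_reg)
   qed (use cf less_imp_le[OF res_less] in auto)
   fix W2 X2 assume *: "?post1 W2 X2"
   then have X2: "X2 = X" and fr12: "frame mulR {2..<7} ?W1 W2" and out: "\<And>t. t < 2 * m \<Longrightarrow> W2 (ad 6 t) = cmul (2 * m) ?f ?q t"
    using *[unfolded N] by auto
   have fr2: "frame nodeR ({2..<7} \<union> {12}) W W2" by (rule frame_trans[OF fr1 fr12]) auto
   have env2: "env W2" by (rule env_frame[OF env fr2]) auto
   let ?post2 = "filled 12 0 mb (\<lambda>j. res (transposed x (cf r) m 0 mb j)) W2 X"
   have "ends (map_loop 10 26 root_out) (3 + mb * (4 + 6)) ?post2 W2 X"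
   proof (rule map_loop_ends)
    fix t W' assume t: "t < mb" and fr: "frame loopR {12} W2 W'" and r35: "W' 35 = t"
    have env': "env W'" by (rule env_frame[OF env2 fr]) auto
    have b: "m - 1 + t < 2 * m" using t mbm by simp
    have v: "W' (ad 6 (m - 1 + t)) = res (transposed x (cf r) m 0 mb t)"
     using frame_slot[OF fr ns(1) b] out[OF b] tr[OF t] by simp
    have e': "eval_op Sub w m 1 = m - 1" "eval_op Add w (m - 1) t = m - 1 + t"
     using b m_pos by (intro ev_sub ev_add small_less; linarith)+
    show "computes root_out 4 (res (transposed x (cf r) m 0 mb t)) W' X"
     unfolding root_out_def ends_def using r35 v e' b env_regs[OF env'] ns
     by (simp add: reg_less ad_less ad_add ad_reg frame_upd_reg)
   qed (use env_regs[OF env2] ns mbm in auto)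
   then show "ends (map_loop 10 26 root_out) (3 + mb * (4 + 6)) ?Q W2 X2"
    unfolding X2
   proof (rule ends_mono)
    fix W' X' assume h1: "?post2 W' X'"
    then have fr': "frame loopR {12} W2 W'" by simp
    have "frame nodeR ({2..<7} \<union> {12}) W W'" by (rule frame_trans[OF fr2 fr']) auto
    then show "?Q W' X'" using h1 mbm by auto
   qed simp
  qed
 qed
 then show ?thesis
 proof (rule ends_mono)
  have "Suc k * m \<le> (2 * k) * m" "1 * 64 \<le> k * m" "1 * m \<le> k * m" using u_less m_ge by (intro mult_le_mono; linarith)+
  moreover have "300 * Suc k * (2 * m) = 600 * (Suc k * m)" "mb * (4 + 6) = 10 * mb" "(2 * k) * m = 2 * (k * m)" "2000 * k * m = 2000 * (k * m)"
   by (simp_all add: algebra_simps)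
  ultimately show "4 + (300 * Suc k * 2 ^ Suc k + (3 + mb * (4 + 6))) \<le> 2000 * k * m" unfolding N using mbm by linarith
 qed
qed

section \<open>Descent through the tree\<close>

definition vval :: "words \<Rightarrow> words \<Rightarrow> nat \<Rightarrow> nat \<Rightarrow> nat" where
 "vval x c l i = res (transposed x c m (2 ^ l * (i div 2 ^ l)) (2 ^ l) (i mod 2 ^ l))"

lemma vval_node: "t < 2 ^ l \<Longrightarrow> vval x c l (2 ^ l * b + t) = res (transposed x c m (2 ^ l * b) (2 ^ l) t)"
 by (simp add: vval_def)

lemma vval_less: "vval x c l i < p"
 by (simp add: vval_def res_less)

text \<open>The coefficient 1 of \<open>S\<close> contributes \<open>V t\<close>; the others form a
  convolution with the reversed array, read at \<open>t + h\<close>. The full product is longer than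
  \<open>2 * h\<close>, but its overflow wraps into indices below \<open>h\<close>, while the reads
  are at \<open>h\<close> and above.\<close>

lemma child_step:
 fixes S :: "int poly"
 assumes S0: "coeff S 0 = 1" and h: "t < h"
  and tr: "tr' t = (\<Sum>e\<le>h. coeff S e * tr (t + e))"
  and V: "\<And>e. e < 2 * h \<Longrightarrow> V e = res (tr e)" and A: "\<And>e. e < h \<Longrightarrow> A e = res (coeff S (Suc e))"
 shows "(V t + cmul (2 * h) V (\<lambda>e. if e < h then A (h - 1 - e) else 0) (t + h)) mod p = res (tr' t)"
proof (rule res_congI)
 have "cmul (2 * h) V (\<lambda>e. if e < h then A (h - 1 - e) else 0) (t + h) =
  res (\<Sum>e\<le>t + h. tr e * (if t + h - e < h then coeff S (Suc (h - 1 - (t + h - e))) else 0))"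
 proof (rule cmul_linear)
  show "[int (V e) = tr e] (mod int p)" if "e \<le> t + h" for e using that h V[of e] by (simp add: cong_res)
  show "[int (if e < h then A (h - 1 - e) else 0) = (if e < h then coeff S (Suc (h - 1 - e)) else 0)] (mod int p)" for e
   using A by (auto simp: cong_res)
 qed (use h in auto)
 also have "(\<Sum>e\<le>t + h. tr e * (if t + h - e < h then coeff S (Suc (h - 1 - (t + h - e))) else 0)) =
   (\<Sum>e=Suc t..t + h. coeff S (e - t) * tr e)"
  by (rule sum.mono_neutral_cong_right) (auto simp: Suc_diff_Suc intro!: arg_cong[where f = "coeff S"])
 also have "\<dots> = (\<Sum>e=1 + t..h + t. coeff S (e - t) * tr e)" by (simp add: add.commute)
 also have "\<dots> = (\<Sum>e=1..h. coeff S e * tr (t + e))"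
  unfolding sum.shift_bounds_cl_nat_ivl by (simp add: add.commute)
 finally have c: "cmul (2 * h) V (\<lambda>e. if e < h then A (h - 1 - e) else 0) (t + h) = res (\<Sum>e=1..h. coeff S e * tr (t + e))" .
 have "(\<Sum>e\<le>h. coeff S e * tr (t + e)) = tr t + (\<Sum>e=1..h. coeff S e * tr (t + e))"
  unfolding atMost_atLeast0 by (subst sum.atLeast_Suc_atMost) (simp_all add: S0)
 then have "tr' t = tr t + (\<Sum>e=1..h. coeff S e * tr (t + e))" using tr by simp
 then show "[int (V t + cmul (2 * h) V (\<lambda>e. if e < h then A (h - 1 - e) else 0) (t + h)) = tr' t] (mod int p)"
  unfolding c of_nat_add using V[of t] h by (auto intro!: cong_add cong_res)
qed

lemma vval_child:
 assumes "t < 2 ^ l"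
 shows "(vval x c (Suc l) (2 ^ Suc l * v + t) + cmul (2 * 2 ^ l) (\<lambda>e. vval x c (Suc l) (2 ^ Suc l * v + e))
   (\<lambda>e. if e < 2 ^ l then tval x l (2 ^ Suc l * v + (if right then 0 else 2 ^ l) + (2 ^ l - 1 - e)) else 0) (t + 2 ^ l)) mod p =
  vval x c l (2 ^ Suc l * v + (if right then 2 ^ l else 0) + t)"
proof -
 let ?h = "(2::nat) ^ l" and ?b = "2 ^ Suc l * v"
 have e: "?b = ?h * (2 * v)" "?b + ?h = ?h * (2 * v + 1)" by (simp_all add: algebra_simps)
 have h2: "2 ^ Suc l = ?h + ?h" by simp
 have V: "vval x c (Suc l) (?b + e) = res (transposed x c m ?b (?h + ?h) e)" if "e < 2 * ?h" for e
  using vval_node[of e "Suc l" x c v] that by (simp add: mult_2)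
 show ?thesis
 proof (cases right)
  case True
  have "vval x c l (?b + ?h + t) = res (transposed x c m (?b + ?h) ?h t)"
   unfolding e(2) by (rule vval_node[OF assms])
  moreover have "(vval x c (Suc l) (?b + t) + cmul (2 * ?h) (\<lambda>e. vval x c (Suc l) (?b + e))
    (\<lambda>e. if e < ?h then tval x l (?b + (?h - 1 - e)) else 0) (t + ?h)) mod p = res (transposed x c m (?b + ?h) ?h t)"
   by (rule child_step[where S = "node_poly x ?b ?h" and tr = "transposed x c m ?b (?h + ?h)"])
    (use assms V transposed_right[of x c m ?b ?h t] tval_node[of _ l x "2 * v", folded e(1)] in auto)
  ultimately show ?thesis using True by (simp cong: if_cong)
 next
  case False
  have "vval x c l (?b + t) = res (transposed x c m ?b ?h t)"
   unfolding e(1) by (rule vval_node[OF assms])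
  moreover have "(vval x c (Suc l) (?b + t) + cmul (2 * ?h) (\<lambda>e. vval x c (Suc l) (?b + e))
    (\<lambda>e. if e < ?h then tval x l (?b + ?h + (?h - 1 - e)) else 0) (t + ?h)) mod p = res (transposed x c m ?b ?h t)"
   by (rule child_step[where S = "node_poly x (?b + ?h) ?h" and tr = "transposed x c m ?b (?h + ?h)"])
    (use assms V transposed_left[of x c m ?b ?h t] tval_node[of _ l x "2 * v + 1", folded e(2)] in auto)
  ultimately show ?thesis using False by simp
 qed
qed

lemma down_child_ends:
 assumes env: "env W" and l: "l < u" and h: "h = 2 ^ l" and v: "v * (2 * h) + 2 * h \<le> mb"
  and r: "W 57 = v" "W 58 = h" "W 60 = ad 7 (l * mb)" "W 62 = Suc l"
  and T: "\<And>i. i < mb \<Longrightarrow> W (ad 7 (l * mb + i)) = tval x l i"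
  and V: "\<And>e. e < 2 * h \<Longrightarrow> W (ad 12 (v * (2 * h) + e)) = vval x c (Suc l) (v * (2 * h) + e)"
 shows "ends (down_child right) (340 * (l + 1) * (2 * h)) (\<lambda>W' X'. X' = X \<and> frame nodeR ({2..<7} \<union> {13}) W W' \<and>
   (\<forall>j<2*m. W' (ad 13 j) = (if v * (2 * h) + (if right then h else 0) \<le> j \<and> j < v * (2 * h) + (if right then h else 0) + h
    then vval x c l j else W (ad 13 j)))) W X"
proof -
 define o' where "o' = v * (2 * h)"
 define s where "s = (if right then 0 else h)"
 define d where "d = (if right then h else 0)"
 have h0: "0 < h" "2 * h = 2 ^ Suc l" using h by simp_all
 have ob: "o' + 2 * h \<le> mb" "mb \<le> m" using v u_props by (auto simp: o'_def)
 have sd: "s \<le> h" "d \<le> h" by (auto simp: s_def d_def)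
 have lm: "l * mb + mb + mb \<le> m"
 proof -
  have "(l + 2) * mb \<le> (u + 1) * mb" using l by (intro mult_le_mono1) simp
  then show ?thesis using fit by (simp add: algebra_simps)
 qed
 have ns: "6 < NS" "7 < NS" "12 < NS" "13 < NS" using slot_less by auto
 have e: "eval_op Add w h h = 2 * h" "eval_op Mul w v (2 * h) = o'" "eval_op Add w (Suc l) 0 = Suc l"
 proof -
  have "h + h < 2 ^ w" "v * (2 * h) < 2 ^ w" "Suc l < 2 ^ w" using ob l u_mb unfolding o'_def by (auto intro!: small_less)
  then show "eval_op Add w h h = 2 * h" "eval_op Mul w v (2 * h) = o'" "eval_op Add w (Suc l) 0 = Suc l"
   using ev_add[of h h w] ev_mul[of v "2 * h" w] ev_add[of "Suc l" 0 w] by (simp_all add: o'_def)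
 qed
 have a: "eval_op Add w (ad 12 0) o' = ad 12 o'" "eval_op Add w (ad 7 (l * mb)) o' = ad 7 (l * mb + o')"
  "eval_op Add w (ad 7 (l * mb + o')) h = ad 7 (l * mb + o' + h)" "eval_op Add w (ad 13 0) o' = ad 13 o'"
  "eval_op Add w (ad 13 o') h = ad 13 (o' + h)"
  using ad_add[of 12 0 o'] ad_add[of 7 "l * mb" o'] ad_add[of 7 "l * mb + o'" h] ad_add[of 13 0 o'] ad_add[of 13 o' h] ns lm ob h0 by auto
 let ?W1 = "W(48 := o', 49 := ad 12 o', 50 := ad 7 (l * mb + o' + s), 2 := 0, 52 := Suc l)"
 have fr1: "frame nodeR ({2..<7} \<union> {13}) W ?W1" by (intro frame_upd_reg) auto
 have env1: "env ?W1" by (rule env_frame[OF env fr1]) auto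
 let ?x = "\<lambda>e. if e < 2 * h then vval x c (Suc l) (o' + e) else 0"
 let ?y = "\<lambda>e. if e < h then tval x l (o' + s + (h - 1 - e)) else 0"
 let ?Q = "\<lambda>W' X'. X' = X \<and> frame nodeR ({2..<7} \<union> {13}) W W' \<and>
   (\<forall>j<2*m. W' (ad 13 j) = (if o' + d \<le> j \<and> j < o' + d + h then vval x c l j else W (ad 13 j)))"
 have VV: "W' (ad 12 (o' + t)) = vval x c (Suc l) (o' + t)" if "frame Rs Ss ?W1 W'" "12 \<notin> Ss" "t < 2 * h" for Rs Ss W' t
  using frame_slot[OF that(1) ns(3), of "o' + t"] that V[of t] ob by (auto simp: ad_reg o'_def)
 have TT: "W' (ad 7 (l * mb + o' + s + t)) = tval x l (o' + s + t)" if "frame Rs Ss ?W1 W'" "7 \<notin> Ss" "t < h" for Rs Ss W' t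
  using frame_slot[OF that(1) ns(2), of "l * mb + o' + s + t"] that T[of "o' + s + t"] ob lm sd by (auto simp: ad_reg add.assoc)
 have cm: "cmul (2 ^ Suc l) ?x ?y (t + h) < p" for t using p_pos by (simp add: cmul_def nat_less_iff)
 have step: "(vval x c (Suc l) (o' + t) + cmul (2 ^ Suc l) ?x ?y (t + h)) mod p = vval x c l (o' + d + t)" if "t < h" for t
 proof -
  have o2: "2 ^ Suc l * v = o'" by (simp add: o'_def h mult.commute)
  have "cmul (2 ^ Suc l) ?x ?y (t + h) = cmul (2 * h) (\<lambda>e. vval x c (Suc l) (o' + e)) ?y (t + h)"
  proof -
   have lt: "t + h < 2 * h" using that by simp
   have 1: "(t + h) mod (2 * h) = t + h" using lt by simp
   have 2: "(\<Sum>r<2*h. int (?x (t + h - (t + h) + r)) * int (?y (t + h - (t + h) + (t + h + 2 * h - r) mod (2 * h)))) =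
     (\<Sum>r<2*h. int (vval x c (Suc l) (o' + (t + h - (t + h) + r))) * int (?y (t + h - (t + h) + (t + h + 2 * h - r) mod (2 * h))))"
    by (rule sum.cong) auto
   show ?thesis unfolding h0(2)[symmetric] cmul_def block_conv_def 1 2 ..
  qed
  then show ?thesis
   using vval_child[of t l x c v right, unfolded o2, folded h] that by (simp only: s_def d_def)
 qed
 have "ends (down_child right) (7 + (300 * Suc l * 2 ^ Suc l + (5 + (3 + h * (7 + 6))))) ?Q W X"
  unfolding down_child_def
 proof (rule ends_preI)
  show "ends (add 48 58 58 ;; mul 48 57 48 ;; add 49 26 48 ;; add 50 60 48 ;; (if right then Skip else add 50 50 58) ;; mov 52 62) 7
    (\<lambda>W' X'. W' = ?W1 \<and> X' = X) W X"
   unfolding ends_def mov_def using r e a env_regs[OF env] by (cases right) (simp_all add: reg_less s_def)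
  show "ends (multiply down_v down_s ;;
    (add 48 58 58 ;; mul 48 57 48 ;; add 49 26 48 ;; add 50 27 48 ;; (if right then add 50 50 58 else Skip)) ;; map_loop 58 50 down_out)
    (300 * Suc l * 2 ^ Suc l + (5 + (3 + h * (7 + 6)))) ?Q ?W1 X"
  proof (rule ends_SeqI)
   let ?post1 = "product (Suc l) ?x ?y ?W1 X"
   show "ends (multiply down_v down_s) (300 * Suc l * 2 ^ Suc l) ?post1 ?W1 X"
   proof (rule multiply_ends[OF env1 u_props(1)[OF l]])
    fix t W' assume t: "t < 2 ^ Suc l" and fr: "frame argR {2..<6} ?W1 W'" and r35: "W' 35 = t"
    have env': "env W'" by (rule env_frame[OF env1 fr]) auto
    have r': "W' 58 = h" "W' 49 = ad 12 o'" "W' 50 = ad 7 (l * mb + o' + s)"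
     using frame_reg[OF fr] r by auto
    have t2: "t < 2 * h" using t h0 by simp
    have b: "o' + t < 2 * m" "l * mb + o' + s + (h - 1 - t) < 2 * m" using t2 ob lm sd h0 by linarith+
    have e': "eval_op Sub w h 1 = h - 1" "eval_op Sub w (h - 1) t = h - 1 - t" if "t < h"
     using that ob by (intro ev_sub small_less; linarith)+
    have "W' (ad 12 (o' + t)) = ?x t" using VV[OF fr _ t2] t2 by simp
    then show "computes down_v 20 (?x t) W' X"
     unfolding down_v_def ends_def using r35 r' b ns
     by (simp add: reg_less ad_less ad_add ad_reg frame_upd_reg)
    have "W' (ad 7 (l * mb + o' + s + (h - 1 - t))) = tval x l (o' + s + (h - 1 - t))" if "t < h"
     using TT[OF fr, of "h - 1 - t"] that by simp
    then show "computes down_s 20 (?y t) W' X"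
     unfolding down_s_def ends_def using r35 r' b ns e' env_regs[OF env']
     by (cases "t < h") (simp_all add: reg_less ad_less ad_add ad_reg frame_upd_reg)
   qed (use less_imp_le[OF tval_less] less_imp_le[OF vval_less] in auto)
   fix W2 X2 assume *: "?post1 W2 X2"
   then have X2: "X2 = X" and fr12: "frame mulR {2..<7} ?W1 W2" and out: "\<And>t. t < 2 ^ Suc l \<Longrightarrow> W2 (ad 6 t) = cmul (2 ^ Suc l) ?x ?y t"
    by blast+
   have fr2: "frame nodeR ({2..<7} \<union> {13}) W W2" by (rule frame_trans[OF fr1 fr12]) auto
   have env2: "env W2" by (rule env_frame[OF env fr2]) auto
   have r2: "W2 57 = v" "W2 58 = h" using frame_reg[OF fr2] r by auto
   let ?W3 = "W2(48 := o', 49 := ad 12 o', 50 := ad 13 (o' + d))"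
   have fr13: "frame mulR {2..<7} ?W1 ?W3" using fr12 by (intro frame_upd_reg) auto
   have fr3: "frame nodeR ({2..<7} \<union> {13}) W ?W3" using fr2 by (intro frame_upd_reg) auto
   have env3: "env ?W3" by (rule env_frame[OF env fr3]) auto
   show "ends ((add 48 58 58 ;; mul 48 57 48 ;; add 49 26 48 ;; add 50 27 48 ;; (if right then add 50 50 58 else Skip)) ;; map_loop 58 50 down_out)
    (5 + (3 + h * (7 + 6))) ?Q W2 X2"
    unfolding X2
   proof (rule ends_preI)
    show "ends (add 48 58 58 ;; mul 48 57 48 ;; add 49 26 48 ;; add 50 27 48 ;; (if right then add 50 50 58 else Skip)) 5
      (\<lambda>W' X'. W' = ?W3 \<and> X' = X) W2 X"
     unfolding ends_def using r2 e a env_regs[OF env2] by (cases right) (simp_all add: reg_less d_def)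
    let ?post2 = "filled 13 (o' + d) h (\<lambda>j. vval x c l (o' + d + j)) ?W3 X"
    have "ends (map_loop 58 50 down_out) (3 + h * (7 + 6)) ?post2 ?W3 X"
    proof (rule map_loop_ends[where v = "\<lambda>j. vval x c l (o' + d + j)"])
     fix t W' assume t: "t < h" and fr: "frame loopR {13} ?W3 W'" and r35: "W' 35 = t"
     have env': "env W'" by (rule env_frame[OF env3 fr]) auto
     have r': "W' 58 = h" "W' 49 = ad 12 o'" using frame_reg[OF fr] r2 by auto
     have frW: "frame (mulR) ({2..<7} \<union> {13}) ?W1 W'" by (rule frame_trans[OF fr13 fr]) auto
     have v1: "W' (ad 12 (o' + t)) = vval x c (Suc l) (o' + t)" using VV[OF frW] t by simp
     have v2: "W' (ad 6 (t + h)) = cmul (2 ^ Suc l) ?x ?y (t + h)"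
      using frame_slot[OF fr ns(1), of "t + h"] out[of "t + h"] t h0(2) ob by (simp add: ad_reg)
     have b: "o' + t < 2 * m" "t + h < 2 * m" using t ob by auto
     have e': "eval_op Add w t h = t + h" using b by (intro ev_add small_less) simp
     have e2: "eval_op Add w (vval x c (Suc l) (o' + t)) (cmul (2 ^ Suc l) ?x ?y (t + h)) = vval x c (Suc l) (o' + t) + cmul (2 ^ Suc l) ?x ?y (t + h)"
      using pp_less cm[of t] vval_less[of x c "Suc l" "o' + t"] by (intro ev_add) linarith
     show "computes down_out 7 (vval x c l (o' + d + t)) W' X"
      unfolding down_out_def ends_def using r35 r' v1 v2 b e' e2 ns env_regs[OF env'] step[OF t]
      by (simp add: reg_less ad_less ad_add ad_reg frame_upd_reg ev_mod del: power_Suc)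
    qed (use r2 ns ob sd in auto)
    then show "ends (map_loop 58 50 down_out) (3 + h * (7 + 6)) ?Q ?W3 X"
    proof (rule ends_mono)
     fix W' X' assume **: "?post2 W' X'"
     then have fr': "frame loopR {13} ?W3 W'" by simp
     have "frame nodeR ({2..<7} \<union> {13}) W W'" by (rule frame_trans[OF fr3 fr']) auto
     moreover have "?W3 (ad 13 j) = W (ad 13 j)" if "j < 2 * m" for j
      using frame_slot[OF fr13 ns(4) that] by (simp add: ad_reg)
     ultimately show "?Q W' X'" using ** by auto
    qed simp
   qed
  qed
 qed
 then show ?thesis
  unfolding o'_def[symmetric] d_def[symmetric]
 proof (rule ends_mono)
  have "2 * h \<le> Suc l * (2 * h)" by simp
  moreover have "2 \<le> 2 * h" using h0(1) by simp
  moreover have "h * (7 + 6) = 13 * h" by simp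
  moreover have "300 * Suc l * 2 ^ Suc l = 300 * (Suc l * (2 * h))" "340 * (l + 1) * (2 * h) = 340 * (Suc l * (2 * h))"
   unfolding h0(2)[symmetric] by (simp_all only: mult.assoc Suc_eq_plus1)
  ultimately show "7 + (300 * Suc l * 2 ^ Suc l + (5 + (3 + h * (7 + 6)))) \<le> 340 * (l + 1) * (2 * h)" by linarith
 qed
qed

lemma down_node_ends:
 assumes env: "env W" and l: "l < u" and h: "h = 2 ^ l" and v: "v * (2 * h) + 2 * h \<le> mb"
  and r: "W 57 = v" "W 58 = h" "W 60 = ad 7 (l * mb)" "W 62 = Suc l"
  and T: "\<And>i. i < mb \<Longrightarrow> W (ad 7 (l * mb + i)) = tval x l i"
  and V: "\<And>e. e < 2 * h \<Longrightarrow> W (ad 12 (v * (2 * h) + e)) = vval x c (Suc l) (v * (2 * h) + e)"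
 shows "ends down_node (700 * (l + 1) * (2 * h)) (\<lambda>W' X'. X' = X \<and> frame nodeR evalS W W' \<and>
   (\<forall>j<2*m. W' (ad 12 j) = (if v * (2 * h) \<le> j \<and> j < v * (2 * h) + 2 * h then vval x c l j else W (ad 12 j)))) W X"
proof -
 define o' where "o' = v * (2 * h)"
 have h0: "0 < h" using h by simp
 have ob: "o' + 2 * h \<le> mb" "mb \<le> m" using v u_props by (auto simp: o'_def)
 have lm: "l * mb + mb \<le> m" using level_index[of l "mb - 1"] l h0 ob by simp
 have ns: "7 < NS" "12 < NS" "13 < NS" using slot_less by auto
 have e: "eval_op Add w h h = 2 * h" "eval_op Mul w v (2 * h) = o'"
 proof -
  have "h + h < 2 ^ w" "v * (2 * h) < 2 ^ w" using ob unfolding o'_def by (auto intro!: small_less)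
  then show "eval_op Add w h h = 2 * h" "eval_op Mul w v (2 * h) = o'"
   using ev_add[of h h w] ev_mul[of v "2 * h" w] by (simp_all add: o'_def)
 qed
 have a: "eval_op Add w (ad 12 0) o' = ad 12 o'" "eval_op Add w (ad 13 0) o' = ad 13 o'"
  using ad_add[of 12 0 o'] ad_add[of 13 0 o'] ns ob h0 by auto
 let ?T = "340 * (l + 1) * (2 * h)"
 let ?Q = "\<lambda>W' X'. X' = X \<and> frame nodeR evalS W W' \<and>
   (\<forall>j<2*m. W' (ad 12 j) = (if o' \<le> j \<and> j < o' + 2 * h then vval x c l j else W (ad 12 j)))"
 have "ends down_node (?T + (?T + (4 + (3 + 2 * h * (2 + 6))))) ?Q W X"
  unfolding down_node_def
 proof (rule ends_SeqI)
  let ?post1 = "\<lambda>W' X'. X' = X \<and> frame nodeR ({2..<7} \<union> {13}) W W' \<and> (\<forall>j<2*m. W' (ad 13 j) = (if v * (2 * h) + (if False then h else 0) \<le> j \<and> j < v * (2 * h) + (if False then h else 0) + h then vval x c l j else W (ad 13 j)))"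
  show "ends (down_child False) ?T ?post1 W X"
   by (rule down_child_ends[OF env l h v r T V])
  fix W1 X1 assume 1: "?post1 W1 X1"
  then have X1: "X1 = X" and fr1: "frame nodeR ({2..<7} \<union> {13}) W W1" by blast+
  have env1: "env W1" by (rule env_frame[OF env fr1]) auto
  have r1: "W1 57 = v" "W1 58 = h" "W1 60 = ad 7 (l * mb)" "W1 62 = Suc l" using frame_reg[OF fr1] r by auto
  have T1: "W1 (ad 7 (l * mb + i)) = tval x l i" if "i < mb" for i
   using frame_slot[OF fr1 ns(1), of "l * mb + i"] T[OF that] that lm by auto
  have V1: "W1 (ad 12 (v * (2 * h) + e)) = vval x c (Suc l) (v * (2 * h) + e)" if "e < 2 * h" for e
   using frame_slot[OF fr1 ns(2), of "v * (2 * h) + e"] V[OF that] that ob by (auto simp: o'_def)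
  show "ends (down_child True ;; (add 48 58 58 ;; mul 50 57 48 ;; add 49 27 50 ;; add 50 26 50) ;; map_loop 48 50 (add 36 49 35 ;; load 41 36))
   (?T + (4 + (3 + 2 * h * (2 + 6)))) ?Q W1 X1"
   unfolding X1
  proof (rule ends_SeqI)
   let ?post2 = "\<lambda>W' X'. X' = X \<and> frame nodeR ({2..<7} \<union> {13}) W1 W' \<and> (\<forall>j<2*m. W' (ad 13 j) = (if v * (2 * h) + (if True then h else 0) \<le> j \<and> j < v * (2 * h) + (if True then h else 0) + h then vval x c l j else W1 (ad 13 j)))"
   show "ends (down_child True) ?T ?post2 W1 X"
    by (rule down_child_ends[OF env1 l h v r1 T1 V1])
   fix W2 X2 assume 2: "?post2 W2 X2"
   then have X2: "X2 = X" and fr12: "frame nodeR ({2..<7} \<union> {13}) W1 W2" by blast+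
   have fr2: "frame nodeR ({2..<7} \<union> {13}) W W2" by (rule frame_trans[OF fr1 fr12]) auto
   have env2: "env W2" by (rule env_frame[OF env fr2]) auto
   have r2: "W2 57 = v" "W2 58 = h" using frame_reg[OF fr2] r by auto
   have V2: "W2 (ad 13 (o' + t)) = vval x c l (o' + t)" if "t < 2 * h" for t
   proof -
    have b: "o' + t < 2 * m" using that ob by simp
    show ?thesis using 1 2 b that by (cases "t < h") (auto simp: o'_def)
   qed
   let ?W3 = "W2(48 := 2 * h, 49 := ad 13 o', 50 := ad 12 o')"
   have fr3: "frame nodeR evalS W ?W3"
    by (intro frame_upd_reg frame_trans[OF fr2 frame_refl[of "{}" "{}"]]) auto
   show "ends ((add 48 58 58 ;; mul 50 57 48 ;; add 49 27 50 ;; add 50 26 50) ;; map_loop 48 50 (add 36 49 35 ;; load 41 36))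
    (4 + (3 + 2 * h * (2 + 6))) ?Q W2 X2"
    unfolding X2
   proof (rule ends_preI)
    have sw: "W2(48 := 2 * h, 50 := o', 49 := ad 13 o', 50 := ad 12 o') = ?W3" by auto
    show "ends (add 48 58 58 ;; mul 50 57 48 ;; add 49 27 50 ;; add 50 26 50) 4 (\<lambda>W' X'. W' = ?W3 \<and> X' = X) W2 X"
     unfolding ends_def using r2 e a env_regs[OF env2] sw by (simp add: reg_less)
    let ?post3 = "filled 12 o' (2 * h) (\<lambda>j. vval x c l (o' + j)) ?W3 X"
    have "ends (map_loop 48 50 (add 36 49 35 ;; load 41 36)) (3 + 2 * h * (2 + 6)) ?post3 ?W3 X"
    proof (rule map_loop_ends[where v = "\<lambda>j. vval x c l (o' + j)"])
     fix t W' assume t: "t < 2 * h" and fr: "frame loopR {12} ?W3 W'" and r35: "W' 35 = t"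
     have r': "W' 49 = ad 13 o'" using frame_reg[OF fr] by auto
     have b: "o' + t < 2 * m" using t ob by simp
     have v1: "W' (ad 13 (o' + t)) = vval x c l (o' + t)"
      using frame_slot[OF fr ns(3) b] V2[OF t] by (simp add: ad_reg)
     show "computes (add 36 49 35 ;; load 41 36) 2 (vval x c l (o' + t)) W' X"
      unfolding ends_def using r35 r' v1 b ns by (simp add: reg_less ad_less ad_add ad_reg frame_upd_reg)
    qed (use ns ob in auto)
    then show "ends (map_loop 48 50 (add 36 49 35 ;; load 41 36)) (3 + 2 * h * (2 + 6)) ?Q ?W3 X"
    proof (rule ends_mono)
     fix W' X' assume **: "?post3 W' X'"
     then have fr': "frame loopR {12} ?W3 W'" by simp
     have "frame nodeR evalS W W'" by (rule frame_trans[OF fr3 fr']) auto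
     moreover have "?W3 (ad 12 j) = W (ad 12 j)" if "j < 2 * m" for j
      using frame_slot[OF fr2 ns(2) that] by (simp add: ad_reg)
     ultimately show "?Q W' X'" using ** by auto
    qed simp
   qed
  qed
 qed
 then show ?thesis
  unfolding o'_def[symmetric]
 proof (rule ends_mono)
  have "2 * h \<le> (l + 1) * (2 * h)" by simp
  moreover have "2 \<le> 2 * h" using h0 by simp
  moreover have "2 * h * (2 + 6) = 16 * h" by simp
  moreover have "700 * (l + 1) * (2 * h) = 700 * ((l + 1) * (2 * h))" "340 * (l + 1) * (2 * h) = 340 * ((l + 1) * (2 * h))"
   by (simp_all only: mult.assoc)
  ultimately show "?T + (?T + (4 + (3 + 2 * h * (2 + 6)))) \<le> 700 * (l + 1) * (2 * h)" by linarith
 qed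
qed

lemma down_level_ends:
 assumes env: "env W" and j: "j < u" and r: "W 56 = j"
  and T: "\<And>l i. l \<le> u \<Longrightarrow> i < mb \<Longrightarrow> W (ad 7 (l * mb + i)) = tval x l i"
  and V: "\<And>i. i < mb \<Longrightarrow> W (ad 12 i) = vval x c (u - j) i"
 shows "ends down_level (710 * u * mb + 11) (\<lambda>W' X'. X' = X \<and> frame (treeR - {56, 61}) evalS W W' \<and>
   (\<forall>i<mb. W' (ad 12 i) = vval x c (u - Suc j) i)) W X"
proof -
 define l where "l = u - 1 - j"
 have l: "l < u" "Suc l = u - j" "u - Suc j = l" using j by (auto simp: l_def)
 define h where "h = (2::nat) ^ l"
 define nv where "nv = mb div (2 * h)"
 have nv: "nv * (2 * h) = mb"
  unfolding nv_def h_def mb_eq using l(1) by (intro dvd_div_mult_self) (metis Suc_leI le_imp_power_dvd power_Suc)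
 have h0: "0 < h" by (simp add: h_def)
 have mbm: "mb \<le> m" by (rule u_props)
 have mb0: "0 < mb" by (simp add: mb_eq)
 have nv0: "0 < nv" using nv mb0 by (cases nv) auto
 have hm: "2 * h \<le> mb" using nv nv0 by (metis One_nat_def Suc_leI mult_le_mono1 nat_mult_1)
 have lm: "l * mb + mb \<le> m" using level_index[of l "mb - 1"] l mb0 by simp
 have ns: "7 < NS" "12 < NS" using slot_less by auto
 let ?W1 = "W(60 := ad 7 (l * mb), 58 := h, 62 := Suc l, 48 := 2 * h, 59 := nv)"
 have fr1: "frame (treeR - {56, 61}) evalS W ?W1" by (intro frame_upd_reg) auto
 have env1: "env ?W1" by (rule env_frame[OF env fr1]) auto
 have e: "eval_op Sub w u 1 = u - 1" "eval_op Sub w (u - 1) j = l" "eval_op Mul w l mb = l * mb" "eval_op Shl w 1 l = h"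
  "eval_op Add w l 1 = Suc l" "eval_op Add w h h = 2 * h" "eval_op Add w (ad 7 0) (l * mb) = ad 7 (l * mb)"
 proof -
  have b: "h < 2 ^ w" "h + h < 2 ^ w" "l * mb < 2 ^ w" "u < 2 ^ w" "l + 1 < 2 ^ w"
   using hm mbm lm u_mb l by (auto intro!: small_less)
  show "eval_op Sub w u 1 = u - 1" "eval_op Sub w (u - 1) j = l" using b j unfolding l_def by (intro ev_sub; linarith)+
  show "eval_op Mul w l mb = l * mb" "eval_op Shl w 1 l = h" "eval_op Add w l 1 = Suc l" "eval_op Add w h h = 2 * h"
   using b ev_shl[of 1 l w] ev_add[of h h w] ev_mul[of l mb w] ev_add[of l 1 w] by (simp_all add: h_def)
  show "eval_op Add w (ad 7 0) (l * mb) = ad 7 (l * mb)" using ad_add[of 7 0 "l * mb"] ns lm mb0 by simp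
 qed
 let ?P = "\<lambda>v A X'. X' = X \<and> (\<forall>i<mb. A 12 i = (if i < v * (2 * h) then vval x c l i else vval x c (Suc l) i))"
 let ?B = "700 * (l + 1) * (2 * h)"
 have sw: "W(48 := l, 60 := ad 7 (l * mb), 58 := h, 62 := Suc l, 48 := 2 * h, 59 := nv) = ?W1" by auto
 let ?post2 = "\<lambda>W' X'. frame (nodeR \<union> {57}) evalS ?W1 W' \<and> ?P nv (arr W') X'"
 have "ends down_level (8 + (3 + nv * (?B + 4))) ?post2 W X"
  unfolding down_level_def
 proof (rule ends_preI)
  show "ends (sub 48 9 14 ;; sub 48 48 56 ;; mul 60 48 10 ;; add 60 21 60 ;; shl 58 14 48 ;; add 62 48 14 ;; add 48 58 58 ;; quo 59 10 48) 8
    (\<lambda>W' X'. W' = ?W1 \<and> X' = X) W X"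
   unfolding ends_def using r e sw env_regs[OF env] nv_def[symmetric] by (simp add: reg_less ev_div)
  show "ends (For 57 59 down_node) (3 + nv * (?B + 4)) ?post2 ?W1 X"
  proof (rule loop_ends[where P = ?P])
   have "nv * 1 \<le> nv * (2 * h)" using h0 by (intro mult_le_mono2) simp
   then show "nv < 2 ^ w" using nv mbm by (intro small_less) linarith
   show "?P 0 (arr ?W1) X" using V l by (simp add: arr_def ad_reg)
   fix v W' X' assume v: "v < nv" and fr: "frame (nodeR \<union> {57}) evalS ?W1 W'" and r57: "W' 57 = v" and P: "?P v (arr W') X'"
   have X': "X' = X" using P by simp
   have env': "env W'" by (rule env_frame[OF env1 fr]) auto
   have vb: "v * (2 * h) + 2 * h \<le> mb"
   proof -
    have "Suc v * (2 * h) \<le> nv * (2 * h)" using v by (intro mult_le_mono1) simp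
    then show ?thesis by (simp add: nv)
   qed
   let ?post1 = "\<lambda>W'' X''. X'' = X \<and> frame nodeR evalS W' W'' \<and> (\<forall>j<2*m. W'' (ad 12 j) = (if v * (2 * h) \<le> j \<and> j < v * (2 * h) + 2 * h then vval x c l j else W' (ad 12 j)))"
   have "ends down_node ?B ?post1 W' X"
   proof (rule down_node_ends[OF env' l(1) h_def vb r57])
    show "W' 58 = h" "W' 60 = ad 7 (l * mb)" "W' 62 = Suc l" using frame_reg[OF fr] by auto
    show "W' (ad 7 (l * mb + i)) = tval x l i" if "i < mb" for i
     using frame_slot[OF fr ns(1), of "l * mb + i"] T[of l i] l that lm by (auto simp: ad_reg)
    show "W' (ad 12 (v * (2 * h) + e)) = vval x c (Suc l) (v * (2 * h) + e)" if "e < 2 * h" for e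
     using P vb that by (auto simp: arr_def)
   qed
   then show "ends down_node ?B (\<lambda>W'' X''. frame (nodeR \<union> {57} - {57}) evalS W' W'' \<and> ?P (Suc v) (arr W'') X'') W' X'"
    unfolding X'
   proof (rule ends_mono)
    fix W'' X'' assume *: "?post1 W'' X''"
    then have fr': "frame nodeR evalS W' W''" by simp
    have "frame (nodeR \<union> {57} - {57}) evalS W' W''"
     by (rule frame_trans[OF fr' frame_refl[of "{}" "{}"]]) auto
    moreover have "W'' (ad 12 i) = (if i < Suc v * (2 * h) then vval x c l i else vval x c (Suc l) i)" if "i < mb" for i
     using * P that mbm by (auto simp: arr_def)
    ultimately show "frame (nodeR \<union> {57} - {57}) evalS W' W'' \<and> ?P (Suc v) (arr W'') X''"
     using * by (simp add: arr_def)
   qed simp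
  qed auto
 qed
 then show ?thesis
 proof (rule ends_mono)
  fix W' X' assume *: "?post2 W' X'"
  then have fr': "frame (nodeR \<union> {57}) evalS ?W1 W'" by blast
  have "frame (treeR - {56, 61}) evalS W W'" by (rule frame_trans[OF fr1 fr']) auto
  then show "X' = X \<and> frame (treeR - {56, 61}) evalS W W' \<and> (\<forall>i<mb. W' (ad 12 i) = vval x c (u - Suc j) i)"
   using * nv l(3) by (simp add: arr_def)
 next
  have "nv * (?B + 4) = 700 * ((l + 1) * (nv * (2 * h))) + nv * 4" by (simp add: algebra_simps)
  then have 1: "nv * (?B + 4) = 700 * ((l + 1) * mb) + nv * 4" by (simp only: nv)
  have 2: "(l + 1) * mb \<le> u * mb" using l by (intro mult_le_mono1) simp
  have "nv * 2 \<le> nv * (2 * h)" using h0 by (intro mult_le_mono2) simp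
  then have 3: "nv * 2 \<le> mb" by (simp only: nv)
  have 4: "mb \<le> u * mb" using l by simp
  have "710 * u * mb = 710 * (u * mb)" by simp
  with 1 2 3 4 show "8 + (3 + nv * (?B + 4)) \<le> 710 * u * mb + 11" by linarith
 qed
qed

lemma down_ends:
 assumes env: "env W"
  and T: "\<And>l i. l \<le> u \<Longrightarrow> i < mb \<Longrightarrow> W (ad 7 (l * mb + i)) = tval x l i"
  and V: "\<And>i. i < mb \<Longrightarrow> W (ad 12 i) = res (transposed x c m 0 mb i)"
 shows "ends down (800 * mb * (u + 1) * (u + 1)) (\<lambda>W' X'. X' = X \<and> frame (treeR - {61}) evalS W W' \<and>
   (\<forall>i<mb. W' (ad 12 i) = res (\<Sum>b<m. int (c b) * int (x i) ^ b))) W X"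
proof -
 let ?P = "\<lambda>j A X'. X' = X \<and> (\<forall>i<mb. A 12 i = vval x c (u - j) i)"
 have mbm: "mb \<le> m" by (rule u_props)
 have ns: "7 < NS" using slot_less by auto
 let ?post1 = "\<lambda>W' X'. frame (treeR - {61}) evalS W W' \<and> ?P u (arr W') X'"
 have "ends down (3 + u * (710 * u * mb + 11 + 4)) ?post1 W X"
  unfolding down_def
 proof (rule loop_ends[where P = ?P])
  show "u < 2 ^ w" using mbm u_mb by (intro small_less) linarith
  have "vval x c u i = res (transposed x c m 0 mb i)" if "i < mb" for i
   using vval_node[of i u x c 0] that by (simp add: mb_eq)
  then show "?P 0 (arr W) X" using V by (simp add: arr_def)
  fix j W' X' assume j: "j < u" and fr: "frame (treeR - {61}) evalS W W'" and r: "W' 56 = j" and P: "?P j (arr W') X'"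
  have X': "X' = X" using P by simp
  have env': "env W'" by (rule env_frame[OF env fr]) auto
  have T': "W' (ad 7 (l * mb + i)) = tval x l i" if "l \<le> u" "i < mb" for l i
   using frame_slot[OF fr ns, of "l * mb + i"] T[OF that] level_index[OF that] by auto
  have "ends down_level (710 * u * mb + 11) (\<lambda>W'' X''. X'' = X \<and> frame (treeR - {56, 61}) evalS W' W'' \<and>
    (\<forall>i<mb. W'' (ad 12 i) = vval x c (u - Suc j) i)) W' X"
   by (rule down_level_ends[OF env' j r T']) (use P in \<open>auto simp: arr_def\<close>)
  moreover have "treeR - {61} - {56} = treeR - {56, 61}" by auto
  ultimately show "ends down_level (710 * u * mb + 11) (\<lambda>W'' X''. frame (treeR - {61} - {56}) evalS W' W'' \<and> ?P (Suc j) (arr W'') X'') W' X'"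
   unfolding X' by (simp only:) (erule ends_mono, auto simp: arr_def)
 qed (use env_regs[OF env] in auto)
 then show ?thesis
 proof (rule ends_mono)
  fix W' X' assume *: "?post1 W' X'"
  have "vval x c 0 i = res (\<Sum>b<m. int (c b) * int (x i) ^ b)" for i
   using transposed_leaf[of x c m i] by (simp add: vval_def)
  then show "X' = X \<and> frame (treeR - {61}) evalS W W' \<and> (\<forall>i<mb. W' (ad 12 i) = res (\<Sum>b<m. int (c b) * int (x i) ^ b))"
   using * by (simp add: arr_def)
 next
  have mb1: "1 \<le> mb" by (simp add: mb_eq)
  have e: "u * (710 * u * mb + 11 + 4) = 710 * (mb * (u * u)) + 15 * u"
   "800 * mb * (u + 1) * (u + 1) = 800 * (mb * (u * u)) + 1600 * (mb * u) + 800 * mb" by (simp_all add: algebra_simps)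
  have "u \<le> mb * u" using mb1 by simp
  then show "3 + u * (710 * u * mb + 11 + 4) \<le> 800 * mb * (u + 1) * (u + 1)"
   unfolding e using mb1 by linarith
 qed
qed

text \<open>Tree and inverse series depend on the points but not on the row, so they are computed
  once per batch and shared by all \<open>R\<close> rows.\<close>

definition prepared :: "words \<Rightarrow> words \<Rightarrow> bool" where
 "prepared x W \<longleftrightarrow> (\<forall>l\<le>u. \<forall>i<mb. W (ad 7 (l * mb + i)) = tval x l i) \<and> (\<forall>t<m. W (ad 8 t) = res (ser x $ t))"

lemma prepared_frame:
 assumes "prepared x W" "frame Rs Ss W W'" "7 \<notin> Ss" "8 \<notin> Ss"
 shows "prepared x W'"
proof -
 have "W' (ad 7 j) = W (ad 7 j)" "W' (ad 8 j) = W (ad 8 j)" if "j < m" for j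
  using frame_slot[OF assms(2)] assms(3,4) slot_less that by auto
 then show ?thesis using assms(1) level_index unfolding prepared_def by auto
qed

text \<open>Here the batch size pays off: a pass over the tree, with \<open>u\<close> levels of
  convolutions, costs no more than a constant number of convolutions of length
  \<open>2 * m\<close>.\<close>

lemma fit_k: "mb * (u + 1) * (u + 1) \<le> k * m"
proof -
 have "(mb * (u + 1)) * (u + 1) \<le> m * k" using fit u_less by (intro mult_le_mono) auto
 then show ?thesis by (simp add: mult.commute)
qed

lemma prepare_ends:
 assumes env: "env W" and x: "\<And>j. j < mb \<Longrightarrow> W (ad 11 j) = x j" "\<And>j. j < mb \<Longrightarrow> x j < p"
 shows "ends (tree_up ;; newton) (8000 * k * m) (\<lambda>W' X'. X' = X \<and> frame treeR {2..<9} W W' \<and> prepared x W') W X"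
proof (rule ends_Seq[OF tree_up_ends[OF env x]])
 fix W1 X1 assume *: "X1 = X \<and> frame treeR {2..<8} W W1 \<and> (\<forall>l\<le>u. \<forall>i<mb. W1 (ad 7 (l * mb + i)) = tval x l i)"
 then have X1: "X1 = X" and fr1: "frame treeR {2..<8} W W1" by blast+
 have env1: "env W1" by (rule env_frame[OF env fr1]) auto
 let ?post1 = "\<lambda>W' X'. X' = X \<and> frame treeR newtonS W1 W' \<and> (\<forall>t<m. W' (ad 8 t) = res (ser x $ t))"
 have "ends newton (7000 * k * m) ?post1 W1 X"
  by (rule newton_ends[OF env1]) (use * in blast)
 then show "ends newton (7000 * k * m) (\<lambda>W' X'. X' = X \<and> frame treeR {2..<9} W W' \<and> prepared x W') W1 X1"
  unfolding X1
 proof (rule ends_mono)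
  fix W' X' assume **: "?post1 W' X'"
  then have fr': "frame treeR newtonS W1 W'" by blast
  have "frame treeR {2..<9} W W'" by (rule frame_trans[OF fr1 fr']) auto
  moreover have "W' (ad 7 (l * mb + i)) = tval x l i" if "l \<le> u" "i < mb" for l i
   using frame_slot[OF fr', of 7 "l * mb + i"] * that level_index[OF that] slot_less by auto
  ultimately show "X' = X \<and> frame treeR {2..<9} W W' \<and> prepared x W'" using ** unfolding prepared_def by blast
 qed simp
next
 have "400 * mb * (u + 1) * (u + 1) = 400 * (mb * (u + 1) * (u + 1))" "7000 * k * m = 7000 * (k * m)" "8000 * k * m = 8000 * (k * m)"
  by simp_all
 with fit_k show "400 * mb * (u + 1) * (u + 1) + 7000 * k * m \<le> 8000 * k * m" by linarith
qed

lemma evaluate_ends: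
 assumes env: "env W" and r: "r < R" "W 61 = r" and P: "prepared x W" and cf: "\<And>t. t < m \<Longrightarrow> cf r t \<le> p"
 shows "ends (root ;; down) (3000 * k * m) (\<lambda>W' X'. X' = X \<and> frame (treeR - {61}) evalS W W' \<and>
   (\<forall>i<mb. W' (ad 12 i) = (\<Sum>b<m. cf r b * x i ^ b) mod p)) W X"
proof (rule ends_Seq)
 let ?post1 = "\<lambda>W' X'. X' = X \<and> frame nodeR ({2..<7} \<union> {12}) W W' \<and> (\<forall>i<mb. W' (ad 12 i) = res (transposed x (cf r) m 0 mb i))"
 show "ends root (2000 * k * m) ?post1 W X"
  by (rule root_ends[OF env r]) (use P cf in \<open>auto simp: prepared_def\<close>)
 fix W1 X1 assume *: "?post1 W1 X1"
 then have X1: "X1 = X" and fr1: "frame nodeR ({2..<7} \<union> {12}) W W1" by blast+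
 have env1: "env W1" by (rule env_frame[OF env fr1]) auto
 have P1: "prepared x W1" by (rule prepared_frame[OF P fr1]) auto
 let ?post2 = "\<lambda>W' X'. X' = X \<and> frame (treeR - {61}) evalS W1 W' \<and> (\<forall>i<mb. W' (ad 12 i) = res (\<Sum>b<m. int (cf r b) * int (x i) ^ b))"
 have "ends down (800 * mb * (u + 1) * (u + 1)) ?post2 W1 X"
  by (rule down_ends[OF env1]) (use P1 * in \<open>auto simp: prepared_def\<close>)
 then show "ends down (800 * mb * (u + 1) * (u + 1)) (\<lambda>W' X'. X' = X \<and> frame (treeR - {61}) evalS W W' \<and>
   (\<forall>i<mb. W' (ad 12 i) = (\<Sum>b<m. cf r b * x i ^ b) mod p)) W1 X1"
  unfolding X1
 proof (rule ends_mono)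
  fix W' X' assume **: "?post2 W' X'"
  then have fr': "frame (treeR - {61}) evalS W1 W'" by blast
  have "frame (treeR - {61}) evalS W W'" by (rule frame_trans[OF fr1 fr']) auto
  moreover have "res (\<Sum>b<m. int (cf r b) * int (x i) ^ b) = (\<Sum>b<m. cf r b * x i ^ b) mod p" for i
   by (rule res_congI[symmetric]) simp
  ultimately show "X' = X \<and> frame (treeR - {61}) evalS W W' \<and> (\<forall>i<mb. W' (ad 12 i) = (\<Sum>b<m. cf r b * x i ^ b) mod p)"
   using ** by simp
 qed simp
next
 have "800 * mb * (u + 1) * (u + 1) = 800 * (mb * (u + 1) * (u + 1))" "2000 * k * m = 2000 * (k * m)" "3000 * k * m = 3000 * (k * m)"
  by simp_all
 with fit_k show "2000 * k * m + 800 * mb * (u + 1) * (u + 1) \<le> 3000 * k * m" by linarith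
qed

end

section \<open>Updates and queries\<close>

text \<open>Among the registers only cell \<open>1\<close> keeps its meaning between operations. It
  points to slot 1, where the content of register \<open>i\<close> is saved at offset
  \<open>i\<close>.\<close>

definition load_params :: "nat list \<Rightarrow> com" where
 "load_params il = foldr (\<lambda>i c. (cst 2 i ;; add 2 1 2 ;; load i 2) ;; c) il Skip"

definition save_count :: com where
 "save_count = cst 2 31 ;; add 2 1 2 ;; store 2 31"

text \<open>The address of the counter for point number 56 in row 61. The counters begin at real
  cell \<open>8 + mb\<close>, behind the scratch cells and the buffered increments.\<close>

definition bucket_addr :: com where
 "bucket_addr = add 36 26 56 ;; load 36 36 ;; rem 36 36 7 ;; mul 37 61 7 ;; add 36 36 37 ;;
   cst 37 8 ;; add 37 37 10 ;; add 36 36 37"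

definition flush_body :: com where
 "flush_body = bucket_addr ;; cst 37 8 ;; add 37 37 56 ;; Prim (RLoad 2 37) ;; Prim (RLoad 3 36) ;;
   Prim (RAdd 3 3 2) ;; Prim (RStore 36 3)"

definition flush :: com where
 "flush = (tree_up ;; newton) ;; For 61 11 ((root ;; down) ;; For 56 31 flush_body)"

text \<open>Real cell \<open>8 + j\<close> keeps the increment of the buffered update
  \<open>j\<close>. Real cell \<open>1\<close> keeps the running sum, which is the norm because no
  coordinate is negative.\<close>

definition update_main :: com where
 "update_main = load_params [3..<32] ;;
   (add 36 25 31 ;; store 36 0 ;; cst 37 8 ;; add 37 37 31 ;; Prim (RStore 37 0) ;; Prim (RAdd 1 1 0) ;; add 31 31 14) ;;
   IfW 31 10 Skip (flush ;; cst 31 0) ;; save_count"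

text \<open>The last batch may reach beyond \<open>n\<close>. Its surplus points are replaced by
  \<open>0\<close> to obtain valid input, and \<open>scan_flags\<close> keeps them off the
  list.\<close>

definition scan_points :: com where
 "scan_points = mul 36 63 10 ;; add 41 36 35 ;; IfW 41 12 Skip (cst 41 0)"

definition scan_flags :: com where
 "scan_flags = mul 36 63 10 ;; add 42 36 35 ;; cst 41 0 ;; IfW 42 12 (cst 41 1) Skip"

text \<open>Reals can be added but not multiplied, so the counter is doubled \<open>a\<close> times
  before the comparison with the norm. A failing row clears the flag for good.\<close>

definition scan_test :: com where
 "scan_test = bucket_addr ;; Prim (RLoad 2 36) ;; For 57 13 (Prim (RAdd 2 2 2)) ;;
   IfR 2 1 (add 36 28 56 ;; cst 37 0 ;; store 36 37) Skip"

text \<open>Slot 0 starts at address 64, directly behind the registers, so that the list continues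
  the output. Register 0 counts its entries.\<close>

definition scan_append :: com where
 "scan_append = add 36 28 56 ;; load 36 36 ;; cst 37 0 ;;
   IfW 37 36 (add 36 25 56 ;; load 36 36 ;; cst 37 64 ;; add 37 37 0 ;; store 37 36 ;; add 0 0 14) Skip"

definition scan_block :: com where
 "scan_block = map_loop 10 25 scan_points ;; map_loop 10 28 scan_flags ;; (tree_up ;; newton) ;;
   For 61 11 ((root ;; down) ;; For 56 10 scan_test) ;; For 56 10 scan_append"

definition clear :: "nat list \<Rightarrow> com" where
 "clear il = foldr (\<lambda>i c. cst i 0 ;; c) il Skip"

text \<open>The guard excludes the zero vector, for which every coordinate passes all tests and the
  list would have \<open>n\<close> entries. Real cell \<open>2\<close> serves as the constant zero,
  obtained as a difference. The 63 added to the length accounts for cells 1 to 63 in front of the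
  list.\<close>

definition query_main :: com where
 "query_main = load_params [3..<32] ;; flush ;; cst 31 0 ;; save_count ;; (cst 0 0 ;; Prim (RSub 2 1 1)) ;;
   IfR 2 1 (For 63 30 scan_block) Skip ;; (cst 2 63 ;; add 0 0 2) ;; clear [2..<64]"

primrec push :: "reals \<Rightarrow> words \<Rightarrow> reals \<Rightarrow> nat \<Rightarrow> nat \<Rightarrow> real" where
 "push y i d 0 = y"
| "push y i d (Suc j) = (push y i d j)(i j := push y i d j (i j) + d j)"

lemma push_cong: "(\<And>j. j < c \<Longrightarrow> i j = i' j \<and> d j = d' j) \<Longrightarrow> push y i d c = push y i' d' c"
 by (induction c) auto

context machine
begin

lemma ends_IfW:
 assumes "a < lw" "b < lw" "W a < W b \<Longrightarrow> ends c T Q W X" "\<not> W a < W b \<Longrightarrow> ends d T Q W X"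
 shows "ends (IfW a b c d) (T + 2) Q W X"
proof (cases "W a < W b")
 case True
 from assms(3)[OF this] have "wp c (\<lambda>t. (\<lambda>t (W', X'). t \<le> T + 2 \<and> Q W' X') (t + 1)) (W, X)"
  unfolding ends_def by (rule wp_mono) auto
 then show ?thesis unfolding ends_def using True assms(1,2) by simp
next
 case False
 from assms(4)[OF this] have "wp d (\<lambda>t. (\<lambda>t (W', X'). t \<le> T + 2 \<and> Q W' X') (t + 2)) (W, X)"
  unfolding ends_def by (rule wp_mono) auto
 then show ?thesis unfolding ends_def using False assms(1,2) by simp
qed

lemma ends_cst0: "d < lw \<Longrightarrow> Q (W(d := 0)) X \<Longrightarrow> ends (cst d 0) 1 Q W X"
 by (simp add: ends_def)

lemma ends_IfR:
 assumes "a < lr" "b < lr" "X a < X b \<Longrightarrow> ends c T Q W X" "\<not> X a < X b \<Longrightarrow> ends d T Q W X"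
 shows "ends (IfR a b c d) (T + 2) Q W X"
proof (cases "X a < X b")
 case True
 from assms(3)[OF this] have "wp c (\<lambda>t. (\<lambda>t (W', X'). t \<le> T + 2 \<and> Q W' X') (t + 1)) (W, X)"
  unfolding ends_def by (rule wp_mono) auto
 then show ?thesis unfolding ends_def using True assms(1,2) by simp
next
 case False
 from assms(4)[OF this] have "wp d (\<lambda>t. (\<lambda>t (W', X'). t \<le> T + 2 \<and> Q W' X') (t + 2)) (W, X)"
  unfolding ends_def by (rule wp_mono) auto
 then show ?thesis unfolding ends_def using False assms(1,2) by simp
qed

lemma ends_Skip: "Q W X \<Longrightarrow> ends Skip T Q W X"
 by (simp add: ends_def)

end

text \<open>\<open>n_gt\<close> makes \<open>64 + 2 * m\<close>, the permanent content of cell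
  \<open>1\<close>, a coordinate that may appear in the output.\<close>

locale counters = batch +
 assumes lr_eq: "lr = 8 + mb + R * m" and n_le: "n \<le> nblk * mb" and blk_less: "nblk * mb < 2 ^ w"
  and cf_less: "\<And>r t. r < R \<Longrightarrow> t < m \<Longrightarrow> cf r t < p" and a_less: "a \<le> k" and n_gt: "64 + 2 * m < n"
begin

section \<open>Stored parameters and buffered counters\<close>

definition param :: "nat \<Rightarrow> nat" where
 "param i = [p, f, HB, HF, m, k, u, mb, R, n, a, 1, 2, ad 2 0, ad 3 0, ad 4 0, ad 5 0, ad 6 0, ad 7 0, ad 8 0,
   ad 9 0, ad 10 0, ad 11 0, ad 12 0, ad 13 0, ad 14 0, ad 15 0, nblk] ! (i - 3)"

text \<open>What survives between operations besides the buffer and the counters. In contrast to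
  \<open>env\<close>, no register other than cell \<open>1\<close> is involved.\<close>

definition stat :: "words \<Rightarrow> bool" where
 "stat W \<longleftrightarrow> W 1 = ad 1 0 \<and> (\<forall>i\<in>{3..<31}. W (ad 1 i) = param i) \<and>
   (\<forall>t<m. W (ad 9 t) = rep w (fst (tab t)) \<and> W (ad 10 t) = rep w (snd (tab t))) \<and>
   (\<forall>r<R. \<forall>t<m. W (ad (15 + r) t) = cf r t)"

lemma stat_frame:
 assumes "stat W" "frame Rs Ss W W'" "1 \<notin> Rs" "Ss \<subseteq> {0} \<union> {2..<9} \<union> {11..<15}"
 shows "stat W'"
proof -
 have "W' 1 = W 1" using frame_reg[OF assms(2)] assms(3) by simp
 moreover have "W' (ad s t) = W (ad s t)" if "s \<in> {1, 9, 10} \<union> {15..<NS}" "t < 2 * m" for s t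
  by (rule frame_slot[OF assms(2)]) (use assms(4) that slot_less(1) in auto)
 ultimately show ?thesis
  using assms(1) NS_eq m_ge unfolding stat_def by simp
qed

lemma load_params_ends:
 assumes "set il \<subseteq> {3..<64}" "W 1 = ad 1 0"
 shows "ends (load_params il) (3 * length il) (\<lambda>W' X'. X' = X \<and> (\<forall>r. r \<notin> set il \<longrightarrow> r \<noteq> 2 \<longrightarrow> W' r = W r) \<and>
   (\<forall>r\<in>set il. W' r = W (ad 1 r))) W X"
 using assms
proof (induction il arbitrary: W)
 case Nil
 then show ?case by (simp add: load_params_def ends_Skip)
next
 case (Cons i il)
 have i: "3 \<le> i" "i < 64" "i < 2 * m" using Cons.prems m_ge by auto
 have ns: "1 < NS" using slot_less by auto
 let ?W1 = "W(2 := ad 1 i, i := W (ad 1 i))"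
 have lp: "load_params (i # il) = (cst 2 i ;; add 2 1 2 ;; load i 2) ;; load_params il" by (simp add: load_params_def)
 have e: "i mod 2 ^ w = i" using i small_less[of i] by simp
 let ?post1 = "\<lambda>W' X'. X' = X \<and> (\<forall>r. r \<notin> set il \<longrightarrow> r \<noteq> 2 \<longrightarrow> W' r = ?W1 r) \<and> (\<forall>r\<in>set il. W' r = ?W1 (ad 1 r))"
 have "ends (load_params (i # il)) (3 + 3 * length il) ?post1 W X"
  unfolding lp
 proof (rule ends_preI)
  show "ends (cst 2 i ;; add 2 1 2 ;; load i 2) 3 (\<lambda>W' X'. W' = ?W1 \<and> X' = X) W X"
   unfolding ends_def using i ns e Cons.prems ad_add[of 1 0 i] by (simp add: reg_less ad_less ad_reg)
  show "ends (load_params il) (3 * length il) ?post1 ?W1 X"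
   by (rule Cons.IH) (use Cons.prems i in auto)
 qed
 then show ?case
 proof (rule ends_mono)
  fix W' X' assume *: "?post1 W' X'"
  have "?W1 (ad 1 r) = W (ad 1 r)" for r using i by (simp add: ad_reg)
  with * show "X' = X \<and> (\<forall>r. r \<notin> set (i # il) \<longrightarrow> r \<noteq> 2 \<longrightarrow> W' r = W r) \<and> (\<forall>r\<in>set (i # il). W' r = W (ad 1 r))"
   using i by (auto simp: ad_reg)
 qed simp
qed

lemma load_ends:
 assumes "stat W"
 shows "ends (load_params [3..<32]) 87 (\<lambda>W' X'. X' = X \<and> env W' \<and> stat W' \<and> W' 31 = W (ad 1 31) \<and> W' 0 = W 0 \<and>
  (\<forall>s t. W' (ad s t) = W (ad s t))) W X"
proof (rule ends_mono[OF load_params_ends])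
 show "W 1 = ad 1 0" using assms by (simp add: stat_def)
 fix W' X' assume "X' = X \<and> (\<forall>r. r \<notin> set [3..<32] \<longrightarrow> r \<noteq> 2 \<longrightarrow> W' r = W r) \<and> (\<forall>r\<in>set [3..<32]. W' r = W (ad 1 r))"
 then have *: "X' = X" "\<And>r. r \<notin> {3..<32} \<Longrightarrow> r \<noteq> 2 \<Longrightarrow> W' r = W r" "\<And>r. r \<in> {3..<32} \<Longrightarrow> W' r = W (ad 1 r)"
  unfolding set_upt by blast+
 have sl: "W' (ad s t) = W (ad s t)" for s t by (rule *(2)) (auto simp: ad_def)
 have r01: "W' 0 = W 0" "W' 1 = W 1" by (auto intro: *(2))
 have r31: "W' 31 = W (ad 1 31)" by (rule *(3)) simp
 have st: "stat W'" using assms sl r01 unfolding stat_def by simp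
 have pr: "W' i = param i" if "i \<in> {3..<31}" for i using *(3)[of i] that assms by (simp add: stat_def)
 have "env W'" unfolding env_def
  using pr[of 3] pr[of 4] pr[of 5] pr[of 6] pr[of 7] pr[of 8] pr[of 9] pr[of 10] pr[of 11] pr[of 12] pr[of 13] pr[of 14] pr[of 15]
   pr[of 16] pr[of 17] pr[of 18] pr[of 19] pr[of 20] pr[of 21] pr[of 22] pr[of 23] pr[of 24] pr[of 25] pr[of 26] pr[of 27]
   pr[of 28] pr[of 29] pr[of 30] st
  by (simp add: param_def stat_def)
 then show "X' = X \<and> env W' \<and> stat W' \<and> W' 31 = W (ad 1 31) \<and> W' 0 = W 0 \<and> (\<forall>s t. W' (ad s t) = W (ad s t))"
  using *(1) r01 r31 sl st by blast
qed auto

lemma save_ends: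
 assumes "stat W" "W 31 = c"
 shows "ends save_count 3 (\<lambda>W' X'. X' = X \<and> stat W' \<and> W' (ad 1 31) = c \<and> frame {2} {1} W W') W X"
proof -
 let ?W = "W(2 := ad 1 31, ad 1 31 := c)"
 have b: "31 < 2 * m" "1 < NS" using m_ge slot_less by auto
 have e: "31 mod 2 ^ w = (31::nat)" using small_less[of 31] b by simp
 have fr: "frame {2} {1} W ?W" using b by (intro frame_upd_slot frame_upd_reg) auto
 have "?W (ad s t) = W (ad s t)" if "t < 2 * m" "s \<noteq> 1 \<or> t \<noteq> 31" for s t
  using that b by (auto simp: ad_reg ad_inj)
 then have "stat ?W" using assms(1) m_ge unfolding stat_def by (simp add: ad_reg)
 then show ?thesis
  unfolding ends_def save_count_def using assms b e fr ad_add[of 1 0 31]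
  by (simp add: reg_less ad_less ad_reg stat_def)
qed

definition caddr :: "nat \<Rightarrow> nat \<Rightarrow> nat" where
 "caddr r b = 8 + mb + r * m + b"

lemma caddr_inj: "b < m \<Longrightarrow> b' < m \<Longrightarrow> caddr r b = caddr r' b' \<longleftrightarrow> r = r' \<and> b = b'"
proof
 assume b: "b < m" "b' < m" "caddr r b = caddr r' b'"
 then have *: "r * m + b = r' * m + b'" by (simp add: caddr_def)
 from b(1,2) have "(r * m + b) mod m = b" "(r' * m + b') mod m = b'" by simp_all
 then have "b = b'" using * by simp
 then show "r = r' \<and> b = b'" using * m_pos by auto
qed auto

lemma caddr_less: "r < R \<Longrightarrow> b < m \<Longrightarrow> caddr r b < lr"
proof -
 assume "r < R" "b < m"
 then have "r * m + b < Suc r * m" by simp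
 also have "\<dots> \<le> R * m" using \<open>r < R\<close> by (intro mult_le_mono1) simp
 finally show ?thesis by (simp add: caddr_def lr_eq)
qed

lemma lr_less: "lr < 2 ^ w"
proof -
 have "NS * (2 * m) = 30 * m + 2 * (R * m)" by (simp add: NS_eq algebra_simps)
 then show ?thesis using lw lw_small u_props(2) unfolding lr_eq by linarith
qed

lemma bucket_addr_ends:
 assumes env: "env W" and r: "W 61 = r" "r < R" and j: "W 56 = j" "j < mb" and v: "W (ad 12 j) = v"
 shows "ends bucket_addr 8 (\<lambda>W' X'. W' = W(36 := caddr r (v mod m), 37 := 8 + mb) \<and> X' = X) W X"
proof -
 have b: "12 < NS" "j < 2 * m" "mb \<le> m" using slot_less u_props j by auto
 have c: "caddr r (v mod m) < 2 ^ w" using caddr_less[OF r(2), of "v mod m"] lr_less m_pos by simp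
 then have s: "r * m < 2 ^ w" "v mod m + r * m < 2 ^ w" "8 + mb < 2 ^ w" "v mod m + r * m + (8 + mb) < 2 ^ w"
  by (auto simp: caddr_def)
 have e8: "8 mod 2 ^ w = (8::nat)" using s(3) by simp
 have e: "eval_op Mul w r m = r * m" "eval_op Add w (v mod m) (r * m) = v mod m + r * m" "eval_op Add w 8 mb = 8 + mb"
  "eval_op Add w (v mod m + r * m) (8 + mb) = caddr r (v mod m)"
  using ev_mul[OF s(1)] ev_add[OF s(2)] ev_add[OF s(3)] ev_add[OF s(4)] by (simp_all add: caddr_def)
 have sw: "W(36 := v mod m + r * m, 37 := 8 + mb, 36 := caddr r (v mod m)) = W(36 := caddr r (v mod m), 37 := 8 + mb)" by auto
 show ?thesis
  unfolding bucket_addr_def ends_def using r j v b e e8 sw env_regs[OF env] ad_add[of 12 0 j]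
  by (simp add: reg_less ad_less ad_reg ev_mod fun_upd_twist)
qed

definition hv :: "nat \<Rightarrow> nat \<Rightarrow> nat" where
 "hv r i = poly_hash p m (cf r) i"

lemma hv_less: "hv r i < m"
 using m_pos by (simp add: hv_def poly_hash_def)

definition csum :: "nat \<Rightarrow> nat \<Rightarrow> reals \<Rightarrow> real" where
 "csum r b y = (\<Sum>i | i < n \<and> hv r i = b. y i)"

lemma csum_upd: "i < n \<Longrightarrow> csum r b (y(i := y i + d)) = csum r b y + (if hv r i = b then d else 0)"
proof -
 assume i: "i < n"
 have "csum r b (y(i := y i + d)) = (\<Sum>j | j < n \<and> hv r j = b. y j + (if j = i then d else 0))"
  unfolding csum_def by (rule sum.cong) auto
 also have "\<dots> = csum r b y + (\<Sum>j | j < n \<and> hv r j = b. if j = i then d else 0)"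
  by (simp add: csum_def sum.distrib)
 also have "(\<Sum>j | j < n \<and> hv r j = b. if j = i then d else 0) = (if hv r i = b then d else 0)"
  using i by (subst sum.delta) auto
 finally show ?thesis .
qed

text \<open>All \<open>mb\<close> points have been hashed but only the first \<open>c\<close> are
  added, so a partly filled buffer can be flushed as well. Stale buffer entries take part in the
  evaluation, hence the bound on \<open>x i\<close> for all \<open>i < mb\<close>.\<close>

lemma flush_row_ends:
 assumes env: "env W" and r: "W 61 = r" "r < R" and c: "W 31 = c" "c \<le> mb"
  and V: "\<And>i. i < mb \<Longrightarrow> W (ad 12 i) mod m = hv r (x i)" and x: "\<And>i. i < mb \<Longrightarrow> x i < n"
  and C: "\<And>b. b < m \<Longrightarrow> X (caddr r b) = csum r b y"
 shows "ends (For 56 31 flush_body) (3 + c * 18) (\<lambda>W' X'. frame {2, 36, 37, 56} {} W W' \<and>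
   (\<forall>i<8 + mb. i \<noteq> 2 \<longrightarrow> i \<noteq> 3 \<longrightarrow> X' i = X i) \<and>
   (\<forall>r' b. r' \<noteq> r \<longrightarrow> b < m \<longrightarrow> X' (caddr r' b) = X (caddr r' b)) \<and>
   (\<forall>b<m. X' (caddr r b) = csum r b (push y x (\<lambda>j. X (8 + j)) c))) W X"
proof -
 let ?P = "\<lambda>j A X'. (\<forall>i<8 + mb. i \<noteq> 2 \<longrightarrow> i \<noteq> 3 \<longrightarrow> X' i = X i) \<and>
   (\<forall>r' b. r' \<noteq> r \<longrightarrow> b < m \<longrightarrow> X' (caddr r' b) = X (caddr r' b)) \<and>
   (\<forall>b<m. X' (caddr r b) = csum r b (push y x (\<lambda>j. X (8 + j)) j))"
 have "ends (For 56 31 flush_body) (3 + c * (14 + 4)) (\<lambda>W' X'. frame {2, 36, 37, 56} {} W W' \<and> ?P c (arr W') X') W X"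
 proof (rule loop_ends[where P = ?P])
  show "c < 2 ^ w" using c u_props(2) by (intro small_less) linarith
  fix j W' X' assume j: "j < c" and fr: "frame {2, 36, 37, 56} {} W W'" and rj: "W' 56 = j" and P: "?P j (arr W') X'"
  have env': "env W'" by (rule env_frame[OF env fr]) auto
  have r61: "W' 61 = r" using frame_reg[OF fr] r by simp
  define v where "v = W' (ad 12 j)"
  have jm: "j < mb" using j c by simp
  have vm: "v mod m = hv r (x j)" using frame_slot[OF fr, of 12 j] V[OF jm] jm u_props(2) slot_less by (simp add: v_def)
  define ca where "ca = caddr r (v mod m)"
  have ca: "ca < lr" "8 + mb \<le> ca" using caddr_less[OF r(2), of "v mod m"] m_pos by (simp_all add: ca_def caddr_def)
  have b: "8 + j < lr" "2 < lr" "3 < lr" "(8::nat) < 2 ^ w" using jm lr_eq lr_less by auto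
  let ?W1 = "W'(36 := ca, 37 := 8 + mb)"
  let ?W2 = "W'(36 := ca, 37 := 8 + j)"
  let ?X2 = "X'(2 := X' (8 + j), 3 := X' ca + X' (8 + j), ca := X' ca + X' (8 + j))"
  have e: "eval_op Add w 8 j = 8 + j" "8 mod 2 ^ w = (8::nat)" using b lr_less by (auto simp: ev_add)
  have "ends flush_body (8 + 6) (\<lambda>W'' X''. W'' = ?W2 \<and> X'' = ?X2) W' X'"
   unfolding flush_body_def
  proof (rule ends_preI[OF bucket_addr_ends[OF env' r61 r(2) rj jm v_def[symmetric], folded ca_def]])
   show "ends (cst 37 8 ;; add 37 37 56 ;; Prim (RLoad 2 37) ;; Prim (RLoad 3 36) ;; Prim (RAdd 3 3 2) ;; Prim (RStore 36 3)) 6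
    (\<lambda>W'' X''. W'' = ?W2 \<and> X'' = ?X2) ?W1 X'"
    unfolding ends_def using e b ca rj by (simp add: reg_less)
  qed
  then show "ends flush_body 14 (\<lambda>W'' X''. frame ({2, 36, 37, 56} - {56}) {} W' W'' \<and> ?P (Suc j) (arr W'') X'') W' X'"
  proof (rule ends_mono)
   fix W'' X'' assume *: "W'' = ?W2 \<and> X'' = ?X2"
   have "frame ({2, 36, 37, 56} - {56}) {} W' W''" unfolding conjunct1[OF *] by (intro frame_upd_reg) auto
   moreover have "\<forall>i<8 + mb. i \<noteq> 2 \<longrightarrow> i \<noteq> 3 \<longrightarrow> X'' i = X i" using * P ca by auto
   moreover have "X'' (caddr r' b) = X (caddr r' b)" if "r' \<noteq> r" "b < m" for r' b
   proof -
    have "caddr r' b \<noteq> ca" using that m_pos by (simp add: ca_def caddr_inj)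
    moreover have "caddr r' b \<noteq> 2" "caddr r' b \<noteq> 3" by (auto simp: caddr_def)
    ultimately show ?thesis using * P that by simp
   qed
   moreover have "X'' (caddr r b) = csum r b (push y x (\<lambda>j. X (8 + j)) (Suc j))" if "b < m" for b
   proof -
    have n23: "caddr r b \<noteq> 2" "caddr r b \<noteq> 3" by (auto simp: caddr_def)
    have X8: "X' (8 + j) = X (8 + j)" using P jm by simp
    have eq: "caddr r b = ca \<longleftrightarrow> hv r (x j) = b" using that hv_less vm by (auto simp: ca_def caddr_inj)
    have "X'' (caddr r b) = X' (caddr r b) + (if hv r (x j) = b then X (8 + j) else 0)"
     using * n23 X8 eq by auto
    then show ?thesis using P that x[OF jm] by (simp add: csum_upd)
   qed
   ultimately show "frame ({2, 36, 37, 56} - {56}) {} W' W'' \<and> ?P (Suc j) (arr W'') X''" by blast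
  qed simp
 qed (use c C in auto)
 then show ?thesis by simp
qed

lemma flush_ends:
 assumes env: "env W" and c: "W 31 = c" "c \<le> mb" and x: "\<And>i. i < mb \<Longrightarrow> W (ad 11 i) = x i" "\<And>i. i < mb \<Longrightarrow> x i < n"
  and C: "\<And>r b. r < R \<Longrightarrow> b < m \<Longrightarrow> X (caddr r b) = csum r b y"
 shows "ends flush (12000 * R * k * m) (\<lambda>W' X'. frame treeR ({2..<9} \<union> {12, 13}) W W' \<and>
   (\<forall>i<8 + mb. i \<noteq> 2 \<longrightarrow> i \<noteq> 3 \<longrightarrow> X' i = X i) \<and>
   (\<forall>r<R. \<forall>b<m. X' (caddr r b) = csum r b (push y x (\<lambda>j. X (8 + j)) c))) W X"
proof -
 let ?z = "push y x (\<lambda>j. X (8 + j)) c"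
 let ?Q = "\<lambda>W' X'. frame treeR ({2..<9} \<union> {12, 13}) W W' \<and> (\<forall>i<8 + mb. i \<noteq> 2 \<longrightarrow> i \<noteq> 3 \<longrightarrow> X' i = X i) \<and>
   (\<forall>r<R. \<forall>b<m. X' (caddr r b) = csum r b ?z)"
 have "ends flush (8000 * k * m + (3 + R * (3000 * k * m + (3 + c * 18) + 4))) ?Q W X"
  unfolding flush_def
 proof (rule ends_SeqI[OF prepare_ends[OF env]])
  show "W (ad 11 i) = x i" "x i < p" if "i < mb" for i using x[OF that] n_less by auto
  fix W1 X1 assume 1: "X1 = X \<and> frame treeR {2..<9} W W1 \<and> prepared x W1"
  then have X1: "X1 = X" and fr1: "frame treeR {2..<9} W W1" and P1: "prepared x W1" by blast+
  have env1: "env W1" by (rule env_frame[OF env fr1]) auto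
  have c1: "W1 31 = c" using frame_reg[OF fr1] c by simp
  let ?P = "\<lambda>r A X'. (\<forall>i<8 + mb. i \<noteq> 2 \<longrightarrow> i \<noteq> 3 \<longrightarrow> X' i = X i) \<and>
   (\<forall>r'<R. \<forall>b<m. X' (caddr r' b) = csum r' b (if r' < r then ?z else y))"
  have "ends (For 61 11 ((root ;; down) ;; For 56 31 flush_body)) (3 + R * (3000 * k * m + (3 + c * 18) + 4))
    (\<lambda>W' X'. frame treeR evalS W1 W' \<and> ?P R (arr W') X') W1 X"
  proof (rule loop_ends[where P = ?P])
   show "R < 2 ^ w" using caddr_less[of "R - 1" 0] R_pos m_pos lr_less
   proof -
    have "R * 1 \<le> R * m" using m_pos by (intro mult_le_mono2) simp
    then show ?thesis using lr_eq lr_less by linarith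
   qed
   show "?P 0 (arr W1) X" using C by simp
   fix r W' X' assume r: "r < R" and fr: "frame treeR evalS W1 W'" and r61: "W' 61 = r" and P: "?P r (arr W') X'"
   have env': "env W'" by (rule env_frame[OF env1 fr]) auto
   have P': "prepared x W'" by (rule prepared_frame[OF P1 fr]) auto
   show "ends ((root ;; down) ;; For 56 31 flush_body) (3000 * k * m + (3 + c * 18))
     (\<lambda>W'' X''. frame (treeR - {61}) evalS W' W'' \<and> ?P (Suc r) (arr W'') X'') W' X'"
   proof (rule ends_SeqI[OF evaluate_ends[OF env' r r61 P' less_imp_le[OF cf_less[OF r]]]])
    fix W2 X2 assume 2: "X2 = X' \<and> frame (treeR - {61}) evalS W' W2 \<and>
      (\<forall>i<mb. W2 (ad 12 i) = (\<Sum>b<m. cf r b * x i ^ b) mod p)"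
    then have X2: "X2 = X'" and fr2: "frame (treeR - {61}) evalS W' W2" by blast+
    have env2: "env W2" by (rule env_frame[OF env' fr2]) auto
    have r2: "W2 61 = r" "W2 31 = c" using frame_reg[OF fr2] frame_reg[OF fr] r61 c1 by auto
    let ?post1 = "\<lambda>W' X''. frame {2, 36, 37, 56} {} W2 W' \<and> (\<forall>i<8 + mb. i \<noteq> 2 \<longrightarrow> i \<noteq> 3 \<longrightarrow> X'' i = X' i) \<and> (\<forall>r' b. r' \<noteq> r \<longrightarrow> b < m \<longrightarrow> X'' (caddr r' b) = X' (caddr r' b)) \<and> (\<forall>b<m. X'' (caddr r b) = csum r b (push y x (\<lambda>j. X' (8 + j)) c))"
    have "ends (For 56 31 flush_body) (3 + c * 18) ?post1 W2 X'"
     by (rule flush_row_ends[OF env2 r2(1) r r2(2) c(2)]) (use 2 x P r in \<open>auto simp: hv_def poly_hash_def\<close>)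
    then show "ends (For 56 31 flush_body) (3 + c * 18) (\<lambda>W'' X''. frame (treeR - {61}) evalS W' W'' \<and> ?P (Suc r) (arr W'') X'') W2 X2"
     unfolding X2
    proof (rule ends_mono)
     fix W3 X3 assume 3: "?post1 W3 X3"
     \<comment> \<open>Apart from the counters, earlier rows changed only real cells 2 and 3, so the
       buffered increments are those present at the start.\<close>
     have pz: "push y x (\<lambda>j. X' (8 + j)) c = ?z" by (rule push_cong) (use P c in auto)
     from 3 have fr3: "frame {2, 36, 37, 56} {} W2 W3" by blast
     have "frame (treeR - {61}) evalS W' W3" by (rule frame_trans[OF fr2 fr3]) auto
     moreover have "X3 (caddr r' b) = csum r' b (if r' < Suc r then ?z else y)" if "r' < R" "b < m" for r' b
      using 3 P that pz by (cases "r' = r") (auto simp: less_Suc_eq)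
     ultimately show "frame (treeR - {61}) evalS W' W3 \<and> ?P (Suc r) (arr W3) X3"
      using 3 P by simp
    qed simp
   qed
  qed (use env_regs[OF env1] in auto)
  then show "ends (For 61 11 ((root ;; down) ;; For 56 31 flush_body)) (3 + R * (3000 * k * m + (3 + c * 18) + 4)) ?Q W1 X1"
   unfolding X1
  proof (rule ends_mono)
   fix W' X' assume *: "frame treeR evalS W1 W' \<and> ?P R (arr W') X'"
   then have fr': "frame treeR evalS W1 W'" by blast
   have "frame treeR ({2..<9} \<union> {12, 13}) W W'" by (rule frame_trans[OF fr1 fr']) auto
   then show "?Q W' X'" using * by auto
  qed simp
 qed
 then show ?thesis
 proof (rule ends_mono)
  have km: "1 * 64 \<le> k * m" "1 * m \<le> k * m" using u_less m_ge by (intro mult_le_mono; linarith)+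
  have "3000 * k * m + (3 + c * 18) + 4 = 3000 * (k * m) + 18 * c + 7" by simp
  also have "\<dots> \<le> 3100 * (k * m)" using km c(2) u_props(2) by linarith
  finally have "R * (3000 * k * m + (3 + c * 18) + 4) \<le> R * (3100 * (k * m))" by (intro mult_le_mono2)
  moreover have "R * (3100 * (k * m)) = 3100 * (R * (k * m))" "8000 * k * m = 8000 * (k * m)" "12000 * R * k * m = 12000 * (R * (k * m))" by simp_all
  moreover have "1 * (k * m) \<le> R * (k * m)" using R_pos by (intro mult_le_mono1)
  ultimately show "8000 * k * m + (3 + R * (3000 * k * m + (3 + c * 18) + 4)) \<le> 12000 * R * k * m" using km by linarith
 qed
qed

text \<open>The counters describe the vector \<open>y\<close> of the last flush, and the represented
  vector \<open>x\<close> is \<open>y\<close> after the \<open>c\<close> buffered updates. The sum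
  in real cell \<open>1\<close> is always current.\<close>

definition state_inv :: "reals \<Rightarrow> nat \<Rightarrow> words \<Rightarrow> reals \<Rightarrow> bool" where
 "state_inv x c W X \<longleftrightarrow> stat W \<and> W (ad 1 31) = c \<and> c < mb \<and> (\<forall>j<mb. W (ad 11 j) < n) \<and> X 1 = (\<Sum>i<n. x i) \<and>
   (\<exists>y. (\<forall>r<R. \<forall>b<m. X (caddr r b) = csum r b y) \<and> x = push y (\<lambda>j. W (ad 11 j)) (\<lambda>j. X (8 + j)) c)"

lemma update_main_ends:
 assumes state_inv: "state_inv x c W X" and i: "W 0 = i" "i < n"
 shows "ends update_main (if Suc c = mb then 12000 * R * k * m + 110 else 110)
  (\<lambda>W' X'. state_inv (x(i := x i + X 0)) (if Suc c = mb then 0 else Suc c) W' X') W X"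
proof -
 from state_inv[unfolded state_inv_def] obtain y where st: "stat W" and c: "W (ad 1 31) = c" "c < mb" and idx: "\<And>j. j < mb \<Longrightarrow> W (ad 11 j) < n"
  and nm: "X 1 = (\<Sum>i<n. x i)" and C: "\<And>r b. r < R \<Longrightarrow> b < m \<Longrightarrow> X (caddr r b) = csum r b y"
  and xp: "x = push y (\<lambda>j. W (ad 11 j)) (\<lambda>j. X (8 + j)) c" by blast
 let ?x' = "x(i := x i + X 0)" and ?c' = "if Suc c = mb then 0 else Suc c"
 let ?F = "if Suc c = mb then 12000 * R * k * m + 1 else 0"
 have mbm: "mb \<le> m" by (rule u_props)
 have ns: "11 < NS" "1 < NS" using slot_less by auto
 have b: "8 + c < lr" "1 < lr" "0 < lr" "8 + c < 2 ^ w" using c lr_eq lr_less by auto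
 have e: "eval_op Add w 8 c = 8 + c" "8 mod 2 ^ w = (8::nat)" "eval_op Add w c 1 = Suc c"
  using b by (auto simp: ev_add)
 have sum': "(\<Sum>j<n. ?x' j) = X 1 + X 0"
 proof -
  have "(\<Sum>j<n. ?x' j) = (\<Sum>j<n. x j + (if j = i then X 0 else 0))" by (rule sum.cong) auto
  then show ?thesis using i nm by (simp add: sum.distrib)
 qed
 have "ends update_main (87 + (7 + (?F + 2 + 3))) (\<lambda>W' X'. state_inv ?x' ?c' W' X') W X"
  unfolding update_main_def
 proof (rule ends_SeqI[OF load_ends[OF st]])
  fix W1 X1 assume 1: "X1 = X \<and> env W1 \<and> stat W1 \<and> W1 31 = W (ad 1 31) \<and> W1 0 = W 0 \<and> (\<forall>s t. W1 (ad s t) = W (ad s t))"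
  then have X1: "X1 = X" and env1: "env W1" and st1: "stat W1" and r1: "W1 31 = c" "W1 0 = i" and sl: "\<And>s t. W1 (ad s t) = W (ad s t)"
   using c i by auto
  let ?W2 = "W1(36 := ad 11 c, ad 11 c := i, 37 := 8 + c, 31 := Suc c)"
  let ?X2 = "X(8 + c := X 0, 1 := X 1 + X 0)"
  have cm: "c < 2 * m" using c mbm by simp
  have fr2: "frame ({31} \<union> {36, 37}) {11} W1 ?W2" using cm by (intro frame_upd_reg frame_upd_slot) auto
  have env2: "env ?W2" by (rule env_frame[OF env1 fr2]) auto
  have st2: "stat ?W2" by (rule stat_frame[OF st1 fr2]) auto
  have id2: "?W2 (ad 11 j) = (if j = c then i else W (ad 11 j))" if "j < mb" for j
   using that cm mbm sl by (auto simp: ad_reg ad_inj)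
  have C2: "?X2 (caddr r b) = csum r b y" if "r < R" "b < m" for r b
  proof -
   have "caddr r b \<noteq> 8 + c" "caddr r b \<noteq> 1" using c by (auto simp: caddr_def)
   then show ?thesis using C[OF that] by simp
  qed
  have x2: "push y (\<lambda>j. ?W2 (ad 11 j)) (\<lambda>j. ?X2 (8 + j)) (Suc c) = ?x'"
  proof -
   have "push y (\<lambda>j. ?W2 (ad 11 j)) (\<lambda>j. ?X2 (8 + j)) c = x"
    unfolding xp by (rule push_cong) (use id2 c in auto)
   then show ?thesis using id2[OF c(2)] by simp
  qed
  show "ends ((add 36 25 31 ;; store 36 0 ;; cst 37 8 ;; add 37 37 31 ;; Prim (RStore 37 0) ;; Prim (RAdd 1 1 0) ;; add 31 31 14) ;;
    IfW 31 10 Skip (flush ;; cst 31 0) ;; save_count) (7 + (?F + 2 + 3)) (\<lambda>W' X'. state_inv ?x' ?c' W' X') W1 X1"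
   unfolding X1
  proof (rule ends_preI)
   show "ends (add 36 25 31 ;; store 36 0 ;; cst 37 8 ;; add 37 37 31 ;; Prim (RStore 37 0) ;; Prim (RAdd 1 1 0) ;; add 31 31 14) 7
     (\<lambda>W' X'. W' = ?W2 \<and> X' = ?X2) W1 X"
    unfolding ends_def using r1 e b cm ns env_regs[OF env1] ad_add[of 11 0 c] by (simp add: reg_less ad_less ad_reg)
   let ?M = "\<lambda>W' X'. stat W' \<and> W' 31 = ?c' \<and> (\<forall>j<mb. W' (ad 11 j) < n) \<and> X' 1 = X 1 + X 0 \<and>
    (\<exists>y. (\<forall>r<R. \<forall>b<m. X' (caddr r b) = csum r b y) \<and> ?x' = push y (\<lambda>j. W' (ad 11 j)) (\<lambda>j. X' (8 + j)) ?c')"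
   show "ends (IfW 31 10 Skip (flush ;; cst 31 0) ;; save_count) (?F + 2 + 3) (\<lambda>W' X'. state_inv ?x' ?c' W' X') ?W2 ?X2"
   proof (rule ends_Seq[where P = ?M, OF ends_IfW _ order_refl])
    assume "?W2 31 < ?W2 10"
    then have "Suc c < mb" using env_regs[OF env2] by simp
    then have c': "?c' = Suc c" by simp
    have M2: "?M ?W2 ?X2" unfolding c'
    proof (intro conjI exI[of _ y] allI impI)
     show "?W2 (ad 11 j) < n" if "j < mb" for j unfolding id2[OF that] using i idx[OF that] by simp
     show "?x' = push y (\<lambda>j. ?W2 (ad 11 j)) (\<lambda>j. ?X2 (8 + j)) (Suc c)" by (rule x2[symmetric])
     show "stat ?W2" by (rule st2)
     show "?X2 (caddr r b) = csum r b y" if "r < R" "b < m" for r b by (rule C2[OF that])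
    qed simp_all
    show "ends Skip ?F ?M ?W2 ?X2" by (rule ends_Skip, rule M2)
   next
    assume "\<not> ?W2 31 < ?W2 10"
    then have cc: "Suc c = mb" using env_regs[OF env2] c by simp
    then have c0: "?c' = 0" by simp
    have "ends (flush ;; cst 31 0) (12000 * R * k * m + 1) ?M ?W2 ?X2"
    proof (rule ends_SeqI[OF flush_ends[OF env2 _ _ refl]])
     show "?W2 31 = Suc c" "Suc c \<le> mb" using c by auto
     show "?W2 (ad 11 j) < n" if "j < mb" for j using id2[OF that] idx[OF that] i by simp
     show "?X2 (caddr r b) = csum r b y" if "r < R" "b < m" for r b by (rule C2[OF that])
     fix W3 X3 assume 3: "frame treeR ({2..<9} \<union> {12, 13}) ?W2 W3 \<and> (\<forall>i<8 + mb. i \<noteq> 2 \<longrightarrow> i \<noteq> 3 \<longrightarrow> X3 i = ?X2 i) \<and>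
      (\<forall>r<R. \<forall>b<m. X3 (caddr r b) = csum r b (push y (\<lambda>j. ?W2 (ad 11 j)) (\<lambda>j. ?X2 (8 + j)) (Suc c)))"
     then have fr3: "frame treeR ({2..<9} \<union> {12, 13}) ?W2 W3" by blast
     have st3: "stat W3" by (rule stat_frame[OF st2 fr3]) auto
     have st4: "stat (W3(31 := 0))"
      by (rule stat_frame[OF st3, of "{31}" "{}"]) (auto intro: frame_upd_reg)
     have id3: "W3 (ad 11 j) < n" if "j < mb" for j
      using frame_slot[OF fr3 ns(1), of j] id2[OF that] idx[OF that] i mbm that by simp
     have "X3 1 = X 1 + X 0" using 3 by simp
     moreover have "\<forall>r<R. \<forall>b<m. X3 (caddr r b) = csum r b ?x'" using 3 x2 by simp
     ultimately have "?M (W3(31 := 0)) X3"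
      unfolding c0 by (intro conjI exI[of _ ?x'] allI impI) (use st4 id3 in \<open>simp_all add: ad_reg\<close>)
     then show "ends (cst 31 0) 1 ?M W3 X3" by (rule ends_cst0[OF reg_less, rotated]) simp
    qed
    then show "ends (flush ;; cst 31 0) ?F ?M ?W2 ?X2" using cc by simp
   next
    fix W4 X4 assume 4: "?M W4 X4"
    then have st4: "stat W4" and c4: "W4 31 = ?c'" by blast+
    show "ends save_count 3 (\<lambda>W' X'. state_inv ?x' ?c' W' X') W4 X4"
    proof (rule ends_mono[OF save_ends[OF st4 c4]])
     fix W5 X5 assume 5: "X5 = X4 \<and> stat W5 \<and> W5 (ad 1 31) = ?c' \<and> frame {2} {1} W4 W5"
     then have fr5: "frame {2} {1} W4 W5" by blast
     have id5: "W5 (ad 11 j) = W4 (ad 11 j)" if "j < mb" for j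
      using frame_slot[OF fr5 ns(1), of j] mbm that by simp
     have c'm: "?c' < mb" using c by auto
     from 4 obtain y' where y': "\<forall>r<R. \<forall>b<m. X4 (caddr r b) = csum r b y'" "?x' = push y' (\<lambda>j. W4 (ad 11 j)) (\<lambda>j. X4 (8 + j)) ?c'"
      by blast
     have "push y' (\<lambda>j. W5 (ad 11 j)) (\<lambda>j. X5 (8 + j)) ?c' = push y' (\<lambda>j. W4 (ad 11 j)) (\<lambda>j. X4 (8 + j)) ?c'"
      by (rule push_cong) (use id5 5 c'm in auto)
     then have x5: "?x' = push y' (\<lambda>j. W5 (ad 11 j)) (\<lambda>j. X5 (8 + j)) ?c'" using y'(2) by simp
     show "state_inv ?x' ?c' W5 X5" unfolding state_inv_def
     proof (intro conjI exI[of _ y'] allI impI)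
      show "stat W5" "W5 (ad 1 31) = ?c'" using 5 by blast+
      show "W5 (ad 11 j) < n" if "j < mb" for j unfolding id5[OF that] using 4 that by blast
      show "X5 1 = (\<Sum>i<n. ?x' i)" unfolding sum' using 4 5 by blast
      show "X5 (caddr r b) = csum r b y'" if "r < R" "b < m" for r b using y'(1) 5 that by blast
     qed (rule c'm, rule x5)
    qed simp
   qed (auto simp: reg_less)
  qed
 qed
 then show ?thesis by (rule ends_mono) auto
qed

section \<open>Scanning all coordinates for a query\<close>

abbreviation (input) "keeps X X' \<equiv> \<forall>q. q \<noteq> 2 \<longrightarrow> X' q = (X q :: real)"

definition accepted :: "reals \<Rightarrow> nat \<Rightarrow> nat \<Rightarrow> bool" where
 "accepted X r i \<longleftrightarrow> X 1 \<le> 2 ^ a * X (caddr r (hv r i))"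

lemma double_ends:
 assumes env: "env W"
 shows "ends (For 57 13 (Prim (RAdd 2 2 2))) (3 + a * 5) (\<lambda>W' X'. frame {2, 57} {} W W' \<and> X' = X(2 := 2 ^ a * X 2)) W X"
proof -
 have b: "2 < lr" by (simp add: lr_eq)
 have km: "k < m" using m_eq less_exp[of k] by simp
 have "ends (For 57 13 (Prim (RAdd 2 2 2))) (3 + a * (1 + 4)) (\<lambda>W' X'. frame {2, 57} {} W W' \<and> X' = X(2 := 2 ^ a * X 2)) W X"
 proof (rule loop_ends[where P = "\<lambda>j A X'. X' = X(2 := 2 ^ j * X 2)"])
  show "a < 2 ^ w" using a_less km by (intro small_less) linarith
  fix j W' X' assume "X' = X(2 := 2 ^ j * X 2)"
  then show "ends (Prim (RAdd 2 2 2)) 1 (\<lambda>W'' X''. frame ({2, 57} - {57}) {} W' W'' \<and> X'' = X(2 := 2 ^ Suc j * X 2)) W' X'"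
   unfolding ends_def using b by (simp add: fun_eq_iff)
 qed (use env_regs[OF env] in auto)
 then show ?thesis by simp
qed

lemma scan_test_ends:
 assumes env: "env W" and r: "W 61 = r" "r < R" and j: "W 56 = j" "j < mb" and v: "W (ad 12 j) mod m = hv r i"
 shows "ends scan_test (5 * k + 20) (\<lambda>W' X'. frame {2, 36, 37, 57} {14} W W' \<and> keeps X X' \<and>
   (\<forall>t<2*m. W' (ad 14 t) = (if t = j \<and> \<not> accepted X r i then 0 else W (ad 14 t)))) W X" (is "ends _ _ ?Q _ _")
proof -
 define ca where "ca = caddr r (hv r i)"
 have ca: "ca < lr" using caddr_less[OF r(2) hv_less] by (simp add: ca_def)
 have ca2: "ca \<noteq> 2" by (simp add: ca_def caddr_def)
 have b: "2 < lr" "1 < lr" "14 < NS" "j < 2 * m" using slot_less j u_props(2) by (auto simp: lr_eq)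
 let ?W1 = "W(36 := ca, 37 := 8 + mb)"
 let ?X1 = "X(2 := X ca)"
 have fr1: "frame {2, 36, 37, 57} {} W ?W1" by (intro frame_upd_reg) auto
 have env1: "env ?W1" by (rule env_frame[OF env fr1]) auto
 have "ends scan_test (8 + (1 + (3 + a * 5 + 5))) ?Q W X"
  unfolding scan_test_def
 proof (rule ends_preI[OF bucket_addr_ends[OF env r j refl, unfolded v, folded ca_def]])
  show "ends (Prim (RLoad 2 36) ;; For 57 13 (Prim (RAdd 2 2 2)) ;; IfR 2 1 (add 36 28 56 ;; cst 37 0 ;; store 36 37) Skip)
   (1 + (3 + a * 5 + 5)) ?Q ?W1 X"
  proof (rule ends_preI)
   show "ends (Prim (RLoad 2 36)) 1 (\<lambda>W' X'. W' = ?W1 \<and> X' = ?X1) ?W1 X"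
    unfolding ends_def using ca b by (simp add: reg_less)
   show "ends (For 57 13 (Prim (RAdd 2 2 2)) ;; IfR 2 1 (add 36 28 56 ;; cst 37 0 ;; store 36 37) Skip) (3 + a * 5 + 5) ?Q ?W1 ?X1"
   proof (rule ends_SeqI[OF double_ends[OF env1]])
    fix W2 X2 assume *: "frame {2, 57} {} ?W1 W2 \<and> X2 = ?X1(2 := 2 ^ a * ?X1 2)"
    then have fr12: "frame {2, 57} {} ?W1 W2" and X2: "X2 = X(2 := 2 ^ a * X ca)" by auto
    have fr2: "frame {2, 36, 37, 57} {} W W2" by (rule frame_trans[OF fr1 fr12]) auto
    have env2: "env W2" by (rule env_frame[OF env fr2]) auto
    have r2: "W2 56 = j" using frame_reg[OF fr2] j by simp
    have s14: "W2 (ad 14 t) = W (ad 14 t)" if "t < 2 * m" for t using frame_slot[OF fr2 b(3) that] by simp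
    have acc: "X2 2 < X2 1 \<longleftrightarrow> \<not> accepted X r i" by (auto simp: X2 accepted_def ca_def)
    show "ends (IfR 2 1 (add 36 28 56 ;; cst 37 0 ;; store 36 37) Skip) 5 ?Q W2 X2"
    proof (cases "accepted X r i")
     case True
     have "frame {2, 36, 37, 57} {14} W W2" by (rule frame_trans[OF fr2 frame_refl[of "{}" "{}"]]) auto
     then have "?Q W2 X2" using True s14 by (auto simp: X2)
     moreover have "\<not> X2 2 < X2 1" using acc True by simp
     ultimately show ?thesis unfolding ends_def using b by simp
    next
     case False
     let ?W3 = "W2(36 := ad 14 j, 37 := 0, ad 14 j := 0)"
     have "frame {2, 36, 37, 57} {14} W ?W3"
      using b by (intro frame_upd_reg frame_upd_slot frame_trans[OF fr2 frame_refl[of "{}" "{}"]]) auto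
     then have "?Q ?W3 X2" using False s14 b by (auto simp: X2 ad_reg ad_inj)
     moreover have "X2 2 < X2 1" using acc False by simp
     ultimately show ?thesis unfolding ends_def using b r2 env_regs[OF env2] ad_add[of 14 0 j]
      by (simp add: reg_less ad_less ad_reg)
    qed
   qed
  qed
 qed
 then show ?thesis by (rule ends_mono) (use a_less in auto)
qed

lemma scan_row_ends:
 assumes env: "env W" and r: "W 61 = r" "r < R" and V: "\<And>j. j < mb \<Longrightarrow> W (ad 12 j) mod m = hv r (x j)"
 shows "ends (For 56 10 scan_test) (30 * k * m) (\<lambda>W' X'. frame {2, 36, 37, 56, 57} {14} W W' \<and> keeps X X' \<and>
   (\<forall>t<mb. W' (ad 14 t) = (if accepted X r (x t) then W (ad 14 t) else 0))) W X"
proof -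
 have mbm: "mb \<le> m" by (rule u_props)
 let ?P = "\<lambda>j A X'. keeps X X' \<and>
   (\<forall>t<mb. A 14 t = (if t < j \<and> \<not> accepted X r (x t) then 0 else W (ad 14 t)))"
 have "ends (For 56 10 scan_test) (3 + mb * (5 * k + 20 + 4)) (\<lambda>W' X'. frame {2, 36, 37, 56, 57} {14} W W' \<and> ?P mb (arr W') X') W X"
 proof (rule loop_ends[where P = ?P])
  show "mb < 2 ^ w" using mbm by (intro small_less) simp
  fix j W' X' assume j: "j < mb" and fr: "frame {2, 36, 37, 56, 57} {14} W W'" and r56: "W' 56 = j" and P: "?P j (arr W') X'"
  have env': "env W'" by (rule env_frame[OF env fr]) auto
  have r61: "W' 61 = r" using frame_reg[OF fr] r by simp
  have v: "W' (ad 12 j) mod m = hv r (x j)" using frame_slot[OF fr, of 12 j] V[OF j] slot_less j mbm by simp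
  have ac: "accepted X' r i = accepted X r i" for i
  proof -
   have "caddr r (hv r i) \<noteq> 2" by (simp add: caddr_def)
   then show ?thesis using P unfolding accepted_def by simp
  qed
  have fx: "frame ({2, 36, 37, 56, 57} - {56}) {14} W' W''" if "frame {2, 36, 37, 57} {14} W' W''" for W''
   by (rule frame_trans[OF that frame_refl[of "{}" "{}"]]) auto
  show "ends scan_test (5 * k + 20) (\<lambda>W'' X''. frame ({2, 36, 37, 56, 57} - {56}) {14} W' W'' \<and> ?P (Suc j) (arr W'') X'') W' X'"
   by (rule ends_mono[OF scan_test_ends[OF env' r61 r(2) r56 j v]])
    (use P fx mbm in \<open>auto simp: arr_def ac less_Suc_eq\<close>)
 qed (use env_regs[OF env] in \<open>auto simp: arr_def\<close>)
 then show ?thesis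
 proof (rule ends_mono)
  have "mb * k \<le> m * k" "mb * 1 \<le> m * k" "64 * 1 \<le> m * k" using mbm u_less m_ge by (intro mult_le_mono; linarith)+
  moreover have "mb * (5 * k + 20 + 4) = 5 * (mb * k) + 24 * mb" "30 * k * m = 30 * (m * k)" by (simp_all add: algebra_simps)
  ultimately show "3 + mb * (5 * k + 20 + 4) \<le> 30 * k * m" by linarith
 qed (auto simp: arr_def)
qed

definition selected :: "reals \<Rightarrow> nat \<Rightarrow> nat set" where
 "selected X N = {i. i < N \<and> i < n \<and> (\<forall>r<R. accepted X r i)}"

text \<open>Tying the length to the number of selected coordinates bounds the position of every
  write inside slot 0.\<close>

definition listed :: "reals \<Rightarrow> nat \<Rightarrow> nat \<Rightarrow> words \<Rightarrow> bool" where
 "listed X N c A \<longleftrightarrow> c = card (selected X N) \<and> A ` {..<c} = selected X N"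

abbreviation (input) "stores X N W \<equiv> listed X N (W 0) (\<lambda>t. W (ad 0 t))"
abbreviation (input) "scanS \<equiv> {0} \<union> {2..<9} \<union> {11..<15::nat}"

lemma selected_Suc: "selected X (Suc N) = (if N < n \<and> (\<forall>r<R. accepted X r N) then insert N (selected X N) else selected X N)"
 by (auto simp: selected_def less_Suc_eq)

lemma selected_finite: "finite (selected X N)"
 by (rule finite_subset[of _ "{..<n}"]) (auto simp: selected_def)

lemma card_selected_mono: "card (selected X N) \<le> card (selected X n)"
 by (rule card_mono[OF selected_finite]) (auto simp: selected_def)

lemma scan_append_ends:
 assumes env: "env W" and j: "W 56 = j" "j < mb"
  and fl: "W (ad 14 j) = (if N < n \<and> (\<forall>r<R. accepted X r N) then 1 else 0)" and p: "N < n \<Longrightarrow> W (ad 11 j) = N"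
  and L: "stores X N W" and sm: "card (selected X n) < m"
 shows "ends scan_append 12 (\<lambda>W' X'. X' = X \<and> frame {0, 36, 37} {0} W W' \<and> stores X (Suc N) W') W X"
proof -
 have b: "14 < NS" "11 < NS" "0 < NS" "j < 2 * m" using slot_less j u_props(2) by auto
 note er = env_regs[OF env]
 have a1: "eval_op Add w (ad 14 0) j = ad 14 j" "eval_op Add w (ad 11 0) j = ad 11 j" using ad_add[of 14 0 j] ad_add[of 11 0 j] b by auto
 show ?thesis
 proof (cases "N < n \<and> (\<forall>r<R. accepted X r N)")
  case False
  have "stores X (Suc N) W" using L unfolding listed_def selected_Suc if_not_P[OF False] .
  moreover have "frame {0, 36, 37} {0} W (W(36 := 0, 37 := 0))" by (intro frame_upd_reg) auto
  ultimately show ?thesis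
   unfolding scan_append_def ends_def using fl False er b a1 j by (simp add: reg_less ad_less ad_reg)
 next
  case True
  define c where "c = W 0"
  have c: "c < m" using L card_selected_mono[of X N] sm by (simp add: c_def listed_def)
  have c2: "c < 2 * m" using c by simp
  have ac: "64 + c = ad 0 c" by (simp add: ad_def)
  have e: "eval_op Add w 64 c = ad 0 c" "eval_op Add w c 1 = Suc c" "64 mod 2 ^ w = (64::nat)"
   using ad_less[of 0 c] b c2 lw_small ev_add[of 64 c w] ac small_less[of 64] m_ge c by (auto simp: ev_add small_less)
  let ?W = "W(36 := N, 37 := ad 0 c, ad 0 c := N, 0 := Suc c)"
  have fr: "frame {0, 36, 37} {0} W ?W" using c2 by (intro frame_upd_reg frame_upd_slot) auto
  have nin: "N \<notin> selected X N" by (simp add: selected_def)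
  have im: "(\<lambda>t. ?W (ad 0 t)) ` {..<Suc c} = insert N (selected X N)"
  proof -
   have "(\<lambda>t. ?W (ad 0 t)) ` {..<c} = (\<lambda>t. W (ad 0 t)) ` {..<c}"
    by (rule image_cong) (use c in \<open>auto simp: ad_reg ad_inj\<close>)
   also have "\<dots> = selected X N" unfolding c_def using L unfolding listed_def by blast
   finally show ?thesis by (simp add: lessThan_Suc ad_reg)
  qed
  have "listed X (Suc N) (?W 0) (\<lambda>t. ?W (ad 0 t))"
  proof -
   have "card (selected X N) = c" using L by (simp add: listed_def c_def)
   then have "Suc c = card (insert N (selected X N))" using nin selected_finite[of X N] by simp
   moreover have "?W 0 = Suc c" by simp
   ultimately show ?thesis unfolding listed_def selected_Suc if_P[OF True] using im by (simp only:)
  qed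
  then show ?thesis
   unfolding scan_append_def ends_def using fl True p er b a1 j fr e c2 ad_less[of 0 c]
   by (simp add: reg_less ad_less ad_reg c_def[symmetric] fun_upd_twist)
 qed
qed

text \<open>The invariant speaks about register 0, which \<open>arr\<close> hides; therefore
  \<open>wp_For\<close> is applied directly.\<close>

lemma scan_append_loop_ends:
 assumes env: "env W" and N0: "W 63 = blk"
  and fl: "\<And>j. j < mb \<Longrightarrow> W (ad 14 j) = (if blk * mb + j < n \<and> (\<forall>r<R. accepted X r (blk * mb + j)) then 1 else 0)"
  and p: "\<And>j. j < mb \<Longrightarrow> blk * mb + j < n \<Longrightarrow> W (ad 11 j) = blk * mb + j"
  and L: "stores X (blk * mb) W" and sm: "card (selected X n) < m"
 shows "ends (For 56 10 scan_append) (3 + mb * 16) (\<lambda>W' X'. X' = X \<and> frame {0, 2, 36, 37, 56} {0} W W' \<and>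
   stores X (Suc blk * mb) W') W X"
 unfolding ends_def
proof (rule wp_For[where I = "\<lambda>j W' X'. X' = X \<and> frame {0, 2, 36, 37, 56} {0} W W' \<and>
   stores X (blk * mb + j) W'" and B = 12 and N = mb])
 have mbm: "mb \<le> m" by (rule u_props)
 show "mb < 2 ^ w" using mbm by (intro small_less) simp
 show "W 10 = mb" using env_regs[OF env] by simp
 show "X = X \<and> frame {0, 2, 36, 37, 56} {0} W (W(56 := 0)) \<and> listed X (blk * mb + 0) ((W(56 := 0)) 0) (\<lambda>t. (W(56 := 0)) (ad 0 t))"
  using L by (simp add: ad_reg frame_upd_reg)
 fix j W' X' assume j: "j < mb" and I: "X' = X \<and> frame {0, 2, 36, 37, 56} {0} W W' \<and> stores X (blk * mb + j) W'"
  and r: "W' 56 = j" "W' 10 = mb"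
 from I have X': "X' = X" and fr: "frame {0, 2, 36, 37, 56} {0} W W'" and Lj: "stores X (blk * mb + j) W'" by blast+
 \<comment> \<open>Register 0 lies outside the range that \<open>env_frame\<close> permits, so its
   change is separated from the rest of the footprint.\<close>
 have env': "env W'" 
 proof -
  have "frame {0} {} W (W(0 := W' 0))" by (intro frame_upd_reg) auto
  have e0: "env (W(0 := W' 0))" using env unfolding env_def by (simp add: ad_reg)
  have "frame {2, 36, 37, 56} {0} (W(0 := W' 0)) W'" using fr unfolding frame_def by (auto simp: ad_reg)
  then show ?thesis by (rule env_frame[OF e0]) auto
 qed
 have s14: "W' (ad 14 j) = W (ad 14 j)" "W' (ad 11 j) = W (ad 11 j)" using frame_slot[OF fr] slot_less j mbm by auto
 have "ends scan_append 12 (\<lambda>W'' X'. X' = X \<and> frame {0, 36, 37} {0} W' W'' \<and>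
   stores X (Suc (blk * mb + j)) W'') W' X"
  by (rule scan_append_ends[OF env' r(1) j _ _ Lj sm]) (use fl[OF j] p[OF j] s14 in auto)
 then show "wp scan_append (\<lambda>t (W'', X''). t \<le> 12 \<and> W'' 56 = j \<and> W'' 10 = mb \<and> X'' = X \<and>
   frame {0, 2, 36, 37, 56} {0} W (W''(2 := 1, 56 := Suc j)) \<and>
   listed X (blk * mb + Suc j) ((W''(2 := 1, 56 := Suc j)) 0) (\<lambda>t. (W''(2 := 1, 56 := Suc j)) (ad 0 t))) (W', X')"
  unfolding X' ends_def
 proof (rule wp_mono_prod)
  fix t W'' X'' assume *: "t \<le> 12 \<and> X'' = X \<and> frame {0, 36, 37} {0} W' W'' \<and> stores X (Suc (blk * mb + j)) W''"
  then have fr': "frame {0, 36, 37} {0} W' W''" by blast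
  have "frame {0, 2, 36, 37, 56} {0} W W''" by (rule frame_trans[OF fr fr']) auto
  then have "frame {0, 2, 36, 37, 56} {0} W (W''(2 := 1, 56 := Suc j))" by (intro frame_upd_reg) auto
  moreover have "W'' 56 = j" "W'' 10 = mb" using frame_reg[OF fr'] r by auto
  ultimately show "case (W'', X'') of (W'', X'') \<Rightarrow> t \<le> 12 \<and> W'' 56 = j \<and> W'' 10 = mb \<and> X'' = X \<and>
   frame {0, 2, 36, 37, 56} {0} W (W''(2 := 1, 56 := Suc j)) \<and>
   listed X (blk * mb + Suc j) ((W''(2 := 1, 56 := Suc j)) 0) (\<lambda>t. (W''(2 := 1, 56 := Suc j)) (ad 0 t))"
   using * by (simp add: ad_reg)
 qed
next
 fix t W' X' assume "t \<le> 3 + mb * (12 + 4)" "X' = X \<and> frame {0, 2, 36, 37, 56} {0} W W' \<and> stores X (blk * mb + mb) W'"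
 then show "case (W', X') of (W', X') \<Rightarrow> t \<le> 3 + mb * 16 \<and> X' = X \<and> frame {0, 2, 36, 37, 56} {0} W W' \<and>
   stores X (Suc blk * mb) W'"
  by (simp add: add.commute)
qed (auto simp: reg_less)

lemma scan_block_ends:
 assumes env: "env W" and blk: "W 63 = blk" "blk < nblk"
  and L: "stores X (blk * mb) W" and sm: "card (selected X n) < m"
 shows "ends scan_block (13000 * R * k * m) (\<lambda>W' X'. keeps X X' \<and>
   frame (treeR \<union> {0}) scanS W W' \<and> (\<forall>j<mb. W' (ad 11 j) < n) \<and>
   stores X (Suc blk * mb) W') W X" (is "ends _ _ ?Q _ _")
proof -
 have mbm: "mb \<le> m" by (rule u_props)
 have ns: "0 < NS" "11 < NS" "12 < NS" "14 < NS" using slot_less by auto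
 have bb: "blk * mb + j < 2 ^ w" if "j < mb" for j
 proof -
  have "Suc blk * mb \<le> nblk * mb" using blk by (intro mult_le_mono1) simp
  then have "blk * mb + j < nblk * mb" using that by simp
  then show ?thesis using blk_less by linarith
 qed
 have mb0: "0 < mb" by (simp add: mb_eq)
 define x where "x j = (if blk * mb + j < n then blk * mb + j else 0)" for j
 have xn: "x j < n" for j using n_gt by (simp add: x_def)
 have ev: "eval_op Mul w blk mb = blk * mb" using bb[OF mb0] by (simp add: ev_mul)
 have ev': "eval_op Add w (blk * mb) j = blk * mb + j" if "j < mb" for j using bb[OF that] by (simp add: ev_add)
 let ?fl = "\<lambda>j. if blk * mb + j < n then 1 else (0::nat)"
 let ?FS = "{2..<9} \<union> {11..<15}"
 have "ends scan_block (3 + mb * (5 + 6) + (3 + mb * (6 + 6) + (8000 * k * m + (3 + R * (3000 * k * m + 30 * k * m + 4) + (3 + mb * 16))))) ?Q W X"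
  unfolding scan_block_def
 proof (rule ends_SeqI)
  let ?post1 = "filled 11 0 mb x W X"
  show "ends (map_loop 10 25 scan_points) (3 + mb * (5 + 6)) ?post1 W X"
  proof (rule map_loop_ends)
   fix t W' assume t: "t < mb" and fr: "frame loopR {11} W W'" and r: "W' 35 = t"
   have env': "env W'" by (rule env_frame[OF env fr]) auto
   have r63: "W' 63 = blk" using frame_reg[OF fr] blk by simp
   show "computes scan_points 5 (x t) W' X"
    unfolding scan_points_def ends_def using r r63 env_regs(8,10)[OF env'] ev ev'[OF t]
    by (cases "blk * mb + t < n") (simp_all add: reg_less frame_upd_reg x_def)
  qed (use env_regs[OF env] ns mbm in auto)
  fix W1 X1 assume 1: "?post1 W1 X1"
  then have X1: "X1 = X" and fr1: "frame loopR {11} W W1" and p1: "\<And>j. j < mb \<Longrightarrow> W1 (ad 11 j) = x j"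
   using mbm by auto
  have env1: "env W1" by (rule env_frame[OF env fr1]) auto
  have r1: "W1 63 = blk" using frame_reg[OF fr1] blk by simp
  show "ends (map_loop 10 28 scan_flags ;; (tree_up ;; newton) ;; For 61 11 ((root ;; down) ;; For 56 10 scan_test) ;; For 56 10 scan_append)
   (3 + mb * (6 + 6) + (8000 * k * m + (3 + R * (3000 * k * m + 30 * k * m + 4) + (3 + mb * 16)))) ?Q W1 X1"
   unfolding X1
  proof (rule ends_SeqI)
   let ?post2 = "filled 14 0 mb ?fl W1 X"
   show "ends (map_loop 10 28 scan_flags) (3 + mb * (6 + 6)) ?post2 W1 X"
   proof (rule map_loop_ends)
    fix t W' assume t: "t < mb" and fr: "frame loopR {14} W1 W'" and r: "W' 35 = t"
    have env': "env W'" by (rule env_frame[OF env1 fr]) auto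
    have r63: "W' 63 = blk" using frame_reg[OF fr] r1 by simp
    show "computes scan_flags 6 (?fl t) W' X"
     unfolding scan_flags_def ends_def using r r63 env_regs(8,10)[OF env'] ev ev'[OF t] w_pos
     by (cases "blk * mb + t < n") (simp_all add: reg_less frame_upd_reg)
   qed (use env_regs[OF env1] ns mbm in auto)
   fix W2 X2 assume 2: "?post2 W2 X2"
   then have X2: "X2 = X" and fr12: "frame loopR {14} W1 W2" and f2: "\<And>j. j < mb \<Longrightarrow> W2 (ad 14 j) = ?fl j"
    using mbm by auto
   have fr2: "frame treeR ?FS W W2" by (rule frame_trans[OF fr1 fr12]) auto
   have env2: "env W2" by (rule env_frame[OF env fr2]) auto
   have p2: "W2 (ad 11 j) = x j" if "j < mb" for j using frame_slot[OF fr12 ns(2), of j] p1[OF that] mbm that by simp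
   show "ends ((tree_up ;; newton) ;; For 61 11 ((root ;; down) ;; For 56 10 scan_test) ;; For 56 10 scan_append)
    (8000 * k * m + (3 + R * (3000 * k * m + 30 * k * m + 4) + (3 + mb * 16))) ?Q W2 X2"
    unfolding X2
   proof (rule ends_SeqI[OF prepare_ends[OF env2]])
    show "W2 (ad 11 j) = x j" "x j < p" if "j < mb" for j using p2[OF that] xn[of j] n_less by auto
    fix W3 X3 assume 3: "X3 = X \<and> frame treeR {2..<9} W2 W3 \<and> prepared x W3"
    then have X3: "X3 = X" and fr23: "frame treeR {2..<9} W2 W3" and P3: "prepared x W3" by blast+
    have fr3: "frame treeR ?FS W W3" by (rule frame_trans[OF fr2 fr23]) auto
    have env3: "env W3" by (rule env_frame[OF env fr3]) auto
    have p3: "W3 (ad 11 j) = x j" if "j < mb" for j using frame_slot[OF fr23 ns(2), of j] p2[OF that] mbm that by simp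
    have f3: "W3 (ad 14 j) = ?fl j" if "j < mb" for j using frame_slot[OF fr23 ns(4), of j] f2[OF that] mbm that by simp
    let ?P = "\<lambda>r A X'. keeps X X' \<and> (\<forall>j<mb. A 14 j = (if \<forall>r'<r. accepted X r' (x j) then ?fl j else 0))"
    show "ends (For 61 11 ((root ;; down) ;; For 56 10 scan_test) ;; For 56 10 scan_append)
     (3 + R * (3000 * k * m + 30 * k * m + 4) + (3 + mb * 16)) ?Q W3 X3"
     unfolding X3
    proof (rule ends_SeqI)
     let ?post3 = "\<lambda>W' X'. frame treeR ({2..<7} \<union> {12, 13, 14}) W3 W' \<and> ?P R (arr W') X'"
     show "ends (For 61 11 ((root ;; down) ;; For 56 10 scan_test)) (3 + R * (3000 * k * m + 30 * k * m + 4))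
      ?post3 W3 X"
     proof (rule loop_ends[where P = ?P])
      have "R * 1 \<le> R * m" using m_pos by (intro mult_le_mono2) simp
      then show "R < 2 ^ w" using lr_eq lr_less by linarith
      show "?P 0 (arr W3) X" using f3 by (simp add: arr_def)
      fix r W' X' assume r: "r < R" and fr: "frame treeR ({2..<7} \<union> {12, 13, 14}) W3 W'" and r61: "W' 61 = r" and P: "?P r (arr W') X'"
      have env': "env W'" by (rule env_frame[OF env3 fr]) auto
      have P': "prepared x W'" by (rule prepared_frame[OF P3 fr]) auto
      show "ends ((root ;; down) ;; For 56 10 scan_test) (3000 * k * m + 30 * k * m)
        (\<lambda>W'' X''. frame (treeR - {61}) ({2..<7} \<union> {12, 13, 14}) W' W'' \<and> ?P (Suc r) (arr W'') X'') W' X'"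
      proof (rule ends_SeqI[OF evaluate_ends[OF env' r r61 P' less_imp_le[OF cf_less[OF r]]]])
       fix W4 X4 assume 4: "X4 = X' \<and> frame (treeR - {61}) evalS W' W4 \<and>
         (\<forall>i<mb. W4 (ad 12 i) = (\<Sum>b<m. cf r b * x i ^ b) mod p)"
       then have X4: "X4 = X'" and fr4: "frame (treeR - {61}) evalS W' W4" by blast+
       have env4: "env W4" by (rule env_frame[OF env' fr4]) auto
       have r4: "W4 61 = r" using frame_reg[OF fr4] r61 by simp
       have V4: "W4 (ad 12 j) mod m = hv r (x j)" if "j < mb" for j using 4 that by (simp add: hv_def poly_hash_def)
       have f4: "W4 (ad 14 j) = W' (ad 14 j)" if "j < mb" for j using frame_slot[OF fr4 ns(4), of j] mbm that by simp
       have ac: "accepted X' r i = accepted X r i" for i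
       proof -
        have "caddr r (hv r i) \<noteq> 2" by (simp add: caddr_def)
        then show ?thesis using P unfolding accepted_def by simp
       qed
       show "ends (For 56 10 scan_test) (30 * k * m)
        (\<lambda>W'' X''. frame (treeR - {61}) ({2..<7} \<union> {12, 13, 14}) W' W'' \<and> ?P (Suc r) (arr W'') X'') W4 X4"
        unfolding X4
       proof (rule ends_mono[OF scan_row_ends[OF env4 r4 r V4]])
        fix W5 X5 assume 5: "frame {2, 36, 37, 56, 57} {14} W4 W5 \<and> keeps X' X5 \<and>
          (\<forall>t<mb. W5 (ad 14 t) = (if accepted X' r (x t) then W4 (ad 14 t) else 0))"
        then have fr5: "frame {2, 36, 37, 56, 57} {14} W4 W5" by blast
        have "frame (treeR - {61}) ({2..<7} \<union> {12, 13, 14}) W' W5" by (rule frame_trans[OF fr4 fr5]) auto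
        moreover have "W5 (ad 14 j) = (if \<forall>r'<Suc r. accepted X r' (x j) then ?fl j else 0)" if "j < mb" for j
        proof -
         have "W5 (ad 14 j) = (if accepted X r (x j) then W' (ad 14 j) else 0)" using 5 that f4[OF that] ac by simp
         also have "W' (ad 14 j) = (if \<forall>r'<r. accepted X r' (x j) then ?fl j else 0)" using P that by (simp add: arr_def)
         finally show ?thesis by (auto simp: less_Suc_eq)
        qed
        ultimately show "frame (treeR - {61}) ({2..<7} \<union> {12, 13, 14}) W' W5 \<and> ?P (Suc r) (arr W5) X5"
         using 5 P by (simp add: arr_def)
       qed simp_all
      qed
     qed (use env_regs[OF env3] in auto)
     fix W6 X6 assume 6: "?post3 W6 X6"
     then have fr36: "frame treeR ({2..<7} \<union> {12, 13, 14}) W3 W6" and X6: "\<And>q. q \<noteq> 2 \<Longrightarrow> X6 q = X q" by blast+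
     have fr6: "frame treeR ?FS W W6" by (rule frame_trans[OF fr3 fr36]) auto
     have env6: "env W6" by (rule env_frame[OF env fr6]) auto
     have r6: "W6 63 = blk" "W6 0 = W 0" using frame_reg[OF fr6] blk by auto
     have ac: "accepted X6 r i = accepted X r i" for r i
     proof -
      have "caddr r (hv r i) \<noteq> 2" by (simp add: caddr_def)
      then show ?thesis using X6 unfolding accepted_def by simp
     qed
     then have sel: "selected X6 N = selected X N" for N by (simp add: selected_def)
     have lst: "listed X6 N c A = listed X N c A" for N c A by (simp add: listed_def sel)
     have f6: "W6 (ad 14 j) = (if \<forall>r<R. accepted X r (x j) then ?fl j else 0)" if "j < mb" for j
      using 6 that by (simp add: arr_def)
     have p6: "W6 (ad 11 j) = x j" if "j < mb" for j using frame_slot[OF fr36 ns(2), of j] p3[OF that] mbm that by simp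
     have s0: "W6 (ad 0 t) = W (ad 0 t)" if "t < 2 * m" for t using frame_slot[OF fr6 ns(1) that] by simp
     have L6: "stores X6 (blk * mb) W6"
     proof -
      have "W 0 < m" using L sm card_selected_mono[of X "blk * mb"] by (simp add: listed_def)
      then have e: "(\<lambda>t. W6 (ad 0 t)) ` {..<W 0} = (\<lambda>t. W (ad 0 t)) ` {..<W 0}" by (intro image_cong) (auto simp: s0)
      show ?thesis unfolding r6(2) listed_def e sel using L unfolding listed_def .
     qed
     let ?post4 = "\<lambda>W' X'. X' = X6 \<and> frame {0, 2, 36, 37, 56} {0} W6 W' \<and> stores X6 (Suc blk * mb) W'"
     have "ends (For 56 10 scan_append) (3 + mb * 16) ?post4 W6 X6"
     proof (rule scan_append_loop_ends[OF env6 r6(1) _ _ L6])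
      show "card (selected X6 n) < m" using sm by (simp add: sel)
      fix j assume j: "j < mb"
      show "W6 (ad 14 j) = (if blk * mb + j < n \<and> (\<forall>r<R. accepted X6 r (blk * mb + j)) then 1 else 0)"
       unfolding f6[OF j] ac by (simp add: x_def)
      show "W6 (ad 11 j) = blk * mb + j" if "blk * mb + j < n" using p6[OF j] that by (simp add: x_def)
     qed
     then show "ends (For 56 10 scan_append) (3 + mb * 16) ?Q W6 X6"
     proof (rule ends_mono)
      fix W7 X7 assume 7: "?post4 W7 X7"
      then have fr67: "frame {0, 2, 36, 37, 56} {0} W6 W7" by blast
      have "frame (treeR \<union> {0}) scanS W W7" by (rule frame_trans[OF fr6 fr67]) auto
      moreover have "W7 (ad 11 j) < n" if "j < mb" for j
       using frame_slot[OF fr67 ns(2), of j] p6[OF that] mbm that xn[of j] by simp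
      ultimately show "?Q W7 X7" using 7 X6 unfolding lst by blast
     qed simp
    qed
   qed
  qed
 qed
 then show ?thesis
 proof (rule ends_mono)
  have km: "1 * 64 \<le> k * m" "1 * m \<le> k * m" using u_less m_ge by (intro mult_le_mono; linarith)+
  have "3000 * k * m + 30 * k * m + 4 = 3030 * (k * m) + 4" by simp
  also have "\<dots> \<le> 3100 * (k * m)" using km by linarith
  finally have "R * (3000 * k * m + 30 * k * m + 4) \<le> R * (3100 * (k * m))" by (intro mult_le_mono2)
  moreover have "R * (3100 * (k * m)) = 3100 * (R * (k * m))" "8000 * k * m = 8000 * (k * m)" "13000 * R * k * m = 13000 * (R * (k * m))"
   "mb * (5 + 6) = 11 * mb" "mb * (6 + 6) = 12 * mb" by simp_all
  moreover have "1 * (k * m) \<le> R * (k * m)" using R_pos by (intro mult_le_mono1)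
  ultimately show "3 + mb * (5 + 6) + (3 + mb * (6 + 6) + (8000 * k * m + (3 + R * (3000 * k * m + 30 * k * m + 4) + (3 + mb * 16)))) \<le> 13000 * R * k * m"
   using km mbm by linarith
 qed
qed

lemma env_frame':
 assumes "env W" "frame Rs Ss W W'" "Rs \<subseteq> {0, 1, 2} \<union> {31..<64}" "Ss \<subseteq> {0..<9} \<union> {11..<15}"
 shows "env W'"
proof -
 have r: "W' r = W r" if "r \<in> {3..<31}" for r
  using assms(2,3) that by (intro frame_reg[OF assms(2)]) auto
 have t: "W' (ad s t) = W (ad s t)" if "s \<in> {9, 10} \<union> {15..<NS}" "t < m" for s t
  by (rule frame_slot[OF assms(2)]) (use assms(4) that slot_less(1) in auto)
 show ?thesis
  using assms(1) r t NS_eq unfolding env_def by simp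
qed

lemma scan_ends:
 assumes env: "env W" and W0: "W 0 = 0" and idx: "\<And>j. j < mb \<Longrightarrow> W (ad 11 j) < n" and sm: "card (selected X n) < m"
 shows "ends (For 63 30 scan_block) (3 + nblk * (13000 * R * k * m + 4)) (\<lambda>W' X'. keeps X X' \<and>
   frame (treeR \<union> {0, 63}) scanS W W' \<and> (\<forall>j<mb. W' (ad 11 j) < n) \<and>
   stores X n W') W X"
 unfolding ends_def
proof (rule wp_For[where I = "\<lambda>blk W' X'. keeps X X' \<and>
   frame (treeR \<union> {0, 63}) scanS W W' \<and> (\<forall>j<mb. W' (ad 11 j) < n) \<and>
   stores X (blk * mb) W'" and B = "13000 * R * k * m" and N = nblk])
 have "nblk * 1 \<le> nblk * mb" using mb_eq by (intro mult_le_mono2) simp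
 then show "nblk < 2 ^ w" using blk_less by linarith
 show "W 30 = nblk" using env_regs[OF env] by simp
 show "keeps X X \<and> frame (treeR \<union> {0, 63}) scanS W (W(63 := 0)) \<and>
   (\<forall>j<mb. (W(63 := 0)) (ad 11 j) < n) \<and> listed X (0 * mb) ((W(63 := 0)) 0) (\<lambda>t. (W(63 := 0)) (ad 0 t))"
  using W0 idx by (simp add: ad_reg frame_upd_reg listed_def selected_def)
 fix blk W' X' assume blk: "blk < nblk" and I: "keeps X X' \<and>
   frame (treeR \<union> {0, 63}) scanS W W' \<and> (\<forall>j<mb. W' (ad 11 j) < n) \<and>
   stores X (blk * mb) W'" and r: "W' 63 = blk" "W' 30 = nblk"
 from I have X': "\<And>q. q \<noteq> 2 \<Longrightarrow> X' q = X q" and fr: "frame (treeR \<union> {0, 63}) scanS W W'"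
  and Lb: "stores X (blk * mb) W'" by blast+
 have env': "env W'" by (rule env_frame'[OF env fr]) auto
 have ac: "accepted X' r i = accepted X r i" for r i
 proof -
  have "caddr r (hv r i) \<noteq> 2" by (simp add: caddr_def)
  then show ?thesis using X' unfolding accepted_def by simp
 qed
 then have sel: "selected X' N = selected X N" for N by (simp add: selected_def)
 have lst: "listed X' N c A = listed X N c A" for N c A by (simp add: listed_def sel)
 have "ends scan_block (13000 * R * k * m) (\<lambda>W'' X''. keeps X' X'' \<and>
   frame (treeR \<union> {0}) scanS W' W'' \<and> (\<forall>j<mb. W'' (ad 11 j) < n) \<and>
   stores X' (Suc blk * mb) W'') W' X'"
  by (rule scan_block_ends[OF env' r(1) blk]) (use Lb sm in \<open>simp_all add: lst sel\<close>)
 then show "wp scan_block (\<lambda>t (W'', X''). t \<le> 13000 * R * k * m \<and> W'' 63 = blk \<and> W'' 30 = nblk \<and>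
   keeps X X'' \<and>
   frame (treeR \<union> {0, 63}) scanS W (W''(2 := 1, 63 := Suc blk)) \<and>
   (\<forall>j<mb. (W''(2 := 1, 63 := Suc blk)) (ad 11 j) < n) \<and>
   listed X (Suc blk * mb) ((W''(2 := 1, 63 := Suc blk)) 0) (\<lambda>t. (W''(2 := 1, 63 := Suc blk)) (ad 0 t))) (W', X')"
  unfolding ends_def
 proof (rule wp_mono_prod)
  fix t W'' X'' assume *: "t \<le> 13000 * R * k * m \<and> keeps X' X'' \<and>
   frame (treeR \<union> {0}) scanS W' W'' \<and> (\<forall>j<mb. W'' (ad 11 j) < n) \<and>
   stores X' (Suc blk * mb) W''"
  then have fr': "frame (treeR \<union> {0}) scanS W' W''" by blast
  have "frame (treeR \<union> {0, 63}) scanS W W''" by (rule frame_trans[OF fr fr']) auto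
  then have "frame (treeR \<union> {0, 63}) scanS W (W''(2 := 1, 63 := Suc blk))" by (intro frame_upd_reg) auto
  moreover have "W'' 63 = blk" "W'' 30 = nblk" using frame_reg[OF fr'] r by auto
  moreover have "stores X (Suc blk * mb) W''" using * unfolding lst by blast
  ultimately show "case (W'', X'') of (W'', X'') \<Rightarrow> t \<le> 13000 * R * k * m \<and> W'' 63 = blk \<and> W'' 30 = nblk \<and>
   keeps X X'' \<and>
   frame (treeR \<union> {0, 63}) scanS W (W''(2 := 1, 63 := Suc blk)) \<and>
   (\<forall>j<mb. (W''(2 := 1, 63 := Suc blk)) (ad 11 j) < n) \<and>
   listed X (Suc blk * mb) ((W''(2 := 1, 63 := Suc blk)) 0) (\<lambda>t. (W''(2 := 1, 63 := Suc blk)) (ad 0 t))"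
   using * X' by (simp add: ad_reg)
 qed
next
 fix t W' X' assume t: "t \<le> 3 + nblk * (13000 * R * k * m + 4)" and I: "keeps X X' \<and>
   frame (treeR \<union> {0, 63}) scanS W W' \<and> (\<forall>j<mb. W' (ad 11 j) < n) \<and>
   stores X (nblk * mb) W'"
 have "selected X (nblk * mb) = selected X n" using n_le by (auto simp: selected_def)
 then have "listed X (nblk * mb) c A = listed X n c A" for c A by (simp add: listed_def)
 with t I show "case (W', X') of (W', X') \<Rightarrow> t \<le> 3 + nblk * (13000 * R * k * m + 4) \<and> keeps X X' \<and>
   frame (treeR \<union> {0, 63}) scanS W W' \<and> (\<forall>j<mb. W' (ad 11 j) < n) \<and>
   stores X n W'" by simp
qed (auto simp: reg_less)

lemma clear_ends:
 assumes "set il \<subseteq> {..<64}"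
 shows "ends (clear il) (length il) (\<lambda>W' X'. X' = X \<and> W' = (\<lambda>r. if r \<in> set il then 0 else W r)) W X"
 using assms
proof (induction il arbitrary: W)
 case Nil
 then show ?case by (simp add: clear_def ends_def)
next
 case (Cons i il)
 have "ends (clear (i # il)) (1 + length il) (\<lambda>W' X'. X' = X \<and> W' = (\<lambda>r. if r \<in> set il then 0 else (W(i := 0)) r)) W X"
  unfolding clear_def foldr_Cons o_apply
 proof (rule ends_preI)
  show "ends (cst i 0) 1 (\<lambda>W' X'. W' = W(i := 0) \<and> X' = X) W X"
   unfolding ends_def using Cons.prems by (simp add: reg_less)
  show "ends (foldr (\<lambda>i c. cst i 0 ;; c) il Skip) (length il) (\<lambda>W' X'. X' = X \<and> W' = (\<lambda>r. if r \<in> set il then 0 else (W(i := 0)) r)) (W(i := 0)) X"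
   by (rule Cons.IH[of "W(i := 0)", unfolded clear_def]) (use Cons.prems in simp)
 qed
 then show ?case by (rule ends_mono) (auto simp: fun_eq_iff)
qed

text \<open>The coordinates accepted by every row once the counters are exact sums of
  \<open>x\<close>. They include the heavy hitters, and the choice of the hash functions keeps their
  number below \<open>m\<close>.\<close>

definition good :: "reals \<Rightarrow> nat set" where
 "good x = {i. i < n \<and> (\<forall>r<R. (\<Sum>i<n. x i) \<le> 2 ^ a * csum r (hv r i) x)}"

lemma query_main_ends:
 assumes inv: "state_inv x c W X" and sm: "0 < (\<Sum>i<n. x i) \<Longrightarrow> card (good x) < m"
 shows "ends query_main (12000 * R * k * m + nblk * (13000 * R * k * m + 4) + 200)
  (\<lambda>W' X'. state_inv x 0 W' X' \<and> (\<forall>r\<in>{2..<64}. W' r = 0) \<and>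
    (\<exists>q<m. W' 0 = 63 + q \<and> (\<lambda>t. W' (ad 0 t)) ` {..<q} = (if 0 < (\<Sum>i<n. x i) then good x else {}))) W X"
proof -
 from inv[unfolded state_inv_def] obtain y where st: "stat W" and c: "W (ad 1 31) = c" "c < mb" and idx: "\<And>j. j < mb \<Longrightarrow> W (ad 11 j) < n"
  and nm: "X 1 = (\<Sum>i<n. x i)" and C: "\<And>r b. r < R \<Longrightarrow> b < m \<Longrightarrow> X (caddr r b) = csum r b y"
  and xp: "x = push y (\<lambda>j. W (ad 11 j)) (\<lambda>j. X (8 + j)) c" by blast
 let ?nm = "\<Sum>i<n. x i"
 have mbm: "mb \<le> m" by (rule u_props)
 have ns: "11 < NS" "0 < NS" "1 < NS" using slot_less by auto
 have b: "1 < lr" "2 < lr" by (simp_all add: lr_eq)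
 let ?Q = "\<lambda>W' X'. state_inv x 0 W' X' \<and> (\<forall>r\<in>{2..<64}. W' r = 0) \<and>
    (\<exists>q<m. W' 0 = 63 + q \<and> (\<lambda>t. W' (ad 0 t)) ` {..<q} = (if 0 < ?nm then good x else {}))"
 let ?S = "3 + nblk * (13000 * R * k * m + 4)"
 have "ends query_main (87 + (12000 * R * k * m + (1 + (3 + (2 + (?S + 2 + (2 + 62))))))) ?Q W X"
  unfolding query_main_def
 proof (rule ends_SeqI[OF load_ends[OF st]])
  fix W1 X1 assume 1: "X1 = X \<and> env W1 \<and> stat W1 \<and> W1 31 = W (ad 1 31) \<and> W1 0 = W 0 \<and> (\<forall>s t. W1 (ad s t) = W (ad s t))"
  then have X1: "X1 = X" and env1: "env W1" and st1: "stat W1" and r1: "W1 31 = c" and sl: "\<And>s t. W1 (ad s t) = W (ad s t)"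
   using c by auto
  show "ends (flush ;; cst 31 0 ;; save_count ;; (cst 0 0 ;; Prim (RSub 2 1 1)) ;; IfR 2 1 (For 63 30 scan_block) Skip ;;
    (cst 2 63 ;; add 0 0 2) ;; clear [2..<64]) (12000 * R * k * m + (1 + (3 + (2 + (?S + 2 + (2 + 62)))))) ?Q W1 X1"
   unfolding X1
  proof (rule ends_SeqI[OF flush_ends[OF env1 r1 _ refl]])
   show "c \<le> mb" using c by simp
   show "W1 (ad 11 i) < n" if "i < mb" for i using idx[OF that] sl by simp
   show "X (caddr r b) = csum r b y" if "r < R" "b < m" for r b by (rule C[OF that])
   fix W2 X2 assume 2: "frame treeR ({2..<9} \<union> {12, 13}) W1 W2 \<and> (\<forall>i<8 + mb. i \<noteq> 2 \<longrightarrow> i \<noteq> 3 \<longrightarrow> X2 i = X i) \<and>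
    (\<forall>r<R. \<forall>b<m. X2 (caddr r b) = csum r b (push y (\<lambda>i. W1 (ad 11 i)) (\<lambda>j. X (8 + j)) c))"
   then have fr2: "frame treeR ({2..<9} \<union> {12, 13}) W1 W2" and X21: "X2 1 = ?nm" using nm by auto
   have C2: "X2 (caddr r b) = csum r b x" if "r < R" "b < m" for r b using 2 that unfolding xp by (simp add: sl)
   have env2: "env W2" by (rule env_frame[OF env1 fr2]) auto
   have st2: "stat W2" by (rule stat_frame[OF st1 fr2]) auto
   have id2: "W2 (ad 11 j) < n" if "j < mb" for j using frame_slot[OF fr2 ns(1), of j] idx[OF that] sl mbm that by simp
   let ?W3 = "W2(31 := 0)"
   have fr3: "frame {31} {} W2 ?W3" by (intro frame_upd_reg) auto
   have env3: "env ?W3" by (rule env_frame[OF env2 fr3]) auto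
   have st3: "stat ?W3" by (rule stat_frame[OF st2 fr3]) auto
   show "ends (cst 31 0 ;; save_count ;; (cst 0 0 ;; Prim (RSub 2 1 1)) ;; IfR 2 1 (For 63 30 scan_block) Skip ;;
     (cst 2 63 ;; add 0 0 2) ;; clear [2..<64]) (1 + (3 + (2 + (?S + 2 + (2 + 62))))) ?Q W2 X2"
   proof (rule ends_preI)
    show "ends (cst 31 0) 1 (\<lambda>W' X'. W' = ?W3 \<and> X' = X2) W2 X2" unfolding ends_def by (simp add: reg_less)
    show "ends (save_count ;; (cst 0 0 ;; Prim (RSub 2 1 1)) ;; IfR 2 1 (For 63 30 scan_block) Skip ;;
      (cst 2 63 ;; add 0 0 2) ;; clear [2..<64]) (3 + (2 + (?S + 2 + (2 + 62)))) ?Q ?W3 X2"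
    proof (rule ends_SeqI[OF save_ends[OF st3, of 0]])
     show "?W3 31 = 0" by simp
     fix W4 X4 assume 4: "X4 = X2 \<and> stat W4 \<and> W4 (ad 1 31) = 0 \<and> frame {2} {1} ?W3 W4"
     then have X4: "X4 = X2" and st4: "stat W4" and c4: "W4 (ad 1 31) = 0" and fr4: "frame {2} {1} ?W3 W4" by blast+
     have env4: "env W4" by (rule env_frame[OF env3 fr4]) auto
     have id4: "W4 (ad 11 j) < n" if "j < mb" for j using frame_slot[OF fr4 ns(1), of j] id2[OF that] mbm that by (simp add: ad_reg)
     let ?W5 = "W4(0 := 0)" and ?X5 = "X2(2 := 0)"
     have fr5: "frame {0} {} W4 ?W5" by (intro frame_upd_reg) auto
     have env5: "env ?W5" by (rule env_frame'[OF env4 fr5]) auto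
     have st5: "stat ?W5" by (rule stat_frame[OF st4 fr5]) auto
     have C5: "?X5 (caddr r b) = csum r b x" if "r < R" "b < m" for r b
     proof -
      have "caddr r b \<noteq> 2" by (simp add: caddr_def)
      then show ?thesis using C2[OF that] by simp
     qed
     have nm5: "?X5 1 = ?nm" using X21 by simp
     have sel5: "selected ?X5 n = good x"
      unfolding selected_def good_def accepted_def nm5 using C5[OF _ hv_less] by auto
     let ?M = "\<lambda>W' X'. stat W' \<and> W' (ad 1 31) = 0 \<and> (\<forall>j<mb. W' (ad 11 j) < n) \<and> X' 1 = ?nm \<and>
       (\<forall>r<R. \<forall>b<m. X' (caddr r b) = csum r b x) \<and>
       W' 0 < m \<and> (\<lambda>t. W' (ad 0 t)) ` {..<W' 0} = (if 0 < ?nm then good x else {})"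
     show "ends ((cst 0 0 ;; Prim (RSub 2 1 1)) ;; IfR 2 1 (For 63 30 scan_block) Skip ;;
       (cst 2 63 ;; add 0 0 2) ;; clear [2..<64]) (2 + (?S + 2 + (2 + 62))) ?Q W4 X4"
      unfolding X4
     proof (rule ends_preI)
      show "ends (cst 0 0 ;; Prim (RSub 2 1 1)) 2 (\<lambda>W' X'. W' = ?W5 \<and> X' = ?X5) W4 X2"
       unfolding ends_def using b by (simp add: reg_less)
      show "ends (IfR 2 1 (For 63 30 scan_block) Skip ;; (cst 2 63 ;; add 0 0 2) ;; clear [2..<64]) (?S + 2 + (2 + 62)) ?Q ?W5 ?X5"
      proof (rule ends_Seq[where P = ?M, OF ends_IfR _ order_refl])
       show "2 < lr" "1 < lr" using b by auto
      next
       assume "?X5 2 < ?X5 1"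
       then have pos: "0 < ?nm" using nm5 by simp
       have sm5: "card (selected ?X5 n) < m" using sm[OF pos] sel5 by simp
       have w0: "?W5 0 = 0" by simp
       have id5: "?W5 (ad 11 j) < n" if "j < mb" for j using id4[OF that] by (simp add: ad_reg)
       show "ends (For 63 30 scan_block) ?S ?M ?W5 ?X5"
       proof (rule ends_mono[OF scan_ends[OF env5 w0 id5 sm5]])
        fix W6 X6 assume 6: "(\<forall>q. q \<noteq> 2 \<longrightarrow> X6 q = ?X5 q) \<and> frame (treeR \<union> {0, 63}) scanS ?W5 W6 \<and>
          (\<forall>j<mb. W6 (ad 11 j) < n) \<and> listed ?X5 n (W6 0) (\<lambda>t. W6 (ad 0 t))"
        then have fr6: "frame (treeR \<union> {0, 63}) scanS ?W5 W6" and X6: "\<And>q. q \<noteq> 2 \<Longrightarrow> X6 q = ?X5 q"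
         and L6: "listed ?X5 n (W6 0) (\<lambda>t. W6 (ad 0 t))" and id6: "\<forall>j<mb. W6 (ad 11 j) < n" by blast+
        have st6: "stat W6" by (rule stat_frame[OF st5 fr6]) auto
        show "?M W6 X6"
        proof (intro conjI allI impI)
         show "stat W6" by (rule st6)
         show "W6 (ad 1 31) = 0" using frame_slot[OF fr6 ns(3), of 31] c4 m_ge by (simp add: ad_reg)
         show "W6 (ad 11 j) < n" if "j < mb" for j using id6 that by blast
         show "X6 1 = ?nm" using X6[of 1] nm5 by simp
         show "X6 (caddr r b) = csum r b x" if "r < R" "b < m" for r b
         proof -
          have "caddr r b \<noteq> 2" by (simp add: caddr_def)
          from X6[OF this] show ?thesis using C5[OF that] by simp
         qed
         show "W6 0 < m" using L6 sm5 unfolding listed_def by simp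
         show "(\<lambda>t. W6 (ad 0 t)) ` {..<W6 0} = (if 0 < ?nm then good x else {})"
          using L6 unfolding listed_def sel5 if_P[OF pos] by blast
        qed
       qed simp_all
      next
       assume "\<not> ?X5 2 < ?X5 1"
       then have np: "\<not> 0 < ?nm" using nm5 by simp
       have M: "?M ?W5 ?X5"
       proof (intro conjI allI impI)
        show "stat ?W5" by (rule st5)
        show "?W5 (ad 1 31) = 0" using c4 by (simp add: ad_reg)
        show "?W5 (ad 11 j) < n" if "j < mb" for j using id4[OF that] by (simp add: ad_reg)
        show "?X5 1 = ?nm" by (rule nm5)
        show "?X5 (caddr r b) = csum r b x" if "r < R" "b < m" for r b by (rule C5[OF that])
       qed (use np m_pos in simp_all)
       show "ends Skip ?S ?M ?W5 ?X5" by (rule ends_Skip, rule M)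
      next
       fix W6 X6 assume 6: "?M W6 X6"
       have q: "W6 0 < m" using 6 by blast
       let ?W7 = "W6(2 := 63, 0 := 63 + W6 0)"
       have e: "eval_op Add w (W6 0) 63 = 63 + W6 0" "63 mod 2 ^ w = (63::nat)"
        using small_less[of "W6 0 + 63"] small_less[of 63] q m_ge ev_add[of "W6 0" 63 w] by simp_all
       show "ends ((cst 2 63 ;; add 0 0 2) ;; clear [2..<64]) (2 + 62) ?Q W6 X6"
       proof (rule ends_preI)
        show "ends (cst 2 63 ;; add 0 0 2) 2 (\<lambda>W' X'. W' = ?W7 \<and> X' = X6) W6 X6"
         unfolding ends_def using e by (simp add: reg_less)
        have len: "length [2..<64::nat] = 62" by (simp only: length_upt)
        have "ends (clear [2..<64]) (length [2..<64::nat]) ?Q ?W7 X6"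
        proof (rule ends_mono[OF clear_ends])
         fix W8 X8 assume "X8 = X6 \<and> W8 = (\<lambda>r. if r \<in> set [2..<64] then 0 else ?W7 r)"
         then have X8: "X8 = X6" and W8: "\<And>r. W8 r = (if r \<in> {2..<64} then 0 else ?W7 r)" unfolding set_upt by auto
         have fr8: "frame ({0} \<union> {2..<64}) {} W6 W8" unfolding frame_def using W8 by (auto simp: ad_def)
         have sl8: "W8 (ad s t) = W6 (ad s t)" for s t unfolding W8 by (auto simp: ad_def)
         have st8: "stat W8" by (rule stat_frame[OF _ fr8]) (use 6 in auto)
         show "?Q W8 X8"
         proof (intro conjI)
          show "state_inv x 0 W8 X8" unfolding state_inv_def sl8 X8 using 6 st8 c by auto
          show "\<forall>r\<in>{2..<64}. W8 r = 0" using W8 by simp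
          have "W8 0 = 63 + W6 0" using W8 by simp
          then show "\<exists>q<m. W8 0 = 63 + q \<and> (\<lambda>t. W8 (ad 0 t)) ` {..<q} = (if 0 < ?nm then good x else {})"
           unfolding sl8 using 6 by blast
         qed
        qed auto
        then show "ends (clear [2..<64]) 62 ?Q ?W7 X6" unfolding len .
       qed
      qed
     qed
    qed
   qed
  qed
 qed
 then show ?thesis by (rule ends_mono) auto
qed

end

section \<open>Parameters and complexity\<close>

text \<open>Both programs are fixed before \<open>n\<close> and \<epsilon>. Cell \<open>1\<close>
  tells the two regimes apart: it is a positive address if the sketch is in use and \<open>0\<close>
  if all coordinates are listed.\<close>

definition upd_com :: com where
 "upd_com = cst 2 0 ;; IfW 2 1 update_main Skip"

definition qry_com :: com where
 "qry_com = cst 2 0 ;; IfW 2 1 query_main (cst 2 4 ;; add 0 3 2 ;; cst 2 0)"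

definition upd_prog :: program where "upd_prog = compile 0 upd_com @ [Halt]"
definition qry_prog :: program where "qry_prog = compile 0 qry_com @ [Halt]"

lemma strict_turnstile_snocD: "strict_turnstile n (ops @ [oper]) \<Longrightarrow> strict_turnstile n ops"
proof -
 assume *: "strict_turnstile n (ops @ [oper])"
 have "take k ops = take (min k (length ops)) (ops @ [oper])" for k by (simp add: min_def)
 with * show ?thesis unfolding strict_turnstile_def by (metis Un_iff set_append)
qed

lemma strict_turnstile_nonneg: "strict_turnstile n ops \<Longrightarrow> i < n \<Longrightarrow> 0 \<le> stream_vector ops i"
 unfolding strict_turnstile_def by (metis order_refl take_all)

lemma stream_vector_snoc: "stream_vector (ops @ [oper]) = apply_op oper (stream_vector ops)"
 by (simp add: stream_vector_def)

lemma num_updates_snoc [simp]: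
 "num_updates (ops @ [Update i d]) = Suc (num_updates ops)" "num_updates (ops @ [Query]) = num_updates ops"
 by (simp_all add: num_updates_def)

context machine
begin

lemma update_input_mem: "update_input i d (mem_of (W, X)) = mem_of (W(0 := i), X(0 := d))"
 by (simp add: mem_of_def map_upt_update)

text \<open>The invariant sees the accumulated update time \<open>T\<close>, which queries leave
  unchanged; this allows amortised bounds to be carried through the stream.\<close>

lemma processes_invariant:
 assumes init: "I [] 0 s0"
  and upd: "\<And>ops T W X i d. I ops T (W, X) \<Longrightarrow> strict_turnstile n (ops @ [Update i d]) \<Longrightarrow>
   \<exists>t s'. halts w upd (0, mem_of (W(0 := i), X(0 := d))) t (mem_of s') \<and> I (ops @ [Update i d]) (T + t) s'"
  and qry: "\<And>ops T s. I ops T s \<Longrightarrow> strict_turnstile n (ops @ [Query]) \<Longrightarrow>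
   \<exists>t s'. halts w qry (0, mem_of s) t (mem_of s') \<and> I (ops @ [Query]) T s'"
 shows "strict_turnstile n ops \<Longrightarrow> \<exists>T s. processes w upd qry (mem_of s0) ops T (mem_of s) \<and> I ops T s"
proof (induction ops rule: rev_induct)
 case Nil
 show ?case using init processes.init by blast
next
 case (snoc oper ops)
 from snoc.IH[OF strict_turnstile_snocD[OF snoc.prems]] obtain T W X
  where P: "processes w upd qry (mem_of s0) ops T (mem_of (W, X))" and I: "I ops T (W, X)" by fast
 show ?case
 proof (cases oper)
  case (Update i d)
  obtain t s' where "halts w upd (0, mem_of (W(0 := i), X(0 := d))) t (mem_of s')" "I (ops @ [Update i d]) (T + t) s'"
   using upd[OF I] snoc.prems Update by blast
  with processes.update[OF P, of i d t "mem_of s'"] show ?thesis unfolding Update update_input_mem by blast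
 next
  case Query
  obtain t s' where "halts w qry (0, mem_of (W, X)) t (mem_of s')" "I (ops @ [Query]) T s'"
   using qry[OF I] snoc.prems Query by blast
  with processes.query[OF P, of t "mem_of s'"] show ?thesis unfolding Query by blast
 qed
qed

lemma ends_halts:
 assumes "ends c T Q W X"
 obtains t W' X' where "t \<le> T + 1" "Q W' X'" "halts w (compile 0 c @ [Halt]) (0, mem_of (W, X)) t (mem_of (W', X'))"
proof -
 from wp_halts[OF assms[unfolded ends_def]] obtain t s' where
  "(\<lambda>(W', X'). t \<le> T \<and> Q W' X') s'" "halts w (compile 0 c @ [Halt]) (0, mem_of (W, X)) (t + 1) (mem_of s')"
  by metis
 then show ?thesis using that[of "t + 1"] by (cases s') auto
qed

lemma query_output_mem:
 assumes "1 + W 0 \<le> lw"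
 shows "length (query_output (mem_of (W, X))) = W 0" "set (query_output (mem_of (W, X))) = W ` {1..<1 + W 0}"
proof -
 have "lw > 0" using assms by simp
 then have "query_output (mem_of (W, X)) = map W [1..<1 + W 0]"
  using assms by (simp add: mem_of_def drop_map take_map take_upt)
 then show "length (query_output (mem_of (W, X))) = W 0" "set (query_output (mem_of (W, X))) = W ` {1..<1 + W 0}"
  by auto
qed

end

context counters
begin

lemma state_inv_upd_reg:
 assumes "state_inv x c W X" "r = 0 \<or> r = 2"
 shows "state_inv x c (W(r := v)) X"
proof -
 have sl: "(W(r := v)) (ad s t) = W (ad s t)" for s t using assms(2) by (auto simp: ad_def)
 have "(W(r := v)) 1 = W 1" using assms(2) by auto
 then show ?thesis using assms(1) unfolding state_inv_def stat_def sl by simp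
qed

lemma state_inv_upd_real: "state_inv x c W X \<Longrightarrow> state_inv x c W (X(0 := d))"
 unfolding state_inv_def caddr_def by simp

lemma upd_halts:
 assumes inv: "state_inv x c W X" and i: "i < n"
 shows "\<exists>t W' X'. halts w upd_prog (0, mem_of (W(0 := i), X(0 := d))) t (mem_of (W', X')) \<and>
  t \<le> (if Suc c = mb then 12000 * R * k * m else 0) + 120 \<and>
  state_inv (x(i := x i + d)) (if Suc c = mb then 0 else Suc c) W' X'"
proof -
 let ?W = "W(0 := i)" and ?X = "X(0 := d)"
 let ?W1 = "?W(2 := 0)"
 have 1: "state_inv x c ?W1 ?X" using inv by (simp add: state_inv_upd_reg state_inv_upd_real)
 have st: "?W1 1 = ad 1 0" using 1 unfolding state_inv_def stat_def by blast
 let ?T = "if Suc c = mb then 12000 * R * k * m + 110 else 110"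
 let ?Q = "\<lambda>W' X'. state_inv (x(i := x i + d)) (if Suc c = mb then 0 else Suc c) W' X'"
 have "ends upd_com (1 + (?T + 2)) ?Q ?W ?X"
  unfolding upd_com_def
 proof (rule ends_preI)
  show "ends (cst 2 0) 1 (\<lambda>W' X'. W' = ?W1 \<and> X' = ?X) ?W ?X" unfolding ends_def by (simp add: reg_less)
  show "ends (IfW 2 1 update_main Skip) (?T + 2) ?Q ?W1 ?X"
  proof (rule ends_IfW)
   have "?W1 0 = i" by simp
   from update_main_ends[OF 1 this i] show "ends update_main ?T ?Q ?W1 ?X" by (simp only: fun_upd_same)
  qed (use st in \<open>auto simp: reg_less ad_def\<close>)
 qed
 from ends_halts[OF this] obtain t W' X' where "t \<le> 1 + (?T + 2) + 1" "?Q W' X'"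
  "halts w (compile 0 upd_com @ [Halt]) (0, mem_of (?W, ?X)) t (mem_of (W', X'))" .
 then show ?thesis unfolding upd_prog_def by (intro exI[of _ t] exI[of _ W'] exI[of _ X']) (auto split: if_splits)
qed

text \<open>The output consists of the address \<open>64 + 2 * m\<close>, 62 zeros and the list
  proper. All of them are coordinates, so the padding costs only a constant in the length.\<close>

lemma qry_halts:
 assumes inv: "state_inv x c W X" and sm: "0 < (\<Sum>i<n. x i) \<Longrightarrow> card (good x) < m"
 shows "\<exists>t W' X'. halts w qry_prog (0, mem_of (W, X)) t (mem_of (W', X')) \<and>
  t \<le> 12000 * R * k * m + nblk * (13000 * R * k * m + 4) + 210 \<and> state_inv x 0 W' X' \<and>
  length (query_output (mem_of (W', X'))) \<le> 63 + m \<and> set (query_output (mem_of (W', X'))) \<subseteq> {..<n} \<and>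
  (0 < (\<Sum>i<n. x i) \<longrightarrow> good x \<subseteq> set (query_output (mem_of (W', X'))))"
proof -
 let ?W1 = "W(2 := 0)"
 have 1: "state_inv x c ?W1 X" using inv by (simp add: state_inv_upd_reg)
 have st: "?W1 1 = ad 1 0" using 1 unfolding state_inv_def stat_def by blast
 let ?T = "12000 * R * k * m + nblk * (13000 * R * k * m + 4) + 200"
 let ?Q = "\<lambda>W' X'. state_inv x 0 W' X' \<and> (\<forall>r\<in>{2..<64}. W' r = 0) \<and>
    (\<exists>q<m. W' 0 = 63 + q \<and> (\<lambda>t. W' (ad 0 t)) ` {..<q} = (if 0 < (\<Sum>i<n. x i) then good x else {}))"
 have "ends qry_com (1 + (?T + 2)) ?Q W X"
  unfolding qry_com_def
 proof (rule ends_preI)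
  show "ends (cst 2 0) 1 (\<lambda>W' X'. W' = ?W1 \<and> X' = X) W X" unfolding ends_def by (simp add: reg_less)
  show "ends (IfW 2 1 query_main (cst 2 4 ;; add 0 3 2 ;; cst 2 0)) (?T + 2) ?Q ?W1 X"
  proof (rule ends_IfW)
   show "ends query_main ?T ?Q ?W1 X" by (rule query_main_ends[OF 1 sm])
  qed (use st in \<open>auto simp: reg_less ad_def\<close>)
 qed
 from ends_halts[OF this] obtain t W' X' where t: "t \<le> 1 + (?T + 2) + 1" and Q: "?Q W' X'"
  and H: "halts w (compile 0 qry_com @ [Halt]) (0, mem_of (W, X)) t (mem_of (W', X'))" .
 from Q obtain q where q: "q < m" "W' 0 = 63 + q" "(\<lambda>t. W' (ad 0 t)) ` {..<q} = (if 0 < (\<Sum>i<n. x i) then good x else {})" by blast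
 have w1: "W' 1 = 64 + 2 * m" using Q unfolding state_inv_def stat_def by (simp add: ad_def)
 have lw': "1 + W' 0 \<le> lw"
 proof -
  have "1 * (2 * m) \<le> NS * (2 * m)" by (rule mult_le_mono1) (simp add: NS_eq)
  then show ?thesis using lw q by linarith
 qed
 have "{1..<1 + W' 0} = insert 1 ({2..<64} \<union> (+) 64 ` {..<q})"
 proof -
  have "(+) 64 ` {..<q} = {64..<64 + q}" by (simp add: lessThan_atLeast0 add.commute)
  then show ?thesis unfolding q(2) by auto
 qed
 then have "W' ` {1..<1 + W' 0} = insert (W' 1) (W' ` {2..<64} \<union> (\<lambda>t. W' (ad 0 t)) ` {..<q})"
  by (simp add: image_Un image_image ad_def)
 moreover have "W' ` {2..<64} = {0}"
 proof -
  have "W' ` {2..<64} = (\<lambda>_. 0) ` {2..<64::nat}" by (rule image_cong) (use Q in auto)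
  then show ?thesis by (simp add: image_constant_conv)
 qed
 ultimately have S: "set (query_output (mem_of (W', X'))) = insert (64 + 2 * m) ({0} \<union> (if 0 < (\<Sum>i<n. x i) then good x else {}))"
  unfolding query_output_mem(2)[of W' X', OF lw'] q(3) w1 by simp
 have gn: "good x \<subseteq> {..<n}" by (auto simp: good_def)
 show ?thesis
  unfolding qry_prog_def
 proof (intro exI conjI impI)
  show "halts w (compile 0 qry_com @ [Halt]) (0, mem_of (W, X)) t (mem_of (W', X'))" by (rule H)
  show "t \<le> 12000 * R * k * m + nblk * (13000 * R * k * m + 4) + 210" using t by linarith
  show "state_inv x 0 W' X'" using Q by blast
  show "length (query_output (mem_of (W', X'))) \<le> 63 + m" unfolding query_output_mem(1)[of W' X', OF lw'] using q by simp
  show "set (query_output (mem_of (W', X'))) \<subseteq> {..<n}" unfolding S using gn n_gt by auto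
  show "good x \<subseteq> set (query_output (mem_of (W', X')))" if "0 < (\<Sum>i<n. x i)" unfolding S using that by auto
 qed
qed

section \<open>Size and completeness of the answer\<close>

lemma sum_csum: "(\<Sum>b<m. csum r b x) = (\<Sum>i<n. x i)"
proof -
 have "(\<Sum>b<m. csum r b x) = (\<Sum>b<m. \<Sum>i\<in>{i\<in>{..<n}. hv r i = b}. x i)" by (simp add: csum_def)
 also have "\<dots> = (\<Sum>i<n. x i)" by (rule sum.group) (auto simp: hv_less)
 finally show ?thesis .
qed

lemma csum_ge: "(\<And>i. i < n \<Longrightarrow> 0 \<le> x i) \<Longrightarrow> i < n \<Longrightarrow> x i \<le> csum r (hv r i) x"
 unfolding csum_def by (rule member_le_sum) auto

lemma csum_nonneg: "(\<And>i. i < n \<Longrightarrow> 0 \<le> x i) \<Longrightarrow> 0 \<le> csum r b x"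
 unfolding csum_def by (rule sum_nonneg) auto

text \<open>The counters of a row are nonnegative and add up to the total sum, so at most
  \<open>2 ^ a\<close> of them reach a 2^(-a) share of it. These sets of buckets are the
  \<open>V\<close> to which the property of the hash functions is applied.\<close>

lemma card_good:
 assumes x: "\<And>i. i < n \<Longrightarrow> 0 \<le> x i" and pos: "0 < (\<Sum>i<n. x i)"
  and H: "\<And>V. (\<And>r. r < R \<Longrightarrow> V r \<subseteq> {..<m} \<and> card (V r) \<le> 2 ^ a) \<Longrightarrow>
   card {i. i < n \<and> (\<forall>r<R. poly_hash p m (cf r) i \<in> V r)} < m"
 shows "card (good x) < m"
proof -
 define V where "V r = {b. b < m \<and> (\<Sum>i<n. x i) \<le> 2 ^ a * csum r b x}" for r
 have "card (V r) \<le> 2 ^ a" for r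
 proof -
  have "real (card (V r)) * (\<Sum>i<n. x i) = (\<Sum>b\<in>V r. \<Sum>i<n. x i)" by simp
  also have "\<dots> \<le> (\<Sum>b\<in>V r. 2 ^ a * csum r b x)" by (rule sum_mono) (simp add: V_def)
  also have "\<dots> = 2 ^ a * (\<Sum>b\<in>V r. csum r b x)" by (simp add: sum_distrib_left)
  also have "(\<Sum>b\<in>V r. csum r b x) \<le> (\<Sum>b<m. csum r b x)" by (rule sum_mono2) (auto simp: V_def csum_nonneg x)
  also have "\<dots> = (\<Sum>i<n. x i)" by (rule sum_csum)
  finally have "real (card (V r)) * (\<Sum>i<n. x i) \<le> 2 ^ a * (\<Sum>i<n. x i)" by simp
  then have "real (card (V r)) \<le> 2 ^ a" using pos by simp
  then have "real (card (V r)) \<le> real (2 ^ a)" by simp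
  then show ?thesis by (simp only: of_nat_le_iff)
 qed
 then have "card {i. i < n \<and> (\<forall>r<R. poly_hash p m (cf r) i \<in> V r)} < m" by (intro H) (auto simp: V_def)
 moreover have "{i. i < n \<and> (\<forall>r<R. poly_hash p m (cf r) i \<in> V r)} = good x"
  using hv_less unfolding good_def V_def hv_def[symmetric] by auto
 ultimately show ?thesis by simp
qed

lemma heavy_good:
 assumes x: "\<And>i. i < n \<Longrightarrow> 0 \<le> x i" and \<epsilon>: "1 \<le> 2 ^ a * \<epsilon>"
 shows "heavy_hitters n \<epsilon> x \<subseteq> good x"
proof
 fix i assume "i \<in> heavy_hitters n \<epsilon> x"
 moreover have "(\<Sum>i<n. \<bar>x i\<bar>) = (\<Sum>i<n. x i)" by (rule sum.cong) (use x in auto)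
 ultimately have i: "i < n" "\<epsilon> * (\<Sum>i<n. x i) \<le> x i" using x[of i] by (auto simp: heavy_hitters_def l1_norm_def)
 have s0: "0 \<le> (\<Sum>i<n. x i)" by (rule sum_nonneg) (use x in auto)
 have "(\<Sum>i<n. x i) \<le> 2 ^ a * csum r (hv r i) x" for r
 proof -
  have "1 * (\<Sum>i<n. x i) \<le> (2 ^ a * \<epsilon>) * (\<Sum>i<n. x i)" using \<epsilon> s0 by (rule mult_right_mono)
  also have "\<dots> = 2 ^ a * (\<epsilon> * (\<Sum>i<n. x i))" by simp
  also have "\<dots> \<le> 2 ^ a * csum r (hv r i) x"
  proof (intro mult_left_mono)
   have "x i \<le> csum r (hv r i) x" by (rule csum_ge) (use x i in auto)
   with i(2) show "\<epsilon> * (\<Sum>i<n. x i) \<le> csum r (hv r i) x" by linarith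
  qed simp
  finally show ?thesis by simp
 qed
 with i show "i \<in> good x" by (simp add: good_def)
qed

definition initW :: "nat \<Rightarrow> nat" where
 "initW q = (if q = 1 then ad 1 0 else if q < 64 then 0 else
   let s = (q - 64) div (2 * m); t = (q - 64) mod (2 * m) in
    if s = 1 then (if 3 \<le> t \<and> t < 31 then param t else 0)
    else if s = 9 then (if t < m then rep w (fst (tab t)) else 0)
    else if s = 10 then (if t < m then rep w (snd (tab t)) else 0)
    else if 15 \<le> s \<and> t < m then cf (s - 15) t else 0)"

lemma initW_ad: "t < 2 * m \<Longrightarrow> initW (ad s t) = (if s = 1 then (if 3 \<le> t \<and> t < 31 then param t else 0)
    else if s = 9 then (if t < m then rep w (fst (tab t)) else 0)
    else if s = 10 then (if t < m then rep w (snd (tab t)) else 0)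
    else if 15 \<le> s \<and> t < m then cf (s - 15) t else 0)"
proof -
 assume t: "t < 2 * m"
 have "(ad s t - 64) div (2 * m) = s" "(ad s t - 64) mod (2 * m) = t" "ad s t \<noteq> 1" "\<not> ad s t < 64"
  using t by (simp_all add: ad_def)
 then show ?thesis unfolding initW_def Let_def by (simp only: if_False)
qed

lemma initW_inv: "state_inv (\<lambda>_. 0) 0 initW (\<lambda>_. 0)"
proof -
 have "stat initW" unfolding stat_def using m_ge m_pos by (auto simp: initW_ad) (simp add: initW_def)
 moreover have "initW (ad 1 31) = 0" using m_ge by (simp add: initW_ad)
 moreover have "initW (ad 11 j) < n" if "j < mb" for j
  using that u_props(2) n_gt by (simp add: initW_ad)
 moreover have "0 < mb" by (simp add: mb_eq)
 moreover have "\<forall>r<R. \<forall>b<m. 0 = csum r b (\<lambda>_. 0)" by (simp add: csum_def)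
 moreover have "(\<lambda>_. 0) = push (\<lambda>_. 0) (\<lambda>j. initW (ad 11 j)) (\<lambda>j. 0) 0" by simp
 ultimately show ?thesis unfolding state_inv_def by auto
qed

lemma initW_less: "q < lw \<Longrightarrow> initW q < 2 ^ w"
proof -
 assume q: "q < lw"
 have pw: "p < 2 ^ w" using pp_less by linarith
 have param_less: "param i < 2 ^ w" if "3 \<le> i" "i < 31" for i
 proof -
  have "f < 2 ^ w" using f_less less_exp[of w] by linarith
  moreover have "HB < 2 ^ w" "HF < 2 ^ w" unfolding HB_def HF_def using w_pos by (intro power_strict_increasing; simp)+
  moreover have km: "k < m" using m_eq less_exp[of k] by simp
  moreover have "R * 1 \<le> R * m" using m_pos by (intro mult_le_mono2) simp
  then have "R < 2 ^ w" using lr_eq lr_less by linarith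
  moreover have "nblk * 1 \<le> nblk * mb" using mb_eq by (intro mult_le_mono2) simp
  then have "nblk < 2 ^ w" "n < 2 ^ w" using blk_less n_le by linarith+
  moreover have "ad s 0 < 2 ^ w" if "s \<le> 15" for s
   using ad_less[of s 0] that R_pos NS_eq m_pos lw_small by fastforce
  moreover have "m < 2 ^ w" "mb < 2 ^ w" "k < 2 ^ w" "u < 2 ^ w" "a < 2 ^ w" "1 < (2::nat) ^ w" "2 < (2::nat) ^ w"
   using km u_props(2) u_mb a_less m_ge by (intro small_less; linarith)+
  ultimately have all: "\<forall>v\<in>set [p, f, HB, HF, m, k, u, mb, R, n, a, 1, 2, ad 2 0, ad 3 0, ad 4 0, ad 5 0, ad 6 0, ad 7 0, ad 8 0,
   ad 9 0, ad 10 0, ad 11 0, ad 12 0, ad 13 0, ad 14 0, ad 15 0, nblk]. v < 2 ^ w" using pw by simp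
  show ?thesis unfolding param_def by (rule all[rule_format], rule nth_mem) (use that in simp)
 qed
 have c: "cf (s - 15) t < 2 ^ w" if "15 \<le> s" "s < NS" "t < m" for s t
  using cf_less[of "s - 15" t] that NS_eq pw by fastforce
 have s: "(q - 64) div (2 * m) < NS" if "64 \<le> q"
  using that q lw m_pos by (intro less_mult_imp_div_less) simp
 have a1: "ad 1 0 < 2 ^ w" using ad_less[of 1 0] slot_less m_pos lw_small by fastforce
 show ?thesis
  unfolding initW_def Let_def using param_less c s a1 by auto
qed

theorem processes_counters:
 assumes \<epsilon>: "1 \<le> 2 ^ a * \<epsilon>"
  and H: "\<And>V. (\<And>r. r < R \<Longrightarrow> V r \<subseteq> {..<m} \<and> card (V r) \<le> 2 ^ a) \<Longrightarrow>
   card {i. i < n \<and> (\<forall>r<R. poly_hash p m (cf r) i \<in> V r)} < m"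
  and ops: "strict_turnstile n ops"
 shows "\<exists>T s. processes w upd_prog qry_prog (mem_of (initW, \<lambda>_. 0)) ops T (mem_of s) \<and>
  (\<exists>q. q * mb \<le> num_updates ops \<and> T \<le> 120 * num_updates ops + q * (12000 * R * k * m)) \<and>
  (\<exists>t s'. halts w qry_prog (0, mem_of s) t (mem_of s') \<and> t \<le> 12000 * R * k * m + nblk * (13000 * R * k * m + 4) + 210 \<and>
   length (query_output (mem_of s')) \<le> 63 + m \<and> set (query_output (mem_of s')) \<subseteq> {..<n} \<and>
   ((\<exists>i<n. stream_vector ops i \<noteq> 0) \<longrightarrow> heavy_hitters n \<epsilon> (stream_vector ops) \<subseteq> set (query_output (mem_of s'))))"
proof -
 have sm: "card (good (stream_vector ops)) < m" if "strict_turnstile n ops" "0 < (\<Sum>i<n. stream_vector ops i)" for ops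
  by (rule card_good[OF _ that(2) H]) (use strict_turnstile_nonneg[OF that(1)] in auto)
 let ?F = "12000 * R * k * m"
 \<comment> \<open>\<open>q\<close> counts the flushes caused by a full buffer, each paid for by
   \<open>mb\<close> updates. Queries empty the buffer as well, so \<open>q * mb + c\<close> may
   fall behind the number of updates.\<close>
 define I where "I ops T s \<longleftrightarrow> (\<exists>c q. state_inv (stream_vector ops) c (fst s) (snd s) \<and> q * mb + c \<le> num_updates ops \<and>
   T \<le> 120 * num_updates ops + q * ?F)" for ops T and s :: "(nat \<Rightarrow> nat) \<times> (nat \<Rightarrow> real)"
 have "\<exists>T s. processes w upd_prog qry_prog (mem_of (initW, \<lambda>_. 0)) ops T (mem_of s) \<and> I ops T s"
 proof (rule processes_invariant[OF _ _ _ ops])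
  have "stream_vector [] = (\<lambda>_. 0)" by (simp add: stream_vector_def)
  then show "I [] 0 (initW, \<lambda>_. 0)" unfolding I_def using initW_inv by (auto intro!: exI[of _ 0] simp: num_updates_def)
 next
  fix ops T W X i d
  assume I: "I ops T (W, X)" and st: "strict_turnstile n (ops @ [Update i d])"
  have i: "i < n" using st unfolding strict_turnstile_def by auto
  from I obtain c q where inv: "state_inv (stream_vector ops) c W X" and q: "q * mb + c \<le> num_updates ops"
   and T: "T \<le> 120 * num_updates ops + q * ?F" by (auto simp: I_def)
  let ?c' = "if Suc c = mb then 0 else Suc c"
  from upd_halts[OF inv i, of d] obtain t W' X' where h: "halts w upd_prog (0, mem_of (W(0 := i), X(0 := d))) t (mem_of (W', X'))"
   and t: "t \<le> (if Suc c = mb then ?F else 0) + 120"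
   and inv': "state_inv ((stream_vector ops)(i := stream_vector ops i + d)) ?c' W' X'" by blast
  let ?q' = "if Suc c = mb then Suc q else q"
  have "?q' * mb + ?c' \<le> Suc (num_updates ops)" using q by auto
  moreover have "T + t \<le> 120 * Suc (num_updates ops) + ?q' * ?F" using T t by (auto split: if_splits)
  ultimately have "I (ops @ [Update i d]) (T + t) (W', X')"
   unfolding I_def stream_vector_snoc apply_op.simps num_updates_snoc fst_conv snd_conv using inv' by blast
  with h show "\<exists>t s'. halts w upd_prog (0, mem_of (W(0 := i), X(0 := d))) t (mem_of s') \<and> I (ops @ [Update i d]) (T + t) s'" by blast
 next
  fix ops T s assume I: "I ops T s" and st: "strict_turnstile n (ops @ [Query])"
  from I obtain c q where inv: "state_inv (stream_vector ops) c (fst s) (snd s)" and q: "q * mb + c \<le> num_updates ops"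
   and T: "T \<le> 120 * num_updates ops + q * ?F" by (auto simp: I_def)
  from qry_halts[OF inv sm[OF strict_turnstile_snocD[OF st]]] obtain t W' X'
   where h: "halts w qry_prog (0, mem_of s) t (mem_of (W', X'))" and inv': "state_inv (stream_vector ops) 0 W' X'" by auto
  have "q * mb + 0 \<le> num_updates ops" using q by simp
  then have "I (ops @ [Query]) T (W', X')"
   unfolding I_def stream_vector_snoc apply_op.simps num_updates_snoc fst_conv snd_conv using inv' T by blast
  with h show "\<exists>t s'. halts w qry_prog (0, mem_of s) t (mem_of s') \<and> I (ops @ [Query]) T s'" by blast
 qed
 then obtain T s where P: "processes w upd_prog qry_prog (mem_of (initW, \<lambda>_. 0)) ops T (mem_of s)" and I: "I ops T s" by blast
 from I obtain c q where inv: "state_inv (stream_vector ops) c (fst s) (snd s)" and q: "q * mb + c \<le> num_updates ops"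
  and T: "T \<le> 120 * num_updates ops + q * ?F" by (auto simp: I_def)
 from qry_halts[OF inv sm[OF ops]] obtain t W' X'
  where h: "halts w qry_prog (0, mem_of s) t (mem_of (W', X'))" and t: "t \<le> ?F + nblk * (13000 * R * k * m + 4) + 210"
   and len: "length (query_output (mem_of (W', X'))) \<le> 63 + m" and sub: "set (query_output (mem_of (W', X'))) \<subseteq> {..<n}"
   and gd: "0 < (\<Sum>i<n. stream_vector ops i) \<longrightarrow> good (stream_vector ops) \<subseteq> set (query_output (mem_of (W', X')))" by auto
 have hh: "heavy_hitters n \<epsilon> (stream_vector ops) \<subseteq> set (query_output (mem_of (W', X')))" if ex: "\<exists>i<n. stream_vector ops i \<noteq> 0"
 proof -
  note nn = strict_turnstile_nonneg[OF ops]
  from ex obtain i where i: "i < n" "0 < stream_vector ops i" using nn by (metis less_eq_real_def)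
  have "0 < (\<Sum>i<n. stream_vector ops i)" by (rule sum_pos2[of _ i]) (use i nn in auto)
  moreover have "heavy_hitters n \<epsilon> (stream_vector ops) \<subseteq> good (stream_vector ops)" by (rule heavy_good[OF _ \<epsilon>]) (rule nn)
  ultimately show ?thesis using gd by blast
 qed
 have "q * mb \<le> num_updates ops" using q by simp
 with P T h t len sub hh show ?thesis by blast
qed

lemma initial_memory_initW: "initial_memory w (mem_of (initW, \<lambda>_. 0))"
 using initW_less by (auto simp: mem_of_def)

lemma memory_size_le: "memory_size (mem_of s) \<le> 36 * R * m"
proof -
 have "NS * (2 * m) = 30 * m + 2 * (R * m)" by (simp add: NS_eq algebra_simps)
 moreover have "1 * m \<le> R * m" using R_pos by (intro mult_le_mono1)
 moreover have "36 * R * m = 36 * (R * m)" by simp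
 moreover have "memory_size (mem_of s) = lw + lr" by (simp add: mem_of_def)
 ultimately show ?thesis using lw lr_eq u_props(2) m_ge by linarith
qed

end

section \<open>Choice of parameters\<close>

lemma least_power:
 fixes y :: real
 obtains a where "y \<le> 2 ^ a" "a = 0 \<or> 2 ^ (a - 1) < y"
proof -
 have ex: "\<exists>a. y \<le> 2 ^ a" using real_arch_pow[of 2 y] less_imp_le by (metis one_less_numeral_iff semiring_norm(76))
 define a where "a = (LEAST a. y \<le> 2 ^ a)"
 have "y \<le> 2 ^ a" unfolding a_def using ex by (rule LeastI_ex)
 moreover have "a = 0 \<or> 2 ^ (a - 1) < y"
 proof (rule disjCI)
  assume "\<not> 2 ^ (a - 1) < y"
  then have "a \<le> a - 1" unfolding a_def by (intro Least_le) simp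
  then show "a = 0" by simp
 qed
 ultimately show ?thesis using that by blast
qed

definition fix_table :: "nat \<Rightarrow> nat \<Rightarrow> nat \<Rightarrow> int \<times> int" where
 "fix_table f m t = (\<lfloor>2 ^ f * cos (pi * t / m)\<rfloor>, \<lfloor>2 ^ f * sin (pi * t / m)\<rfloor>)"

lemma fix_table: "cmod (cv f (fix_table f m t) - cis (pi * t / m)) \<le> 2 / 2 ^ f"
proof -
 have fl: "\<bar>of_int \<lfloor>2 ^ f * y\<rfloor> / 2 ^ f - y\<bar> \<le> 1 / 2 ^ f" for y :: real
 proof -
  have "\<bar>of_int \<lfloor>2 ^ f * y\<rfloor> - 2 ^ f * y\<bar> \<le> 1" by linarith
  then have "\<bar>of_int \<lfloor>2 ^ f * y\<rfloor> - 2 ^ f * y\<bar> / 2 ^ f \<le> 1 / 2 ^ f" by (simp add: divide_right_mono)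
  also have "\<bar>of_int \<lfloor>2 ^ f * y\<rfloor> - 2 ^ f * y\<bar> / 2 ^ f = \<bar>(of_int \<lfloor>2 ^ f * y\<rfloor> - 2 ^ f * y) / 2 ^ f\<bar>" by simp
  also have "(of_int \<lfloor>2 ^ f * y\<rfloor> - 2 ^ f * y) / 2 ^ f = of_int \<lfloor>2 ^ f * y\<rfloor> / 2 ^ f - y" by (simp add: diff_divide_distrib)
  finally show ?thesis .
 qed
 have "cmod (cv f (fix_table f m t) - cis (pi * t / m)) \<le>
  \<bar>Re (cv f (fix_table f m t) - cis (pi * t / m))\<bar> + \<bar>Im (cv f (fix_table f m t) - cis (pi * t / m))\<bar>"
  by (rule cmod_le)
 also have "\<dots> \<le> 1 / 2 ^ f + 1 / 2 ^ f"
  using fl[of "cos (pi * t / m)"] fl[of "sin (pi * t / m)"] by (intro add_mono) (simp_all add: cv_def fix_table_def)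
 finally show ?thesis by simp
qed

lemma le_power_log: "real n + 1 \<le> 2 ^ nat \<lceil>log 2 (real n + 1)\<rceil>"
proof -
 define l where "l = nat \<lceil>log 2 (real n + 1)\<rceil>"
 have "real n + 1 = 2 powr log 2 (real n + 1)" by simp
 also have "\<dots> \<le> 2 powr real l" by (rule powr_mono) (auto simp: l_def)
 also have "\<dots> = 2 ^ l" by (rule powr_realpow) simp
 finally show ?thesis by (simp only: l_def)
qed

text \<open>The claim for fixed programs and word length factor 128, shared by the two regimes of
  \<epsilon> n.\<close>

definition answers :: "nat \<Rightarrow> real \<Rightarrow> real \<Rightarrow> memory \<Rightarrow> bool" where
 "answers n \<epsilon> C m\<^sub>0 \<longleftrightarrow>
   initial_memory (word_length 128 n) m\<^sub>0 \<and>
   real (memory_size m\<^sub>0) \<le> C * (1 / \<epsilon>) * lg (\<epsilon> * real n) \<and>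
   (\<forall>ops. strict_turnstile n ops \<longrightarrow>
    (\<exists>T m.
     processes (word_length 128 n) upd_prog qry_prog m\<^sub>0 ops T m \<and>
     real T \<le> C * (lg (1 / \<epsilon>))\<^sup>2 * lg (\<epsilon> * real n) * real (num_updates ops) \<and>
     (\<exists>t m'.
       halts (word_length 128 n) qry_prog (0, m) t m' \<and>
       real t \<le> C * real n * (lg (1 / \<epsilon>))\<^sup>2 * lg (\<epsilon> * real n) \<and>
       real (length (query_output m')) \<le> C * (1 / \<epsilon>) \<and>
       set (query_output m') \<subseteq> {..<n} \<and>
       ((\<exists>i<n. stream_vector ops i \<noteq> 0) \<longrightarrow>
        heavy_hitters n \<epsilon> (stream_vector ops) \<subseteq> set (query_output m')))))"

text \<open>The threshold 400 makes room for the padding: \<open>m \<le> 128 / \<epsilon>\<close>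
  bounds \<open>64 + 2 * m\<close> by 320 / \<epsilon>, which is less than \<open>n\<close>.\<close>

lemma answers_large:
 fixes n :: nat and \<epsilon> :: real
 assumes n: "n \<ge> 1" and \<epsilon>: "0 < \<epsilon>" "\<epsilon> \<le> 1" and big: "400 \<le> \<epsilon> * n"
 shows "\<exists>m\<^sub>0. answers n \<epsilon> (10 ^ 7) m\<^sub>0"
proof -
 define l where "l = nat \<lceil>log 2 (real n + 1)\<rceil>"
 define w where "w = word_length 128 n"
 \<comment> \<open>With \<open>p\<close> below 2^(2l+4) and \<open>2 * m\<close> at most 2^l,
   \<open>prec\<close> follows once f reaches 11 l + 15, and \<open>width\<close> once 2 f + 7 l +
   11 is less than w - 1. As l \<ge> 1, the choices 40 l and 128 l satisfy both.\<close>
 define f where "f = 40 * l"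
 have wl: "w = 128 * l" by (simp add: w_def l_def word_length_def)
 have "real (n + 1) \<le> real (2 ^ l)" using le_power_log[of n] by (simp add: l_def)
 then have nl: "n + 1 \<le> 2 ^ l" by (simp only: of_nat_le_iff)
 have e1: "1 \<le> 1 / \<epsilon>" using \<epsilon> by simp
 have n400: "400 / \<epsilon> \<le> n" using big \<epsilon> by (simp add: field_simps)
 \<comment> \<open>The lower limit 8 guarantees \<open>64 \<le> m\<close>; rounding up to a power of
   two still leaves \<open>2 ^ a\<close> of order 1 / \<epsilon>.\<close>
 obtain a where a: "max 8 (1 / \<epsilon>) \<le> 2 ^ a" "a = 0 \<or> 2 ^ (a - 1) < max 8 (1 / \<epsilon>)" by (rule least_power)
 have a0: "a \<noteq> 0" using a(1) by (cases a) auto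
 have "max 8 (1 / \<epsilon>) \<le> 8 / \<epsilon>" using e1 \<epsilon> by (simp add: field_simps)
 moreover have "(2::real) ^ a = 2 * 2 ^ (a - 1)" using a0 by (cases a) auto
 ultimately have a16: "(2::real) ^ a \<le> 16 / \<epsilon>" using a a0 by linarith
 define A where "A = (2::nat) ^ a"
 define k where "k = a + 3"
 define m where "m = (2::nat) ^ k"
 have m8: "m = 8 * A" by (simp add: m_def k_def A_def power_add)
 have Ar: "real A = 2 ^ a" by (simp add: A_def)
 have mr: "real m \<le> 128 / \<epsilon>" using a16 unfolding m8 by (simp add: Ar)
 have "8 \<le> real A" using a(1) Ar by simp
 then have m64: "64 \<le> m" by (simp add: m8)
 have "real (64 + 2 * m) < real n" using mr e1 n400 by simp
 then have mn: "64 + 2 * m < n" by (simp only: of_nat_less_iff)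
 \<comment> \<open>The least number of rows with \<open>n \<le> A * 2 ^ R\<close>, as the union
   bound asks; minimality keeps it of order log (\<epsilon> n).\<close>
 obtain R where R: "real n / A \<le> 2 ^ R" "R = 0 \<or> 2 ^ (R - 1) < real n / A" by (rule least_power)
 have A0: "0 < real A" by (simp add: A_def)
 have R0: "R \<noteq> 0"
 proof
  assume "R = 0"
  then have "real n \<le> A" using R(1) A0 by (simp add: field_simps)
  then show False using mn m8 by simp
 qed
 have "real n \<le> real (A * 2 ^ R)" using R(1) A0 by (simp add: field_simps)
 then have nAR: "n \<le> A * 2 ^ R" by (simp only: of_nat_le_iff)
 have RA: "2 ^ (R - 1) < real n / A" using R R0 by simp
 obtain p where p: "prime p" "n < p" "p \<le> 8 * n\<^sup>2" using prime_polynomial_gap[OF n] by blast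
 have mnn: "m \<le> n" using mn by simp
 have A1: "A \<ge> 1" by (simp add: A_def)
 obtain cf where cf: "\<And>r b. r < R \<Longrightarrow> b < m \<Longrightarrow> cf r b < p"
  and H: "\<And>V. (\<And>r. r < R \<Longrightarrow> V r \<subseteq> {..<m} \<and> card (V r) \<le> A) \<Longrightarrow>
   card {i. i < n \<and> (\<forall>r<R. poly_hash p m (cf r) i \<in> V r)} < m"
 proof (rule hash_family_exists[OF p(1,2) A1 m8 mnn nAR])
  note T = that
  fix c assume 1: "\<And>r b. r < R \<Longrightarrow> b < m \<Longrightarrow> c r b < p"
   and 2: "\<And>W. (\<And>r. r < R \<Longrightarrow> W r \<subseteq> {..<m} \<and> card (W r) \<le> A) \<Longrightarrow>
    card {i. i < n \<and> (\<forall>r<R. poly_hash p m (c r) i \<in> W r)} < m"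
  show thesis
  proof (rule T[of c])
   show "c r b < p" if "r < R" "b < m" for r b by (rule 1[OF that])
   show "card {i. i < n \<and> (\<forall>r<R. poly_hash p m (c r) i \<in> V r)} < m"
    if "\<And>r. r < R \<Longrightarrow> V r \<subseteq> {..<m} \<and> card (V r) \<le> A" for V by (rule 2) (rule that)
  qed
 qed
 \<comment> \<open>Here \<open>2 ^ j\<close> is \<open>k\<close> rounded up to a power of two, so
   that the batch size m / 2^j is again a power of two and of order m / log m.\<close>
 obtain j where j: "real k \<le> 2 ^ j" "j = 0 \<or> 2 ^ (j - 1) < real k" by (rule least_power)
 have j0: "j \<noteq> 0" using j(1) by (cases j) (auto simp: k_def)
 have kj: "k \<le> 2 ^ j"
 proof -
  have "real k \<le> real (2 ^ j)" using j(1) by simp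
  then show ?thesis by (simp only: of_nat_le_iff)
 qed
 have jk: "2 ^ (j - 1) < k"
 proof -
  have "real (2 ^ (j - 1)) < real k" using j(2) j0 by simp
  then show ?thesis by (simp only: of_nat_less_iff)
 qed
 have "j - 1 < 2 ^ (j - 1)" by (rule less_exp)
 then have jlk: "j \<le> k" using jk by linarith
 define u where "u = k - j"
 define mb where "mb = (2::nat) ^ u"
 have mj: "m = 2 ^ j * mb" using jlk by (simp add: m_def mb_def u_def flip: power_add)
 have fit: "mb * (u + 1) \<le> m"
 proof -
  have "u + 1 \<le> 2 ^ j" using kj j0 jlk unfolding u_def by linarith
  then show ?thesis unfolding mj mult.commute[of "2 ^ j"] by (rule mult_le_mono2)
 qed
 have mk: "m \<le> 2 * k * mb"
 proof -
  have "(2::nat) ^ j = 2 * 2 ^ (j - 1)" using j0 by (cases j) auto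
  then have "2 ^ j \<le> 2 * k" using jk by simp
  then show ?thesis unfolding mj by (rule mult_le_mono1)
 qed
 have mb0: "0 < mb" by (simp add: mb_def)
 have mbm: "mb \<le> m" unfolding mj by simp
 define nblk where "nblk = n div mb + 1"
 have nb1: "n \<le> nblk * mb" unfolding nblk_def using mb0 by (metis Suc_eq_plus1 dividend_less_div_times less_imp_le mult.commute mult_Suc add.commute mult.right_neutral add_mult_distrib nat_mult_1)
 have nb2: "nblk * mb \<le> 2 * n"
 proof -
  have "n div mb * mb \<le> n" by simp
  moreover have "nblk * mb = n div mb * mb + mb" by (simp add: nblk_def)
  ultimately show ?thesis using mbm mnn by linarith
 qed
 define NS where "NS = 15 + R"
 define lw where "lw = 64 + NS * (2 * m)"
 define lr where "lr = 8 + mb + R * m"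
 have l1: "1 \<le> l" using nl n by (cases l) auto
 have n2: "n < 2 ^ l" using nl by simp
 have pl: "p \<le> 2 ^ (3 + 2 * l)"
 proof -
  have "n\<^sup>2 \<le> (2 ^ l)\<^sup>2" using n2 by (intro power_mono) auto
  then have "8 * n\<^sup>2 \<le> 2 ^ (3 + 2 * l)" by (simp add: power_add power_mult mult.commute[of 2 l])
  then show ?thesis using p(3) by linarith
 qed
 have ml: "2 * m \<le> 2 ^ l" using mn n2 by linarith
 have pm: "(2 * m) ^ e * p\<^sup>2 \<le> 2 ^ (e * l + 6 + 4 * l)" for e
 proof -
  have "(2 * m) ^ e * p\<^sup>2 \<le> (2 ^ l) ^ e * (2 ^ (3 + 2 * l))\<^sup>2" using ml pl by (intro mult_le_mono power_mono) auto
  also have "\<dots> = 2 ^ (e * l + 6 + 4 * l)" by (simp add: power_mult[symmetric] power_add[symmetric] algebra_simps)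
  finally show ?thesis .
 qed
 have prec: "512 * (2 * m) ^ 7 * p\<^sup>2 \<le> 2 ^ f"
 proof -
  have "512 * ((2 * m) ^ 7 * p\<^sup>2) \<le> 512 * 2 ^ (7 * l + 6 + 4 * l)" using pm[of 7] by (rule mult_le_mono2)
  also have "\<dots> = 2 ^ 9 * 2 ^ (7 * l + 6 + 4 * l)" by simp
  also have "\<dots> = (2::nat) ^ (9 + (7 * l + 6 + 4 * l))" by (simp only: power_add)
  also have "\<dots> \<le> 2 ^ f" using l1 by (intro power_increasing) (auto simp: f_def)
  finally show ?thesis by (simp only: mult.assoc)
 qed
 have width: "32 * 4 ^ f * (2 * m) ^ 3 * p\<^sup>2 < 2 ^ (w - 1)"
 proof -
  have "32 * 4 ^ f * ((2 * m) ^ 3 * p\<^sup>2) \<le> 32 * 4 ^ f * 2 ^ (3 * l + 6 + 4 * l)" using pm[of 3] by (intro mult_le_mono2)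
  also have "\<dots> = 2 ^ 5 * 2 ^ (2 * f) * 2 ^ (3 * l + 6 + 4 * l)" by (simp add: power_mult)
  also have "\<dots> = (2::nat) ^ (5 + 2 * f + (3 * l + 6 + 4 * l))" by (simp only: power_add)
  also have "\<dots> < 2 ^ (w - 1)" using l1 by (intro power_strict_increasing) (auto simp: f_def wl)
  finally show ?thesis by (simp only: mult.assoc)
 qed
 have Rn: "R \<le> n"
 proof -
  have "real (R - 1) < 2 ^ (R - 1)" by (rule of_nat_less_two_power)
  also have "\<dots> < real n / A" by (rule RA)
  also have "\<dots> \<le> real n / 1" using A1 by (intro divide_left_mono) auto
  finally show ?thesis by simp
 qed
 have nn_w: "4 * (n * n) < 2 ^ w"
 proof -
  have "4 * (n * n) < 4 * (2 ^ l * 2 ^ l)" using n2 by (simp add: mult_strict_mono)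
  also have "\<dots> = (2::nat) ^ (2 + 2 * l)" by (simp add: power_add mult_2)
  also have "\<dots> \<le> 2 ^ w" using l1 by (intro power_increasing) (auto simp: wl)
  finally show ?thesis .
 qed
 have lw_small: "lw < 2 ^ w"
 proof -
  have "NS * (2 * m) \<le> (2 * n) * n" unfolding NS_def using Rn mn m64 by (intro mult_le_mono) linarith+
  moreover have "64 * 1 \<le> n * n" using mn n by (intro mult_le_mono) linarith+
  moreover have "(2 * n) * n = 2 * (n * n)" by simp
  ultimately show ?thesis unfolding lw_def using nn_w by linarith
 qed
 have blk_less: "nblk * mb < 2 ^ w"
 proof -
  have "n * 1 \<le> n * n" using n by (intro mult_le_mono2)
  then show ?thesis using nb2 nn_w by linarith
 qed
 interpret counters w lw lr NS f m "fix_table f m" p k u mb R n a nblk cf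
 proof unfold_locales
  show "lw = 64 + NS * (2 * m)" by (rule lw_def)
  show "lw < 2 ^ w" by (rule lw_small)
  show "1 \<le> f" using l1 by (simp add: f_def)
  show "0 < m" using m64 by simp
  show "cmod (cv f (fix_table f m t) - cis (pi * real t / real m)) \<le> 2 / 2 ^ f" for t by (rule fix_table)
  show "f < w" using l1 by (simp add: f_def wl)
  show "NS = 15 + R" by (rule NS_def)
  show "m = 2 ^ k" by (rule m_def)
  show "64 \<le> m" by (rule m64)
  show "mb = 2 ^ u" by (rule mb_def)
  show "1 \<le> R" using R0 by simp
  show "1 \<le> p" "2 \<le> p" using p n by auto
  show "512 * (2 * m) ^ 7 * p\<^sup>2 \<le> 2 ^ f" by (rule prec)
  show "32 * 4 ^ f * (2 * m) ^ 3 * p\<^sup>2 < 2 ^ (w - 1)" by (rule width)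
  show "mb * (u + 1) \<le> m" by (rule fit)
  show "u < k" using j0 by (simp add: u_def k_def)
  show "n < p" by (rule p)
  show "lr = 8 + mb + R * m" by (rule lr_def)
  show "n \<le> nblk * mb" by (rule nb1)
  show "nblk * mb < 2 ^ w" by (rule blk_less)
  show "cf r t < p" if "r < R" "t < m" for r t by (rule cf[OF that])
  show "a \<le> k" by (simp add: k_def)
  show "64 + 2 * m < n" by (rule mn)
 qed
 define E where "E = lg (1 / \<epsilon>)"
 define L where "L = lg (\<epsilon> * n)"
 have EL: "1 \<le> E" "1 \<le> L" "log 2 (1 / \<epsilon>) \<le> E" "log 2 (\<epsilon> * n) \<le> L" by (simp_all add: E_def L_def lg_def)
 have kE: "real k \<le> 8 * E"
 proof -
  have "2 powr real k = real m" by (simp add: m_def powr_realpow)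
  then have "2 powr real k \<le> 128 / \<epsilon>" using mr by linarith
  then have "log 2 (2 powr real k) \<le> log 2 (128 / \<epsilon>)" using \<epsilon> by (subst log_le_cancel_iff) auto
  also have "log 2 (128 / \<epsilon>) = log 2 (2 ^ 7 * (1 / \<epsilon>))" by simp
  also have "\<dots> = log 2 (2 ^ 7) + log 2 (1 / \<epsilon>)" using \<epsilon> by (subst log_mult) auto
  also have "log 2 ((2::real) ^ 7) = 7" by (subst log_pow_cancel) simp_all
  finally show ?thesis using EL by simp
 qed
 have RL: "real R \<le> 2 * L"
 proof -
  have "1 \<le> \<epsilon> * 2 ^ a" using a(1) \<epsilon> by (simp add: field_simps)
  then have "real n * 1 \<le> real n * (\<epsilon> * real A)" unfolding Ar by (intro mult_left_mono) auto
  then have "real n / A \<le> \<epsilon> * n" using A0 by (simp add: field_simps)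
  then have "2 powr real (R - 1) \<le> \<epsilon> * n" using RA by (simp add: powr_realpow)
  then have "log 2 (2 powr real (R - 1)) \<le> log 2 (\<epsilon> * n)" using \<epsilon> n by (subst log_le_cancel_iff) auto
  then have "real (R - 1) \<le> L" using EL by simp
  then show ?thesis using R0 EL by linarith
 qed
 \<comment> \<open>The amortised cost: a flush takes a multiple of \<open>R * k * m\<close> steps
   and is shared by \<open>mb\<close> updates, where \<open>m \<le> 2 * k * mb\<close>.\<close>
 have RKK: "real R * real k * real k \<le> 128 * (E\<^sup>2 * L)"
 proof -
  have "real R * (real k * real k) \<le> (2 * L) * ((8 * E) * (8 * E))" using RL kE EL by (intro mult_mono) auto
  also have "\<dots> = 128 * (E\<^sup>2 * L)" by (simp add: power2_eq_square)
  finally show ?thesis by (simp only: mult.assoc)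
 qed
 have EL1: "1 \<le> E\<^sup>2 * L" using EL mult_mono[of 1 "E\<^sup>2" 1 L] by (simp add: one_le_power)
 have k1: "1 \<le> k" by (simp add: k_def)
 let ?m0 = "mem_of (initW, \<lambda>_. 0)"
 have size: "real (memory_size ?m0) \<le> 10 ^ 7 * (1 / \<epsilon>) * L"
 proof -
  have "real (memory_size ?m0) \<le> real (36 * R * m)" using memory_size_le by (simp only: of_nat_le_iff)
  also have "\<dots> = 36 * (real R * real m)" by simp
  also have "\<dots> \<le> 36 * ((2 * L) * (128 / \<epsilon>))" using RL mr EL by (intro mult_left_mono mult_mono) auto
  also have "\<dots> = 9216 * ((1 / \<epsilon>) * L)" by simp
  also have "\<dots> \<le> 10 ^ 7 * ((1 / \<epsilon>) * L)" using \<epsilon> EL by (intro mult_right_mono) auto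
  finally show ?thesis by simp
 qed
 have eps: "1 \<le> 2 ^ a * \<epsilon>" using a(1) \<epsilon> by (simp add: field_simps)
 have "answers n \<epsilon> (10 ^ 7) ?m0"
  unfolding answers_def w_def[symmetric] E_def[symmetric] L_def[symmetric]
 proof (intro conjI allI impI)
  show "initial_memory w ?m0" by (rule initial_memory_initW)
  show "real (memory_size ?m0) \<le> 10 ^ 7 * (1 / \<epsilon>) * L" by (rule size)
  fix ops assume ops: "strict_turnstile n ops"
  have H': "card {i. i < n \<and> (\<forall>r<R. poly_hash p m (cf r) i \<in> V r)} < m"
   if "\<And>r. r < R \<Longrightarrow> V r \<subseteq> {..<m} \<and> card (V r) \<le> 2 ^ a" for V
   by (rule H) (use that in \<open>simp add: A_def\<close>)
  from processes_counters[OF eps H' ops] obtain T s q t s' where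
   P: "processes w upd_prog qry_prog ?m0 ops T (mem_of s)" and q: "q * mb \<le> num_updates ops"
   and T: "T \<le> 120 * num_updates ops + q * (12000 * R * k * m)"
   and h: "halts w qry_prog (0, mem_of s) t (mem_of s')" and t: "t \<le> 12000 * R * k * m + nblk * (13000 * R * k * m + 4) + 210"
   and len: "length (query_output (mem_of s')) \<le> 63 + m" and sub: "set (query_output (mem_of s')) \<subseteq> {..<n}"
   and hh: "(\<exists>i<n. stream_vector ops i \<noteq> 0) \<longrightarrow> heavy_hitters n \<epsilon> (stream_vector ops) \<subseteq> set (query_output (mem_of s'))"
   by blast
  let ?nu = "num_updates ops"
  have Tr: "real T \<le> 10 ^ 7 * E\<^sup>2 * L * real ?nu"
  proof -
   have "q * m \<le> q * (2 * k * mb)" using mk by (rule mult_le_mono2)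
   also have "\<dots> = 2 * k * (q * mb)" by simp
   also have "\<dots> \<le> 2 * k * ?nu" using q by (rule mult_le_mono2)
   finally have "12000 * R * k * (q * m) \<le> 12000 * R * k * (2 * k * ?nu)" by (rule mult_le_mono2)
   moreover have "q * (12000 * R * k * m) = 12000 * R * k * (q * m)" "12000 * R * k * (2 * k * ?nu) = 24000 * (R * k * k * ?nu)"
    by simp_all
   ultimately have "T \<le> 120 * ?nu + 24000 * (R * k * k * ?nu)" using T by linarith
   then have "real T \<le> real (120 * ?nu + 24000 * (R * k * k * ?nu))" by (simp only: of_nat_le_iff)
   also have "\<dots> = (120 * 1 + 24000 * (real R * real k * real k)) * real ?nu" by (simp add: algebra_simps)
   also have "\<dots> \<le> (120 * (E\<^sup>2 * L) + 24000 * (128 * (E\<^sup>2 * L))) * real ?nu"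
    using RKK EL1 by (intro mult_right_mono add_mono mult_left_mono) auto
   also have "\<dots> = 3072120 * (E\<^sup>2 * L * real ?nu)" by simp
   also have "\<dots> \<le> 10 ^ 7 * (E\<^sup>2 * L * real ?nu)" using EL by (intro mult_right_mono) auto
   finally show ?thesis by (simp add: mult.assoc)
  qed
  have tr: "real t \<le> 10 ^ 7 * real n * E\<^sup>2 * L"
  proof -
   have "nblk * m \<le> nblk * (2 * k * mb)" using mk by (rule mult_le_mono2)
   also have "\<dots> = 2 * k * (nblk * mb)" by simp
   also have "\<dots> \<le> 2 * k * (2 * n)" using nb2 by (rule mult_le_mono2)
   finally have "13000 * R * k * (nblk * m) \<le> 13000 * R * k * (2 * k * (2 * n))" by (rule mult_le_mono2)
   moreover have "nblk * (13000 * R * k * m + 4) = 13000 * R * k * (nblk * m) + 4 * nblk" by (simp add: algebra_simps)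
   moreover have "13000 * R * k * (2 * k * (2 * n)) = 52000 * (R * k * k * n)" by simp
   moreover have "12000 * R * k * m \<le> 12000 * (R * k * k * n)"
   proof -
    have "R * k * 1 * m \<le> R * k * k * n" using k1 mnn by (intro mult_le_mono) auto
    then show ?thesis by simp
   qed
   moreover have "4 * nblk \<le> 8 * n"
   proof -
    have "nblk * 1 \<le> nblk * mb" using mb0 by (intro mult_le_mono2) simp
    then show ?thesis using nb2 by linarith
   qed
   moreover have "1 * n \<le> R * k * k * n" using R0 k1 by (intro mult_le_mono1) simp
   ultimately have "t \<le> 65000 * (R * k * k * n)" using t mn by linarith
   then have "real t \<le> real (65000 * (R * k * k * n))" by (simp only: of_nat_le_iff)
   also have "\<dots> = 65000 * (real R * real k * real k) * real n" by simp
   also have "\<dots> \<le> 65000 * (128 * (E\<^sup>2 * L)) * real n" using RKK by (intro mult_right_mono mult_left_mono) auto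
   also have "\<dots> = 8320000 * (real n * (E\<^sup>2 * L))" by simp
   also have "\<dots> \<le> 10 ^ 7 * (real n * (E\<^sup>2 * L))" using EL by (intro mult_right_mono) auto
   finally show ?thesis by (simp add: mult.assoc)
  qed
  have lenr: "real (length (query_output (mem_of s'))) \<le> 10 ^ 7 * (1 / \<epsilon>)"
  proof -
   have "real (length (query_output (mem_of s'))) \<le> 63 + real m" using len by linarith
   also have "\<dots> \<le> 191 * (1 / \<epsilon>)" using mr e1 by simp
   also have "\<dots> \<le> 10 ^ 7 * (1 / \<epsilon>)" using \<epsilon> by (intro mult_right_mono) auto
   finally show ?thesis .
  qed
  show "\<exists>T m. processes w upd_prog qry_prog ?m0 ops T m \<and> real T \<le> 10 ^ 7 * E\<^sup>2 * L * real (num_updates ops) \<and>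
    (\<exists>t m'. halts w qry_prog (0, m) t m' \<and> real t \<le> 10 ^ 7 * real n * E\<^sup>2 * L \<and>
     real (length (query_output m')) \<le> 10 ^ 7 * (1 / \<epsilon>) \<and> set (query_output m') \<subseteq> {..<n} \<and>
     ((\<exists>i<n. stream_vector ops i \<noteq> 0) \<longrightarrow> heavy_hitters n \<epsilon> (stream_vector ops) \<subseteq> set (query_output m')))"
   using P Tr h tr lenr sub hh by blast
 qed
 then show ?thesis by blast
qed

text \<open>Since \<open>n\<close> is below 400 / \<epsilon>, the list of all coordinates is short
  enough and can be written in advance. Cell \<open>3\<close> stores \<open>n - 1\<close> instead of
  \<open>n\<close> because it belongs to the output and must be a coordinate itself.\<close>

lemma answers_small:
 fixes n :: nat and \<epsilon> :: real
 assumes n: "n \<ge> 1" and \<epsilon>: "0 < \<epsilon>" "\<epsilon> \<le> 1" and small: "\<epsilon> * n < 400"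
 shows "\<exists>m\<^sub>0. answers n \<epsilon> (10 ^ 7) m\<^sub>0"
proof -
 define l where "l = nat \<lceil>log 2 (real n + 1)\<rceil>"
 define w where "w = word_length 128 n"
 have wl: "w = 128 * l" by (simp add: w_def l_def word_length_def)
 have "real (n + 1) \<le> real (2 ^ l)" using le_power_log[of n] by (simp add: l_def)
 then have nl: "n + 1 \<le> 2 ^ l" by (simp only: of_nat_le_iff)
 have l1: "1 \<le> l" using nl n by (cases l) auto
 have nw: "n + 3 < 2 ^ w"
 proof -
  have "n + 3 < 2 ^ l * 2 ^ 2" using nl by simp
  also have "\<dots> = (2::nat) ^ (l + 2)" by (simp only: power_add)
  also have "\<dots> \<le> 2 ^ w" using l1 by (intro power_increasing) (auto simp: wl)
  finally show ?thesis .
 qed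
 define lw where "lw = n + 4"
 define lr where "lr = (1::nat)"
 interpret machine w lw lr .
 have lw: "0 < lw" "1 < lw" "2 < lw" "3 < lw" by (simp_all add: lw_def)
 \<comment> \<open>The list starts at cell \<open>4\<close>. Truncated subtraction puts
   \<open>0\<close> into cells 1 and 2, which are part of the output, and the zero in cell
   \<open>1\<close> selects this regime.\<close>
 define W0 :: "nat \<Rightarrow> nat" where "W0 q = (if q = 3 then n - 1 else q - 4)" for q
 define ok where "ok W \<longleftrightarrow> W 1 = 0 \<and> W 3 = n - 1 \<and> (\<forall>i<n. W (4 + i) = i)" for W :: "nat \<Rightarrow> nat"
 have ok0: "ok W0" by (simp add: ok_def W0_def)
 have e: "4 mod 2 ^ w = (4::nat)" "eval_op Add w (n - Suc 0) 4 = n + 3" using nw n by (auto simp: ev_add)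
 have upd: "ends upd_com 3 (\<lambda>W' X'. ok W') W X" if "ok W" for W and X :: "nat \<Rightarrow> real"
  unfolding upd_com_def ends_def using that lw by (simp add: ok_def)
 have qry: "ends qry_com 6 (\<lambda>W' X'. ok W' \<and> W' 0 = n + 3 \<and> W' 2 = 0) W X" if "ok W" for W and X :: "nat \<Rightarrow> real"
  unfolding qry_com_def ends_def using that e lw by (simp add: ok_def)
 have en: "real n \<le> 400 * (1 / \<epsilon>)" using small \<epsilon> by (simp add: field_simps)
 define E where "E = lg (1 / \<epsilon>)"
 define L where "L = lg (\<epsilon> * n)"
 have EL: "1 \<le> E" "1 \<le> L" by (simp_all add: E_def L_def lg_def)
 have EL1: "1 \<le> E\<^sup>2 * L" using EL mult_mono[of 1 "E\<^sup>2" 1 L] by (simp add: one_le_power)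
 have e1: "1 \<le> 1 / \<epsilon>" using \<epsilon> by simp
 let ?m0 = "mem_of (W0, \<lambda>_. 0)"
 have "answers n \<epsilon> (10 ^ 7) ?m0"
  unfolding answers_def w_def[symmetric] E_def[symmetric] L_def[symmetric]
 proof (intro conjI allI impI)
  show "initial_memory w ?m0" unfolding mem_of_def using nw by (auto simp: W0_def lw_def)
  have "real (memory_size ?m0) = real n + 5" unfolding mem_of_def by (simp add: lw_def lr_def)
  also have "\<dots> \<le> 405 * (1 / \<epsilon>) * 1" using en e1 by linarith
  also have "\<dots> \<le> 10 ^ 7 * (1 / \<epsilon>) * L" using EL \<epsilon> by (intro mult_mono) auto
  finally show "real (memory_size ?m0) \<le> 10 ^ 7 * (1 / \<epsilon>) * L" .
  fix ops assume ops: "strict_turnstile n ops"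
  have "\<exists>T s. processes w upd_prog qry_prog ?m0 ops T (mem_of s) \<and> (ok (fst s) \<and> T \<le> 4 * num_updates ops)"
  proof (rule processes_invariant[OF _ _ _ ops])
   show "ok (fst (W0, \<lambda>_. 0 :: real)) \<and> 0 \<le> 4 * num_updates []" using ok0 by simp
  next
   fix ops T W and X :: "nat \<Rightarrow> real" and i d
   assume I: "ok (fst (W, X)) \<and> T \<le> 4 * num_updates ops"
   then have "ok (W(0 := i))" by (simp add: ok_def)
   from ends_halts[OF upd[OF this, of "X(0 := d)"]] obtain t W' X' where "t \<le> 3 + 1" "ok W'"
    "halts w (compile 0 upd_com @ [Halt]) (0, mem_of (W(0 := i), X(0 := d))) t (mem_of (W', X'))" .
   then show "\<exists>t s'. halts w upd_prog (0, mem_of (W(0 := i), X(0 := d))) t (mem_of s') \<and>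
     (ok (fst s') \<and> T + t \<le> 4 * num_updates (ops @ [Update i d]))"
    unfolding upd_prog_def using I by (intro exI[of _ t] exI[of _ "(W', X')"]) simp
  next
   fix ops T and s :: "(nat \<Rightarrow> nat) \<times> (nat \<Rightarrow> real)" assume I: "ok (fst s) \<and> T \<le> 4 * num_updates ops"
   obtain W X where s: "s = (W, X)" by (cases s)
   from I s have "ok W" by simp
   from ends_halts[OF qry[OF this, of X]] obtain t W' X' where "ok W' \<and> W' 0 = n + 3 \<and> W' 2 = 0"
    "halts w (compile 0 qry_com @ [Halt]) (0, mem_of (W, X)) t (mem_of (W', X'))" .
   then show "\<exists>t s'. halts w qry_prog (0, mem_of s) t (mem_of s') \<and> (ok (fst s') \<and> T \<le> 4 * num_updates (ops @ [Query]))"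
    unfolding qry_prog_def s using I by (intro exI[of _ t] exI[of _ "(W', X')"]) simp
  qed
  then obtain T W X where P: "processes w upd_prog qry_prog ?m0 ops T (mem_of (W, X))" and okW: "ok W" and T: "T \<le> 4 * num_updates ops"
   by fastforce
  from ends_halts[OF qry[OF okW, of X]] obtain t W' X' where t: "t \<le> 6 + 1" and Q: "ok W' \<and> W' 0 = n + 3 \<and> W' 2 = 0"
   and h: "halts w (compile 0 qry_com @ [Halt]) (0, mem_of (W, X)) t (mem_of (W', X'))" .
  have lw': "1 + W' 0 \<le> lw" using Q by (simp add: lw_def)
  note qo = query_output_mem[of W' X', OF lw']
  have S: "set (query_output (mem_of (W', X'))) = {..<n}"
  proof -
   have "{1..<1 + W' 0} = {1, 2, 3} \<union> (+) 4 ` {..<n}"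
   proof -
    have "(+) 4 ` {..<n} = {4..<4 + n}" by (simp add: lessThan_atLeast0 add.commute)
    then show ?thesis using Q by auto
   qed
   then have "W' ` {1..<1 + W' 0} = {W' 1, W' 2, W' 3} \<union> (\<lambda>i. W' (4 + i)) ` {..<n}" by (simp add: image_Un image_image)
   also have "(\<lambda>i. W' (4 + i)) ` {..<n} = {..<n}" using Q unfolding ok_def by (auto simp: image_iff)
   also have "{W' 1, W' 2, W' 3} \<union> {..<n} = {..<n}" using Q n unfolding ok_def by auto
   finally show ?thesis unfolding qo(2) .
  qed
  have Tr: "real T \<le> 10 ^ 7 * E\<^sup>2 * L * real (num_updates ops)"
  proof -
   have "real T \<le> 4 * 1 * real (num_updates ops)" using T by linarith
   also have "\<dots> \<le> 10 ^ 7 * (E\<^sup>2 * L) * real (num_updates ops)" using EL1 by (intro mult_right_mono mult_mono) auto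
   finally show ?thesis by (simp add: mult.assoc)
  qed
  have tr: "real t \<le> 10 ^ 7 * real n * E\<^sup>2 * L"
  proof -
   have "real t \<le> 10 ^ 7 * 1 * 1" using t by simp
   also have "\<dots> \<le> 10 ^ 7 * real n * (E\<^sup>2 * L)" using EL1 n by (intro mult_mono) auto
   finally show ?thesis by (simp add: mult.assoc)
  qed
  have lenr: "real (length (query_output (mem_of (W', X')))) \<le> 10 ^ 7 * (1 / \<epsilon>)"
  proof -
   have "real (length (query_output (mem_of (W', X')))) = real n + 3" unfolding qo(1) using Q by simp
   also have "\<dots> \<le> 403 * (1 / \<epsilon>)" using en e1 by linarith
   also have "\<dots> \<le> 10 ^ 7 * (1 / \<epsilon>)" using \<epsilon> by (intro mult_right_mono) auto
   finally show ?thesis .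
  qed
  have "heavy_hitters n \<epsilon> (stream_vector ops) \<subseteq> {..<n}" by (auto simp: heavy_hitters_def)
  then show "\<exists>T m. processes w upd_prog qry_prog ?m0 ops T m \<and> real T \<le> 10 ^ 7 * E\<^sup>2 * L * real (num_updates ops) \<and>
    (\<exists>t m'. halts w qry_prog (0, m) t m' \<and> real t \<le> 10 ^ 7 * real n * E\<^sup>2 * L \<and>
     real (length (query_output m')) \<le> 10 ^ 7 * (1 / \<epsilon>) \<and> set (query_output m') \<subseteq> {..<n} \<and>
     ((\<exists>i<n. stream_vector ops i \<noteq> 0) \<longrightarrow> heavy_hitters n \<epsilon> (stream_vector ops) \<subseteq> set (query_output m')))"
   using P Tr h[folded qry_prog_def] tr lenr S by blast
 qed
 then show ?thesis by blast
qed

theorem theorem1: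
 "\<exists>(upd :: program) (qry :: program) (c :: nat) (C :: real). C > 0 \<and>
   (\<forall>(n :: nat) (\<epsilon> :: real). n \<ge> 1 \<longrightarrow> 0 < \<epsilon> \<longrightarrow> \<epsilon> \<le> 1 \<longrightarrow>
    (\<exists>m\<^sub>0.
     initial_memory (word_length c n) m\<^sub>0 \<and>
     real (memory_size m\<^sub>0) \<le> C * (1 / \<epsilon>) * lg (\<epsilon> * real n) \<and>
     (\<forall>ops. strict_turnstile n ops \<longrightarrow>
      (\<exists>T m.
        processes (word_length c n) upd qry m\<^sub>0 ops T m \<and>
        real T \<le> C * (lg (1 / \<epsilon>))\<^sup>2 * lg (\<epsilon> * real n) * real (num_updates ops) \<and>
        (\<exists>t m'.
         halts (word_length c n) qry (0, m) t m' \<and>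
         real t \<le> C * real n * (lg (1 / \<epsilon>))\<^sup>2 * lg (\<epsilon> * real n) \<and>
         real (length (query_output m')) \<le> C * (1 / \<epsilon>) \<and>
         set (query_output m') \<subseteq> {..<n} \<and>
         ((\<exists>i<n. stream_vector ops i \<noteq> 0) \<longrightarrow>
           heavy_hitters n \<epsilon> (stream_vector ops) \<subseteq> set (query_output m')))))))"
proof (rule exI[of _ upd_prog], rule exI[of _ qry_prog], rule exI[of _ 128], rule exI[of _ "10 ^ 7"], intro conjI allI impI)
 fix n :: nat and \<epsilon> :: real
 assume *: "1 \<le> n" "0 < \<epsilon>" "\<epsilon> \<le> 1"
 show "\<exists>m\<^sub>0. initial_memory (word_length 128 n) m\<^sub>0 \<and>
   real (memory_size m\<^sub>0) \<le> 10 ^ 7 * (1 / \<epsilon>) * lg (\<epsilon> * real n) \<and>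
   (\<forall>ops. strict_turnstile n ops \<longrightarrow>
    (\<exists>T m.
     processes (word_length 128 n) upd_prog qry_prog m\<^sub>0 ops T m \<and>
     real T \<le> 10 ^ 7 * (lg (1 / \<epsilon>))\<^sup>2 * lg (\<epsilon> * real n) * real (num_updates ops) \<and>
     (\<exists>t m'.
       halts (word_length 128 n) qry_prog (0, m) t m' \<and>
       real t \<le> 10 ^ 7 * real n * (lg (1 / \<epsilon>))\<^sup>2 * lg (\<epsilon> * real n) \<and>
       real (length (query_output m')) \<le> 10 ^ 7 * (1 / \<epsilon>) \<and>
       set (query_output m') \<subseteq> {..<n} \<and>
       ((\<exists>i<n. stream_vector ops i \<noteq> 0) \<longrightarrow>
        heavy_hitters n \<epsilon> (stream_vector ops) \<subseteq> set (query_output m')))))"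
  using answers_large[OF *] answers_small[OF *] unfolding answers_def by (cases "400 \<le> \<epsilon> * n") auto
qed simp

end
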